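(* Let $(\mathbf u,p,Z)$ be a weak solution of the inviscid Leray-$\alpha$ gaseous stars model on $\mathbb T^3\times(0,T)$ such that $\mathbf u\in L^3((0,T);B^s_{3,\infty}(\mathbb T^3))$ and $Z\in L^3((0,T);B^r_{3,\infty}(\mathbb T^3))$ with $s,r>0$ and $s+2r>1$. Then the weak solution conserves energy: for almost all $t_1,t_2\in(0,T)$, $$\|\mathbf u(t_1,\cdot)\|_{L^2}^2+\|Z(t_1,\cdot)\|_{L^2}^2=\|\mathbf u(t_2,\cdot)\|_{L^2}^2+\|Z(t_2,\cdot)\|_{L^2}^2.$$
   Context: $T>0$, $\alpha>0$ are fixed, $\mathbb T^3$ is the torus $[-\pi,\pi]^3$ with opposite faces identified (functions are $2\pi$-periodic in each variable). The Einstein summation convention is used. $\mathcal D(\mathbb T^3\times(0,T);\mathbb R^m)$ denotes smooth $\mathbb R^m$-valued functions with compact support in $\mathbb T^3\times(0,T)$. The inviscid Leray-$\alpha$ gaseous stars model is $$\partial_t\mathbf u+(v\cdot\nabla)\mathbf u+\nabla p=0,\quad \partial_tZ+\nabla\cdot(Z\mathbf u)+K\phi(\bar\theta)\bar Z=0,\quad -K\phi(\bar\theta)\bar Z=0,\quad \mathbf u=v-\alpha^2\Delta v,\quad \nabla\cdot\mathbf u=\nabla\cdot v=0,$$ with velocity fields $\mathbf u=(u_1,u_2,u_3)$ and $v=(v_1,v_2,v_3)$, scalar pressure $p$, and scalar reactant mass fraction $Z$. Here $K$ is a reaction-rate constant, $\phi:[0,\infty)\to[0,\infty)$ is an increasing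 Lipschitz reaction function, and $\bar\theta,\bar Z$ are the temperature and mass fraction in the reaction term; by the third equation $K\phi(\bar\theta)\bar Z=0$. A weak solution is a triplet $\mathbf u\in L^\infty(0,T;L^2(\mathbb T^3))$, $p\in L^\infty(0,T;L^1(\mathbb T^3))$, $Z\in L^\infty(0,T;L^2(\mathbb T^3))$, with $v=(1-\alpha^2\Delta)^{-1}\mathbf u$, $K\phi(\bar\theta)\bar Z=0$ and $\int_{\mathbb T^3}p(x,t)\,dx=0$, such that for all $\varphi\in\mathcal D(\mathbb T^3\times(0,T);\mathbb R^3)$ and $\chi_1,\chi_2\in\mathcal D(\mathbb T^3\times(0,T);\mathbb R)$ $$\int_0^T\!\!\int_{\mathbb T^3}\mathbf u\cdot\partial_t\varphi+u_jv_i\,\partial_i\varphi_j+p\,\nabla\cdot\varphi\,dx\,dt=0,$$ $$\int_0^T\!\!\int_{\mathbb T^3}Z\,\partial_t\chi_1+Z\mathbf u\cdot\nabla\chi_1+K\phi(\bar\theta)\bar Z\,\chi_1\,dx\,dt=0,\qquad \int_0^T\!\!\int_{\mathbb T^3}v_i\,\partial_i\chi_2\,dx\,dt=0$$ (so $v$ and $\mathbf u$ are divergence free). $B^s_{3,\infty}(\mathbb T^3)$ is the standard inhomogeneous Besov space with norm $\sup_{j\ge-1}2^{js}\|\Delta_jf\|_{L^3}$, where $\Delta_j$ are the inhomogeneous Littlewood–Paley blocks. *)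

theory Defs
  imports "HOL-Analysis.Analysis"
begin

text \<open>Functions on the torus are functions on \<^typ>\<open>real^3\<close> that are \<open>2\<pi>\<close>-periodic in each variable;
  integrals are taken over the fundamental domain. A space-time field takes the argument \<open>(x, t)\<close>.\<close>

definition torus3 :: "(real^3) set" where
  "torus3 = cbox (\<chi> i. - pi) (\<chi> i. pi)"

definition spacetime :: "real \<Rightarrow> ((real^3) \<times> real) set" where
  "spacetime T = torus3 \<times> {0<..<T}"

definition space_periodic :: "((real^3) \<times> real \<Rightarrow> 'b) \<Rightarrow> bool" where
  "space_periodic f \<longleftrightarrow> (\<forall>x t i. f (x + axis i (2 * pi), t) = f (x, t))"

definition slice :: "('a \<times> real \<Rightarrow> 'b) \<Rightarrow> real \<Rightarrow> 'a \<Rightarrow> 'b" where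
  "slice f t = (\<lambda>x. f (x, t))"

text \<open>This is the usual norm only when \<open>|f|^p\<close> is integrable (otherwise the Bochner integral
  defaults to 0), so membership in \<open>L^p\<close> is always required separately.\<close>

definition torus_Lp_norm :: "real \<Rightarrow> (real^3 \<Rightarrow> 'b::euclidean_space) \<Rightarrow> real" where
  "torus_Lp_norm p f = (LINT x|lebesgue_on torus3. norm (f x) powr p) powr (1 / p)"

text \<open>\<open>L^\<infinity>(0,T; L^p)\<close> for \<open>1 \<le> p < \<infinity>\<close>. Since \<open>L^p\<close> is separable, strong measurability in time is
  joint measurability of a representative.\<close>

definition Linf_Lp :: "real \<Rightarrow> real \<Rightarrow> ((real^3) \<times> real \<Rightarrow> 'b::euclidean_space) \<Rightarrow> bool" where
  "Linf_Lp T p f \<longleftrightarrow>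
     f \<in> borel_measurable (lebesgue_on (spacetime T)) \<and>
     (\<exists>C. AE t in lebesgue_on {0<..<T}.
        slice f t \<in> borel_measurable (lebesgue_on torus3) \<and>
        integrable (lebesgue_on torus3) (\<lambda>x. norm (slice f t x) powr p) \<and>
        torus_Lp_norm p (slice f t) \<le> C)"

primrec Ck :: "nat \<Rightarrow> ('a::euclidean_space \<Rightarrow> 'b::real_normed_vector) \<Rightarrow> bool" where
  "Ck 0 f \<longleftrightarrow> continuous_on UNIV f"
| "Ck (Suc n) f \<longleftrightarrow>
     (\<forall>x. f differentiable (at x)) \<and> (\<forall>h. Ck n (\<lambda>x. frechet_derivative f (at x) h))"

definition smooth :: "('a::euclidean_space \<Rightarrow> 'b::real_normed_vector) \<Rightarrow> bool" where
  "smooth f \<longleftrightarrow> (\<forall>n. Ck n f)"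

text \<open>Compact support in the torus times \<open>(0,T)\<close>: the torus is compact, so only the support in
  time is constrained; test functions are extended by 0 to all times.\<close>

definition test_function :: "real \<Rightarrow> ((real^3) \<times> real \<Rightarrow> 'b::real_normed_vector) \<Rightarrow> bool" where
  "test_function T f \<longleftrightarrow> smooth f \<and> space_periodic f \<and>
     (\<exists>a b. 0 < a \<and> b < T \<and> (\<forall>x t. f (x, t) \<noteq> 0 \<longrightarrow> a \<le> t \<and> t \<le> b))"

definition dt :: "((real^3) \<times> real \<Rightarrow> 'b::real_normed_vector) \<Rightarrow> (real^3) \<times> real \<Rightarrow> 'b" where
  "dt f z = frechet_derivative f (at z) (0, 1)"

definition dx :: "3 \<Rightarrow> ((real^3) \<times> real \<Rightarrow> 'b::real_normed_vector) \<Rightarrow> (real^3) \<times> real \<Rightarrow> 'b" where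
  "dx i f z = frechet_derivative f (at z) (axis i 1, 0)"

definition freq :: "int^3 \<Rightarrow> real^3" where
  "freq k = (\<chi> i. of_int (k $ i))"

definition fourier_coeff :: "(real^3 \<Rightarrow> real) \<Rightarrow> int^3 \<Rightarrow> complex" where
  "fourier_coeff f k =
     (LINT y|lebesgue_on torus3. complex_of_real (f y) * cis (- (freq k \<bullet> y)))
       / complex_of_real ((2 * pi) ^ 3)"

text \<open>The operator \<open>m(D)\<close>, acting componentwise on vector fields. It is used only for real even
  symbols \<open>m\<close>, for which the sum over frequencies is already real, and on \<open>L^2\<close> functions with \<open>m\<close>
  square summable over the lattice, so that the sum converges absolutely.\<close>

definition torus_multiplier ::
    "(real^3 \<Rightarrow> real) \<Rightarrow> (real^3 \<Rightarrow> 'b::euclidean_space) \<Rightarrow> real^3 \<Rightarrow> 'b" where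
  "torus_multiplier m f x =
     (\<Sum>b\<in>Basis. Re (\<Sum>\<^sub>\<infinity>k\<in>UNIV.
        complex_of_real (m (freq k)) * fourier_coeff (\<lambda>y. f y \<bullet> b) k * cis (freq k \<bullet> x)) *\<^sub>R b)"

text \<open>\<open>(1 - \<alpha>\<^sup>2 \<Delta>)\<^sup>-\<^sup>1\<close>; its symbol \<open>1 / (1 + \<alpha>\<^sup>2 |k|\<^sup>2)\<close> is square summable in dimension 3.\<close>

definition helmholtz_inv :: "real \<Rightarrow> (real^3 \<Rightarrow> real^3) \<Rightarrow> real^3 \<Rightarrow> real^3" where
  "helmholtz_inv \<alpha> = torus_multiplier (\<lambda>\<xi>. 1 / (1 + \<alpha>\<^sup>2 * (norm \<xi>)\<^sup>2))"

definition filtered :: "real \<Rightarrow> ((real^3) \<times> real \<Rightarrow> real^3) \<Rightarrow> (real^3) \<times> real \<Rightarrow> real^3" where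
  "filtered \<alpha> u = (\<lambda>(x, t). helmholtz_inv \<alpha> (slice u t) x)"

text \<open>\<open>(\<eta>, \<rho>)\<close> is a smooth radial dyadic partition of unity in the standard normalisation; any two
  such pairs give equivalent Besov norms.\<close>

definition dyadic_partition :: "(real^3 \<Rightarrow> real) \<Rightarrow> (real^3 \<Rightarrow> real) \<Rightarrow> bool" where
  "dyadic_partition \<eta> \<rho> \<longleftrightarrow>
     smooth \<eta> \<and> smooth \<rho> \<and>
     (\<forall>\<xi>. 0 \<le> \<eta> \<xi> \<and> \<eta> \<xi> \<le> 1) \<and> (\<forall>\<xi>. 0 \<le> \<rho> \<xi> \<and> \<rho> \<xi> \<le> 1) \<and>
     (\<forall>\<xi> \<zeta>. norm \<xi> = norm \<zeta> \<longrightarrow> \<eta> \<xi> = \<eta> \<zeta> \<and> \<rho> \<xi> = \<rho> \<zeta>) \<and>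
     (\<forall>\<xi>. \<eta> \<xi> \<noteq> 0 \<longrightarrow> norm \<xi> \<le> 4 / 3) \<and>
     (\<forall>\<xi>. \<rho> \<xi> \<noteq> 0 \<longrightarrow> 3 / 4 \<le> norm \<xi> \<and> norm \<xi> \<le> 8 / 3) \<and>
     (\<forall>\<xi>. (\<lambda>j. \<rho> ((1 / 2 ^ j) *\<^sub>R \<xi>)) sums (1 - \<eta> \<xi>))"

definition lp_block :: "(real^3 \<Rightarrow> real) \<Rightarrow> (real^3 \<Rightarrow> real) \<Rightarrow> int \<Rightarrow>
    (real^3 \<Rightarrow> 'b::euclidean_space) \<Rightarrow> real^3 \<Rightarrow> 'b" where
  "lp_block \<eta> \<rho> j =
     torus_multiplier (if j = -1 then \<eta> else (\<lambda>\<xi>. \<rho> ((2 powi (- j)) *\<^sub>R \<xi>)))"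

text \<open>The value may be infinite; \<open>f\<close> is assumed to be a periodic \<open>L^p\<close> function for some \<open>p \<ge> 1\<close>.\<close>

definition besov_norm :: "(real^3 \<Rightarrow> real) \<Rightarrow> (real^3 \<Rightarrow> real) \<Rightarrow> real \<Rightarrow> real \<Rightarrow>
    (real^3 \<Rightarrow> 'b::euclidean_space) \<Rightarrow> ennreal" where
  "besov_norm \<eta> \<rho> p s f =
     (SUP j\<in>{-1..}. ennreal (2 powr (of_int j * s) * torus_Lp_norm p (lp_block \<eta> \<rho> j f)))"

text \<open>The norm condition defining \<open>L^3((0,T); B^s_{3,\<infinity>})\<close>, for fields already known to lie in
  \<open>L^\<infinity>(0,T; L^2)\<close>.\<close>

definition L3_Besov :: "(real^3 \<Rightarrow> real) \<Rightarrow> (real^3 \<Rightarrow> real) \<Rightarrow> real \<Rightarrow> real \<Rightarrow>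
    ((real^3) \<times> real \<Rightarrow> 'b::euclidean_space) \<Rightarrow> bool" where
  "L3_Besov \<eta> \<rho> T s f \<longleftrightarrow>
     (\<integral>\<^sup>+t. (besov_norm \<eta> \<rho> 3 s (slice f t)) ^ 3 \<partial>lebesgue_on {0<..<T}) < \<infinity>"

text \<open>\<open>\<theta>\<close> and \<open>Y\<close> stand for the temperature and the mass fraction in the reaction term
  \<open>K \<phi>(\<theta>) Y\<close>.\<close>

definition weak_solution :: "real \<Rightarrow> real \<Rightarrow> (real \<Rightarrow> real) \<Rightarrow>
    ((real^3) \<times> real \<Rightarrow> real) \<Rightarrow> ((real^3) \<times> real \<Rightarrow> real) \<Rightarrow> real \<Rightarrow>
    ((real^3) \<times> real \<Rightarrow> real^3) \<Rightarrow> ((real^3) \<times> real \<Rightarrow> real) \<Rightarrow> ((real^3) \<times> real \<Rightarrow> real) \<Rightarrow> bool" where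
  "weak_solution \<alpha> K \<phi> \<theta> Y T u p Z \<longleftrightarrow>
     space_periodic u \<and> space_periodic p \<and> space_periodic Z \<and>
     Linf_Lp T 2 u \<and> Linf_Lp T 1 p \<and> Linf_Lp T 2 Z \<and>
     (AE z in lebesgue_on (spacetime T). K * \<phi> (\<theta> z) * Y z = 0) \<and>
     (AE t in lebesgue_on {0<..<T}. (LINT x|lebesgue_on torus3. p (x, t)) = 0) \<and>
     (let v = filtered \<alpha> u in
       (\<forall>\<psi> :: (real^3) \<times> real \<Rightarrow> real^3. test_function T \<psi> \<longrightarrow>
          (LINT z|lebesgue_on (spacetime T).
             u z \<bullet> dt \<psi> z
             + (\<Sum>i\<in>UNIV. \<Sum>j\<in>UNIV. u z $ j * v z $ i * dx i \<psi> z $ j)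
             + p z * (\<Sum>i\<in>UNIV. dx i \<psi> z $ i)) = 0) \<and>
       (\<forall>\<chi>1 :: (real^3) \<times> real \<Rightarrow> real. test_function T \<chi>1 \<longrightarrow>
          (LINT z|lebesgue_on (spacetime T).
             Z z * dt \<chi>1 z
             + Z z * (\<Sum>i\<in>UNIV. u z $ i * dx i \<chi>1 z)
             + K * \<phi> (\<theta> z) * Y z * \<chi>1 z) = 0) \<and>
       (\<forall>\<chi>2 :: (real^3) \<times> real \<Rightarrow> real. test_function T \<chi>2 \<longrightarrow>
          (LINT z|lebesgue_on (spacetime T). (\<Sum>i\<in>UNIV. v z $ i * dx i \<chi>2 z)) = 0))"

end

theory Submission
  imports Defs
begin

text \<open>
The solution is not regular enough to be tested with itself, so its energy is measured through a
mollifier: with Fourier coefficients \<open>\<F>\<close> and the multipliers \<open>\<kappa>\<^sub>n(k) \<rightarrow> 1\<close> of a kernel, the quantity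
\<open>E\<^sub>n(t) = \<Sum>\<^sub>k \<kappa>\<^sub>n(k) (|\<F>Z(k)|\<^sup>2 + \<Sum>\<^sub>j |\<F>u\<^sub>j(k)|\<^sup>2)\<close> is a finite sum that tends to the energy at almost every
time, by Parseval's identity (\<open>mollified_energy_tendsto\<close>). Both equations are conservation laws
\<open>\<partial>\<^sub>tg + div(g w) = 0\<close> up to the pressure, with \<open>g = Z\<close>, \<open>w = u\<close> for the reactant and \<open>g = u\<^sub>j\<close>, \<open>w = v\<close>
for the velocity. Testing them with plane waves gives an ordinary differential equation for every
Fourier coefficient, and therefore \<open>E\<^sub>n\<close> is an indefinite integral of
\<open>2 \<Phi>\<^sub>n(Z, u) + 2 \<Sum>\<^sub>j \<Phi>\<^sub>n(u\<^sub>j, v)\<close>, where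
\<open>\<Phi>\<^sub>n(g, w) = \<Sum>\<^sub>k \<kappa>\<^sub>n(k) k \<bullet> Im(cnj \<F>g(k) \<F>(g w)(k))\<close> is called \<open>flux\<close> below
(\<open>reactant_energy_rate\<close>, \<open>velocity_energy_rate\<close>). The pressure drops out of the sum over \<open>j\<close> because
\<open>k \<bullet> \<F>u(k) = 0\<close>, and the reaction term vanishes by the third equation of the model. Energy is
conserved as soon as the time integral of the flux tends to zero (\<open>vanishing_rate_conserved\<close>).

The point is that the flux is an expression in increments. For divergence free \<open>w\<close> the
Duchon--Robert identity (\<open>flux_increments\<close>) writes \<open>\<Phi>\<^sub>n(g, w)\<close> as a multiple of
\<open>\<integral> \<nabla>K\<^sub>n(z) \<bullet> \<integral> (\<delta>\<^sub>zg)\<^sup>2 \<delta>\<^sub>zw dx dz\<close> with \<open>\<delta>\<^sub>zg(x) = g(x + z) - g(x)\<close>. The kernel lives at scale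
\<open>n\<^sup>-\<^sup>1\<^sup>/\<^sup>2\<close> and its gradient costs \<open>n\<^sup>1\<^sup>/\<^sup>2\<close> (\<open>ker_dx_moment\<close>), so the flux is small once the inner integral
is \<open>O(|z|\<^sup>1\<^sup>+\<^sup>\<delta>)\<close> (\<open>flux_bound\<close>). Regularity \<open>B\<^sup>\<sigma>\<^sub>3\<^sub>,\<^sub>\<infinity>\<close> bounds the \<open>L\<^sup>3\<close> norm of an increment by almost
\<open>|z|\<^sup>\<sigma>\<close> (\<open>lp_partial_increment\<close>, from Bernstein's inequality for each dyadic block). In the reactant
equation this gives the exponent \<open>s + 2r > 1\<close> (\<open>reactant_flux_bound\<close>). In the momentum equation the
advecting field \<open>v = (1 - \<alpha>\<^sup>2\<Delta>)\<^sup>-\<^sup>1u\<close> gains two derivatives over \<open>u \<in> L\<^sup>2\<close>; its increments are \<open>O(|z|)\<close>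
even in \<open>L\<^sup>4\<close>, and the exponent is \<open>1 + 2s > 1\<close> for every \<open>s > 0\<close> (\<open>velocity_flux_bound\<close>).

The kernel is a trigonometric polynomial, so the flux at fixed \<open>n\<close> depends on finitely many Fourier
coefficients and is continuous in \<open>L\<^sup>2\<close>. The increment estimates are therefore needed for trigonometric
polynomials only, uniformly in their degree.
\<close>


section \<open>Integration of continuous periodic functions over the torus\<close>

abbreviation M3 :: "(real^3) measure" where "M3 \<equiv> lebesgue_on torus3"

definition periodic :: "(real^3 \<Rightarrow> 'b) \<Rightarrow> bool" where
  "periodic f \<longleftrightarrow> (\<forall>x i. f (x + axis i (2 * pi)) = f x)"

lemma torus3_lmeasurable [simp]: "torus3 \<in> lmeasurable"
  by (simp add: torus3_def)

lemma torus3_sets [simp]: "torus3 \<in> sets lebesgue"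
  by (simp add: torus3_def)

lemma mem_torus3: "x \<in> torus3 \<longleftrightarrow> (\<forall>i. \<bar>x $ i\<bar> \<le> pi)"
  by (auto simp: torus3_def mem_box_cart abs_le_iff) (metis minus_le_iff)+

lemma measure_torus3: "measure lebesgue torus3 = (2 * pi) ^ 3"
proof -
  have "cbox (\<chi> i. - pi) (\<chi> i. pi) \<noteq> ({} :: (real^3) set)"
    using mem_box_cart(2)[of 0 "\<chi> i. - pi" "\<chi> i. pi"] by auto
  then show ?thesis
    by (simp add: torus3_def content_cbox_cart)
qed

lemma finite_M3: "finite_measure M3"
  by (rule finite_measure_lebesgue_on) simp

lemma measure_M3: "measure M3 torus3 = (2 * pi) ^ 3"
  using measure_torus3 by (simp add: measure_restrict_space)

lemma integral_M3_const: "(LINT x|M3. (c::'b::euclidean_space)) = ((2 * pi) ^ 3) *\<^sub>R c"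
  using measure_M3 by simp

lemma continuous_integrable_M3:
  fixes f :: "real^3 \<Rightarrow> 'b::euclidean_space"
  assumes "continuous_on UNIV f" shows "integrable M3 f"
  unfolding torus3_def
  by (rule continuous_imp_integrable) (rule continuous_on_subset[OF assms], simp)

lemma continuous_LINT_M3:
  fixes f :: "real^3 \<Rightarrow> 'b::euclidean_space"
  assumes "continuous_on UNIV f" shows "(LINT x|M3. f x) = integral torus3 f"
  by (rule lebesgue_integral_eq_integral[OF continuous_integrable_M3[OF assms]]) simp

lemma continuous_LINT_param:
  fixes f :: "'a::euclidean_space \<Rightarrow> real^3 \<Rightarrow> 'b::euclidean_space"
  assumes "continuous_on UNIV (\<lambda>(x, y). f x y)"
  shows "continuous_on UNIV (\<lambda>x. LINT y|M3. f x y)"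
proof -
  have "continuous_on UNIV (f x)" for x
    using continuous_on_compose2[OF assms, of UNIV "\<lambda>y. (x, y)"] by (simp add: continuous_intros)
  then have eq: "(LINT y|M3. f x y) = integral torus3 (f x)" for x
    by (simp add: continuous_LINT_M3)
  show ?thesis
    unfolding eq unfolding torus3_def
    by (rule integral_continuous_on_param) (rule continuous_on_subset[OF assms], simp)
qed

lemma LINT_swap:
  fixes f :: "real^3 \<Rightarrow> real^3 \<Rightarrow> 'b::euclidean_space"
  assumes c: "continuous_on UNIV (\<lambda>(x, y). f x y)"
  shows "(LINT x|M3. LINT y|M3. f x y) = (LINT y|M3. LINT x|M3. f x y)"
proof -
  have c1: "continuous_on UNIV (f x)" for x
    using continuous_on_compose2[OF c, of UNIV "\<lambda>y. (x, y)"] by (simp add: continuous_intros)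
  have c2: "continuous_on UNIV (\<lambda>x. f x y)" for y
    using continuous_on_compose2[OF c, of UNIV "\<lambda>x. (x, y)"] by (simp add: continuous_intros)
  have c': "continuous_on UNIV (\<lambda>(y, x). f x y)"
    using continuous_on_compose2[OF c, of UNIV "\<lambda>(x, y). (y, x)"]
    by (simp add: continuous_intros case_prod_unfold)
  have "(LINT x|M3. LINT y|M3. f x y) = integral torus3 (\<lambda>x. integral torus3 (f x))"
    using continuous_LINT_M3[OF continuous_LINT_param[OF c]] by (simp add: continuous_LINT_M3 c1)
  also have "\<dots> = integral torus3 (\<lambda>y. integral torus3 (\<lambda>x. f x y))"
    unfolding torus3_def
    by (rule integral_swap_continuous) (rule continuous_on_subset[OF c], simp)
  also have "\<dots> = (LINT y|M3. LINT x|M3. f x y)"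
    using continuous_LINT_M3[OF continuous_LINT_param[OF c']] by (simp add: continuous_LINT_M3 c2)
  finally show ?thesis .
qed

lemma periodic_int:
  assumes "periodic f" shows "f (x + axis i (2 * pi * of_int m)) = f x"
proof (induction m rule: int_induct[where k = 0])
  case base then show ?case by (simp add: axis_def vec_eq_iff zero_vec_def[symmetric])
next
  case (step1 m)
  have "x + axis i (2 * pi * of_int (m + 1)) = (x + axis i (2 * pi * of_int m)) + axis i (2 * pi)"
    by (simp add: vec_eq_iff axis_def algebra_simps)
  then show ?case using step1 assms by (metis periodic_def)
next
  case (step2 m)
  have "x + axis i (2 * pi * of_int m) = (x + axis i (2 * pi * of_int (m - 1))) + axis i (2 * pi)"
    by (simp add: vec_eq_iff axis_def algebra_simps)
  then show ?case using step2 assms by (metis periodic_def)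
qed

lemma mem_cbox_coord:
  fixes x :: "real^'n"
  shows "x \<in> cbox a b \<longleftrightarrow> (a $ i \<le> x $ i \<and> x $ i \<le> b $ i) \<and> (\<forall>j. j \<noteq> i \<longrightarrow> a $ j \<le> x $ j \<and> x $ j \<le> b $ j)"
  by (metis mem_box_cart(2))

text \<open>A shift by \<open>0 \<le> c \<le> 2\<pi>\<close> in one coordinate moves a slab out of the fundamental domain; a
  translation by the period moves it back in on the opposite side.\<close>

lemma integral_torus_shift_axis:
  fixes f :: "real^3 \<Rightarrow> 'b::euclidean_space"
  assumes cont: "continuous_on UNIV f" and per: "periodic f" and c: "0 \<le> c" "c \<le> 2 * pi"
  shows "integral torus3 (\<lambda>x. f (x + axis i c)) = integral torus3 f"
proof -
  let ?a = "(\<chi> i. - pi)::real^3" and ?b = "(\<chi> i. pi)::real^3"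
  have int: "f integrable_on cbox a b" for a b
    by (rule integrable_continuous) (rule continuous_on_subset[OF cont], simp)
  have Bi: "axis i 1 \<in> (Basis::(real^3) set)" by (auto simp: Basis_vec_def)
  have split: "integral (cbox a b) f = integral (cbox a b \<inter> {x. x $ i \<le> d}) f
                 + integral (cbox a b \<inter> {x. x $ i \<ge> d}) f" for a b d
    using integral_split[OF int Bi, of a b d] by (simp add: inner_axis)
  have "integral torus3 (\<lambda>x. f (x + axis i c)) = integral (cbox (?a + axis i c) (?b + axis i c)) f"
    using integral_shift_cbox[of "?a + axis i c" "axis i c" "?b + axis i c" f]
    unfolding torus3_def add_diff_cancel_right' .
  also have "\<dots> = integral (cbox (?a + axis i c) (?b + axis i c) \<inter> {x. x $ i \<le> pi}) f
                 + integral (cbox (?a + axis i c) (?b + axis i c) \<inter> {x. x $ i \<ge> pi}) f"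
    by (rule split)
  also have "cbox (?a + axis i c) (?b + axis i c) \<inter> {x. x $ i \<le> pi} = cbox ?a ?b \<inter> {x. x $ i \<ge> - pi + c}"
    using c by (intro set_eqI) (auto simp: mem_cbox_coord[of _ _ _ i] axis_def)
  also have "cbox (?a + axis i c) (?b + axis i c) \<inter> {x. x $ i \<ge> pi}
              = cbox (?a + axis i (2 * pi)) ((\<chi> j. if j = i then - pi + c else pi) + axis i (2 * pi))"
    using c by (intro set_eqI) (auto simp: mem_cbox_coord[of _ _ _ i] axis_def)
  also have "integral \<dots> f = integral (cbox ?a (\<chi> j. if j = i then - pi + c else pi)) (\<lambda>x. f (x + axis i (2 * pi)))"
    using integral_shift_cbox[of "?a + axis i (2*pi)" "axis i (2*pi)" "(\<chi> j. if j = i then - pi + c else pi) + axis i (2 * pi)" f]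
    unfolding add_diff_cancel_right' by (rule sym)
  also have "(\<lambda>x. f (x + axis i (2 * pi))) = f" using per by (simp add: periodic_def)
  also have "cbox ?a (\<chi> j. if j = i then - pi + c else pi) = cbox ?a ?b \<inter> {x. x $ i \<le> - pi + c}"
    using c by (intro set_eqI) (auto simp: mem_cbox_coord[of _ _ _ i])
  finally show ?thesis using split[of ?a ?b "- pi + c"] by (simp add: torus3_def add.commute)
qed

lemma LINT_torus_shift_axis:
  fixes f :: "real^3 \<Rightarrow> 'b::euclidean_space"
  assumes cont: "continuous_on UNIV f" and per: "periodic f"
  shows "(LINT x|M3. f (x + axis i c)) = (LINT x|M3. f x)"
proof -
  define m where "m = \<lfloor>c / (2 * pi)\<rfloor>"
  define d where "d = c - 2 * pi * of_int m"
  have "of_int m \<le> c / (2 * pi)" "c / (2 * pi) < of_int m + 1" by (auto simp: m_def)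
  then have d: "0 \<le> d" "d \<le> 2 * pi"
    using pi_gt_zero by (auto simp: d_def field_simps)
  have "f (x + axis i c) = f (x + axis i d)" for x
  proof -
    have "x + axis i c = (x + axis i d) + axis i (2 * pi * of_int m)"
      by (simp add: d_def vec_eq_iff axis_def)
    then show ?thesis using periodic_int[OF per] by metis
  qed
  moreover have "continuous_on UNIV (\<lambda>x. f (x + axis i d))"
    by (rule continuous_on_compose2[OF cont]) (auto intro: continuous_intros)
  ultimately show ?thesis
    using integral_torus_shift_axis[OF cont per d] by (simp add: continuous_LINT_M3 cont)
qed

lemma periodic_shift: "periodic f \<Longrightarrow> periodic (\<lambda>x. f (x + z))"
  unfolding periodic_def by (metis add.commute add.left_commute)

lemma continuous_shift:
  fixes f :: "real^3 \<Rightarrow> 'b::topological_space"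
  shows "continuous_on UNIV f \<Longrightarrow> continuous_on UNIV (\<lambda>x. f (x + z))"
  by (rule continuous_on_compose2[of UNIV f]) (auto intro: continuous_intros)

lemma vec3_axis_expansion: "(z::real^3) = axis 1 (z $ 1) + axis 2 (z $ 2) + axis 3 (z $ 3)"
  by (simp add: vec_eq_iff forall_3 axis_def)

lemma LINT_torus_shift:
  fixes f :: "real^3 \<Rightarrow> 'b::euclidean_space"
  assumes cont: "continuous_on UNIV f" and per: "periodic f"
  shows "(LINT x|M3. f (x + z)) = (LINT x|M3. f x)"
proof -
  define f1 where "f1 = (\<lambda>x. f (x + axis 1 (z $ 1)))"
  define f2 where "f2 = (\<lambda>x. f1 (x + axis 2 (z $ 2)))"
  have f1: "continuous_on UNIV f1" "periodic f1"
    unfolding f1_def by (auto intro: continuous_shift periodic_shift cont per)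
  have f2: "continuous_on UNIV f2" "periodic f2"
    unfolding f2_def by (auto intro: continuous_shift periodic_shift f1)
  have "f (x + z) = f2 (x + axis 3 (z $ 3))" for x
    by (subst vec3_axis_expansion[of z]) (simp add: f1_def f2_def algebra_simps)
  then have "(LINT x|M3. f (x + z)) = (LINT x|M3. f2 x)"
    using LINT_torus_shift_axis[OF f2] by simp
  also have "\<dots> = (LINT x|M3. f1 x)"
    unfolding f2_def using LINT_torus_shift_axis[OF f1] by simp
  also have "\<dots> = (LINT x|M3. f x)"
    unfolding f1_def using LINT_torus_shift_axis[OF cont per] by simp
  finally show ?thesis .
qed

section \<open>Characters and trigonometric polynomials\<close>

definition ch :: "int^3 \<Rightarrow> real^3 \<Rightarrow> complex" where
  "ch k x = cis (freq k \<bullet> x)"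

lemma freq_add: "freq (k + l) = freq k + freq l"
  and freq_minus: "freq (- k) = - freq k"
  and freq_0 [simp]: "freq 0 = 0"
  by (simp_all add: freq_def vec_eq_iff)

lemma freq_nth [simp]: "freq k $ i = of_int (k $ i)"
  by (simp add: freq_def)

lemma ch_mult: "ch k x * ch l x = ch (k + l) x"
  by (simp add: ch_def freq_add cis_mult inner_add_left)

lemma ch_0 [simp]: "ch 0 x = 1" by (simp add: ch_def)

lemma cnj_ch: "cnj (ch k x) = ch (- k) x"
  by (simp add: ch_def freq_minus cis_cnj)

lemma ch_uminus: "ch k (- x) = ch (- k) x"
  by (simp add: ch_def freq_minus)

lemma ch_add: "ch k (x + z) = ch k x * ch k z"
  by (simp add: ch_def cis_mult inner_add_right)

lemma norm_ch [simp]: "norm (ch k x) = 1" by (simp add: ch_def)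

lemma continuous_ch: "continuous_on UNIV (ch k)"
  unfolding ch_def by (intro continuous_intros)

lemma continuous_ch' [continuous_intros]:
  "continuous_on S f \<Longrightarrow> continuous_on S (\<lambda>x. ch k (f x))"
  by (rule continuous_on_compose2[OF continuous_ch]) auto

lemma periodic_ch: "periodic (ch k)"
proof -
  have "ch k (axis i (2 * pi)) = 1" for i
    unfolding ch_def inner_axis
    using cis_multiple_2pi[of "of_int (k $ i)"] by (simp add: mult.commute)
  then show ?thesis by (simp add: periodic_def ch_add)
qed

lemma ch_integral: "(LINT x|M3. ch k x) = (if k = 0 then of_real ((2 * pi) ^ 3) else 0)"
proof (cases "k = 0")
  case True
  then show ?thesis using integral_M3_const[of "1::complex"] by (simp add: scaleR_conv_of_real)
next
  case False
  then obtain i where i: "k $ i \<noteq> 0" by (auto simp: vec_eq_iff)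
  have "ch k (axis i (pi / of_int (k $ i))) = - 1"
    using i unfolding ch_def inner_axis by simp
  then have "(LINT x|M3. ch k x) = - (LINT x|M3. ch k x)"
    using LINT_torus_shift_axis[OF continuous_ch periodic_ch, of k i "pi / of_int (k $ i)"]
    by (simp add: ch_add)
  then show ?thesis using False by simp
qed

text \<open>Trigonometric polynomials are generated inductively, which makes closure under products a
  double induction; the finite expansion follows.\<close>

inductive trigpoly :: "(real^3 \<Rightarrow> complex) \<Rightarrow> bool" where
  trigpoly_ch: "trigpoly (\<lambda>x. c * ch k x)"
| trigpoly_add: "trigpoly f \<Longrightarrow> trigpoly g \<Longrightarrow> trigpoly (\<lambda>x. f x + g x)"

lemma trigpoly_const: "trigpoly (\<lambda>x. c)"
  using trigpoly_ch[of c 0] by simp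

lemma trigpoly_mult_ch:
  assumes "trigpoly f" shows "trigpoly (\<lambda>x. c * ch k x * f x)"
  using assms
proof induction
  case (trigpoly_ch d l)
  then show ?case
    using trigpoly.trigpoly_ch[of "c * d" "k + l"] by (simp add: ch_mult[symmetric] ac_simps)
next
  case (trigpoly_add f g)
  then show ?case
    using trigpoly.trigpoly_add by (fastforce simp: distrib_left)
qed

lemma trigpoly_mult:
  assumes "trigpoly f" "trigpoly g" shows "trigpoly (\<lambda>x. f x * g x)"
  using assms(1)
proof induction
  case (trigpoly_ch c k)
  then show ?case using trigpoly_mult_ch[OF assms(2)] by simp
next
  case (trigpoly_add f g)
  then show ?case
    using trigpoly.trigpoly_add by (fastforce simp: distrib_right)
qed

lemma trigpoly_power:
  assumes "trigpoly f" shows "trigpoly (\<lambda>x. f x ^ n)"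
  by (induction n) (auto intro: trigpoly_const trigpoly_mult assms)

lemma freq_axis: "freq (axis i m) = axis i (of_int m)"
  by (simp add: vec_eq_iff axis_def)

lemma trigpoly_cos: "trigpoly (\<lambda>x. complex_of_real (cos (x $ i)))"
proof -
  have "complex_of_real (cos (x $ i)) = 1/2 * ch (axis i 1) x + 1/2 * ch (axis i (- 1)) x" for x
    by (simp add: ch_def freq_axis inner_axis' complex_eq_iff)
  then have "(\<lambda>x. complex_of_real (cos (x $ i))) = (\<lambda>x. 1/2 * ch (axis i 1) x + 1/2 * ch (axis i (- 1)) x)" by (rule ext)
  then show ?thesis by (simp only: trigpoly_add trigpoly_ch)
qed

lemma trigpoly_sin: "trigpoly (\<lambda>x. complex_of_real (sin (x $ i)))"
proof -
  have "complex_of_real (sin (x $ i)) = (- \<i>/2) * ch (axis i 1) x + (\<i>/2) * ch (axis i (- 1)) x" for x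
    by (simp add: ch_def freq_axis inner_axis' complex_eq_iff)
  then have "(\<lambda>x. complex_of_real (sin (x $ i))) = (\<lambda>x. (- \<i>/2) * ch (axis i 1) x + (\<i>/2) * ch (axis i (- 1)) x)" by (rule ext)
  then show ?thesis by (simp only: trigpoly_add trigpoly_ch)
qed

lemma trigpoly_prod:
  assumes "\<And>i. i \<in> I \<Longrightarrow> trigpoly (f i)"
  shows "trigpoly (\<lambda>x. \<Prod>i\<in>I. f i x)"
  using assms by (induction I rule: infinite_finite_induct) (auto intro: trigpoly_const trigpoly_mult)

lemma trigpoly_expansion:
  assumes "trigpoly f"
  shows "\<exists>A c. finite A \<and> (\<forall>x. f x = (\<Sum>k\<in>A. c k * ch k x))"
  using assms
proof (induction rule: trigpoly.induct)
  case (trigpoly_ch c k)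
  have "finite {k} \<and> (\<forall>x. c * ch k x = (\<Sum>l\<in>{k}. c * ch l x))" by simp
  then show ?case by (rule_tac exI, rule_tac exI)
next
  case (trigpoly_add f g)
  obtain A c where A: "finite A" "\<And>x. f x = (\<Sum>k\<in>A. c k * ch k x)"
    using trigpoly_add.IH(1) by auto
  obtain B d where B: "finite B" "\<And>x. g x = (\<Sum>k\<in>B. d k * ch k x)"
    using trigpoly_add.IH(2) by auto
  define e where "e k = (if k \<in> A then c k else 0) + (if k \<in> B then d k else 0)" for k
  have "f x + g x = (\<Sum>k\<in>A \<union> B. e k * ch k x)" for x
  proof -
    have "(\<Sum>k\<in>A \<union> B. (if k \<in> A then c k else 0) * ch k x) = (\<Sum>k\<in>A. c k * ch k x)"
      by (rule sum.mono_neutral_cong_right) (use A B in auto)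
    moreover have "(\<Sum>k\<in>A \<union> B. (if k \<in> B then d k else 0) * ch k x) = (\<Sum>k\<in>B. d k * ch k x)"
      by (rule sum.mono_neutral_cong_right) (use A B in auto)
    ultimately show ?thesis
      by (simp add: A(2) B(2) e_def distrib_right sum.distrib)
  qed
  then have "finite (A \<union> B) \<and> (\<forall>x. f x + g x = (\<Sum>k\<in>A \<union> B. e k * ch k x))"
    using A(1) B(1) by simp
  then show ?case by (rule_tac exI, rule_tac exI)
qed

lemma ch_axis: "ch k (axis i h) = cis (of_int (k $ i) * h)"
  by (simp add: ch_def inner_axis mult.commute)

lemma has_vector_derivative_cis:
  "((\<lambda>h. cis (a * h)) has_vector_derivative \<i> * of_real a * cis (a * h)) (at h)"
proof -
  have "((\<lambda>h. exp (\<i> * (of_real a * of_real h))) has_vector_derivative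
          (\<i> * of_real a) * exp (\<i> * (of_real a * of_real h))) (at h)"
    by (rule derivative_eq_intros has_vector_derivative_real_field refl | simp add: ac_simps)+
  then show ?thesis by (simp add: cis_conv_exp)
qed

lemma ch_axis_derivative:
  "((\<lambda>h. ch k (x + axis i h)) has_vector_derivative \<i> * of_int (k $ i) * ch k x) (at 0)"
proof -
  have "((\<lambda>h. ch k x * cis (of_int (k $ i) * h)) has_vector_derivative
          ch k x * (\<i> * of_real (of_int (k $ i)) * cis (of_int (k $ i) * 0))) (at 0)"
    by (rule has_vector_derivative_mult_right) (rule has_vector_derivative_cis)
  then show ?thesis by (simp add: ch_add ch_axis ac_simps)
qed

lemma sum_ch_axis_derivative:
  "((\<lambda>h. \<Sum>k\<in>A. c k * ch k (x + axis i h)) has_vector_derivative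
      (\<Sum>k\<in>A. c k * (\<i> * of_int (k $ i) * ch k x))) (at 0)"
  by (intro has_vector_derivative_sum has_vector_derivative_mult_right ch_axis_derivative)

lemma sum_ch_integral:
  assumes "finite A"
  shows "(LINT x|M3. (\<Sum>k\<in>A. c k * ch k x)) = (if 0 \<in> A then of_real ((2 * pi) ^ 3) * c 0 else 0)"
proof -
  have "(LINT x|M3. (\<Sum>k\<in>A. c k * ch k x)) = (\<Sum>k\<in>A. c k * (LINT x|M3. ch k x))"
    by (subst Bochner_Integration.integral_sum)
       (auto intro!: continuous_integrable_M3 continuous_intros)
  also have "\<dots> = (if 0 \<in> A then of_real ((2 * pi) ^ 3) * c 0 else 0)"
    using assms by (simp add: ch_integral if_distrib[of "\<lambda>z. _ * z"] sum.delta cong: if_cong)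
  finally show ?thesis .
qed

text \<open>Integration by parts on the torus has no boundary terms: the derivative of a trigonometric polynomial
has no zero mode.\<close>

lemma trigpoly_derivative_integral:
  assumes "trigpoly f" and d: "\<And>x. ((\<lambda>h. f (x + axis i h)) has_vector_derivative f' x) (at 0)"
  shows "(LINT x|M3. f' x) = 0"
proof -
  obtain A c where A: "finite A" "\<And>x. f x = (\<Sum>k\<in>A. c k * ch k x)"
    using trigpoly_expansion[OF assms(1)] by metis
  have "f' x = (\<Sum>k\<in>A. c k * (\<i> * of_int (k $ i) * ch k x))" for x
    using vector_derivative_unique_at[OF d[of x, unfolded A(2)] sum_ch_axis_derivative] .
  then have "(LINT x|M3. f' x) = (LINT x|M3. (\<Sum>k\<in>A. (c k * \<i> * of_int (k $ i)) * ch k x))"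
    by (simp add: mult.assoc)
  then show ?thesis using A(1) by (simp add: sum_ch_integral)
qed

lemma trigpoly_derivative_integral_real:
  fixes f :: "real^3 \<Rightarrow> real"
  assumes "trigpoly (\<lambda>x. complex_of_real (f x))"
    and d: "\<And>x. ((\<lambda>h. f (x + axis i h)) has_real_derivative f' x) (at 0)"
  shows "(LINT x|M3. f' x) = 0"
proof -
  have "(LINT x|M3. complex_of_real (f' x)) = 0"
    by (rule trigpoly_derivative_integral[OF assms(1), of i])
       (rule has_vector_derivative_of_real, use d in \<open>simp add: has_real_derivative_iff_has_vector_derivative\<close>)
  then show ?thesis by simp
qed

section \<open>A positive trigonometric kernel concentrated at the origin\<close>

text \<open>The powers of this product, divided by their integral, are the de la Vallee Poussin kernels, an
approximate identity of nonnegative trigonometric polynomials.\<close>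

definition kw :: "real^3 \<Rightarrow> real" where
  "kw z = (\<Prod>i\<in>UNIV. (1 + cos (z $ i)) / 2)"

definition kw_rest :: "3 \<Rightarrow> real^3 \<Rightarrow> real" where
  "kw_rest i z = (\<Prod>l\<in>UNIV - {i}. (1 + cos (z $ l)) / 2)"

lemma half_cos_nonneg: "0 \<le> (1 + cos t) / (2::real)"
proof -
  have "0 \<le> (1 + c) / 2" if "- 1 \<le> c" for c :: real using that by simp
  then show ?thesis using cos_ge_minus_one[of t] by blast
qed

lemma half_cos_le_1: "(1 + cos t) / (2::real) \<le> 1"
proof -
  have "(1 + c) / 2 \<le> 1" if "c \<le> 1" for c :: real using that by simp
  then show ?thesis using cos_le_one[of t] by blast
qed

lemma sin_mult_sin: "sin t * sin t = (1 - cos t) * (1 + cos (t::real))"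
  using sin_squared_eq[of t] by (simp add: power2_eq_square algebra_simps)

lemma kw_bounds: "0 \<le> kw z" "kw z \<le> 1" "0 \<le> kw_rest i z" "kw_rest i z \<le> 1"
  unfolding kw_def kw_rest_def by (auto intro!: prod_nonneg prod_le_1 half_cos_nonneg half_cos_le_1)

lemma kw_split: "kw z = (1 + cos (z $ i)) / 2 * kw_rest i z"
  unfolding kw_def kw_rest_def by (subst prod.remove[of UNIV i]) auto

lemma kw_rest_axis: "kw_rest i (z + axis i h) = kw_rest i z"
  unfolding kw_rest_def by (intro prod.cong) (auto simp: axis_def)

lemma kw_uminus: "kw (- z) = kw z" by (simp add: kw_def)

lemma kw_ge: "kw z \<ge> 1 - (\<Sum>i\<in>UNIV. (1 - cos (z $ i))) / 2"
proof -
  define a where "a = (1 - cos (z $ 1)) / 2"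
  define b where "b = (1 - cos (z $ 2)) / 2"
  define c where "c = (1 - cos (z $ 3)) / 2"
  have "0 \<le> (1 - t) / 2 \<and> (1 - t) / 2 \<le> 1" if "- 1 \<le> t" "t \<le> 1" for t :: real
    using that by simp
  then have r: "0 \<le> a" "a \<le> 1" "0 \<le> b" "b \<le> 1" "0 \<le> c" "c \<le> 1"
    unfolding a_def b_def c_def using cos_ge_minus_one cos_le_one by blast+
  have "(1 - a) * (1 - b) \<ge> 1 - a - b" using r by (simp add: algebra_simps)
  then have "(1 - a) * (1 - b) * (1 - c) \<ge> (1 - a - b) * (1 - c)"
    using r by (intro mult_right_mono) auto
  also have "(1 - a - b) * (1 - c) \<ge> 1 - a - b - c"
    using r mult_nonneg_nonneg[of a c] mult_nonneg_nonneg[of b c] by (simp add: algebra_simps)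
  finally have "(1 - a) * (1 - b) * (1 - c) \<ge> 1 - a - b - c" .
  moreover have "kw z = (1 - a) * (1 - b) * (1 - c)"
    unfolding kw_def UNIV_3 by (simp add: a_def b_def c_def field_simps)
  moreover have "(\<Sum>i\<in>UNIV. (1 - cos (z $ i))) / 2 = a + b + c"
    unfolding sum_3 by (simp add: a_def b_def c_def field_simps)
  ultimately show ?thesis by linarith
qed

lemma continuous_cos_nth:
  fixes f :: "'a::t2_space \<Rightarrow> real^3"
  assumes "continuous_on S f" shows "continuous_on S (\<lambda>x. cos (f x $ i))"
  by (intro continuous_on_cos continuous_on_component assms)

lemma continuous_kw [continuous_intros]:
  fixes f :: "'a::t2_space \<Rightarrow> real^3"
  shows "continuous_on S f \<Longrightarrow> continuous_on S (\<lambda>x. kw (f x))"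
  unfolding kw_def
  by (intro continuous_on_prod continuous_on_divide continuous_on_add continuous_on_const
      continuous_cos_nth) auto

lemma continuous_kw_rest [continuous_intros]:
  fixes f :: "'a::t2_space \<Rightarrow> real^3"
  shows "continuous_on S f \<Longrightarrow> continuous_on S (\<lambda>x. kw_rest i (f x))"
  unfolding kw_rest_def
  by (intro continuous_on_prod continuous_on_divide continuous_on_add continuous_on_const
      continuous_cos_nth) auto

lemma trigpoly_kw: "trigpoly (\<lambda>z. complex_of_real (kw z))"
proof -
  have "complex_of_real (kw z) = (\<Prod>i\<in>UNIV. 1/2 * (1 + complex_of_real (cos (z $ i))))" for z
    by (simp add: kw_def field_simps)
  then have "(\<lambda>z. complex_of_real (kw z)) = (\<lambda>z. \<Prod>i\<in>UNIV. 1/2 * (1 + complex_of_real (cos (z $ i))))"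
    by (rule ext)
  then show ?thesis
    by (simp only:) (intro trigpoly_prod trigpoly_mult trigpoly_const trigpoly_add trigpoly_cos)
qed

definition kw_power_dx :: "nat \<Rightarrow> 3 \<Rightarrow> real^3 \<Rightarrow> real" where
  "kw_power_dx n i z = - (real n * kw z ^ (n - 1) * sin (z $ i) * kw_rest i z / 2)"

lemma kw_axis_derivative:
  "((\<lambda>h. kw (z + axis i h)) has_real_derivative - sin (z $ i) / 2 * kw_rest i z) (at 0)"
proof -
  have "kw (z + axis i h) = (1 + cos (z $ i + h)) / 2 * kw_rest i z" for h
    using kw_split[of "z + axis i h" i] by (simp only: kw_rest_axis) (simp add: axis_def)
  then have eq: "(\<lambda>h. kw (z + axis i h)) = (\<lambda>h. (1 + cos (z $ i + h)) / 2 * kw_rest i z)" by (rule ext)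
  show ?thesis unfolding eq
    by (auto intro!: derivative_eq_intros)
qed

lemma kw_power_axis_derivative:
  "((\<lambda>h. kw (z + axis i h) ^ n) has_real_derivative kw_power_dx n i z) (at 0)"
  using DERIV_power[OF kw_axis_derivative[of z i], of n]
  by (simp add: kw_power_dx_def axis_def zero_vec_def[symmetric] field_simps)

definition kw_mass :: "nat \<Rightarrow> real" where
  "kw_mass n = (LINT z|M3. kw z ^ n)"

lemma kw_mass_pos: "kw_mass n > 0"
proof -
  have "kw_mass n \<ge> 0" unfolding kw_mass_def by (simp add: kw_bounds)
  moreover have "kw_mass n \<noteq> 0"
  proof
    assume "kw_mass n = 0"
    then have "integral torus3 (\<lambda>z. kw z ^ n) = 0"
      unfolding kw_mass_def by (subst (asm) continuous_LINT_M3) (auto intro!: continuous_intros)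
    moreover have "box (\<chi> i. - pi) (\<chi> i. pi) \<noteq> ({} :: (real^3) set)"
      using mem_box_cart(1)[of 0 "\<chi> i. - pi" "\<chi> i. pi"] by auto
    ultimately have "\<forall>z\<in>torus3. kw z ^ n = 0"
      unfolding torus3_def
      by (subst (asm) integral_cbox_eq_0_iff) (auto intro!: continuous_intros zero_le_power kw_bounds simp: mem_box_cart Basis_vec_def inner_axis)
    moreover have "(0::real^3) \<in> torus3" by (simp add: mem_torus3)
    ultimately have "kw 0 ^ n = 0" by blast
    then show False by (simp add: kw_def)
  qed
  ultimately show ?thesis by simp
qed

text \<open>Integrating \<open>\<partial>\<^sub>i(sin z\<^sub>i (1 - cos z\<^sub>i)\<^sup>a w\<^sup>n)\<close> over the period expresses the moments of
  the kernel by lower ones, because \<open>sin z\<^sub>i \<partial>\<^sub>iw = - (1 - cos z\<^sub>i) w\<close>.\<close>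

lemma kw_moment1_eq:
  "real n * (LINT z|M3. (1 - cos (z $ i)) * kw z ^ n) = (LINT z|M3. cos (z $ i) * kw z ^ n)"
proof -
  have "(LINT z|M3. cos (z $ i) * kw z ^ n - real n * ((1 - cos (z $ i)) * kw z ^ n)) = 0"
  proof (rule trigpoly_derivative_integral_real[where f = "\<lambda>z. sin (z $ i) * kw z ^ n" and i = i])
    show "trigpoly (\<lambda>z. complex_of_real (sin (z $ i) * kw z ^ n))"
      by (simp only: of_real_mult of_real_power) (intro trigpoly_mult trigpoly_sin trigpoly_power trigpoly_kw)
    fix z
    have "((\<lambda>h. sin (z $ i + h) * kw (z + axis i h) ^ n) has_real_derivative
        cos (z $ i) * kw z ^ n + sin (z $ i) * kw_power_dx n i z) (at 0)"
      by (rule derivative_eq_intros kw_power_axis_derivative refl | simp add: axis_def zero_vec_def[symmetric])+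
    also have "sin (z $ i) * kw_power_dx n i z = - (real n * ((1 - cos (z $ i)) * kw z ^ n))"
    proof (cases n)
      case (Suc m)
      have "sin (z $ i) * sin (z $ i) = (1 - cos (z $ i)) * (1 + cos (z $ i))"
        by (rule sin_mult_sin)
      then have "sin (z $ i) * sin (z $ i) * kw_rest i z / 2 = (1 - cos (z $ i)) * kw z"
        by (simp add: kw_split[of z i])
      then have "real n * kw z ^ m * (sin (z $ i) * sin (z $ i) * kw_rest i z / 2)
               = real n * kw z ^ m * ((1 - cos (z $ i)) * kw z)" by simp
      then show ?thesis using Suc by (simp add: kw_power_dx_def algebra_simps)
    qed (simp add: kw_power_dx_def)
    finally show "((\<lambda>h. sin ((z + axis i h) $ i) * kw (z + axis i h) ^ n) has_real_derivative
        cos (z $ i) * kw z ^ n - real n * ((1 - cos (z $ i)) * kw z ^ n)) (at 0)"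
      by (simp add: axis_def)
  qed
  moreover have "integrable M3 (\<lambda>z. cos (z $ i) * kw z ^ n)"
    "integrable M3 (\<lambda>z. (1 - cos (z $ i)) * kw z ^ n)"
    by (auto intro!: continuous_integrable_M3 continuous_intros)
  ultimately show ?thesis by simp
qed

lemma kw_moment1: "real n * (LINT z|M3. (1 - cos (z $ i)) * kw z ^ n) \<le> kw_mass n"
  unfolding kw_moment1_eq kw_mass_def
proof (intro integral_mono continuous_integrable_M3 continuous_intros)
  show "cos (z $ i) * kw z ^ n \<le> kw z ^ n" for z
    using mult_right_mono[OF cos_le_one[of "z $ i"], of "kw z ^ n"] by (simp add: kw_bounds)
qed

lemma kw_moment2:
  "real n * (LINT z|M3. (1 - cos (z $ i))\<^sup>2 * kw z ^ n) \<le> 3 * (LINT z|M3. (1 - cos (z $ i)) * kw z ^ n)"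
proof -
  have "(LINT z|M3. (1 - cos (z $ i)) * (1 + 2 * cos (z $ i)) * kw z ^ n
            - real n * ((1 - cos (z $ i))\<^sup>2 * kw z ^ n)) = 0"
  proof (rule trigpoly_derivative_integral_real
      [where f = "\<lambda>z. (sin (z $ i) * (1 - cos (z $ i))) * kw z ^ n" and i = i])
    have "trigpoly (\<lambda>z. (complex_of_real (sin (z $ i)) * (1 + (-1) * complex_of_real (cos (z $ i)))) *
        complex_of_real (kw z) ^ n)"
      by (intro trigpoly_mult trigpoly_sin trigpoly_add trigpoly_const trigpoly_cos trigpoly_power trigpoly_kw)
    then show "trigpoly (\<lambda>z. complex_of_real (sin (z $ i) * (1 - cos (z $ i)) * kw z ^ n))"
      by simp
    fix z :: "real^3"
    have s2: "sin (z $ i) * sin (z $ i) = (1 - cos (z $ i)) * (1 + cos (z $ i))"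
      by (rule sin_mult_sin)
    have "((\<lambda>h. (sin (z $ i + h) * (1 - cos (z $ i + h))) * kw (z + axis i h) ^ n) has_real_derivative
        (cos (z $ i) * (1 - cos (z $ i)) + sin (z $ i) * sin (z $ i)) * kw z ^ n
         + (sin (z $ i) * (1 - cos (z $ i))) * kw_power_dx n i z) (at 0)"
      by (rule derivative_eq_intros kw_power_axis_derivative refl
          | simp add: axis_def zero_vec_def[symmetric] algebra_simps)+
    also have "cos (z $ i) * (1 - cos (z $ i)) + sin (z $ i) * sin (z $ i)
             = (1 - cos (z $ i)) * (1 + 2 * cos (z $ i))"
      unfolding s2 by (simp add: algebra_simps)
    also have "(sin (z $ i) * (1 - cos (z $ i))) * kw_power_dx n i z
             = - (real n * ((1 - cos (z $ i))\<^sup>2 * kw z ^ n))"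
    proof (cases n)
      case (Suc m)
      have "sin (z $ i) * sin (z $ i) * kw_rest i z / 2 = (1 - cos (z $ i)) * kw z"
        unfolding s2 by (simp add: kw_split[of z i])
      have "(sin (z $ i) * (1 - cos (z $ i))) * kw_power_dx n i z
          = - (real n * kw z ^ m * (1 - cos (z $ i)) * (sin (z $ i) * sin (z $ i) * kw_rest i z / 2))"
        using Suc by (simp add: kw_power_dx_def)
      also have "sin (z $ i) * sin (z $ i) * kw_rest i z / 2 = (1 - cos (z $ i)) * kw z" by fact
      finally show ?thesis using Suc by (simp add: power2_eq_square)
    qed (simp add: kw_power_dx_def)
    finally show "((\<lambda>h. sin ((z + axis i h) $ i) * (1 - cos ((z + axis i h) $ i)) * kw (z + axis i h) ^ n)
        has_real_derivative (1 - cos (z $ i)) * (1 + 2 * cos (z $ i)) * kw z ^ n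
            - real n * ((1 - cos (z $ i))\<^sup>2 * kw z ^ n)) (at 0)"
      by (simp add: axis_def)
  qed
  moreover have int: "integrable M3 (\<lambda>z. (1 - cos (z $ i)) * (1 + 2 * cos (z $ i)) * kw z ^ n)"
    "integrable M3 (\<lambda>z. (1 - cos (z $ i))\<^sup>2 * kw z ^ n)"
    "integrable M3 (\<lambda>z. 3 * ((1 - cos (z $ i)) * kw z ^ n))"
    by (auto intro!: continuous_integrable_M3 continuous_intros)
  ultimately have "real n * (LINT z|M3. (1 - cos (z $ i))\<^sup>2 * kw z ^ n)
      = (LINT z|M3. (1 - cos (z $ i)) * (1 + 2 * cos (z $ i)) * kw z ^ n)" by simp
  also have "\<dots> \<le> (LINT z|M3. 3 * ((1 - cos (z $ i)) * kw z ^ n))"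
  proof (rule integral_mono[OF int(1,3)])
    fix z
    have "(1 + 2 * cos (z $ i)) * ((1 - cos (z $ i)) * kw z ^ n) \<le> 3 * ((1 - cos (z $ i)) * kw z ^ n)"
      by (rule mult_right_mono) (auto simp: kw_bounds)
    then show "(1 - cos (z $ i)) * (1 + 2 * cos (z $ i)) * kw z ^ n \<le> 3 * ((1 - cos (z $ i)) * kw z ^ n)"
      by (simp add: ac_simps)
  qed
  finally show ?thesis by simp
qed

text \<open>The first moments say that under the density \<open>kw\<^sup>n\<close> the mean of \<open>\<Sum>\<^sub>i (1 - cos z\<^sub>i) / 2\<close> is at most
\<open>3 / (2n) \<le> 1 / 2\<close>, and one more factor \<open>kw\<close> loses no more than this mean.\<close>

lemma kw_mass_Suc: assumes "n \<ge> 3" shows "kw_mass n \<le> 2 * kw_mass (Suc n)"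
proof -
  have int: "integrable M3 (\<lambda>z. kw z ^ n)" "integrable M3 (\<lambda>z. kw z ^ Suc n)"
    "\<And>i. integrable M3 (\<lambda>z. (1 - cos (z $ i)) * kw z ^ n / 2)"
    by (auto intro!: continuous_integrable_M3 continuous_intros)
  have m: "(LINT z|M3. (1 - cos (z $ i)) * kw z ^ n / 2) \<le> kw_mass n / 6" for i
  proof -
    have "3 * (LINT z|M3. (1 - cos (z $ i)) * kw z ^ n) \<le> real n * (LINT z|M3. (1 - cos (z $ i)) * kw z ^ n)"
      using assms by (intro mult_right_mono integral_nonneg) (auto simp: kw_bounds)
    also have "\<dots> \<le> kw_mass n" by (rule kw_moment1)
    finally show ?thesis by simp
  qed
  have "kw_mass n - (\<Sum>i\<in>UNIV. (LINT z|M3. (1 - cos (z $ i)) * kw z ^ n / 2))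
      = (LINT z|M3. kw z ^ n - (\<Sum>i\<in>UNIV. (1 - cos (z $ i)) * kw z ^ n / 2))"
    unfolding kw_mass_def using int
    by (subst Bochner_Integration.integral_diff)
       (auto intro!: Bochner_Integration.integrable_sum simp: Bochner_Integration.integral_sum
             simp del: integral_divide_zero)
  also have "\<dots> \<le> kw_mass (Suc n)"
    unfolding kw_mass_def
  proof (rule integral_mono)
    fix z
    have "kw z ^ n * (1 - (\<Sum>i\<in>UNIV. (1 - cos (z $ i))) / 2) \<le> kw z ^ n * kw z"
      by (rule mult_left_mono[OF kw_ge]) (simp add: kw_bounds)
    then show "kw z ^ n - (\<Sum>i\<in>UNIV. (1 - cos (z $ i)) * kw z ^ n / 2) \<le> kw z ^ Suc n"
      by (simp add: sum_3 field_simps)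
  qed (use int in \<open>auto intro!: Bochner_Integration.integrable_diff Bochner_Integration.integrable_sum\<close>)
  finally have "kw_mass n - (\<Sum>i\<in>UNIV. (LINT z|M3. (1 - cos (z $ i)) * kw z ^ n / 2)) \<le> kw_mass (Suc n)" .
  then show ?thesis using m[of 1] m[of 2] m[of 3] by (simp add: sum_3)
qed

lemma sin_ge_linear: assumes "0 \<le> s" "s \<le> pi / 2" shows "s / 2 \<le> sin s"
proof -
  have cvx: "convex_on {0..pi/2} (\<lambda>x. - sin x)"
  proof (rule f''_ge0_imp_convex)
    show "((\<lambda>x. - sin x) has_real_derivative - cos x) (at x)" for x :: real
      by (auto intro!: derivative_eq_intros)
    show "((\<lambda>x. - cos x) has_real_derivative sin x) (at x)" for x :: real
      by (auto intro!: derivative_eq_intros)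
  qed (auto intro!: sin_ge_zero)
  define t where "t = 2 * s / pi"
  have t: "0 \<le> t" "t \<le> 1" using assms by (auto simp: t_def field_simps)
  have "- sin ((1 - t) *\<^sub>R 0 + t *\<^sub>R (pi/2)) \<le> (1 - t) * - sin 0 + t * - sin (pi/2)"
    by (rule convex_onD_Icc[OF cvx _ t]) simp
  moreover have "(1 - t) *\<^sub>R 0 + t *\<^sub>R (pi/2) = s" by (simp add: t_def)
  ultimately have "t \<le> sin s" by simp
  moreover have "s / 2 \<le> t" using mult_right_mono[of pi 4 s] assms pi_less_4 by (simp add: t_def field_simps)
  ultimately show ?thesis by simp
qed

lemma square_le_one_minus_cos: assumes "\<bar>t\<bar> \<le> pi" shows "t\<^sup>2 \<le> 8 * (1 - cos t)"
proof -
  have "\<bar>t\<bar> / 2 / 2 \<le> sin (\<bar>t\<bar> / 2)" by (rule sin_ge_linear) (use assms in auto)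
  then have "(\<bar>t\<bar> / 4)\<^sup>2 \<le> (sin (\<bar>t\<bar> / 2))\<^sup>2" by (intro power_mono) auto
  moreover have "cos \<bar>t\<bar> = 1 - 2 * (sin (\<bar>t\<bar> / 2))\<^sup>2"
    using cos_double_sin[of "\<bar>t\<bar> / 2"] by simp
  ultimately show ?thesis by (simp add: power_divide)
qed

lemma norm_sq_vec3: "(norm (z::real^3))\<^sup>2 = (\<Sum>i\<in>UNIV. (z $ i)\<^sup>2)"
  unfolding power2_norm_eq_inner inner_vec_def by (simp add: power2_eq_square)

lemma norm2_le_torus: "z \<in> torus3 \<Longrightarrow> (norm z)\<^sup>2 \<le> 8 * (\<Sum>i\<in>UNIV. (1 - cos (z $ i)))"
  unfolding norm_sq_vec3 sum_distrib_left
  by (intro sum_mono square_le_one_minus_cos) (simp add: mem_torus3)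

lemma sum3_square_le: "((a::real) + b + c)\<^sup>2 \<le> 3 * (a\<^sup>2 + b\<^sup>2 + c\<^sup>2)"
proof -
  have "0 \<le> (a - b)\<^sup>2 + (a - c)\<^sup>2 + (b - c)\<^sup>2" by simp
  then show ?thesis by (simp add: power2_eq_square algebra_simps)
qed

lemma norm4_le_torus:
  assumes "z \<in> torus3" shows "(norm z) ^ 4 \<le> 192 * (\<Sum>i\<in>UNIV. (1 - cos (z $ i))\<^sup>2)"
proof -
  have "(norm z) ^ 4 = ((norm z)\<^sup>2)\<^sup>2" by simp
  also have "\<dots> \<le> (8 * (\<Sum>i\<in>UNIV. (1 - cos (z $ i))))\<^sup>2"
    by (rule power_mono[OF norm2_le_torus[OF assms]]) simp
  also have "\<dots> \<le> 192 * (\<Sum>i\<in>UNIV. (1 - cos (z $ i))\<^sup>2)"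
    unfolding sum_3 power_mult_distrib
    using sum3_square_le[of "1 - cos (z $ 1)" "1 - cos (z $ 2)" "1 - cos (z $ 3)"] by simp
  finally show ?thesis .
qed

lemma kw_norm2_moment: assumes "n > 0"
  shows "(LINT z|M3. (norm z)\<^sup>2 * kw z ^ n) \<le> 24 * kw_mass n / real n"
proof -
  have m: "(LINT z|M3. (1 - cos (z $ i)) * kw z ^ n) \<le> kw_mass n / real n" for i
    using kw_moment1[of n i] assms by (simp add: field_simps)
  have "(LINT z|M3. (norm z)\<^sup>2 * kw z ^ n) \<le> (LINT z|M3. 8 * (\<Sum>i\<in>UNIV. (1 - cos (z $ i)) * kw z ^ n))"
  proof (intro integral_mono continuous_integrable_M3 continuous_intros continuous_cos_nth)
    fix z assume "z \<in> space M3"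
    then have "(norm z)\<^sup>2 * kw z ^ n \<le> (8 * (\<Sum>i\<in>UNIV. (1 - cos (z $ i)))) * kw z ^ n"
      by (intro mult_right_mono norm2_le_torus) (auto simp: kw_bounds)
    then show "(norm z)\<^sup>2 * kw z ^ n \<le> 8 * (\<Sum>i\<in>UNIV. (1 - cos (z $ i)) * kw z ^ n)"
      by (simp add: sum_distrib_right mult.assoc)
  qed
  also have "\<dots> = 8 * (\<Sum>i\<in>UNIV. LINT z|M3. (1 - cos (z $ i)) * kw z ^ n)"
    by (subst integral_mult_right_zero, subst Bochner_Integration.integral_sum)
       (auto intro!: continuous_integrable_M3 continuous_intros continuous_cos_nth)
  also have "\<dots> \<le> 8 * (\<Sum>i\<in>(UNIV::3 set). kw_mass n / real n)"
    by (intro mult_left_mono sum_mono m) auto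
  finally show ?thesis by simp
qed

lemma kw_norm4_moment: assumes "n > 0"
  shows "(LINT z|M3. (norm z) ^ 4 * kw z ^ n) \<le> 1728 * kw_mass n / (real n)\<^sup>2"
proof -
  have m: "(LINT z|M3. (1 - cos (z $ i))\<^sup>2 * kw z ^ n) \<le> 3 * kw_mass n / (real n)\<^sup>2" for i
  proof -
    have "(LINT z|M3. (1 - cos (z $ i))\<^sup>2 * kw z ^ n) \<le> 3 * (LINT z|M3. (1 - cos (z $ i)) * kw z ^ n) / real n"
      using kw_moment2[of n i] assms by (simp add: field_simps)
    also have "\<dots> \<le> 3 * (kw_mass n / real n) / real n"
      using kw_moment1[of n i] assms by (intro divide_right_mono mult_left_mono) (simp_all add: field_simps)
    finally show ?thesis by (simp add: power2_eq_square)
  qed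
  have "(LINT z|M3. (norm z) ^ 4 * kw z ^ n) \<le> (LINT z|M3. 192 * (\<Sum>i\<in>UNIV. (1 - cos (z $ i))\<^sup>2 * kw z ^ n))"
  proof (intro integral_mono continuous_integrable_M3 continuous_intros continuous_cos_nth)
    fix z assume "z \<in> space M3"
    then have "(norm z) ^ 4 * kw z ^ n \<le> (192 * (\<Sum>i\<in>UNIV. (1 - cos (z $ i))\<^sup>2)) * kw z ^ n"
      by (intro mult_right_mono norm4_le_torus) (auto simp: kw_bounds)
    then show "(norm z) ^ 4 * kw z ^ n \<le> 192 * (\<Sum>i\<in>UNIV. (1 - cos (z $ i))\<^sup>2 * kw z ^ n)"
      by (simp add: sum_distrib_right mult.assoc)
  qed
  also have "\<dots> = 192 * (\<Sum>i\<in>UNIV. LINT z|M3. (1 - cos (z $ i))\<^sup>2 * kw z ^ n)"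
    by (subst integral_mult_right_zero, subst Bochner_Integration.integral_sum)
       (auto intro!: continuous_integrable_M3 continuous_intros continuous_cos_nth)
  also have "\<dots> \<le> 192 * (\<Sum>i\<in>(UNIV::3 set). 3 * kw_mass n / (real n)\<^sup>2)"
    by (intro mult_left_mono sum_mono m) auto
  finally show ?thesis by simp
qed

definition vol3 :: real where "vol3 = (2 * pi) ^ 3"

lemma vol3_pos [simp]: "vol3 > 0" by (simp add: vol3_def)

definition ker :: "nat \<Rightarrow> real^3 \<Rightarrow> real" where
  "ker n z = vol3 / kw_mass n * kw z ^ n"

definition ker_dx :: "nat \<Rightarrow> 3 \<Rightarrow> real^3 \<Rightarrow> real" where
  "ker_dx n i z = vol3 / kw_mass n * kw_power_dx n i z"

lemma ker_nonneg: "ker n z \<ge> 0"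
  using kw_mass_pos[of n] vol3_pos by (simp add: ker_def kw_bounds less_imp_le)

lemma continuous_ker [continuous_intros]:
  fixes f :: "'a::t2_space \<Rightarrow> real^3"
  shows "continuous_on S f \<Longrightarrow> continuous_on S (\<lambda>x. ker n (f x))"
  unfolding ker_def by (intro continuous_intros)

lemma continuous_ker_dx [continuous_intros]:
  fixes f :: "'a::t2_space \<Rightarrow> real^3"
  assumes "continuous_on S f" shows "continuous_on S (\<lambda>x. ker_dx n i (f x))"
proof -
  have "continuous_on S (\<lambda>x. sin (f x $ i))"
    by (intro continuous_on_sin continuous_on_component assms)
  then show ?thesis
    unfolding ker_dx_def kw_power_dx_def by (intro continuous_intros assms) auto
qed

lemma ker_integral: "(LINT z|M3. ker n z) = vol3"
  unfolding ker_def using kw_mass_pos[of n] by (simp add: kw_mass_def)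

lemma ker_uminus: "ker n (- z) = ker n z"
  by (simp add: ker_def kw_uminus)

lemma trigpoly_ker: "trigpoly (\<lambda>z. complex_of_real (ker n z))"
  unfolding ker_def of_real_mult of_real_power
  by (intro trigpoly_mult trigpoly_const trigpoly_power trigpoly_kw)

lemma ker_axis_derivative:
  "((\<lambda>h. ker n (z + axis i h)) has_real_derivative ker_dx n i z) (at 0)"
  unfolding ker_def ker_dx_def by (intro DERIV_cmult kw_power_axis_derivative)

lemma ker_moment1: assumes "n > 0"
  shows "(LINT z|M3. (1 - cos (z $ i)) * ker n z) \<le> vol3 / real n"
proof -
  have "(LINT z|M3. (1 - cos (z $ i)) * ker n z) = vol3 / kw_mass n * (LINT z|M3. (1 - cos (z $ i)) * kw z ^ n)"
    unfolding ker_def by (subst integral_mult_right_zero[symmetric]) (simp add: ac_simps)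
  also have "\<dots> \<le> vol3 / kw_mass n * (kw_mass n / real n)"
    using kw_moment1[of n i] assms kw_mass_pos[of n]
    by (intro mult_left_mono) (simp_all add: field_simps less_imp_le)
  also have "\<dots> = vol3 / real n" using kw_mass_pos[of n] by simp
  finally show ?thesis .
qed

lemma abs_sin_le: "\<bar>sin t\<bar> \<le> \<bar>t\<bar>" for t :: real
  using abs_sin_x_le_abs_x by simp

text \<open>The gradient of the kernel has mass \<open>O(n\<^sup>1\<^sup>/\<^sup>2)\<close> and the kernel lives at scale \<open>n\<^sup>-\<^sup>1\<^sup>/\<^sup>2\<close>, so
  a weight \<open>|z|\<^sup>1\<^sup>+\<^sup>\<delta>\<close> more than pays for the derivative. The weight is split into second and fourth
  moments at the scale of the kernel.\<close>

lemma ker_dx_moment: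
  assumes n: "n \<ge> 3" and d: "0 < \<delta>" "\<delta> \<le> 2"
  shows "(LINT z|M3. \<bar>ker_dx (Suc n) i z\<bar> * norm z powr (1 + \<delta>)) \<le> 3504 * vol3 * real n powr (- \<delta> / 2)"
proof -
  \<comment> \<open>The scale of the kernel.\<close>
  define h where "h = real n powr (- 1 / 2)"
  have h: "h > 0" using n by (simp add: h_def)
  have hd: "h powr \<delta> = real n powr (- \<delta> / 2)" by (simp add: h_def powr_powr)
  have h2: "h\<^sup>2 = 1 / real n"
  proof -
    have "h\<^sup>2 = real n powr (- 1 / 2 + - 1 / 2)"
      by (simp only: h_def power2_eq_square powr_add)
    also have "\<dots> = real n powr (- 1)" by simp
    finally show ?thesis by (simp only: powr_minus_divide powr_one_gt_zero_iff powr_one of_nat_0_le_iff)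
  qed
  have hd2: "h powr (\<delta> - 2) = real n powr (- \<delta> / 2) * real n"
    using n h h2 by (simp add: powr_diff hd)
  define c where "c = vol3 / kw_mass (Suc n)"
  have c: "c > 0" using kw_mass_pos[of "Suc n"] by (simp add: c_def)
  have split: "r powr (2 + \<delta>) \<le> h powr \<delta> * r\<^sup>2 + h powr (\<delta> - 2) * r ^ 4" if "r \<ge> 0" for r
  proof (cases "r \<le> h")
    case True
    have "r powr (2 + \<delta>) = r powr \<delta> * r\<^sup>2"
      using that by (cases "r = 0") (simp_all add: powr_add mult.commute)
    also have "\<dots> \<le> h powr \<delta> * r\<^sup>2"
      using True that d by (intro mult_right_mono powr_mono2) auto
    finally show ?thesis using h by (simp add: add_increasing2)
  next
    case False
    then have r: "r > 0" using h by simp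
    have "r powr (2 + \<delta>) = r powr (\<delta> - 2) * r ^ 4"
    proof -
      have "r ^ 4 = r powr 4" using r powr_realpow[of r 4] by simp
      then show ?thesis using powr_add[of r "\<delta> - 2" 4] by (simp add: add.commute)
    qed
    also have "\<dots> \<le> h powr (\<delta> - 2) * r ^ 4"
      using False h d by (intro mult_right_mono powr_mono2') auto
    finally show ?thesis using h by (simp add: add_increasing)
  qed
  have pt: "\<bar>ker_dx (Suc n) i z\<bar> * norm z powr (1 + \<delta>)
      \<le> c * real n * (h powr \<delta> * ((norm z)\<^sup>2 * kw z ^ n) + h powr (\<delta> - 2) * ((norm z) ^ 4 * kw z ^ n))" for z
  proof -
    have "\<bar>ker_dx (Suc n) i z\<bar> = c * (real (Suc n) * kw z ^ n * \<bar>sin (z $ i)\<bar> * kw_rest i z / 2)"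
      using c by (simp add: ker_dx_def kw_power_dx_def c_def[symmetric] abs_mult kw_bounds)
    also have "\<dots> \<le> c * (real (Suc n) * kw z ^ n * norm z * 1 / 2)"
      using c abs_sin_le[of "z $ i"] component_le_norm_cart[of z i]
      by (intro mult_left_mono divide_right_mono mult_mono) (auto simp: kw_bounds)
    also have "\<dots> \<le> c * (real n * (kw z ^ n * norm z))"
    proof -
      have "real (Suc n) / 2 * (kw z ^ n * norm z) \<le> real n * (kw z ^ n * norm z)"
        using n by (intro mult_right_mono) (auto simp: kw_bounds)
      then show ?thesis using c by (intro mult_left_mono) auto
    qed
    finally have "\<bar>ker_dx (Suc n) i z\<bar> * norm z powr (1 + \<delta>) \<le> c * (real n * (kw z ^ n * norm z)) * norm z powr (1 + \<delta>)"
      by (intro mult_right_mono) auto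
    also have "\<dots> = c * real n * (norm z powr (2 + \<delta>) * kw z ^ n)"
      by (cases "z = 0") (simp_all add: powr_add power2_eq_square)
    also have "\<dots> \<le> c * real n * ((h powr \<delta> * (norm z)\<^sup>2 + h powr (\<delta> - 2) * (norm z) ^ 4) * kw z ^ n)"
      using c by (intro mult_left_mono mult_right_mono split) (auto simp: kw_bounds)
    finally show ?thesis by (simp add: algebra_simps)
  qed
  have int: "integrable M3 (\<lambda>z. (norm z)\<^sup>2 * kw z ^ n)" "integrable M3 (\<lambda>z. (norm z) ^ 4 * kw z ^ n)"
    by (intro continuous_integrable_M3 continuous_intros)+
  have "(LINT z|M3. \<bar>ker_dx (Suc n) i z\<bar> * norm z powr (1 + \<delta>))
      \<le> (LINT z|M3. c * real n * (h powr \<delta> * ((norm z)\<^sup>2 * kw z ^ n) + h powr (\<delta> - 2) * ((norm z) ^ 4 * kw z ^ n)))"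
    using d by (intro integral_mono pt continuous_integrable_M3 continuous_intros continuous_on_powr') auto
  also have "\<dots> = c * real n * (h powr \<delta> * (LINT z|M3. (norm z)\<^sup>2 * kw z ^ n)
                    + h powr (\<delta> - 2) * (LINT z|M3. (norm z) ^ 4 * kw z ^ n))"
    using int by simp
  also have "\<dots> \<le> c * real n * (h powr \<delta> * (24 * kw_mass n / real n)
                    + h powr (\<delta> - 2) * (1728 * kw_mass n / (real n)\<^sup>2))"
    using c n by (intro mult_left_mono add_mono kw_norm2_moment kw_norm4_moment) auto
  also have "\<dots> = c * kw_mass n * (1752 * real n powr (- \<delta> / 2))"
    using n by (simp add: hd hd2 field_simps power2_eq_square)
  also have "\<dots> \<le> c * (2 * kw_mass (Suc n)) * (1752 * real n powr (- \<delta> / 2))"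
    using c kw_mass_Suc[OF n] by (intro mult_right_mono mult_left_mono) auto
  also have "\<dots> = 3504 * vol3 * real n powr (- \<delta> / 2)"
    using kw_mass_pos[of "Suc n"] by (simp add: c_def)
  finally show ?thesis .
qed

section \<open>Fourier coefficients\<close>

lemma fourier_coeff_eq: "fourier_coeff f k = (LINT y|M3. of_real (f y) * ch (- k) y) / of_real vol3"
  by (simp add: fourier_coeff_def ch_def freq_minus vol3_def)

lemma integrable_mult_ch:
  assumes "integrable M3 f"
  shows "integrable M3 (\<lambda>x. complex_of_real (f x) * ch k x)"
proof (rule Bochner_Integration.integrable_bound[OF assms])
  show "(\<lambda>x. complex_of_real (f x) * ch k x) \<in> borel_measurable M3"
    using assms continuous_integrable_M3[OF continuous_ch] by (intro borel_measurable_times) auto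
qed (simp add: norm_mult)

lemma LINT_mult_ch: "(LINT y|M3. of_real (f y) * ch k y) = of_real vol3 * fourier_coeff f (- k)"
  by (simp add: fourier_coeff_eq less_imp_neq[OF vol3_pos, symmetric])

lemma fourier_coeff_uminus: "fourier_coeff f (- k) = cnj (fourier_coeff f k)"
proof -
  show ?thesis unfolding fourier_coeff_eq complex_cnj_divide Bochner_Integration.integral_cnj[symmetric]
    by (simp add: cnj_ch del: Bochner_Integration.integral_cnj)
qed

lemma norm_fourier_coeff_le: "norm (fourier_coeff f k) \<le> (LINT y|M3. \<bar>f y\<bar>) / vol3"
proof -
  have "norm (LINT y|M3. of_real (f y) * ch (- k) y) \<le> (LINT y|M3. norm (of_real (f y) * ch (- k) y))"
    by (rule integral_norm_bound)
  then show ?thesis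
    by (simp add: fourier_coeff_eq norm_divide norm_mult divide_right_mono less_imp_le)
qed

lemma fourier_coeff_diff:
  assumes "integrable M3 f" "integrable M3 g"
  shows "fourier_coeff (\<lambda>x. f x - g x) k = fourier_coeff f k - fourier_coeff g k"
  using integrable_mult_ch[OF assms(1)] integrable_mult_ch[OF assms(2)]
  by (simp add: fourier_coeff_eq left_diff_distrib diff_divide_distrib)

lemma fourier_coeff_sum_ch:
  assumes "finite A" and f: "\<And>x. complex_of_real (f x) = (\<Sum>l\<in>A. c l * ch l x)"
  shows "fourier_coeff f k = (if k \<in> A then c k else 0)"
proof -
  have "(LINT y|M3. complex_of_real (f y) * ch (- k) y) = (LINT y|M3. (\<Sum>l\<in>A. c l * ch (l - k) y))"
    by (simp add: f sum_distrib_right mult.assoc ch_mult)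
  also have "\<dots> = (\<Sum>l\<in>A. c l * (LINT y|M3. ch (l - k) y))"
    by (subst Bochner_Integration.integral_sum) (auto intro!: continuous_integrable_M3 continuous_intros)
  also have "\<dots> = (\<Sum>l\<in>A. if l = k then of_real vol3 * c k else 0)"
    by (intro sum.cong) (auto simp: ch_integral vol3_def)
  also have "\<dots> = of_real vol3 * (if k \<in> A then c k else 0)"
    using assms(1) by (simp add: sum.delta)
  finally show ?thesis
    by (simp add: fourier_coeff_eq less_imp_neq[OF vol3_pos, symmetric])
qed

lemma trigpoly_fourier:
  assumes "trigpoly (\<lambda>x. complex_of_real (f x))"
  shows "\<exists>A. finite A \<and> (\<forall>k. k \<notin> A \<longrightarrow> fourier_coeff f k = 0) \<and>
             (\<forall>x. complex_of_real (f x) = (\<Sum>k\<in>A. fourier_coeff f k * ch k x))"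
proof -
  obtain A c where A: "finite A" "\<And>x. complex_of_real (f x) = (\<Sum>k\<in>A. c k * ch k x)"
    using trigpoly_expansion[OF assms] by metis
  have "fourier_coeff f k = (if k \<in> A then c k else 0)" for k
    by (rule fourier_coeff_sum_ch[OF A])
  then show ?thesis using A by (intro exI[of _ A]) (auto intro!: sum.cong)
qed

lemma LINT_M3_uminus:
  fixes f :: "real^3 \<Rightarrow> 'b::euclidean_space"
  assumes "continuous_on UNIV f" shows "(LINT x|M3. f (- x)) = (LINT x|M3. f x)"
proof -
  have "continuous_on UNIV (\<lambda>x. f (- x))"
    by (rule continuous_on_compose2[OF assms]) (auto intro: continuous_intros)
  moreover have "torus3 = cbox (- (\<chi> i. pi)) (- (\<chi> i. - pi))" by (simp add: torus3_def vec_eq_iff uminus_vec_def)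
  ultimately show ?thesis
    using integral_reflect[of "\<chi> i. pi" "\<chi> i. - pi" f] assms
    by (simp add: continuous_LINT_M3) (simp add: torus3_def)
qed

definition kap :: "nat \<Rightarrow> int^3 \<Rightarrow> real" where
  "kap n k = Re (fourier_coeff (ker n) k)"

definition kset :: "nat \<Rightarrow> (int^3) set" where
  "kset n = {k. fourier_coeff (ker n) k \<noteq> 0}"

lemma fourier_coeff_ker: "fourier_coeff (ker n) k = of_real (kap n k)"
proof -
  have "(LINT y|M3. complex_of_real (ker n (- y)) * ch (- k) (- y)) = (LINT y|M3. complex_of_real (ker n y) * ch (- k) y)"
    by (rule LINT_M3_uminus) (intro continuous_intros)
  then have "fourier_coeff (ker n) (- k) = fourier_coeff (ker n) k"
    by (simp add: fourier_coeff_eq ker_uminus ch_uminus)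
  then show ?thesis
    unfolding fourier_coeff_uminus kap_def by (simp add: complex_eq_iff)
qed

lemma finite_kset [simp]: "finite (kset n)"
  and ker_expansion: "complex_of_real (ker n z) = (\<Sum>k\<in>kset n. of_real (kap n k) * ch k z)"
proof -
  obtain A where A: "finite A" "\<And>k. k \<notin> A \<Longrightarrow> fourier_coeff (ker n) k = 0"
     "\<And>x. complex_of_real (ker n x) = (\<Sum>k\<in>A. fourier_coeff (ker n) k * ch k x)"
    using trigpoly_fourier[OF trigpoly_ker, of n] by metis
  have sub: "kset n \<subseteq> A" using A(2) by (auto simp: kset_def)
  then show "finite (kset n)" using A(1) finite_subset by blast
  have "(\<Sum>k\<in>A. fourier_coeff (ker n) k * ch k z) = (\<Sum>k\<in>kset n. fourier_coeff (ker n) k * ch k z)"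
    by (rule sum.mono_neutral_right) (use A sub in \<open>auto simp: kset_def\<close>)
  then show "complex_of_real (ker n z) = (\<Sum>k\<in>kset n. of_real (kap n k) * ch k z)"
    by (simp add: A(3) flip: fourier_coeff_ker)
qed

lemma ker_dx_expansion:
  "complex_of_real (ker_dx n i z) = (\<Sum>k\<in>kset n. of_real (kap n k) * (\<i> * of_int (k $ i) * ch k z))"
proof -
  have "((\<lambda>h. complex_of_real (ker n (z + axis i h))) has_vector_derivative complex_of_real (ker_dx n i z)) (at 0)"
    by (rule has_vector_derivative_of_real)
       (use ker_axis_derivative[of n z i] in \<open>simp add: has_real_derivative_iff_has_vector_derivative\<close>)
  then show ?thesis
    unfolding ker_expansion by (rule vector_derivative_unique_at[OF _ sum_ch_axis_derivative])
qed

lemma abs_kap_le: "\<bar>kap n k\<bar> \<le> 1"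
proof -
  have "\<bar>kap n k\<bar> \<le> norm (fourier_coeff (ker n) k)"
    unfolding kap_def by (rule abs_Re_le_cmod)
  also have "\<dots> \<le> (LINT y|M3. \<bar>ker n y\<bar>) / vol3" by (rule norm_fourier_coeff_le)
  also have "\<dots> = 1" by (simp add: ker_nonneg ker_integral less_imp_neq[OF vol3_pos, symmetric])
  finally show ?thesis .
qed

lemma ker_norm2_moment: assumes "n > 0"
  shows "(LINT z|M3. (norm z)\<^sup>2 * ker n z) \<le> 24 * vol3 / real n"
proof -
  have "(LINT z|M3. (norm z)\<^sup>2 * ker n z) = vol3 / kw_mass n * (LINT z|M3. (norm z)\<^sup>2 * kw z ^ n)"
    unfolding ker_def by (subst integral_mult_right_zero[symmetric]) (simp add: ac_simps)
  also have "\<dots> \<le> vol3 / kw_mass n * (24 * kw_mass n / real n)"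
    using kw_norm2_moment[OF assms] kw_mass_pos[of n]
    by (intro mult_left_mono) (simp_all add: less_imp_le)
  also have "\<dots> = 24 * vol3 / real n" using kw_mass_pos[of n] by simp
  finally show ?thesis .
qed

lemma one_minus_cos_le: "1 - cos t \<le> t\<^sup>2 / 2" for t :: real
proof -
  have "cos t = 1 - 2 * (sin (t / 2))\<^sup>2" using cos_double_sin[of "t / 2"] by simp
  moreover have "(sin (t / 2))\<^sup>2 \<le> (t / 2)\<^sup>2"
    by (rule abs_le_square_iff[THEN iffD1, OF abs_sin_le])
  ultimately show ?thesis by (simp add: power_divide)
qed

text \<open>The multiplier is the mean of \<open>cos (k \<bullet> z)\<close> under the kernel, and \<open>1 - cos (k \<bullet> z) \<le> |k|\<^sup>2|z|\<^sup>2 / 2\<close> has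
mean \<open>O(1 / n)\<close> by the second moment.\<close>

lemma kap_tendsto: "(\<lambda>n. kap n k) \<longlonglongrightarrow> 1"
proof -
  have le: "\<bar>kap n k - 1\<bar> \<le> 12 * (norm (freq k))\<^sup>2 / real n" if n: "n > 0" for n
  proof -
    have "of_real vol3 * fourier_coeff (ker n) k = (LINT y|M3. complex_of_real (ker n y) * ch (- k) y)"
      by (simp add: fourier_coeff_eq less_imp_neq[OF vol3_pos, symmetric])
    then have "vol3 * kap n k = Re (LINT y|M3. complex_of_real (ker n y) * ch (- k) y)"
      unfolding fourier_coeff_ker by (metis Re_complex_of_real of_real_mult)
    also have "\<dots> = (LINT y|M3. Re (complex_of_real (ker n y) * ch (- k) y))"
      by (rule integral_Re[symmetric]) (intro continuous_integrable_M3 continuous_intros)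
    also have "\<dots> = (LINT y|M3. ker n y * cos (freq k \<bullet> y))"
      by (simp add: ch_def freq_minus)
    finally have "vol3 * (1 - kap n k) = (LINT y|M3. ker n y * (1 - cos (freq k \<bullet> y)))"
      by (simp add: right_diff_distrib ker_integral Bochner_Integration.integral_diff
          continuous_integrable_M3 continuous_intros)
    also have "\<dots> \<le> (LINT y|M3. (norm (freq k))\<^sup>2 / 2 * ((norm y)\<^sup>2 * ker n y))"
    proof (intro integral_mono continuous_integrable_M3 continuous_intros)
      fix y
      have "1 - cos (freq k \<bullet> y) \<le> (freq k \<bullet> y)\<^sup>2 / 2" by (rule one_minus_cos_le)
      also have "\<dots> \<le> (norm (freq k) * norm y)\<^sup>2 / 2"
        using Cauchy_Schwarz_ineq2[of "freq k" y] by (simp add: abs_le_square_iff[symmetric] abs_mult)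
      finally have "ker n y * (1 - cos (freq k \<bullet> y)) \<le> ker n y * ((norm (freq k) * norm y)\<^sup>2 / 2)"
        by (intro mult_left_mono ker_nonneg)
      then show "ker n y * (1 - cos (freq k \<bullet> y)) \<le> (norm (freq k))\<^sup>2 / 2 * ((norm y)\<^sup>2 * ker n y)"
        by (simp add: power_mult_distrib ac_simps)
    qed
    also have "\<dots> = (norm (freq k))\<^sup>2 / 2 * (LINT y|M3. (norm y)\<^sup>2 * ker n y)" by simp
    also have "\<dots> \<le> (norm (freq k))\<^sup>2 / 2 * (24 * vol3 / real n)"
      by (intro mult_left_mono ker_norm2_moment n) auto
    finally have "vol3 * (1 - kap n k) \<le> vol3 * (12 * (norm (freq k))\<^sup>2 / real n)" by (simp add: ac_simps)
    then have "1 - kap n k \<le> 12 * (norm (freq k))\<^sup>2 / real n" by (simp only: mult_le_cancel_left_pos vol3_pos)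
    moreover have "kap n k \<le> 1" using abs_kap_le[of n k] by simp
    ultimately show ?thesis by simp
  qed
  have "(\<lambda>n. 12 * (norm (freq k))\<^sup>2 / real n) \<longlonglongrightarrow> 0" by (rule lim_const_over_n)
  then have "(\<lambda>n. kap n k - 1) \<longlonglongrightarrow> 0"
    by (rule Lim_null_comparison[rotated]) (use le in \<open>auto intro!: eventually_sequentiallyI[of 1]\<close>)
  then show ?thesis by (simp add: LIM_zero_iff)
qed

section \<open>Square integrable functions and Parseval's identity\<close>

definition L2 :: "(real^3 \<Rightarrow> real) \<Rightarrow> bool" where
  "L2 f \<longleftrightarrow> f \<in> borel_measurable M3 \<and> integrable M3 (\<lambda>x. (f x)\<^sup>2)"

lemma abs_mult_le_squares: "\<bar>a * b\<bar> \<le> a\<^sup>2 + b\<^sup>2" for a b :: real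
proof -
  have "0 \<le> (\<bar>a\<bar> - \<bar>b\<bar>)\<^sup>2" by simp
  then have "2 * (\<bar>a\<bar> * \<bar>b\<bar>) \<le> a\<^sup>2 + b\<^sup>2" by (simp add: power2_diff)
  moreover have "\<bar>a\<bar> * \<bar>b\<bar> \<le> 2 * (\<bar>a\<bar> * \<bar>b\<bar>)" by (simp add: mult_nonneg_nonneg)
  ultimately show ?thesis unfolding abs_mult by (rule order.trans[rotated])
qed

lemma square_diff_le: "(a - b)\<^sup>2 \<le> 2 * a\<^sup>2 + 2 * b\<^sup>2" for a b :: real
proof -
  have "0 \<le> (a + b)\<^sup>2" by simp
  then show ?thesis by (simp add: power2_sum power2_diff)
qed

lemma L2_continuous: "continuous_on UNIV f \<Longrightarrow> L2 f"
  using continuous_integrable_M3[of f] continuous_integrable_M3[of "\<lambda>x. (f x)\<^sup>2"]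
  by (auto simp: L2_def intro: continuous_intros borel_measurable_integrable)

lemma L2_mult_integrable:
  assumes "L2 f" "L2 g" shows "integrable M3 (\<lambda>x. f x * g x)"
proof (rule Bochner_Integration.integrable_bound)
  show "integrable M3 (\<lambda>x. (f x)\<^sup>2 + (g x)\<^sup>2)"
    using assms by (simp add: L2_def)
  show "(\<lambda>x. f x * g x) \<in> borel_measurable M3"
    using assms unfolding L2_def by (intro borel_measurable_times) auto
  show "AE x in M3. norm (f x * g x) \<le> norm ((f x)\<^sup>2 + (g x)\<^sup>2)"
    using abs_mult_le_squares by (auto intro!: AE_I2)
qed

lemma L2_integrable: assumes "L2 f" shows "integrable M3 f"
  using L2_mult_integrable[OF assms L2_continuous[of "\<lambda>_. 1"]] by simp

lemma L2_diff: assumes "L2 f" "L2 g" shows "L2 (\<lambda>x. f x - g x)"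
proof -
  have "integrable M3 (\<lambda>x. (f x)\<^sup>2 - 2 * (f x * g x) + (g x)\<^sup>2)"
    using assms L2_mult_integrable[OF assms] by (simp add: L2_def)
  moreover have "(\<lambda>x. f x - g x) \<in> borel_measurable M3"
    using assms unfolding L2_def by (intro borel_measurable_diff) auto
  ultimately show ?thesis by (simp add: L2_def power2_diff algebra_simps)
qed

text \<open>The Cauchy--Schwarz inequality, from the nonnegative quadratic polynomial
  \<open>\<integral>(|f| - c|g|)\<^sup>2\<close>.\<close>

lemma L2_cauchy_schwarz:
  assumes "L2 f" "L2 g"
  shows "(LINT x|M3. \<bar>f x * g x\<bar>) \<le> sqrt (LINT x|M3. (f x)\<^sup>2) * sqrt (LINT x|M3. (g x)\<^sup>2)"
proof -
  define F where "F = (LINT x|M3. (f x)\<^sup>2)"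
  define G where "G = (LINT x|M3. (g x)\<^sup>2)"
  define P where "P = (LINT x|M3. \<bar>f x * g x\<bar>)"
  have FG: "0 \<le> F" "0 \<le> G" "0 \<le> P" by (auto simp: F_def G_def P_def)
  have int: "integrable M3 (\<lambda>x. (f x)\<^sup>2)" "integrable M3 (\<lambda>x. (g x)\<^sup>2)" "integrable M3 (\<lambda>x. \<bar>f x * g x\<bar>)"
    using assms L2_mult_integrable[OF assms] by (auto simp: L2_def)
  have quad: "2 * c * P \<le> F + c\<^sup>2 * G" for c
  proof -
    have "0 \<le> (LINT x|M3. (\<bar>f x\<bar> - c * \<bar>g x\<bar>)\<^sup>2)" by simp
    also have "\<dots> = (LINT x|M3. (f x)\<^sup>2 - 2 * c * \<bar>f x * g x\<bar> + c\<^sup>2 * (g x)\<^sup>2)"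
      by (intro Bochner_Integration.integral_cong)
         (simp_all add: power2_diff power_mult_distrib abs_mult algebra_simps)
    also have "\<dots> = F - 2 * c * P + c\<^sup>2 * G"
      using int by (simp add: F_def G_def P_def)
    finally show ?thesis by simp
  qed
  have "P\<^sup>2 \<le> F * G"
  proof (cases "G = 0")
    case True
    have "P \<le> 0"
    proof (rule ccontr)
      assume "\<not> P \<le> 0"
      then show False using quad[of "(F + 1) / (2 * P)"] FG True by simp
    qed
    then show ?thesis using FG True by simp
  next
    case False
    then have G: "G > 0" using FG by simp
    have "2 * (P / G) * P \<le> F + (P / G)\<^sup>2 * G" by (rule quad)
    then have "P\<^sup>2 / G \<le> F" using G by (simp add: power2_eq_square field_simps)
    then show ?thesis using G by (simp add: field_simps)
  qed
  then have "P \<le> sqrt (F * G)" by (rule real_le_rsqrt)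
  then show ?thesis by (simp add: real_sqrt_mult F_def G_def P_def)
qed

lemma sum_ch_norm2_integral:
  assumes "finite A"
  shows "(LINT x|M3. (cmod (\<Sum>k\<in>A. c k * ch k x))\<^sup>2) = vol3 * (\<Sum>k\<in>A. (cmod (c k))\<^sup>2)"
proof -
  have "complex_of_real (LINT x|M3. (cmod (\<Sum>k\<in>A. c k * ch k x))\<^sup>2)
      = (LINT x|M3. complex_of_real ((cmod (\<Sum>k\<in>A. c k * ch k x))\<^sup>2))"
    by (rule integral_complex_of_real[symmetric])
  also have "\<dots> = (LINT x|M3. (\<Sum>k\<in>A. \<Sum>l\<in>A. c k * cnj (c l) * ch (k - l) x))"
  proof (rule Bochner_Integration.integral_cong[OF refl])
    fix x
    have "complex_of_real ((cmod (\<Sum>k\<in>A. c k * ch k x))\<^sup>2) = (\<Sum>k\<in>A. c k * ch k x) * cnj (\<Sum>k\<in>A. c k * ch k x)"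
      by (rule complex_norm_square)
    also have "\<dots> = (\<Sum>k\<in>A. \<Sum>l\<in>A. (c k * ch k x) * (cnj (c l) * ch (- l) x))"
      by (simp add: sum_product cnj_ch)
    also have "\<dots> = (\<Sum>k\<in>A. \<Sum>l\<in>A. c k * cnj (c l) * (ch k x * ch (- l) x))"
      by (simp add: ac_simps)
    finally show "complex_of_real ((cmod (\<Sum>k\<in>A. c k * ch k x))\<^sup>2) = (\<Sum>k\<in>A. \<Sum>l\<in>A. c k * cnj (c l) * ch (k - l) x)"
      by (simp add: ch_mult)
  qed
  also have "\<dots> = (\<Sum>k\<in>A. \<Sum>l\<in>A. c k * cnj (c l) * (LINT x|M3. ch (k - l) x))"
    by (simp add: Bochner_Integration.integral_sum continuous_integrable_M3 continuous_intros)
  also have "\<dots> = (\<Sum>k\<in>A. \<Sum>l\<in>A. if l = k then of_real vol3 * (c k * cnj (c k)) else 0)"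
    by (intro sum.cong) (auto simp: ch_integral vol3_def)
  also have "\<dots> = (\<Sum>k\<in>A. of_real vol3 * (c k * cnj (c k)))"
    using assms by (simp add: sum.delta)
  also have "\<dots> = complex_of_real (vol3 * (\<Sum>k\<in>A. (cmod (c k))\<^sup>2))"
    by (simp only: complex_norm_square[symmetric] of_real_mult of_real_sum sum_distrib_left)
  finally show ?thesis by (simp only: of_real_eq_iff)
qed

lemma cmod_of_real_diff_square: "(cmod (of_real a - z))\<^sup>2 = a\<^sup>2 - 2 * (a * Re z) + (cmod z)\<^sup>2"
  by (simp add: cmod_power2 power2_diff)

text \<open>Completing the square separates the optimal coefficients from the rest. Bessel's inequality and the best
approximation property are both read off from this.\<close>

lemma L2_distance_sum_ch:
  assumes f: "L2 f" and A: "finite A"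
  shows "(LINT x|M3. (cmod (of_real (f x) - (\<Sum>k\<in>A. c k * ch k x)))\<^sup>2)
       = (LINT x|M3. (f x)\<^sup>2) - vol3 * (\<Sum>k\<in>A. (cmod (fourier_coeff f k))\<^sup>2)
         + vol3 * (\<Sum>k\<in>A. (cmod (c k - fourier_coeff f k))\<^sup>2)"
proof -
  let ?P = "\<lambda>x. \<Sum>k\<in>A. c k * ch k x"
  note fi = L2_integrable[OF f]
  have ich: "integrable M3 (\<lambda>x. complex_of_real (f x) * ch k x)" for k
    by (rule integrable_mult_ch[OF fi])
  have eq: "complex_of_real (f x) * ?P x = (\<Sum>k\<in>A. c k * (of_real (f x) * ch k x))" for x
    by (simp add: sum_distrib_left ac_simps)
  have ifP: "integrable M3 (\<lambda>x. complex_of_real (f x) * ?P x)"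
    unfolding eq using ich by (intro Bochner_Integration.integrable_sum integrable_mult_right)
  have reP: "(\<lambda>x. f x * Re (?P x)) = (\<lambda>x. Re (complex_of_real (f x) * ?P x))" by simp
  have iRe: "integrable M3 (\<lambda>x. f x * Re (?P x))"
    unfolding reP using ifP by (rule integrable_Re)
  have iP: "integrable M3 (\<lambda>x. (cmod (?P x))\<^sup>2)"
    by (intro continuous_integrable_M3 continuous_intros)
  have "(LINT x|M3. f x * Re (?P x)) = Re (LINT x|M3. complex_of_real (f x) * ?P x)"
    unfolding reP using ifP by (rule integral_Re)
  also have "(LINT x|M3. complex_of_real (f x) * ?P x) = (\<Sum>k\<in>A. c k * (of_real vol3 * cnj (fourier_coeff f k)))"
    unfolding eq using ich by (simp add: Bochner_Integration.integral_sum LINT_mult_ch fourier_coeff_uminus)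
  also have "Re \<dots> = vol3 * (\<Sum>k\<in>A. Re (c k * cnj (fourier_coeff f k)))"
    by (simp add: sum_distrib_left algebra_simps)
  finally have cross: "(LINT x|M3. f x * Re (?P x)) = vol3 * (\<Sum>k\<in>A. Re (c k * cnj (fourier_coeff f k)))" .
  have "(LINT x|M3. (cmod (of_real (f x) - ?P x))\<^sup>2)
      = (LINT x|M3. (f x)\<^sup>2 - 2 * (f x * Re (?P x)) + (cmod (?P x))\<^sup>2)"
    by (simp only: cmod_of_real_diff_square)
  also have "\<dots> = (LINT x|M3. (f x)\<^sup>2) - 2 * (LINT x|M3. f x * Re (?P x)) + (LINT x|M3. (cmod (?P x))\<^sup>2)"
    using f iRe iP by (simp add: L2_def)
  also have "\<dots> = (LINT x|M3. (f x)\<^sup>2) - 2 * (vol3 * (\<Sum>k\<in>A. Re (c k * cnj (fourier_coeff f k))))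
                   + vol3 * (\<Sum>k\<in>A. (cmod (c k))\<^sup>2)"
    unfolding cross by (simp only: sum_ch_norm2_integral[OF A])
  also have "vol3 * (\<Sum>k\<in>A. (cmod (c k))\<^sup>2)
      = vol3 * (\<Sum>k\<in>A. (cmod (c k - fourier_coeff f k))\<^sup>2 + 2 * Re (c k * cnj (fourier_coeff f k)) - (cmod (fourier_coeff f k))\<^sup>2)"
    by (simp add: cmod_power2 power2_diff algebra_simps)
  finally show ?thesis
    by (simp add: sum.distrib sum_subtractf sum_distrib_left algebra_simps)
qed

lemma bessel:
  assumes "L2 f" "finite A"
  shows "vol3 * (\<Sum>k\<in>A. (cmod (fourier_coeff f k))\<^sup>2) \<le> (LINT x|M3. (f x)\<^sup>2)"
proof -
  have "0 \<le> (LINT x|M3. (cmod (of_real (f x) - (\<Sum>k\<in>A. fourier_coeff f k * ch k x)))\<^sup>2)" by simp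
  then show ?thesis using L2_distance_sum_ch[OF assms, of "fourier_coeff f"] by simp
qed

text \<open>Continuous functions that vanish on the boundary of the fundamental domain are dense in
  \<open>L\<^sup>2\<close>: truncate, approximate the truncation almost everywhere by continuous functions, and cut off
  near the boundary.\<close>

definition bdry_dist :: "real^3 \<Rightarrow> real" where
  "bdry_dist x = (\<Prod>i\<in>UNIV. (pi - \<bar>x $ i\<bar>))"

lemma L2_approx_continuous:
  assumes f: "L2 f" and e: "e > 0"
  shows "\<exists>h. continuous_on UNIV h \<and> (\<forall>x\<in>torus3. (\<exists>i. \<bar>x $ i\<bar> = pi) \<longrightarrow> h x = 0) \<and>
             (LINT x|M3. (f x - h x)\<^sup>2) < e"
proof -
  have fm: "f \<in> borel_measurable M3" and f2: "integrable M3 (\<lambda>x. (f x)\<^sup>2)" using f by (auto simp: L2_def)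
  define tr where "tr m x = max (- real m) (min (real m) x)" for m x
  have tr_bound: "\<bar>tr m x\<bar> \<le> real m" for m x by (auto simp: tr_def)
  have tr_le: "\<bar>tr m x\<bar> \<le> \<bar>x\<bar>" for m x by (auto simp: tr_def)
  have "(\<lambda>m. LINT x|M3. (f x - tr m (f x))\<^sup>2) \<longlonglongrightarrow> (LINT x|M3. 0)"
  proof (rule integral_dominated_convergence)
    show "integrable M3 (\<lambda>x. 4 * (f x)\<^sup>2)" using f2 by simp
    show "AE x in M3. (\<lambda>m. (f x - tr m (f x))\<^sup>2) \<longlonglongrightarrow> 0"
    proof (rule AE_I2)
      fix x
      obtain m0 where m0: "\<bar>f x\<bar> \<le> real m0" using real_arch_simple by blast
      have "tr m (f x) = f x" if "m \<ge> m0" for m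
        using that m0 by (auto simp: tr_def)
      then show "(\<lambda>m. (f x - tr m (f x))\<^sup>2) \<longlonglongrightarrow> 0"
        by (intro tendsto_eventually eventually_sequentiallyI[of m0]) simp
    qed
    show "AE x in M3. norm ((f x - tr m (f x))\<^sup>2) \<le> 4 * (f x)\<^sup>2" for m
    proof (rule AE_I2)
      fix x
      have "(tr m (f x))\<^sup>2 \<le> (f x)\<^sup>2" using tr_le abs_le_square_iff by blast
      then show "norm ((f x - tr m (f x))\<^sup>2) \<le> 4 * (f x)\<^sup>2"
        using square_diff_le[of "f x" "tr m (f x)"] by simp
    qed
  qed (use fm in \<open>auto simp: tr_def\<close>)
  then have "eventually (\<lambda>m. (LINT x|M3. (f x - tr m (f x))\<^sup>2) < e / 4) sequentially"
    using e by (intro order_tendstoD(2)[where y = 0]) simp_all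
  then obtain m where m: "(LINT x|M3. (f x - tr m (f x))\<^sup>2) < e / 4"
    using eventually_happens'[OF sequentially_bot] by blast
  have "f measurable_on torus3"
    using fm by (simp add: measurable_on_iff_borel_measurable)
  then obtain N g where N: "negligible N" and g: "\<And>n. continuous_on UNIV (g n)"
    and lim: "\<And>x. x \<notin> N \<Longrightarrow> (\<lambda>n. g n x) \<longlonglongrightarrow> (if x \<in> torus3 then f x else 0)"
    unfolding measurable_on_def by blast
  define cut where "cut n x = min 1 (real n * \<bar>bdry_dist x\<bar>)" for n x
  define h where "h n x = tr m (g n x) * cut n x" for n x
  have ctr: "continuous_on UNIV (tr m)" unfolding tr_def by (intro continuous_intros)
  have conth: "continuous_on UNIV (h n)" for n
    unfolding h_def cut_def bdry_dist_def
    by (intro continuous_intros continuous_on_compose2[OF ctr] g) auto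
  have cutb: "0 \<le> cut n x" "cut n x \<le> 1" for n x by (auto simp: cut_def)
  have hb: "\<bar>h n x\<bar> \<le> real m" for n x
    using mult_mono[OF tr_bound[of m "g n x"] cutb(2)[of n x]] cutb[of n x] by (simp add: h_def abs_mult)
  have "(\<lambda>n. LINT x|M3. (tr m (f x) - h n x)\<^sup>2) \<longlonglongrightarrow> (LINT x|M3. 0)"
  proof (rule integral_dominated_convergence)
    show "integrable M3 (\<lambda>x. 4 * (real m)\<^sup>2)"
      by (rule continuous_integrable_M3) (rule continuous_on_const)
    have N2: "negligible (cbox (\<chi> i. - pi) (\<chi> i. pi) - box (\<chi> i. - pi) (\<chi> i. pi) :: (real^3) set)"
      by (rule negligible_frontier_interval)
    have "AE x in lebesgue. x \<notin> N \<union> (cbox (\<chi> i. - pi) (\<chi> i. pi) - box (\<chi> i. - pi) (\<chi> i. pi))"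
      using negligible_Un[OF N N2] by (intro AE_not_in) (simp add: negligible_iff_null_sets)
    then have ae: "AE x in M3. x \<notin> N \<union> (cbox (\<chi> i. - pi) (\<chi> i. pi) - box (\<chi> i. - pi) (\<chi> i. pi))"
      by (simp add: AE_restrict_space_iff) (auto elim: eventually_mono)
    show "AE x in M3. (\<lambda>n. (tr m (f x) - h n x)\<^sup>2) \<longlonglongrightarrow> 0"
      using ae
    proof (rule AE_mp, intro AE_I2 impI)
      fix x assume x: "x \<in> space M3" and nx: "x \<notin> N \<union> (cbox (\<chi> i. - pi) (\<chi> i. pi) - box (\<chi> i. - pi) (\<chi> i. pi))"
      have "x \<in> box (\<chi> i. - pi) (\<chi> i. pi)" using x nx by (auto simp: torus3_def)
      then have "\<bar>x $ i\<bar> < pi" for i by (simp add: mem_box_cart abs_less_iff) (metis minus_less_iff)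
      then have pos: "bdry_dist x > 0" unfolding bdry_dist_def by (intro prod_pos) simp
      obtain n0 where n0: "1 / bdry_dist x \<le> real n0" using real_arch_simple by blast
      have "cut n x = 1" if "n \<ge> n0" for n
      proof -
        have "1 / bdry_dist x \<le> real n" using n0 that by simp
        then show ?thesis using pos by (simp add: cut_def field_simps)
      qed
      then have 1: "(\<lambda>n. cut n x) \<longlonglongrightarrow> 1"
        by (intro tendsto_eventually eventually_sequentiallyI[of n0])
      have "(\<lambda>n. g n x) \<longlonglongrightarrow> f x" using lim[of x] nx x by simp
      then have "(\<lambda>n. tr m (g n x)) \<longlonglongrightarrow> tr m (f x)"
        unfolding tr_def by (intro tendsto_intros)
      then have "(\<lambda>n. h n x) \<longlonglongrightarrow> tr m (f x) * 1"
        unfolding h_def by (intro tendsto_mult 1)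
      then have "(\<lambda>n. (tr m (f x) - h n x)\<^sup>2) \<longlonglongrightarrow> (tr m (f x) - tr m (f x) * 1)\<^sup>2"
        by (intro tendsto_intros)
      then show "(\<lambda>n. (tr m (f x) - h n x)\<^sup>2) \<longlonglongrightarrow> 0" by simp
    qed
    show "AE x in M3. norm ((tr m (f x) - h n x)\<^sup>2) \<le> 4 * (real m)\<^sup>2" for n
    proof (rule AE_I2)
      fix x
      have "(tr m (f x))\<^sup>2 \<le> (real m)\<^sup>2" "(h n x)\<^sup>2 \<le> (real m)\<^sup>2"
        using tr_bound[of m "f x"] hb[of n x] by (simp_all flip: abs_le_square_iff)
      then show "norm ((tr m (f x) - h n x)\<^sup>2) \<le> 4 * (real m)\<^sup>2"
        using square_diff_le[of "tr m (f x)" "h n x"] by simp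
    qed
    have "h n \<in> borel_measurable M3" for n
      using continuous_integrable_M3[OF conth] by (rule borel_measurable_integrable)
    then show "(\<lambda>x. (tr m (f x) - h n x)\<^sup>2) \<in> borel_measurable M3" for n
      using fm unfolding tr_def by (intro borel_measurable_power borel_measurable_diff borel_measurable_max borel_measurable_min) auto
  qed simp
  then have "eventually (\<lambda>n. (LINT x|M3. (tr m (f x) - h n x)\<^sup>2) < e / 4) sequentially"
    using e by (intro order_tendstoD(2)[where y = 0]) simp_all
  then obtain n where n: "(LINT x|M3. (tr m (f x) - h n x)\<^sup>2) < e / 4"
    using eventually_happens'[OF sequentially_bot] by blast
  have L2tr: "L2 (\<lambda>x. tr m (f x))"
    unfolding L2_def
  proof
    show tm: "(\<lambda>x. tr m (f x)) \<in> borel_measurable M3" using fm by (simp add: tr_def)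
    show "integrable M3 (\<lambda>x. (tr m (f x))\<^sup>2)"
    proof (rule Bochner_Integration.integrable_bound[OF f2])
      show "AE x in M3. norm ((tr m (f x))\<^sup>2) \<le> norm ((f x)\<^sup>2)"
        using tr_le by (intro AE_I2) (simp flip: abs_le_square_iff)
    qed (use tm in simp)
  qed
  have d1: "integrable M3 (\<lambda>x. (f x - tr m (f x))\<^sup>2)" and d2: "integrable M3 (\<lambda>x. (tr m (f x) - h n x)\<^sup>2)"
    and d3: "integrable M3 (\<lambda>x. (f x - h n x)\<^sup>2)"
    using L2_diff[OF f L2tr] L2_diff[OF L2tr L2_continuous[OF conth]] L2_diff[OF f L2_continuous[OF conth]]
    by (auto simp: L2_def)
  have "(LINT x|M3. (f x - h n x)\<^sup>2) \<le> (LINT x|M3. 2 * (f x - tr m (f x))\<^sup>2 + 2 * (tr m (f x) - h n x)\<^sup>2)"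
  proof (rule integral_mono[OF d3])
    fix x show "(f x - h n x)\<^sup>2 \<le> 2 * (f x - tr m (f x))\<^sup>2 + 2 * (tr m (f x) - h n x)\<^sup>2"
      using square_diff_le[of "f x - tr m (f x)" "h n x - tr m (f x)"] by (simp add: power2_commute)
  qed (use d1 d2 in simp)
  also have "\<dots> = 2 * (LINT x|M3. (f x - tr m (f x))\<^sup>2) + 2 * (LINT x|M3. (tr m (f x) - h n x)\<^sup>2)"
    using d1 d2 by simp
  also have "\<dots> < e" using m n by simp
  finally have "(LINT x|M3. (f x - h n x)\<^sup>2) < e" .
  moreover have "h n x = 0" if b: "\<exists>i. \<bar>x $ i\<bar> = pi" for x
  proof -
    obtain i where "\<bar>x $ i\<bar> = pi" using b by blast
    then have "bdry_dist x = 0" unfolding bdry_dist_def by (intro prod_zero bexI[of _ i]) auto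
    then show ?thesis by (simp add: h_def cut_def)
  qed
  ultimately show ?thesis using conth by blast
qed

text \<open>Two points of the closed fundamental domain whose coordinates agree modulo \<open>2\<pi>\<close> either
  coincide or both lie on the boundary, where \<open>h\<close> vanishes; by compactness the oscillation of \<open>h\<close>
  is controlled by the periodic distance.\<close>

lemma torus_modulus_of_continuity:
  assumes conth: "continuous_on UNIV h" and bd: "\<And>x. x \<in> torus3 \<Longrightarrow> \<exists>i. \<bar>x $ i\<bar> = pi \<Longrightarrow> h x = 0"
    and e: "(e::real) > 0"
  shows "\<exists>C\<ge>0. \<forall>x\<in>torus3. \<forall>y\<in>torus3. \<bar>h x - h y\<bar> \<le> e + C * (\<Sum>i\<in>UNIV. (1 - cos (x $ i - y $ i)))"
proof -
  define q where "q p = (\<Sum>i\<in>UNIV. (1 - cos (fst p $ i - snd p $ i)))" for p :: "(real^3) \<times> (real^3)"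
  define osc where "osc p = \<bar>h (fst p) - h (snd p)\<bar>" for p :: "(real^3) \<times> (real^3)"
  have cq: "continuous_on UNIV q" unfolding q_def
    by (intro continuous_intros continuous_on_cos)
  have co: "continuous_on UNIV osc" unfolding osc_def
    by (intro continuous_intros continuous_on_compose2[OF conth]) auto
  have qnn: "q p \<ge> 0" for p unfolding q_def by (intro sum_nonneg) simp
  have ct: "compact (torus3 \<times> torus3)" by (intro compact_Times) (simp_all add: torus3_def)
  define S where "S = (torus3 \<times> torus3) \<inter> {p. e \<le> osc p}"
  have cS: "compact S" unfolding S_def
    by (rule compact_Int_closed[OF ct]) (rule closed_Collect_le[OF continuous_on_const co])
  have qpos: "q p > 0" if "p \<in> S" for p
  proof (rule ccontr)
    assume "\<not> q p > 0"
    then have "q p = 0" using qnn[of p] by simp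
    then have c1: "cos (fst p $ i - snd p $ i) = 1" for i
      unfolding q_def by (subst (asm) sum_nonneg_eq_0_iff) auto
    have t: "\<bar>fst p $ i\<bar> \<le> pi" "\<bar>snd p $ i\<bar> \<le> pi" for i
      using that by (auto simp: S_def mem_torus3)
    have "osc p = 0"
    proof (cases "fst p = snd p")
      case False
      then obtain i where i: "fst p $ i \<noteq> snd p $ i" by (auto simp: vec_eq_iff)
      obtain m :: int where m: "fst p $ i - snd p $ i = of_int m * 2 * pi"
        using c1[of i] cos_one_2pi_int by blast
      have "m \<noteq> 0" using i m by auto
      then have "1 \<le> \<bar>real_of_int m\<bar>" by linarith
      then have "2 * pi \<le> \<bar>fst p $ i - snd p $ i\<bar>" unfolding m by (simp add: abs_mult)
      then have "\<bar>fst p $ i\<bar> = pi" "\<bar>snd p $ i\<bar> = pi" using t[of i] by linarith+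
      then have "h (fst p) = 0" "h (snd p) = 0"
        using that by (auto simp: S_def intro!: bd)
      then show ?thesis by (simp add: osc_def)
    qed (simp add: osc_def)
    then show False using that e by (simp add: S_def)
  qed
  obtain B where B: "\<And>p. p \<in> torus3 \<times> torus3 \<Longrightarrow> osc p \<le> B"
    using compact_imp_bounded[OF compact_continuous_image[OF continuous_on_subset[OF co subset_UNIV] ct]]
    by (auto simp: bounded_iff) (metis abs_le_D1)
  have onn: "osc p \<ge> 0" for p by (simp add: osc_def)
  obtain d where d: "d > 0" "\<And>p. p \<in> S \<Longrightarrow> d \<le> q p"
  proof (cases "S = {}")
    case False
    obtain p0 where "p0 \<in> S" "\<And>p. p \<in> S \<Longrightarrow> q p0 \<le> q p"
      using continuous_attains_inf[OF cS False continuous_on_subset[OF cq subset_UNIV]] by blast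
    then show ?thesis using that[of "q p0"] qpos by auto
  qed (use that[of 1] in auto)
  define C where "C = max 0 B / d"
  have "\<bar>h x - h y\<bar> \<le> e + C * (\<Sum>i\<in>UNIV. (1 - cos (x $ i - y $ i)))" if "x \<in> torus3" "y \<in> torus3" for x y
  proof (cases "(x, y) \<in> S")
    case True
    have "osc (x, y) \<le> max 0 B" using B[of "(x, y)"] that by auto
    also have "\<dots> = C * d" using d by (simp add: C_def)
    also have "\<dots> \<le> C * q (x, y)" using d True by (intro mult_left_mono) (auto simp: C_def)
    finally show ?thesis using e by (simp add: osc_def q_def)
  next
    case False
    then have "osc (x, y) \<le> e" using that by (auto simp: S_def)
    moreover have "0 \<le> C * q (x, y)" using d qnn by (simp add: C_def)
    ultimately show ?thesis by (simp add: osc_def q_def)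
  qed
  moreover have "C \<ge> 0" using d by (simp add: C_def)
  ultimately show ?thesis by blast
qed

lemma ker_shift_integral:
  fixes x :: "real^3"
  assumes "continuous_on UNIV \<psi>" "periodic \<psi>"
  shows "(LINT y|M3. \<psi> (x - y) :: real) = (LINT z|M3. \<psi> z)"
proof -
  have c: "continuous_on UNIV (\<lambda>y. \<psi> (x + y))"
    by (rule continuous_on_compose2[OF assms(1)]) (auto intro: continuous_intros)
  have "(LINT y|M3. \<psi> (x - y)) = (LINT y|M3. \<psi> (x + y))"
    using LINT_M3_uminus[OF c] by simp
  also have "\<dots> = (LINT z|M3. \<psi> z)"
    using LINT_torus_shift[OF assms, of x] by (simp add: add.commute)
  finally show ?thesis .
qed

lemma periodic_ker: "periodic (ker n)"
  unfolding periodic_def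
proof (intro allI)
  fix x i
  have "complex_of_real (ker n (x + axis i (2 * pi))) = complex_of_real (ker n x)"
    unfolding ker_expansion using periodic_ch by (simp add: periodic_def)
  then show "ker n (x + axis i (2 * pi)) = ker n x" by simp
qed

lemma periodic_cos_nth: "periodic (\<lambda>z. cos (z $ i))"
  by (auto simp: periodic_def axis_def)

lemma ker_convolution_expansion:
  assumes "integrable M3 h"
  shows "complex_of_real ((LINT y|M3. ker n (x - y) * h y) / vol3)
         = (\<Sum>k\<in>kset n. of_real (kap n k) * fourier_coeff h k * ch k x)"
proof -
  have eq: "complex_of_real (ker n (x - y) * h y)
      = (\<Sum>k\<in>kset n. of_real (kap n k) * ch k x * (of_real (h y) * ch (- k) y))" for y
  proof -
    have "ch k (x - y) = ch k x * ch (- k) y" for k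
      using ch_add[of k x "- y"] by (simp add: ch_uminus)
    then have "complex_of_real (ker n (x - y) * h y)
        = (\<Sum>k\<in>kset n. of_real (kap n k) * (ch k x * ch (- k) y)) * of_real (h y)"
      by (simp add: ker_expansion)
    then show ?thesis unfolding sum_distrib_right by (simp add: ac_simps)
  qed
  have "complex_of_real (LINT y|M3. ker n (x - y) * h y) = (LINT y|M3. complex_of_real (ker n (x - y) * h y))"
    by (rule integral_complex_of_real[symmetric])
  also have "\<dots> = (\<Sum>k\<in>kset n. of_real (kap n k) * ch k x * (LINT y|M3. of_real (h y) * ch (- k) y))"
    unfolding eq
    by (subst Bochner_Integration.integral_sum)
       (auto intro!: integrable_mult_right integrable_mult_ch assms)
  finally show ?thesis
    by (simp add: LINT_mult_ch sum_divide_distrib less_imp_neq[OF vol3_pos, symmetric] ac_simps)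
qed

text \<open>The modulus of continuity in terms of \<open>1 - cos\<close> is exactly what the first moments of the kernel
integrate to \<open>O(1 / n)\<close>.\<close>

lemma ker_convolution_approx:
  assumes conth: "continuous_on UNIV h" and bd: "\<And>x. x \<in> torus3 \<Longrightarrow> \<exists>i. \<bar>x $ i\<bar> = pi \<Longrightarrow> h x = 0"
    and e: "(e::real) > 0"
  shows "\<exists>n. \<forall>x\<in>torus3. cmod (of_real (h x) - (\<Sum>k\<in>kset n. of_real (kap n k) * fourier_coeff h k * ch k x)) \<le> e"
proof -
  obtain C where C: "C \<ge> 0" "\<And>x y. x \<in> torus3 \<Longrightarrow> y \<in> torus3 \<Longrightarrow>
      \<bar>h x - h y\<bar> \<le> e / 2 + C * (\<Sum>i\<in>UNIV. (1 - cos (x $ i - y $ i)))"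
    using torus_modulus_of_continuity[OF conth bd, of "e / 2"] e by auto
  obtain n0 where n0: "6 * C / e \<le> real n0" using real_arch_simple by blast
  define n where "n = Suc n0"
  have n: "n > 0" "3 * C / real n \<le> e / 2"
    using n0 e C(1) by (auto simp: n_def field_simps)
  have "cmod (of_real (h x) - (\<Sum>k\<in>kset n. of_real (kap n k) * fourier_coeff h k * ch k x)) \<le> e"
    if x: "x \<in> torus3" for x
  proof -
    have ck: "continuous_on UNIV (\<lambda>y. ker n (x - y))" by (intro continuous_intros)
    have ck2: "continuous_on UNIV (\<lambda>y. ker n (x - y) * h y)" by (intro continuous_intros ck conth)
    have ck3: "continuous_on UNIV (\<lambda>y. (1 - cos (x $ i - y $ i)) * ker n (x - y))" for i
      by (intro continuous_intros ck continuous_on_cos)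
    have "(\<Sum>k\<in>kset n. of_real (kap n k) * fourier_coeff h k * ch k x)
        = complex_of_real ((LINT y|M3. ker n (x - y) * h y) / vol3)"
      by (rule ker_convolution_expansion[OF continuous_integrable_M3[OF conth], symmetric])
    moreover have "h x = (LINT y|M3. ker n (x - y) * h x) / vol3"
      using ker_shift_integral[OF continuous_ker[OF continuous_on_id] periodic_ker, of n x]
      by (simp add: ker_integral less_imp_neq[OF vol3_pos, symmetric])
    ultimately have "of_real (h x) - (\<Sum>k\<in>kset n. of_real (kap n k) * fourier_coeff h k * ch k x)
        = complex_of_real ((LINT y|M3. ker n (x - y) * h x) / vol3 - (LINT y|M3. ker n (x - y) * h y) / vol3)"
      by simp
    also have "(LINT y|M3. ker n (x - y) * h x) / vol3 - (LINT y|M3. ker n (x - y) * h y) / vol3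
        = (LINT y|M3. ker n (x - y) * (h x - h y)) / vol3"
      by (simp add: right_diff_distrib diff_divide_distrib Bochner_Integration.integral_diff
          continuous_integrable_M3 ck ck2 continuous_intros)
    finally have cm: "cmod (of_real (h x) - (\<Sum>k\<in>kset n. of_real (kap n k) * fourier_coeff h k * ch k x))
        = \<bar>LINT y|M3. ker n (x - y) * (h x - h y)\<bar> / vol3"
      using vol3_pos by (simp only: norm_of_real abs_divide abs_of_pos)
    have "\<bar>LINT y|M3. ker n (x - y) * (h x - h y)\<bar> \<le> (LINT y|M3. \<bar>ker n (x - y) * (h x - h y)\<bar>)"
      by (rule integral_abs_bound)
    also have "\<dots> \<le> (LINT y|M3. e / 2 * ker n (x - y) + C * (\<Sum>i\<in>UNIV. (1 - cos (x $ i - y $ i)) * ker n (x - y)))"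
    proof (rule integral_mono)
      fix y assume "y \<in> space M3"
      then have "ker n (x - y) * \<bar>h x - h y\<bar> \<le> ker n (x - y) * (e / 2 + C * (\<Sum>i\<in>UNIV. (1 - cos (x $ i - y $ i))))"
        using C(2)[OF x] by (intro mult_left_mono ker_nonneg) auto
      then show "\<bar>ker n (x - y) * (h x - h y)\<bar> \<le> e / 2 * ker n (x - y) + C * (\<Sum>i\<in>UNIV. (1 - cos (x $ i - y $ i)) * ker n (x - y))"
        unfolding abs_mult abs_of_nonneg[OF ker_nonneg]
        by (simp add: sum_distrib_left distrib_left mult.left_commute mult.commute)
    qed (intro continuous_integrable_M3 continuous_intros ck conth ck3)+
    also have "\<dots> = e / 2 * (LINT y|M3. ker n (x - y)) + C * (\<Sum>i\<in>UNIV. LINT y|M3. (1 - cos (x $ i - y $ i)) * ker n (x - y))"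
      using continuous_integrable_M3[OF ck] continuous_integrable_M3[OF ck3]
      by (simp add: Bochner_Integration.integral_sum)
    also have "(LINT y|M3. ker n (x - y)) = vol3"
      using ker_shift_integral[OF continuous_ker[OF continuous_on_id] periodic_ker, of n x] by (simp add: ker_integral)
    finally have bnd: "\<bar>LINT y|M3. ker n (x - y) * (h x - h y)\<bar>
      \<le> e / 2 * vol3 + C * (\<Sum>i\<in>UNIV. LINT y|M3. (1 - cos (x $ i - y $ i)) * ker n (x - y))" .
    have "(\<Sum>i\<in>UNIV. LINT y|M3. (1 - cos (x $ i - y $ i)) * ker n (x - y)) \<le> (\<Sum>i\<in>(UNIV::3 set). vol3 / real n)"
    proof (rule sum_mono)
      fix i :: 3
      have "(LINT y|M3. (1 - cos (x $ i - y $ i)) * ker n (x - y)) = (LINT y|M3. (1 - cos ((x - y) $ i)) * ker n (x - y))"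
        by simp
      also have "\<dots> = (LINT z|M3. (1 - cos (z $ i)) * ker n z)"
      proof (rule ker_shift_integral)
        show "continuous_on UNIV (\<lambda>z. (1 - cos (z $ i)) * ker n z)"
          by (intro continuous_intros continuous_cos_nth)
        show "periodic (\<lambda>z. (1 - cos (z $ i)) * ker n z)"
          using periodic_ker periodic_cos_nth by (simp add: periodic_def)
      qed
      also have "\<dots> \<le> vol3 / real n" by (rule ker_moment1[OF n(1)])
      finally show "(LINT y|M3. (1 - cos (x $ i - y $ i)) * ker n (x - y)) \<le> vol3 / real n" .
    qed
    then have "C * (\<Sum>i\<in>UNIV. LINT y|M3. (1 - cos (x $ i - y $ i)) * ker n (x - y)) \<le> C * (3 * (vol3 / real n))"
      using C(1) by (intro mult_left_mono) simp_all
    then have "\<bar>LINT y|M3. ker n (x - y) * (h x - h y)\<bar> \<le> e / 2 * vol3 + C * (3 * (vol3 / real n))"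
      using bnd by linarith
    then have "cmod (of_real (h x) - (\<Sum>k\<in>kset n. of_real (kap n k) * fourier_coeff h k * ch k x))
        \<le> (e / 2 * vol3 + C * (3 * (vol3 / real n))) / vol3"
      unfolding cm by (intro divide_right_mono) (simp_all add: less_imp_le)
    also have "\<dots> = e / 2 + 3 * C / real n"
      by (simp add: add_divide_distrib less_imp_neq[OF vol3_pos, symmetric])
    also have "\<dots> \<le> e" using n(2) by simp
    finally show ?thesis .
  qed
  then show ?thesis by blast
qed

text \<open>Bessel's inequality is one half. For the other half, \<open>f\<close> is close in \<open>L\<^sup>2\<close> to a continuous function, which
is uniformly close to a trigonometric polynomial, and the partial Fourier sum is at least as good.\<close>

theorem parseval:
  assumes f: "L2 f"
  shows "((\<lambda>k. (cmod (fourier_coeff f k))\<^sup>2) has_sum (LINT x|M3. (f x)\<^sup>2) / vol3) UNIV"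
proof -
  let ?S = "(LINT x|M3. (f x)\<^sup>2) / vol3"
  have up: "(\<Sum>k\<in>A. (cmod (fourier_coeff f k))\<^sup>2) \<le> ?S" if "finite A" for A
    using bessel[OF f that] by (simp add: field_simps)
  have low: "\<exists>A. finite A \<and> ?S - e < (\<Sum>k\<in>A. (cmod (fourier_coeff f k))\<^sup>2)" if e: "e > 0" for e
  proof -
    define e1 where "e1 = vol3 * e / 4"
    define e2 where "e2 = sqrt (e / 8)"
    have e1: "e1 > 0" and e2: "e2 > 0" using e by (auto simp: e1_def e2_def)
    obtain h where conth: "continuous_on UNIV h" and bd: "\<And>x. x \<in> torus3 \<Longrightarrow> \<exists>i. \<bar>x $ i\<bar> = pi \<Longrightarrow> h x = 0"
      and fh: "(LINT x|M3. (f x - h x)\<^sup>2) < e1"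
      using L2_approx_continuous[OF f e1] by blast
    obtain n where n: "\<And>x. x \<in> torus3 \<Longrightarrow>
        cmod (of_real (h x) - (\<Sum>k\<in>kset n. of_real (kap n k) * fourier_coeff h k * ch k x)) \<le> e2"
      using ker_convolution_approx[OF conth bd e2] by blast
    let ?P = "\<lambda>x. \<Sum>k\<in>kset n. (of_real (kap n k) * fourier_coeff h k) * ch k x"
    have cP: "continuous_on UNIV ?P" by (intro continuous_intros)
    have i1: "integrable M3 (\<lambda>x. (f x - h x)\<^sup>2)"
      using L2_diff[OF f L2_continuous[OF conth]] by (simp add: L2_def)
    have "(LINT x|M3. (f x)\<^sup>2) - vol3 * (\<Sum>k\<in>kset n. (cmod (fourier_coeff f k))\<^sup>2)
        \<le> (LINT x|M3. (cmod (of_real (f x) - ?P x))\<^sup>2)"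
      unfolding L2_distance_sum_ch[OF f finite_kset]
      by (simp add: sum_nonneg less_imp_le)
    also have "\<dots> \<le> (LINT x|M3. 2 * (f x - h x)\<^sup>2 + 2 * e2\<^sup>2)"
    proof (rule integral_mono')
      show "integrable M3 (\<lambda>x. 2 * (f x - h x)\<^sup>2 + 2 * e2\<^sup>2)"
        using i1 continuous_integrable_M3[OF continuous_on_const[of UNIV "2 * e2\<^sup>2"]] by simp
      fix x assume x: "x \<in> space M3"
      have "cmod (of_real (f x) - ?P x) \<le> cmod (of_real (f x - h x)) + cmod (of_real (h x) - ?P x)"
        using norm_triangle_ineq[of "of_real (f x - h x)" "of_real (h x) - ?P x"] by simp
      also have "\<dots> \<le> \<bar>f x - h x\<bar> + e2" using n x by (intro add_mono) (auto simp: mult.assoc)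
      finally have "(cmod (of_real (f x) - ?P x))\<^sup>2 \<le> (\<bar>f x - h x\<bar> + e2)\<^sup>2"
        by (intro power_mono) auto
      also have "\<dots> \<le> 2 * (f x - h x)\<^sup>2 + 2 * e2\<^sup>2"
        using square_diff_le[of "\<bar>f x - h x\<bar>" "- e2"] by simp
      finally show "(cmod (of_real (f x) - ?P x))\<^sup>2 \<le> 2 * (f x - h x)\<^sup>2 + 2 * e2\<^sup>2" .
    qed simp
    also have "\<dots> = 2 * (LINT x|M3. (f x - h x)\<^sup>2) + vol3 * (2 * e2\<^sup>2)"
      using i1 continuous_integrable_M3[OF continuous_on_const[of UNIV "2 * e2\<^sup>2"]]
        integral_M3_const[of "2 * e2\<^sup>2"] by (simp add: vol3_def)
    also have "\<dots> < 2 * e1 + vol3 * (2 * e2\<^sup>2)" using fh by simp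
    also have "\<dots> \<le> vol3 * e" using e by (simp add: e1_def e2_def field_simps)
    finally have "(LINT x|M3. (f x)\<^sup>2) - vol3 * e < vol3 * (\<Sum>k\<in>kset n. (cmod (fourier_coeff f k))\<^sup>2)" by simp
    then have "?S - e < (\<Sum>k\<in>kset n. (cmod (fourier_coeff f k))\<^sup>2)" by (simp add: field_simps)
    then show ?thesis using finite_kset by blast
  qed
  show ?thesis
    unfolding has_sum_def tendsto_iff
  proof (intro allI impI)
    fix e :: real assume "e > 0"
    then obtain A where A: "finite A" "?S - e < (\<Sum>k\<in>A. (cmod (fourier_coeff f k))\<^sup>2)" using low by blast
    show "\<forall>\<^sub>F B in finite_subsets_at_top UNIV. dist (\<Sum>k\<in>B. (cmod (fourier_coeff f k))\<^sup>2) ?S < e"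
      unfolding eventually_finite_subsets_at_top
    proof (rule exI[of _ A], intro conjI allI impI A(1) subset_UNIV)
      fix B assume B: "finite B \<and> A \<subseteq> B \<and> B \<subseteq> UNIV"
      then have "(\<Sum>k\<in>A. (cmod (fourier_coeff f k))\<^sup>2) \<le> (\<Sum>k\<in>B. (cmod (fourier_coeff f k))\<^sup>2)"
        by (intro sum_mono2) auto
      then show "dist (\<Sum>k\<in>B. (cmod (fourier_coeff f k))\<^sup>2) ?S < e"
        using A(2) up[of B] B by (simp add: dist_real_def)
    qed
  qed
qed

section \<open>Bernstein's inequality and increments in \<open>L\<^sup>3\<close>\<close>

lemma sum_roots_of_unity:
  assumes M: "M > 0" and a: "\<bar>a\<bar> < int M"
  shows "(\<Sum>l<M. cis (of_int a * (2 * pi * real l / real M))) = (if a = 0 then of_nat M else 0)"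
proof -
  define w where "w = cis (2 * pi * of_int a / real M)"
  have eq: "cis (of_int a * (2 * pi * real l / real M)) = w ^ l" for l
    unfolding w_def Complex.DeMoivre using M by (intro arg_cong[of _ _ cis]) (simp add: field_simps)
  show ?thesis
  proof (cases "a = 0")
    case False
    have "w \<noteq> 1"
    proof
      assume "w = 1"
      then have "cos (2 * pi * of_int a / real M) = 1" by (simp add: w_def complex_eq_iff)
      then obtain m :: int where "2 * pi * of_int a / real M = of_int m * 2 * pi"
        using cos_one_2pi_int by blast
      then have "real_of_int a = of_int m * real M" using M by (simp add: field_simps)
      then have "a = m * int M" by (metis of_int_eq_iff of_int_mult of_int_of_nat_eq)
      then have "int M dvd a" by simp
      then show False using False a zdvd_not_zless[of "\<bar>a\<bar>" "int M"] by simp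
    qed
    moreover have "w ^ M = 1"
    proof -
      have "w ^ M = cis (2 * pi * of_int a)" using M by (simp add: w_def Complex.DeMoivre)
      also have "\<dots> = 1" by (rule cis_multiple_2pi) simp
      finally show ?thesis .
    qed
    ultimately show ?thesis using False unfolding eq by (simp add: geometric_sum)
  qed (simp add: w_def)
qed

definition fejer :: "nat \<Rightarrow> real \<Rightarrow> real" where
  "fejer n t = (cmod (\<Sum>p<n. cis (real p * t)))\<^sup>2 / real n"

lemma fejer_nonneg: "fejer n t \<ge> 0" by (simp add: fejer_def)

lemma fejer_expansion:
  "complex_of_real (fejer n t) = (\<Sum>p<n. \<Sum>q<n. cis (of_int (int p - int q) * t)) / of_nat n"
proof -
  have "complex_of_real ((cmod (\<Sum>p<n. cis (real p * t)))\<^sup>2) = (\<Sum>p<n. cis (real p * t)) * cnj (\<Sum>p<n. cis (real p * t))"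
    by (rule complex_norm_square)
  also have "\<dots> = (\<Sum>p<n. \<Sum>q<n. cis (of_int (int p - int q) * t))"
    by (simp add: sum_product cis_cnj cis_mult left_diff_distrib)
  finally show ?thesis by (simp add: fejer_def)
qed

definition bnode :: "nat \<Rightarrow> nat \<Rightarrow> real" where
  "bnode n l = 2 * pi * real l / real (3 * n)"

definition bweight :: "nat \<Rightarrow> nat \<Rightarrow> real" where
  "bweight n l = 2 / 3 * sin (real n * bnode n l) * fejer n (bnode n l)"

lemma count_pairs_diff:
  "(\<Sum>p<n. \<Sum>q<n. if int p - int q = d then (1::complex) else 0) = of_nat (n - nat \<bar>d\<bar>)"
proof -
  have *: "(\<Sum>p<n. \<Sum>q<n. if p = q + e then (1::complex) else 0) = of_nat (n - e)" for e
  proof -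
    have "(\<Sum>p<n. \<Sum>q<n. if p = q + e then (1::complex) else 0) = (\<Sum>q<n. \<Sum>p<n. if p = q + e then 1 else 0)"
      by (rule sum.swap)
    also have "\<dots> = (\<Sum>q<n. if q < n - e then 1 else 0)"
      by (intro sum.cong) (auto simp: sum.delta)
    also have "\<dots> = (\<Sum>q\<in>{q. q < n \<and> q < n - e}. 1)"
      by (simp add: sum.inter_filter[symmetric] conj_commute)
    also have "{q. q < n \<and> q < n - e} = {..<n - e}" by auto
    finally show ?thesis by simp
  qed
  show ?thesis
  proof (cases "d \<ge> 0")
    case True
    then have "(int p - int q = d) \<longleftrightarrow> (p = q + nat d)" for p q by auto
    then show ?thesis using *[of "nat d"] True by simp
  next
    case False
    then have "(int p - int q = d) \<longleftrightarrow> (q = p + nat (- d))" for p q by auto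
    then have "(\<Sum>p<n. \<Sum>q<n. if int p - int q = d then (1::complex) else 0)
        = (\<Sum>q<n. \<Sum>p<n. if q = p + nat (- d) then 1 else 0)"
      by (simp add: sum.swap[of _ "{..<n}" "{..<n}"])
    then show ?thesis using *[of "nat (- d)"] False by simp
  qed
qed

text \<open>With \<open>3n\<close> nodes there is no aliasing: the frequencies \<open>m + p - q\<close> that occur have absolute value less than
\<open>3n\<close>, so the sum over the nodes counts the pairs with \<open>m + p - q = 0\<close>.\<close>

lemma fejer_node_sum:
  assumes n: "n > 0" and m: "\<bar>m\<bar> \<le> 2 * int n"
  shows "(\<Sum>l<3 * n. cis (of_int m * bnode n l) * of_real (fejer n (bnode n l))) = 3 * of_nat (n - nat \<bar>m\<bar>)"
proof -
  have "(\<Sum>l<3 * n. cis (of_int m * bnode n l) * of_real (fejer n (bnode n l)))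
      = (\<Sum>l<3 * n. \<Sum>p<n. \<Sum>q<n. cis (of_int (m + int p - int q) * bnode n l)) / of_nat n"
    unfolding fejer_expansion
    by (simp add: sum_distrib_left sum_divide_distrib cis_mult algebra_simps)
  also have "(\<Sum>l<3 * n. \<Sum>p<n. \<Sum>q<n. cis (of_int (m + int p - int q) * bnode n l))
      = (\<Sum>p<n. \<Sum>q<n. \<Sum>l<3 * n. cis (of_int (m + int p - int q) * bnode n l))"
    by (subst sum.swap, rule sum.cong[OF refl], subst sum.swap, rule refl)
  also have "\<dots> = (\<Sum>p<n. \<Sum>q<n. of_nat (3 * n) * (if int p - int q = - m then 1 else 0))"
  proof (intro sum.cong refl)
    fix p q assume "p \<in> {..<n}" "q \<in> {..<n}"
    then have "\<bar>m + int p - int q\<bar> < int (3 * n)" using m by auto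
    then have "(\<Sum>l<3 * n. cis (of_int (m + int p - int q) * (2 * pi * real l / real (3 * n))))
        = (if m + int p - int q = 0 then of_nat (3 * n) else 0)"
      using n by (intro sum_roots_of_unity) auto
    then show "(\<Sum>l<3 * n. cis (of_int (m + int p - int q) * bnode n l)) = of_nat (3 * n) * (if int p - int q = - m then 1 else 0)"
      unfolding bnode_def by auto
  qed
  also have "\<dots> = of_nat (3 * n) * of_nat (n - nat \<bar>m\<bar>)"
    unfolding sum_distrib_left[symmetric] count_pairs_diff by simp
  finally show ?thesis using n by simp
qed

text \<open>Modulating a Fejer kernel by \<open>sin (n t)\<close> places the two slopes of its triangular spectrum so
  that the spectrum is linear on \<open>[-n, n]\<close>: sampled at \<open>3n\<close> nodes it differentiates trigonometric
  polynomials of degree \<open>n\<close>.\<close>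

lemma bweight_sum:
  assumes n: "n > 0" and m: "\<bar>m\<bar> \<le> int n"
  shows "(\<Sum>l<3 * n. of_real (bweight n l) * cis (of_int m * bnode n l)) = \<i> * of_int m"
proof -
  have sin_cis: "complex_of_real (sin t) = (cis t - cis (- t)) / (2 * \<i>)" for t
    by (simp add: complex_eq_iff)
  have W: "of_real (bweight n l) * cis (of_int m * bnode n l)
      = (1 / (3 * \<i>)) * (cis (of_int (m + int n) * bnode n l) * of_real (fejer n (bnode n l))
          - cis (of_int (m - int n) * bnode n l) * of_real (fejer n (bnode n l)))" for l
  proof -
    have p: "cis (of_int (m + int n) * bnode n l) = cis (of_int m * bnode n l) * cis (real n * bnode n l)"
      and q: "cis (of_int (m - int n) * bnode n l) = cis (of_int m * bnode n l) * cis (- (real n * bnode n l))"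
      by (simp_all add: cis_mult algebra_simps)
    show ?thesis unfolding p q bweight_def of_real_mult sin_cis by (simp add: field_simps)
  qed
  have "\<bar>m + int n\<bar> \<le> 2 * int n" "\<bar>m - int n\<bar> \<le> 2 * int n" using m by linarith+
  note s = this[THEN fejer_node_sum[OF n]]
  have "(\<Sum>l<3 * n. of_real (bweight n l) * cis (of_int m * bnode n l))
      = (1 / (3 * \<i>)) * (3 * of_nat (n - nat \<bar>m + int n\<bar>) - 3 * of_nat (n - nat \<bar>m - int n\<bar>))"
    unfolding W sum_distrib_left[symmetric] sum_subtractf s ..
  also have "(3 * of_nat (n - nat \<bar>m + int n\<bar>) - 3 * of_nat (n - nat \<bar>m - int n\<bar>)) = - 3 * (of_int m :: complex)"
  proof (cases "m \<ge> 0")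
    case True
    then obtain a where a: "m = int a" "a \<le> n" using m by (metis abs_of_nonneg nonneg_int_cases of_nat_le_iff)
    then have "n - nat \<bar>m + int n\<bar> = 0" "n - nat \<bar>m - int n\<bar> = a" by auto
    then show ?thesis using a(1) by simp
  next
    case False
    define a where "a = nat (- m)"
    have a: "m = - int a" "a \<le> n" using False m by (auto simp: a_def)
    then have "n - nat \<bar>m + int n\<bar> = a" "n - nat \<bar>m - int n\<bar> = 0" by auto
    then show ?thesis using a(1) by simp
  qed
  finally show ?thesis by simp
qed

text \<open>The Fejer kernel is nonnegative, so dropping the factor \<open>sin\<close> leaves its zeroth coefficient.\<close>

lemma abs_bweight_sum: assumes n: "n > 0" shows "(\<Sum>l<3 * n. \<bar>bweight n l\<bar>) \<le> 2 * real n"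
proof -
  have "complex_of_real (\<Sum>l<3 * n. fejer n (bnode n l)) = of_real (3 * real n)"
    using fejer_node_sum[OF n, of 0] by simp
  then have s: "(\<Sum>l<3 * n. fejer n (bnode n l)) = 3 * real n" by (simp only: of_real_eq_iff)
  have "\<bar>bweight n l\<bar> \<le> 2 / 3 * fejer n (bnode n l)" for l
  proof -
    have "\<bar>sin (real n * bnode n l)\<bar> * fejer n (bnode n l) \<le> 1 * fejer n (bnode n l)"
      by (intro mult_right_mono fejer_nonneg) simp
    then show ?thesis by (simp add: bweight_def abs_mult fejer_nonneg mult.commute)
  qed
  then have "(\<Sum>l<3 * n. \<bar>bweight n l\<bar>) \<le> (\<Sum>l<3 * n. 2 / 3 * fejer n (bnode n l))" by (intro sum_mono)
  also have "\<dots> = 2 * real n" unfolding sum_distrib_left[symmetric] s by simp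
  finally show ?thesis .
qed

text \<open>Minkowski's inequality in \<open>L\<^sup>3\<close> for finitely many continuous functions, from the convexity of
  the cube.\<close>

lemma L3_sum_le_pos:
  fixes f :: "'i \<Rightarrow> real^3 \<Rightarrow> real"
  assumes I: "finite I" "I \<noteq> {}" and cont: "\<And>j. j \<in> I \<Longrightarrow> continuous_on UNIV (f j)"
    and b: "\<And>j. j \<in> I \<Longrightarrow> b j > 0" and le: "\<And>j. j \<in> I \<Longrightarrow> (LINT x|M3. \<bar>f j x\<bar> ^ 3) \<le> b j ^ 3"
  shows "(LINT x|M3. \<bar>\<Sum>j\<in>I. f j x\<bar> ^ 3) \<le> (\<Sum>j\<in>I. b j) ^ 3"
proof -
  define B where "B = (\<Sum>j\<in>I. b j)"
  have B: "B > 0" using I b by (simp add: B_def sum_pos)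
  have pt: "\<bar>\<Sum>j\<in>I. f j x\<bar> ^ 3 \<le> (\<Sum>j\<in>I. B\<^sup>2 / (b j)\<^sup>2 * \<bar>f j x\<bar> ^ 3)" for x
  proof -
    have "\<bar>\<Sum>j\<in>I. f j x\<bar> \<le> (\<Sum>j\<in>I. \<bar>f j x\<bar>)" by (rule sum_abs)
    also have "\<dots> = (\<Sum>j\<in>I. (b j / B) *\<^sub>R (\<bar>f j x\<bar> * B / b j))"
      using b B by (intro sum.cong) (auto simp: field_simps less_imp_neq[symmetric])
    finally have "\<bar>\<Sum>j\<in>I. f j x\<bar> ^ 3 \<le> (\<Sum>j\<in>I. (b j / B) *\<^sub>R (\<bar>f j x\<bar> * B / b j)) ^ 3"
      by (intro power_mono) auto
    also have "\<dots> \<le> (\<Sum>j\<in>I. (b j / B) * (\<bar>f j x\<bar> * B / b j) ^ 3)"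
    proof (rule convex_on_sum[OF I, of "{0..}" "\<lambda>x. x ^ 3"])
      show "convex_on {0::real..} (\<lambda>x. x ^ 3)" by (rule convex_power_odd) simp
      show "(\<Sum>j\<in>I. b j / B) = 1" using B by (simp add: B_def flip: sum_divide_distrib)
    qed (use b B in \<open>auto intro!: divide_nonneg_pos simp: less_imp_le\<close>)
    also have "\<dots> = (\<Sum>j\<in>I. B\<^sup>2 / (b j)\<^sup>2 * \<bar>f j x\<bar> ^ 3)"
    proof (intro sum.cong refl)
      fix j assume "j \<in> I"
      then have "b j \<noteq> 0" using b by fastforce
      then show "(b j / B) * (\<bar>f j x\<bar> * B / b j) ^ 3 = B\<^sup>2 / (b j)\<^sup>2 * \<bar>f j x\<bar> ^ 3"
        using B by (simp add: power_divide power_mult_distrib power2_eq_square power3_eq_cube field_simps)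
    qed
    finally show ?thesis .
  qed
  have int: "integrable M3 (\<lambda>x. \<bar>f j x\<bar> ^ 3)" if "j \<in> I" for j
    using cont[OF that] by (intro continuous_integrable_M3 continuous_intros)
  have "(LINT x|M3. \<bar>\<Sum>j\<in>I. f j x\<bar> ^ 3) \<le> (LINT x|M3. (\<Sum>j\<in>I. B\<^sup>2 / (b j)\<^sup>2 * \<bar>f j x\<bar> ^ 3))"
    using cont int
    by (intro integral_mono pt continuous_integrable_M3 continuous_intros) auto
  also have "\<dots> = (\<Sum>j\<in>I. B\<^sup>2 / (b j)\<^sup>2 * (LINT x|M3. \<bar>f j x\<bar> ^ 3))"
    using int by (simp add: Bochner_Integration.integral_sum)
  also have "\<dots> \<le> (\<Sum>j\<in>I. B\<^sup>2 / (b j)\<^sup>2 * b j ^ 3)"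
    using le by (intro sum_mono mult_left_mono) auto
  also have "\<dots> = (\<Sum>j\<in>I. B\<^sup>2 * b j)"
  proof (intro sum.cong refl)
    fix j assume "j \<in> I"
    then have "b j \<noteq> 0" using b by fastforce
    then show "B\<^sup>2 / (b j)\<^sup>2 * b j ^ 3 = B\<^sup>2 * b j" by (simp add: power2_eq_square power3_eq_cube)
  qed
  also have "\<dots> = B ^ 3" by (simp add: sum_distrib_left[symmetric] B_def power2_eq_square power3_eq_cube)
  finally show ?thesis by (simp add: B_def)
qed

lemma L3_sum_le:
  fixes f :: "'i \<Rightarrow> real^3 \<Rightarrow> real"
  assumes I: "finite I" and cont: "\<And>j. j \<in> I \<Longrightarrow> continuous_on UNIV (f j)"
    and b: "\<And>j. j \<in> I \<Longrightarrow> b j \<ge> 0" and le: "\<And>j. j \<in> I \<Longrightarrow> (LINT x|M3. \<bar>f j x\<bar> ^ 3) \<le> b j ^ 3"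
  shows "(LINT x|M3. \<bar>\<Sum>j\<in>I. f j x\<bar> ^ 3) \<le> (\<Sum>j\<in>I. b j) ^ 3"
proof (cases "I = {}")
  case False
  have "(\<lambda>n. (\<Sum>j\<in>I. b j + inverse (real (Suc n))) ^ 3) \<longlonglongrightarrow> (\<Sum>j\<in>I. b j + 0) ^ 3"
    by (intro tendsto_intros LIMSEQ_inverse_real_of_nat)
  moreover have "(LINT x|M3. \<bar>\<Sum>j\<in>I. f j x\<bar> ^ 3) \<le> (\<Sum>j\<in>I. b j + inverse (real (Suc n))) ^ 3" for n
  proof (rule L3_sum_le_pos[OF I False cont])
    fix j assume j: "j \<in> I"
    show "b j + inverse (real (Suc n)) > 0" using b[OF j] by (simp add: add_nonneg_pos)
    have "b j ^ 3 \<le> (b j + inverse (real (Suc n))) ^ 3" using b[OF j] by (intro power_mono) auto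
    then show "(LINT x|M3. \<bar>f j x\<bar> ^ 3) \<le> (b j + inverse (real (Suc n))) ^ 3" using le[OF j] by linarith
  qed
  ultimately have "(LINT x|M3. \<bar>\<Sum>j\<in>I. f j x\<bar> ^ 3) \<le> (\<Sum>j\<in>I. b j + 0) ^ 3"
    by (intro LIMSEQ_le_const) auto
  then show ?thesis by simp
qed simp

lemma L3_cmult:
  fixes c :: real
  shows "(LINT x|M3. \<bar>c * f x\<bar> ^ 3) = \<bar>c\<bar> ^ 3 * (LINT x|M3. \<bar>f x\<bar> ^ 3)"
  by (simp add: abs_mult power_mult_distrib)

lemma L3_shift:
  assumes "continuous_on UNIV f" "periodic f"
  shows "(LINT x|M3. \<bar>f (x + z)\<bar> ^ 3) = (LINT x|M3. \<bar>f x :: real\<bar> ^ 3)"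
  by (rule LINT_torus_shift[of "\<lambda>x. \<bar>f x\<bar> ^ 3"])
     (use assms in \<open>auto intro!: continuous_intros simp: periodic_def\<close>)

definition degree_le :: "nat \<Rightarrow> (real^3 \<Rightarrow> real) \<Rightarrow> bool" where
  "degree_le n g \<longleftrightarrow> (\<exists>A c. finite A \<and> (\<forall>k\<in>A. \<forall>i. \<bar>k $ i\<bar> \<le> int n) \<and>
     (\<forall>x. complex_of_real (g x) = (\<Sum>k\<in>A. c k * ch k x)))"

lemma sum_ch_real_continuous:
  assumes "\<And>x. complex_of_real (g x) = (\<Sum>k\<in>A. c k * ch k x)"
  shows "continuous_on UNIV g" and "periodic g"
proof -
  have "g = (\<lambda>x. Re (\<Sum>k\<in>A. c k * ch k x))"
    by (rule ext) (metis Re_complex_of_real assms)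
  moreover have "continuous_on UNIV (\<lambda>x. Re (\<Sum>k\<in>A. c k * ch k x))" by (intro continuous_intros)
  ultimately show "continuous_on UNIV g" by simp
  have "complex_of_real (g (x + axis i (2 * pi))) = of_real (g x)" for x i
    unfolding assms using periodic_ch by (simp add: periodic_def)
  then show "periodic g" by (simp add: periodic_def)
qed

lemma abs_cos_minus_1_le: "\<bar>cos t - 1\<bar> \<le> \<bar>t\<bar>" for t :: real
proof (cases "\<bar>t\<bar> \<le> 2")
  case True
  have "1 - cos t \<le> \<bar>t\<bar> * \<bar>t\<bar> / 2" using one_minus_cos_le[of t] by (simp add: power2_eq_square)
  also have "\<dots> \<le> \<bar>t\<bar> * 2 / 2" using True by (intro divide_right_mono mult_left_mono) auto
  finally show ?thesis by simp
next
  case False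
  have "\<bar>c - 1\<bar> \<le> 2" if "- 1 \<le> c" "c \<le> 1" for c :: real using that by simp
  then have "\<bar>cos t - 1\<bar> \<le> 2" using cos_ge_minus_one[of t] cos_le_one[of t] by blast
  then show ?thesis by (rule order.trans) (use False in simp)
qed

lemma abs_sin_minus_le: "\<bar>sin t - t\<bar> \<le> t\<^sup>2" for t :: real
proof -
  have *: "\<bar>sin t - t\<bar> \<le> t\<^sup>2" if t: "t > 0" for t :: real
  proof -
    have d: "((\<lambda>x. sin x - x) has_real_derivative cos x - 1) (at x)" for x :: real
      by (auto intro!: derivative_eq_intros)
    obtain s where s: "0 < s" "s < t" "(sin t - t) - (sin 0 - 0) = (t - 0) * (cos s - 1)"
      using MVT2[OF t, of "\<lambda>x. sin x - x" "\<lambda>x. cos x - 1"] d by blast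
    then have "\<bar>sin t - t\<bar> = t * \<bar>cos s - 1\<bar>" using t by (simp add: abs_mult)
    also have "\<dots> \<le> t * t" using abs_cos_minus_1_le[of s] s t by (intro mult_left_mono) auto
    finally show ?thesis by (simp add: power2_eq_square)
  qed
  show ?thesis using *[of t] *[of "- t"] by (cases t "0::real" rule: linorder_cases) auto
qed

lemma norm_cis_taylor: "cmod (cis t - 1 - \<i> * of_real t) \<le> 2 * t\<^sup>2"
proof -
  have "cmod (cis t - 1 - \<i> * of_real t) \<le> \<bar>cos t - 1\<bar> + \<bar>sin t - t\<bar>"
    using cmod_le[of "cis t - 1 - \<i> * of_real t"] by simp
  also have "\<dots> \<le> t\<^sup>2 / 2 + t\<^sup>2"
    using one_minus_cos_le[of t] by (intro add_mono abs_sin_minus_le) simp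
  also have "\<dots> \<le> 2 * t\<^sup>2" by simp
  finally show ?thesis .
qed

text \<open>The increment over \<open>z\<close> is a sum of \<open>P\<close> increments over \<open>z / P\<close>, and each of these is \<open>1 / P\<close>
  times the derivative in direction \<open>z\<close>, up to a uniform error of order \<open>P\<^sup>-\<^sup>2\<close>.\<close>

lemma L3_increment_bernstein:
  assumes g: "degree_le n g" and n: "n > 0" and b: "b \<ge> 0" "(LINT x|M3. \<bar>g x\<bar> ^ 3) \<le> b ^ 3"
  shows "(LINT x|M3. \<bar>g (x + z) - g x\<bar> ^ 3) \<le> (6 * real n * norm z * b) ^ 3"
proof -
  obtain A c where A: "finite A" "\<And>k i. k \<in> A \<Longrightarrow> \<bar>k $ i\<bar> \<le> int n"
    "\<And>x. complex_of_real (g x) = (\<Sum>k\<in>A. c k * ch k x)"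
    using g unfolding degree_le_def by blast
  note cg = sum_ch_real_continuous(1)[OF A(3)] and pg = sum_ch_real_continuous(2)[OF A(3)]
  \<comment> \<open>The derivative of \<open>g\<close> in direction \<open>z\<close>, as a combination of translates of \<open>g\<close>.\<close>
  define D where "D x = (\<Sum>(i, l)\<in>UNIV \<times> {..<3 * n}. z $ i * bweight n l * g (x + axis i (bnode n l)))" for x
  have D: "complex_of_real (D x) = (\<Sum>k\<in>A. c k * (\<i> * of_real (freq k \<bullet> z)) * ch k x)" for x
  proof -
    have "complex_of_real (D x) = (\<Sum>i\<in>UNIV. of_real (z $ i) * (\<Sum>l<3 * n. of_real (bweight n l) *
        (\<Sum>k\<in>A. c k * ch k x * cis (of_int (k $ i) * bnode n l))))"
      unfolding D_def sum.cartesian_product[symmetric]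
      by (simp add: A(3) ch_add ch_axis sum_distrib_left ac_simps)
    also have "\<dots> = (\<Sum>i\<in>UNIV. of_real (z $ i) * (\<Sum>k\<in>A. c k * ch k x *
        (\<Sum>l<3 * n. of_real (bweight n l) * cis (of_int (k $ i) * bnode n l))))"
      unfolding sum_distrib_left by (intro sum.cong refl, subst sum.swap) (simp add: ac_simps)
    also have "\<dots> = (\<Sum>i\<in>UNIV. of_real (z $ i) * (\<Sum>k\<in>A. c k * ch k x * (\<i> * of_int (k $ i))))"
      using A(2) by (simp add: bweight_sum[OF n])
    also have "\<dots> = (\<Sum>k\<in>A. c k * ch k x * \<i> * (\<Sum>i\<in>UNIV. of_real (z $ i) * of_int (k $ i)))"
      unfolding sum_distrib_left by (subst sum.swap) (simp add: ac_simps)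
    finally show ?thesis
      by (simp add: inner_vec_def ac_simps)
  qed
  have cD: "continuous_on UNIV D" by (rule sum_ch_real_continuous(1)[OF D])
  define L where "L = 6 * real n * norm z * b"
  have DL: "(LINT x|M3. \<bar>D x\<bar> ^ 3) \<le> L ^ 3"
  proof -
    have "(LINT x|M3. \<bar>D x\<bar> ^ 3) \<le> (\<Sum>(i, l)\<in>UNIV \<times> {..<3 * n}. \<bar>z $ i\<bar> * \<bar>bweight n l\<bar> * b) ^ 3"
      unfolding D_def
    proof (rule L3_sum_le)
      fix j :: "3 \<times> nat" assume "j \<in> UNIV \<times> {..<3 * n}"
      obtain i l where j: "j = (i, l)" by (cases j)
      show "continuous_on UNIV (\<lambda>x. case j of (i, l) \<Rightarrow> z $ i * bweight n l * g (x + axis i (bnode n l)))"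
        unfolding j by (auto intro!: continuous_intros continuous_shift cg)
      show "0 \<le> (case j of (i, l) \<Rightarrow> \<bar>z $ i\<bar> * \<bar>bweight n l\<bar> * b)" using b by (simp add: j)
      have "(LINT x|M3. \<bar>z $ i * bweight n l * g (x + axis i (bnode n l))\<bar> ^ 3)
          = \<bar>z $ i * bweight n l\<bar> ^ 3 * (LINT x|M3. \<bar>g x\<bar> ^ 3)"
        unfolding L3_cmult L3_shift[OF cg pg] ..
      also have "\<dots> \<le> \<bar>z $ i * bweight n l\<bar> ^ 3 * b ^ 3" by (intro mult_left_mono b) auto
      finally show "(LINT x|M3. \<bar>case j of (i, l) \<Rightarrow> z $ i * bweight n l * g (x + axis i (bnode n l))\<bar> ^ 3)
           \<le> (case j of (i, l) \<Rightarrow> \<bar>z $ i\<bar> * \<bar>bweight n l\<bar> * b) ^ 3"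
        by (simp add: j abs_mult power_mult_distrib)
    qed simp
    also have "(\<Sum>(i, l)\<in>UNIV \<times> {..<3 * n}. \<bar>z $ i\<bar> * \<bar>bweight n l\<bar> * b) = (\<Sum>i\<in>UNIV. \<bar>z $ i\<bar>) * (\<Sum>l<3 * n. \<bar>bweight n l\<bar>) * b"
      unfolding sum.cartesian_product[symmetric] by (simp only: sum_product) (simp only: sum_distrib_right)
    also have "\<dots> ^ 3 \<le> L ^ 3"
    proof (intro power_mono)
      have "(\<Sum>i\<in>UNIV. \<bar>z $ i\<bar>) \<le> 3 * norm z"
        using sum_mono[of UNIV "\<lambda>i. \<bar>z $ i\<bar>" "\<lambda>i::3. norm z"] component_le_norm_cart[of z] by simp
      then have "(\<Sum>i\<in>UNIV. \<bar>z $ i\<bar>) * (\<Sum>l<3 * n. \<bar>bweight n l\<bar>) * b \<le> (3 * norm z) * (2 * real n) * b"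
        using b abs_bweight_sum[OF n] by (intro mult_right_mono mult_mono) (auto simp: sum_nonneg)
      then show "(\<Sum>i\<in>UNIV. \<bar>z $ i\<bar>) * (\<Sum>l<3 * n. \<bar>bweight n l\<bar>) * b \<le> L" by (simp add: L_def ac_simps)
      show "0 \<le> (\<Sum>i\<in>UNIV. \<bar>z $ i\<bar>) * (\<Sum>l<3 * n. \<bar>bweight n l\<bar>) * b" using b by (simp add: sum_nonneg)
    qed
    finally show ?thesis .
  qed
  have L0: "L \<ge> 0" using b by (simp add: L_def)
  define R where "R = (\<Sum>k\<in>A. cmod (c k) * (2 * (freq k \<bullet> z)\<^sup>2))"
  have R0: "R \<ge> 0" by (auto simp: R_def intro!: sum_nonneg)
  define r where "r P x = g (x + z /\<^sub>R real P) - g x - D x / real P" for P x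
  have rb: "\<bar>r P x\<bar> \<le> R / (real P)\<^sup>2" for P x
  proof -
    have rc: "complex_of_real (r P x) = (\<Sum>k\<in>A. c k * ch k x * (cis ((freq k \<bullet> z) / real P) - 1 - \<i> * of_real ((freq k \<bullet> z) / real P)))"
      unfolding r_def of_real_diff of_real_divide A(3) D sum_divide_distrib sum_subtractf[symmetric]
    proof (intro sum.cong refl)
      fix k
      have "ch k (x + z /\<^sub>R real P) = ch k x * cis ((freq k \<bullet> z) / real P)"
        by (simp add: ch_add ch_def[of k "z /\<^sub>R real P"] divide_inverse mult.commute)
      then show "c k * ch k (x + z /\<^sub>R real P) - c k * ch k x - c k * (\<i> * of_real (freq k \<bullet> z)) * ch k x / of_real (real P)
          = c k * ch k x * (cis ((freq k \<bullet> z) / real P) - 1 - \<i> * (of_real (freq k \<bullet> z) / of_real (real P)))"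
        by (simp only: right_diff_distrib) (simp add: ac_simps)
    qed
    have "\<bar>r P x\<bar> = cmod (complex_of_real (r P x))" by simp
    also have "\<dots> \<le> (\<Sum>k\<in>A. cmod (c k * ch k x * (cis ((freq k \<bullet> z) / real P) - 1 - \<i> * of_real ((freq k \<bullet> z) / real P))))"
      unfolding rc by (rule norm_sum)
    also have "\<dots> \<le> (\<Sum>k\<in>A. cmod (c k) * (2 * ((freq k \<bullet> z) / real P)\<^sup>2))"
      by (intro sum_mono) (simp only: norm_mult norm_ch mult_1_right, intro mult_left_mono norm_cis_taylor norm_ge_zero)
    also have "\<dots> = R / (real P)\<^sup>2" by (simp add: R_def sum_divide_distrib power_divide)
    finally show ?thesis .
  qed
  define V where "V = 2 * pi"
  have V3: "V ^ 3 = vol3" "V > 0" by (auto simp: V_def vol3_def)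
  have step: "(LINT x|M3. \<bar>g (x + z) - g x\<bar> ^ 3) \<le> (L + R * V / real P) ^ 3" if P: "P > 0" for P
  proof -
    define d where "d p x = g (x + (real p / real P) *\<^sub>R z + z /\<^sub>R real P) - g (x + (real p / real P) *\<^sub>R z)" for p x
    have tel: "g (x + z) - g x = (\<Sum>p<P. d p x)" for x
    proof -
      have "(\<Sum>p<P. d p x) = (\<Sum>p<P. g (x + (real (Suc p) / real P) *\<^sub>R z) - g (x + (real p / real P) *\<^sub>R z))"
        by (simp add: d_def add_divide_distrib scaleR_add_left divide_inverse algebra_simps)
      also have "\<dots> = g (x + (real P / real P) *\<^sub>R z) - g (x + (real 0 / real P) *\<^sub>R z)"
        by (rule sum_lessThan_telescope)
      finally show ?thesis using P by simp
    qed
    have d0: "(LINT x|M3. \<bar>g (x + z /\<^sub>R real P) - g x\<bar> ^ 3) \<le> (L / real P + R * V / (real P)\<^sup>2) ^ 3"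
    proof -
      define F where "F j x = (if j then D x / real P else r P x)" for j x
      define bb where "bb j = (if j then L / real P else R * V / (real P)\<^sup>2)" for j
      have cr: "continuous_on UNIV (r P)"
        unfolding r_def by (intro continuous_intros continuous_shift cg cD) (use P in auto)
      have "(LINT x|M3. \<bar>\<Sum>j\<in>UNIV. F j x\<bar> ^ 3) \<le> (\<Sum>j\<in>UNIV. bb j) ^ 3"
      proof (rule L3_sum_le)
        show "continuous_on UNIV (F j)" for j
          unfolding F_def using P cr by (cases j) (auto intro!: continuous_intros cD)
        show "bb j \<ge> 0" for j using L0 R0 V3 P by (auto simp: bb_def)
        show "(LINT x|M3. \<bar>F j x\<bar> ^ 3) \<le> bb j ^ 3" for j
        proof (cases j)
          case True
          have "(LINT x|M3. \<bar>D x / real P\<bar> ^ 3) = (LINT x|M3. \<bar>D x\<bar> ^ 3) / real P ^ 3"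
            by (simp add: abs_divide power_divide)
          also have "\<dots> \<le> L ^ 3 / real P ^ 3" by (intro divide_right_mono DL) auto
          finally show ?thesis using True by (simp add: F_def bb_def power_divide)
        next
          case False
          have "(LINT x|M3. \<bar>r P x\<bar> ^ 3) \<le> (LINT x|M3. (R / (real P)\<^sup>2) ^ 3)"
            using cr rb by (intro integral_mono continuous_integrable_M3 continuous_intros power_mono) auto
          also have "\<dots> = vol3 * (R / (real P)\<^sup>2) ^ 3" using integral_M3_const[of "(R / (real P)\<^sup>2) ^ 3"] by (simp add: vol3_def)
          finally show ?thesis using False by (simp add: F_def bb_def V3(1)[symmetric] power_mult_distrib power_divide ac_simps)
        qed
      qed simp
      then show ?thesis by (simp add: UNIV_bool F_def bb_def r_def add.commute)
    qed
    have "(LINT x|M3. \<bar>\<Sum>p<P. d p x\<bar> ^ 3) \<le> (\<Sum>p<P. L / real P + R * V / (real P)\<^sup>2) ^ 3"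
    proof (rule L3_sum_le)
      fix p
      have cd: "continuous_on UNIV (\<lambda>x. g (x + z /\<^sub>R real P) - g x)"
        by (intro continuous_intros continuous_shift cg)
      have pd: "periodic (\<lambda>x. g (x + z /\<^sub>R real P) - g x)"
        using periodic_shift[OF pg, of "z /\<^sub>R real P"] pg by (simp add: periodic_def)
      have dd: "d p x = (\<lambda>x. g (x + z /\<^sub>R real P) - g x) (x + (real p / real P) *\<^sub>R z)" for x
        by (simp add: d_def)
      show "continuous_on UNIV (d p)" unfolding dd using continuous_shift[OF cd] .
      show "(LINT x|M3. \<bar>d p x\<bar> ^ 3) \<le> (L / real P + R * V / (real P)\<^sup>2) ^ 3"
        unfolding dd L3_shift[OF cd pd] by (rule d0)
      show "0 \<le> L / real P + R * V / (real P)\<^sup>2" using L0 R0 V3 by simp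
    qed simp
    also have "(\<Sum>p<P. L / real P + R * V / (real P)\<^sup>2) = L + R * V / real P"
      using P by (simp add: distrib_left power2_eq_square)
    finally show ?thesis unfolding tel .
  qed
  have "(\<lambda>P. (L + R * V / real (Suc P)) ^ 3) \<longlonglongrightarrow> (L + 0) ^ 3"
    by (intro tendsto_intros LIMSEQ_Suc[of "\<lambda>P. R * V / real P"] lim_const_over_n)
  moreover have "(LINT x|M3. \<bar>g (x + z) - g x\<bar> ^ 3) \<le> (L + R * V / real (Suc P)) ^ 3" for P
    using step[of "Suc P"] by simp
  ultimately have "(LINT x|M3. \<bar>g (x + z) - g x\<bar> ^ 3) \<le> (L + 0) ^ 3"
    by (intro LIMSEQ_le_const) auto
  then show ?thesis by (simp add: L_def)
qed

lemma degree_le_continuous: "degree_le n g \<Longrightarrow> continuous_on UNIV g"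
  and degree_le_periodic: "degree_le n g \<Longrightarrow> periodic g"
  unfolding degree_le_def using sum_ch_real_continuous by blast+

text \<open>Bernstein's inequality for \<open>n|z| \<le> 1\<close> and the triangle inequality otherwise.\<close>

lemma L3_increment_block:
  assumes g: "degree_le n g" and n: "n > 0" and b: "b \<ge> 0" "(LINT x|M3. \<bar>g x\<bar> ^ 3) \<le> b ^ 3"
    and s: "0 < \<sigma>" "\<sigma> \<le> 1"
  shows "(LINT x|M3. \<bar>g (x + z) - g x\<bar> ^ 3) \<le> (6 * b * (real n * norm z) powr \<sigma>) ^ 3"
proof (cases "real n * norm z \<le> 1")
  case True
  have "real n * norm z \<le> (real n * norm z) powr \<sigma>"
  proof (cases "z = 0")
    case False
    then have "(real n * norm z) powr 1 \<le> (real n * norm z) powr \<sigma>"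
      using True s n by (intro powr_mono') auto
    then show ?thesis using n by simp
  qed simp
  then have "(6 * b) * (real n * norm z) \<le> (6 * b) * (real n * norm z) powr \<sigma>"
    using b by (intro mult_left_mono) auto
  then have "(6 * real n * norm z * b) ^ 3 \<le> (6 * b * (real n * norm z) powr \<sigma>) ^ 3"
    using b by (intro power_mono) (auto simp: ac_simps)
  then show ?thesis using L3_increment_bernstein[OF g n b, of z] by linarith
next
  case False
  note cg = degree_le_continuous[OF g] and pg = degree_le_periodic[OF g]
  define F where "F j x = (if j then g (x + z) else - g x)" for j x
  have "(LINT x|M3. \<bar>\<Sum>j\<in>UNIV. F j x\<bar> ^ 3) \<le> (\<Sum>j\<in>(UNIV::bool set). b) ^ 3"
  proof (rule L3_sum_le)
    show "continuous_on UNIV (F j)" for j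
      unfolding F_def by (cases j) (auto intro!: continuous_intros cg continuous_shift)
    show "(LINT x|M3. \<bar>F j x\<bar> ^ 3) \<le> b ^ 3" for j
      unfolding F_def using b by (cases j) (auto simp: L3_shift[OF cg pg])
  qed (use b in auto)
  then have "(LINT x|M3. \<bar>g (x + z) - g x\<bar> ^ 3) \<le> (2 * b) ^ 3"
    by (simp add: UNIV_bool F_def)
  also have "\<dots> \<le> (6 * b * (real n * norm z) powr \<sigma>) ^ 3"
  proof (intro power_mono)
    have "1 \<le> (real n * norm z) powr \<sigma>" using False s by (intro ge_one_powr_ge_zero) auto
    then have "(6 * b) * 1 \<le> (6 * b) * (real n * norm z) powr \<sigma>" using b by (intro mult_left_mono) auto
    then show "2 * b \<le> 6 * b * (real n * norm z) powr \<sigma>" using b by simp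
  qed (use b in auto)
  finally show ?thesis .
qed

text \<open>Giving up a little regularity makes the dyadic sum geometric.\<close>

lemma L3_increment_dyadic:
  assumes g: "\<And>j. j < N \<Longrightarrow> degree_le (2 ^ Suc j) (g j)" and B: "B \<ge> 0"
    and b: "\<And>j. j < N \<Longrightarrow> (LINT x|M3. \<bar>g j x\<bar> ^ 3) \<le> (2 powr (- (real j * s)) * B) ^ 3"
    and s: "0 < \<sigma>" "\<sigma> \<le> 1" "\<sigma> < s"
  shows "(LINT x|M3. \<bar>(\<Sum>j<N. g j (x + z)) - (\<Sum>j<N. g j x)\<bar> ^ 3)
           \<le> (12 / (1 - 2 powr (\<sigma> - s)) * norm z powr \<sigma> * B) ^ 3"
proof -
  define q where "q = 2 powr (\<sigma> - s)"
  have q: "0 < q" "q < 1" using s by (auto simp: q_def powr_less_one)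
  define bb where "bb j = 6 * (2 powr (- (real j * s)) * B) * (real (2 ^ Suc j) * norm z) powr \<sigma>" for j
  have bbq: "bb j \<le> 12 * norm z powr \<sigma> * B * q ^ j" for j
  proof -
    have "real (2 ^ Suc j) = 2 powr real (Suc j)"
      by (simp add: powr_realpow[symmetric] del: power_Suc of_nat_Suc)
    then have "(real (2 ^ Suc j) * norm z) powr \<sigma> = 2 powr (real (Suc j) * \<sigma>) * norm z powr \<sigma>"
      by (simp add: powr_mult powr_powr)
    moreover have "2 powr (real (Suc j) * \<sigma>) * 2 powr (- (real j * s)) = 2 powr \<sigma> * q ^ j"
    proof -
      have "q ^ j = 2 powr (real j * (\<sigma> - s))"
      proof -
        have "q ^ j = q powr real j" using q(1) by (simp add: powr_realpow)
        then show ?thesis by (simp add: q_def powr_powr mult.commute)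
      qed
      then show ?thesis by (simp add: powr_add[symmetric] algebra_simps)
    qed
    ultimately have "bb j = 6 * 2 powr \<sigma> * (norm z powr \<sigma> * B * q ^ j)"
      unfolding bb_def by (simp add: ac_simps)
    also have "\<dots> \<le> 12 * (norm z powr \<sigma> * B * q ^ j)"
    proof (rule mult_right_mono)
      have "2 powr \<sigma> \<le> 2 powr 1" using s by (intro powr_mono) auto
      then show "6 * 2 powr \<sigma> \<le> (12::real)" by simp
    qed (use B q in auto)
    finally show ?thesis by simp
  qed
  have bb0: "bb j \<ge> 0" for j using B by (simp add: bb_def)
  have "(LINT x|M3. \<bar>\<Sum>j<N. g j (x + z) - g j x\<bar> ^ 3) \<le> (\<Sum>j<N. bb j) ^ 3"
  proof (rule L3_sum_le)
    fix j assume j: "j \<in> {..<N}"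
    then show "continuous_on UNIV (\<lambda>x. g j (x + z) - g j x)"
      using degree_le_continuous[OF g] by (auto intro!: continuous_intros continuous_shift)
    show "(LINT x|M3. \<bar>g j (x + z) - g j x\<bar> ^ 3) \<le> bb j ^ 3"
      unfolding bb_def using j B s by (intro L3_increment_block g b) auto
  qed (use bb0 in auto)
  also have "\<dots> \<le> (12 / (1 - q) * norm z powr \<sigma> * B) ^ 3"
  proof (intro power_mono)
    have "(\<Sum>j<N. bb j) \<le> (\<Sum>j<N. 12 * norm z powr \<sigma> * B * q ^ j)" by (intro sum_mono bbq)
    also have "\<dots> = 12 * norm z powr \<sigma> * B * (\<Sum>j<N. q ^ j)" by (simp add: sum_distrib_left)
    also have "(\<Sum>j<N. q ^ j) \<le> 1 / (1 - q)"
      using q by (simp add: sum_gp_strict divide_right_mono)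
    finally show "(\<Sum>j<N. bb j) \<le> 12 / (1 - q) * norm z powr \<sigma> * B"
      using B by (simp add: mult_left_mono)
  qed (simp add: sum_nonneg bb0)
  finally show ?thesis by (simp add: sum_subtractf q_def)
qed

section \<open>The energy flux as a cubic expression in increments\<close>

text \<open>Half the rate of change of the mollified energy \<open>\<Sum>\<^sub>k \<kappa>\<^sub>n(k) |\<F>g(k)|\<^sup>2\<close> when \<open>g\<close> is transported by
the conservation law \<open>\<partial>\<^sub>tg + div(g w) = 0\<close>.\<close>

definition flux :: "nat \<Rightarrow> (real^3 \<Rightarrow> real) \<Rightarrow> (3 \<Rightarrow> real^3 \<Rightarrow> real) \<Rightarrow> real" where
  "flux n g w = (\<Sum>k\<in>kset n. kap n k *
     (\<Sum>i\<in>UNIV. of_int (k $ i) * Im (cnj (fourier_coeff g k) * fourier_coeff (\<lambda>x. g x * w i x) k)))"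

lemma LINT_of_real_complex: "complex_of_real (LINT x|M. f x) = (LINT x|M. complex_of_real (f x))"
  by (rule integral_complex_of_real[symmetric])

text \<open>Characters diagonalise correlations on the torus.\<close>

lemma ker_dx_correlation:
  assumes a: "continuous_on UNIV a" and b: "continuous_on UNIV b" "periodic b"
  shows "(LINT z|M3. ker_dx n i z * (LINT x|M3. a x * b (x + z)))
       = vol3\<^sup>2 * (\<Sum>k\<in>kset n. kap n k * (of_int (k $ i) * Im (cnj (fourier_coeff a k) * fourier_coeff b k)))"
proof -
  have ca2: "continuous_on UNIV (\<lambda>p::(real^3) \<times> (real^3). a (snd p))"
    by (rule continuous_on_compose2[OF a]) (auto intro!: continuous_intros)
  have cb2: "continuous_on UNIV (\<lambda>p::(real^3) \<times> (real^3). b (snd p + fst p))"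
    by (rule continuous_on_compose2[OF b(1)]) (auto intro!: continuous_intros)
  have key: "(LINT z|M3. ch k z * of_real (LINT x|M3. a x * b (x + z)))
      = of_real (vol3\<^sup>2) * (fourier_coeff a k * cnj (fourier_coeff b k))" for k
  proof -
    have "(LINT z|M3. ch k z * of_real (LINT x|M3. a x * b (x + z)))
        = (LINT z|M3. LINT x|M3. ch k z * of_real (a x * b (x + z)))"
      unfolding LINT_of_real_complex integral_mult_right_zero ..
    also have "\<dots> = (LINT x|M3. LINT z|M3. ch k z * of_real (a x * b (x + z)))"
      by (rule LINT_swap) (unfold case_prod_unfold, intro continuous_intros ca2 cb2)
    also have "\<dots> = (LINT x|M3. of_real (a x) * ch (- k) x * (of_real vol3 * cnj (fourier_coeff b k)))"
    proof (rule Bochner_Integration.integral_cong[OF refl])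
      fix x
      have c: "continuous_on UNIV (\<lambda>y. of_real (b y) * ch k y)" by (intro continuous_intros b)
      have p: "periodic (\<lambda>y. of_real (b y) * ch k y)"
        using b(2) periodic_ch by (simp add: periodic_def)
      have eq: "ch k z * of_real (a x * b (x + z)) = (of_real (a x) * ch (- k) x) * (of_real (b (z + x)) * ch k (z + x))" for z
      proof -
        have "ch (- k) x * ch k (z + x) = ch k z"
          by (simp add: ch_add mult.left_commute[of "ch (- k) x"] ch_mult)
        then show ?thesis by (simp add: add.commute ac_simps)
      qed
      have "(LINT z|M3. ch k z * of_real (a x * b (x + z)))
          = (of_real (a x) * ch (- k) x) * (LINT z|M3. of_real (b (z + x)) * ch k (z + x))"
        unfolding eq by (rule integral_mult_right_zero)
      also have "(LINT z|M3. of_real (b (z + x)) * ch k (z + x)) = (LINT y|M3. of_real (b y) * ch k y)"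
        by (rule LINT_torus_shift[OF c p])
      finally show "(LINT z|M3. ch k z * of_real (a x * b (x + z)))
          = of_real (a x) * ch (- k) x * (of_real vol3 * cnj (fourier_coeff b k))"
        by (simp add: LINT_mult_ch fourier_coeff_uminus)
    qed
    also have "\<dots> = (of_real vol3 * fourier_coeff a k) * (of_real vol3 * cnj (fourier_coeff b k))"
      by (simp add: LINT_mult_ch)
    finally show ?thesis by (simp add: power2_eq_square ac_simps)
  qed
  have cL: "continuous_on UNIV (\<lambda>z. LINT x|M3. a x * b (x + z))"
    by (rule continuous_LINT_param) (unfold case_prod_unfold, intro continuous_intros ca2 cb2)
  have "complex_of_real (LINT z|M3. ker_dx n i z * (LINT x|M3. a x * b (x + z)))
      = (LINT z|M3. (\<Sum>k\<in>kset n. (of_real (kap n k) * (\<i> * of_int (k $ i))) * (ch k z * of_real (LINT x|M3. a x * b (x + z)))))"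
  proof -
    have "complex_of_real (ker_dx n i z * (LINT x|M3. a x * b (x + z)))
        = (\<Sum>k\<in>kset n. (of_real (kap n k) * (\<i> * of_int (k $ i))) * (ch k z * of_real (LINT x|M3. a x * b (x + z))))" for z
      by (simp only: of_real_mult ker_dx_expansion sum_distrib_right mult.assoc)
    then show ?thesis by (subst LINT_of_real_complex) (rule Bochner_Integration.integral_cong[OF refl])
  qed
  also have "\<dots> = (\<Sum>k\<in>kset n. (of_real (kap n k) * (\<i> * of_int (k $ i))) *
        (LINT z|M3. ch k z * of_real (LINT x|M3. a x * b (x + z))))"
    by (subst Bochner_Integration.integral_sum)
       (auto intro!: continuous_integrable_M3 continuous_intros cL)
  also have "\<dots> = (\<Sum>k\<in>kset n. of_real (kap n k * of_int (k $ i) * vol3\<^sup>2) * (\<i> * (fourier_coeff a k * cnj (fourier_coeff b k))))"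
    unfolding key by (intro sum.cong) (auto simp: ac_simps)
  finally have c: "complex_of_real (LINT z|M3. ker_dx n i z * (LINT x|M3. a x * b (x + z)))
      = (\<Sum>k\<in>kset n. of_real (kap n k * of_int (k $ i) * vol3\<^sup>2) * (\<i> * (fourier_coeff a k * cnj (fourier_coeff b k))))" .
  have re: "Re (of_real c * (\<i> * (x * cnj y))) = c * Im (cnj x * y)" for c x y
    by (simp add: algebra_simps)
  have "(LINT z|M3. ker_dx n i z * (LINT x|M3. a x * b (x + z)))
      = (\<Sum>k\<in>kset n. kap n k * of_int (k $ i) * vol3\<^sup>2 * Im (cnj (fourier_coeff a k) * fourier_coeff b k))"
    using arg_cong[OF c, of Re] unfolding Re_sum re Re_complex_of_real .
  also have "\<dots> = (\<Sum>k\<in>kset n. vol3\<^sup>2 * (kap n k * (of_int (k $ i) * Im (cnj (fourier_coeff a k) * fourier_coeff b k))))"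
    by (intro sum.cong refl) (simp only: ac_simps)
  finally show ?thesis by (simp add: sum_distrib_left)
qed

text \<open>The Duchon--Robert identity. After expanding the square, each product of factors at the two
  points \<open>x\<close> and \<open>x + z\<close> is a correlation; the terms in \<open>g\<^sup>2\<close> and \<open>w\<close> alone drop out because \<open>w\<close>
  is divergence free.\<close>

lemma flux_increments:
  assumes g: "continuous_on UNIV g" "periodic g"
    and w: "\<And>i. continuous_on UNIV (w i)" "\<And>i. periodic (w i)"
    and div: "\<And>k. (\<Sum>i\<in>UNIV. of_int (k $ i) * fourier_coeff (w i) k) = 0"
  shows "(\<Sum>i\<in>UNIV. LINT z|M3. ker_dx n i z * (LINT x|M3. (g (x + z) - g x)\<^sup>2 * (w i (x + z) - w i x)))
       = - 4 * vol3\<^sup>2 * flux n g w"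
proof -
  let ?fc = fourier_coeff
  define X where "X a b = (\<lambda>k. Im (cnj (?fc a k) * ?fc b k))" for a b
  have Xswap: "X b a k = - X a b k" for a b k by (simp add: X_def)
  define g2 where "g2 x = (g x)\<^sup>2" for x
  define gw where "gw i x = g x * w i x" for i x
  have g2: "continuous_on UNIV g2" "periodic g2" using g by (auto simp: g2_def[abs_def] periodic_def intro!: continuous_intros)
  have gw: "continuous_on UNIV (gw i)" "periodic (gw i)" for i
    using g w by (auto simp: gw_def[abs_def] periodic_def intro!: continuous_intros)
  define cor where "cor a b z = (LINT x|M3. a x * b (x + z))" for a b :: "real^3 \<Rightarrow> real" and z
  have int: "integrable M3 (\<lambda>x. a x * b (x + z))" if "continuous_on UNIV a" "continuous_on UNIV b" for a b :: "real^3 \<Rightarrow> real" and z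
    using that by (intro continuous_integrable_M3 continuous_intros continuous_shift)
  have inner: "(LINT x|M3. (g (x + z) - g x)\<^sup>2 * (w i (x + z) - w i x))
      = cor g2 (w i) z - cor (w i) g2 z - 2 * cor g (gw i) z + 2 * cor (gw i) g z" for i z
  proof -
    have c: "continuous_on UNIV (\<lambda>x. g2 x * w i x)" and p: "periodic (\<lambda>x. g2 x * w i x)"
      using g2 w by (auto simp: periodic_def intro!: continuous_intros)
    have "(LINT x|M3. (g (x + z) - g x)\<^sup>2 * (w i (x + z) - w i x))
        = (LINT x|M3. (g2 (x + z) * w i (x + z) - g2 x * w i x) + (g2 x * w i (x + z) - w i x * g2 (x + z)
              - 2 * (g x * gw i (x + z)) + 2 * (gw i x * g (x + z))))"
      by (intro Bochner_Integration.integral_cong) (simp_all add: g2_def gw_def power2_eq_square algebra_simps)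
    also have "\<dots> = (LINT x|M3. g2 (x + z) * w i (x + z) - g2 x * w i x)
        + (cor g2 (w i) z - cor (w i) g2 z - 2 * cor g (gw i) z + 2 * cor (gw i) g z)"
      unfolding cor_def using int[OF g2(1) w(1)[of i]] int[OF w(1)[of i] g2(1)] int[OF g(1) gw(1)[of i]] int[OF gw(1)[of i] g(1)]
        continuous_integrable_M3[OF c] continuous_integrable_M3[OF continuous_shift[OF c]]
      by simp
    also have "(LINT x|M3. g2 (x + z) * w i (x + z) - g2 x * w i x) = 0"
      using continuous_integrable_M3[OF c] continuous_integrable_M3[OF continuous_shift[OF c]] LINT_torus_shift[OF c p]
      by simp
    finally show ?thesis by simp
  qed
  have ccor: "continuous_on UNIV (cor a b)" if "continuous_on UNIV a" "continuous_on UNIV b" for a b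
    unfolding cor_def
  proof (rule continuous_LINT_param)
    show "continuous_on UNIV (\<lambda>(z, x). a x * b (x + z))"
      by (auto simp: case_prod_unfold intro!: continuous_intros continuous_on_compose2[OF that(1)] continuous_on_compose2[OF that(2)])
  qed
  have iK: "integrable M3 (\<lambda>z. ker_dx n i z * cor a b z)" if "continuous_on UNIV a" "continuous_on UNIV b" for a b i
    by (intro continuous_integrable_M3 continuous_intros ccor that)
  define Y where "Y i a b = vol3\<^sup>2 * (\<Sum>k\<in>kset n. kap n k * (of_int (k $ i) * X a b k))" for i a b
  have K: "(LINT z|M3. ker_dx n i z * cor a b z) = Y i a b"
    if "continuous_on UNIV a" "continuous_on UNIV b" "periodic b" for i a b
    unfolding cor_def Y_def X_def by (rule ker_dx_correlation[OF that])
  have Yswap: "Y i b a = - Y i a b" for i a b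
    by (simp add: Y_def Xswap[of b a] sum_negf)
  have outer: "(LINT z|M3. ker_dx n i z * (LINT x|M3. (g (x + z) - g x)\<^sup>2 * (w i (x + z) - w i x)))
      = 2 * Y i g2 (w i) - 4 * Y i g (gw i)" for i
  proof -
    have "(LINT z|M3. ker_dx n i z * (LINT x|M3. (g (x + z) - g x)\<^sup>2 * (w i (x + z) - w i x)))
        = (LINT z|M3. ker_dx n i z * cor g2 (w i) z - ker_dx n i z * cor (w i) g2 z
             - 2 * (ker_dx n i z * cor g (gw i) z) + 2 * (ker_dx n i z * cor (gw i) g z))"
      unfolding inner by (intro Bochner_Integration.integral_cong) (simp_all add: algebra_simps)
    also have "\<dots> = Y i g2 (w i) - Y i (w i) g2 - 2 * Y i g (gw i) + 2 * Y i (gw i) g"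
      using iK[OF g2(1) w(1)] iK[OF w(1) g2(1)] iK[OF g(1) gw(1)] iK[OF gw(1) g(1)]
      by (simp add: K g g2 w gw)
    finally show ?thesis using Yswap[of i "w i" g2] Yswap[of i "gw i" g] by simp
  qed
  have Ydiv: "(\<Sum>i\<in>UNIV. Y i g2 (w i)) = 0"
  proof -
    have "(\<Sum>i\<in>UNIV. of_int (k $ i) * X g2 (w i) k) = 0" for k
    proof -
      have "(\<Sum>i\<in>UNIV. of_int (k $ i) * X g2 (w i) k) = Im (cnj (?fc g2 k) * (\<Sum>i\<in>UNIV. of_int (k $ i) * ?fc (w i) k))"
        unfolding sum_distrib_left Im_sum X_def by (intro sum.cong) (auto simp: algebra_simps)
      then show ?thesis by (simp add: div)
    qed
    then have "(\<Sum>k\<in>kset n. kap n k * (\<Sum>i\<in>UNIV. of_int (k $ i) * X g2 (w i) k)) = 0" by simp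
    moreover have "(\<Sum>i\<in>UNIV. Y i g2 (w i)) = vol3\<^sup>2 * (\<Sum>k\<in>kset n. kap n k * (\<Sum>i\<in>UNIV. of_int (k $ i) * X g2 (w i) k))"
      unfolding Y_def sum_distrib_left by (rule sum.swap)
    ultimately show ?thesis by simp
  qed
  have Yflux: "(\<Sum>i\<in>UNIV. Y i g (gw i)) = vol3\<^sup>2 * flux n g w"
    unfolding Y_def flux_def X_def gw_def[abs_def] sum_distrib_left by (rule sum.swap)
  have "(\<Sum>i\<in>UNIV. LINT z|M3. ker_dx n i z * (LINT x|M3. (g (x + z) - g x)\<^sup>2 * (w i (x + z) - w i x)))
      = 2 * (\<Sum>i\<in>UNIV. Y i g2 (w i)) - 4 * (\<Sum>i\<in>UNIV. Y i g (gw i))"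
    by (simp add: outer sum_subtractf sum_distrib_left)
  then show ?thesis by (simp add: Ydiv Yflux)
qed

lemma square_mult_le_cubes: "a\<^sup>2 * \<bar>b\<bar> \<le> \<bar>a\<bar> ^ 3 + \<bar>b\<bar> ^ 3" for a b :: real
proof (cases "\<bar>a\<bar> \<le> \<bar>b\<bar>")
  case True
  have "\<bar>a\<bar>\<^sup>2 * \<bar>b\<bar> \<le> \<bar>b\<bar>\<^sup>2 * \<bar>b\<bar>" using True by (intro mult_right_mono power_mono) auto
  then show ?thesis by (simp add: power3_eq_cube power2_eq_square add_increasing)
next
  case False
  have "\<bar>a\<bar>\<^sup>2 * \<bar>b\<bar> \<le> \<bar>a\<bar>\<^sup>2 * \<bar>a\<bar>" using False by (intro mult_left_mono) auto
  then show ?thesis by (simp add: power3_eq_cube power2_eq_square add_increasing2)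
qed

text \<open>Rescaling the increments by their expected size first turns the pointwise inequality
  \<open>a\<^sup>2b \<le> a\<^sup>3 + b\<^sup>3\<close> into a substitute for Holder's inequality.\<close>

lemma increments_trilinear:
  assumes g: "continuous_on UNIV g" and w: "continuous_on UNIV w"
    and ig: "(LINT x|M3. \<bar>g (x + z) - g x\<bar> ^ 3) \<le> D1 * norm z powr (3 * \<sigma>1)"
    and iw: "(LINT x|M3. \<bar>w (x + z) - w x\<bar> ^ 3) \<le> D2 * norm z powr (3 * \<sigma>2)"
  shows "\<bar>LINT x|M3. (g (x + z) - g x)\<^sup>2 * (w (x + z) - w x)\<bar> \<le> (D1 + D2) * norm z powr (2 * \<sigma>1 + \<sigma>2)"
proof (cases "z = 0")
  case False
  define p where "p = norm z powr \<sigma>1"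
  define q where "q = norm z powr \<sigma>2"
  have pq: "p > 0" "q > 0" using False by (auto simp: p_def q_def)
  have p3: "norm z powr (3 * \<sigma>1) = p ^ 3" "norm z powr (3 * \<sigma>2) = q ^ 3" "norm z powr (2 * \<sigma>1 + \<sigma>2) = p\<^sup>2 * q"
  proof -
    have e: "(norm z powr t) ^ m = norm z powr (real m * t)" for t m
      using False by (simp add: powr_realpow[symmetric] powr_powr mult.commute)
    show "norm z powr (3 * \<sigma>1) = p ^ 3" "norm z powr (3 * \<sigma>2) = q ^ 3" "norm z powr (2 * \<sigma>1 + \<sigma>2) = p\<^sup>2 * q"
      by (simp_all add: p_def q_def e powr_add)
  qed
  have pt: "\<bar>(g (x + z) - g x)\<^sup>2 * (w (x + z) - w x)\<bar>
      \<le> p\<^sup>2 * q / p ^ 3 * \<bar>g (x + z) - g x\<bar> ^ 3 + p\<^sup>2 * q / q ^ 3 * \<bar>w (x + z) - w x\<bar> ^ 3" for x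
  proof -
    let ?a = "(g (x + z) - g x) / p" and ?b = "(w (x + z) - w x) / q"
    have "\<bar>(g (x + z) - g x)\<^sup>2 * (w (x + z) - w x)\<bar> = p\<^sup>2 * q * (?a\<^sup>2 * \<bar>?b\<bar>)"
      using pq by (simp add: power_divide abs_mult abs_divide)
    also have "\<dots> \<le> p\<^sup>2 * q * (\<bar>?a\<bar> ^ 3 + \<bar>?b\<bar> ^ 3)"
      using pq by (intro mult_left_mono square_mult_le_cubes) auto
    also have "\<dots> = p\<^sup>2 * q / p ^ 3 * \<bar>g (x + z) - g x\<bar> ^ 3 + p\<^sup>2 * q / q ^ 3 * \<bar>w (x + z) - w x\<bar> ^ 3"
      using pq by (simp add: power_divide abs_divide distrib_left)
    finally show ?thesis .
  qed
  have i: "integrable M3 (\<lambda>x. \<bar>g (x + z) - g x\<bar> ^ 3)" "integrable M3 (\<lambda>x. \<bar>w (x + z) - w x\<bar> ^ 3)"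
    by (intro continuous_integrable_M3 continuous_intros continuous_shift g w)+
  have "\<bar>LINT x|M3. (g (x + z) - g x)\<^sup>2 * (w (x + z) - w x)\<bar> \<le> (LINT x|M3. \<bar>(g (x + z) - g x)\<^sup>2 * (w (x + z) - w x)\<bar>)"
    by (rule integral_abs_bound)
  also have "\<dots> \<le> (LINT x|M3. p\<^sup>2 * q / p ^ 3 * \<bar>g (x + z) - g x\<bar> ^ 3 + p\<^sup>2 * q / q ^ 3 * \<bar>w (x + z) - w x\<bar> ^ 3)"
    by (intro integral_mono pt continuous_integrable_M3 continuous_intros continuous_shift g w)
  also have "\<dots> = p\<^sup>2 * q / p ^ 3 * (LINT x|M3. \<bar>g (x + z) - g x\<bar> ^ 3) + p\<^sup>2 * q / q ^ 3 * (LINT x|M3. \<bar>w (x + z) - w x\<bar> ^ 3)"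
    using i by simp
  also have "\<dots> \<le> p\<^sup>2 * q / p ^ 3 * (D1 * p ^ 3) + p\<^sup>2 * q / q ^ 3 * (D2 * q ^ 3)"
    using ig iw pq unfolding p3 by (intro add_mono mult_left_mono) auto
  also have "\<dots> = (D1 + D2) * (p\<^sup>2 * q)" using pq by (simp add: distrib_right)
  finally show ?thesis by (simp add: p3)
qed simp

lemma flux_bound_continuous:
  assumes n: "n \<ge> 3" and d: "0 < \<delta>" "\<delta> \<le> 2" "2 * \<sigma>1 + \<sigma>2 = 1 + \<delta>"
    and g: "continuous_on UNIV g" "periodic g"
    and w: "\<And>i. continuous_on UNIV (w i)" "\<And>i. periodic (w i)"
    and div: "\<And>k. (\<Sum>i\<in>UNIV. of_int (k $ i) * fourier_coeff (w i) k) = 0"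
    and ig: "\<And>z. (LINT x|M3. \<bar>g (x + z) - g x\<bar> ^ 3) \<le> D1 * norm z powr (3 * \<sigma>1)"
    and iw: "\<And>z i. (LINT x|M3. \<bar>w i (x + z) - w i x\<bar> ^ 3) \<le> D2 * norm z powr (3 * \<sigma>2)"
  shows "\<bar>flux (Suc n) g w\<bar> \<le> 2628 / vol3 * (D1 + D2) * real n powr (- \<delta> / 2)"
proof -
  define A where "A i z = (LINT x|M3. (g (x + z) - g x)\<^sup>2 * (w i (x + z) - w i x))" for i z
  have Ab: "\<bar>A i z\<bar> \<le> (D1 + D2) * norm z powr (1 + \<delta>)" for i z
    unfolding A_def d(3)[symmetric] by (rule increments_trilinear[OF g(1) w(1) ig iw])
  have D: "D1 + D2 \<ge> 0"
  proof -
    have "0 \<le> (D1 + D2) * norm (axis 1 1 :: real^3) powr (1 + \<delta>)"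
      using Ab[of 1 "axis 1 1"] by linarith
    then show ?thesis by simp
  qed
  have cA: "continuous_on UNIV (A i)" for i
    unfolding A_def
    by (rule continuous_LINT_param)
       (auto simp: case_prod_unfold intro!: continuous_intros continuous_on_compose2[OF g(1)] continuous_on_compose2[OF w(1)])
  have one: "\<bar>LINT z|M3. ker_dx (Suc n) i z * A i z\<bar> \<le> (D1 + D2) * (3504 * vol3 * real n powr (- \<delta> / 2))" for i
  proof -
    have cp: "continuous_on UNIV (\<lambda>z::real^3. norm z powr (1 + \<delta>))"
      using d by (intro continuous_on_powr' continuous_intros) auto
    have "\<bar>LINT z|M3. ker_dx (Suc n) i z * A i z\<bar> \<le> (LINT z|M3. \<bar>ker_dx (Suc n) i z * A i z\<bar>)"
      by (rule integral_abs_bound)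
    also have "\<dots> \<le> (LINT z|M3. (D1 + D2) * (\<bar>ker_dx (Suc n) i z\<bar> * norm z powr (1 + \<delta>)))"
    proof (intro integral_mono continuous_integrable_M3 cA cp continuous_intros)
      fix z
      have "\<bar>ker_dx (Suc n) i z\<bar> * \<bar>A i z\<bar> \<le> \<bar>ker_dx (Suc n) i z\<bar> * ((D1 + D2) * norm z powr (1 + \<delta>))"
        by (intro mult_left_mono Ab) auto
      then show "\<bar>ker_dx (Suc n) i z * A i z\<bar> \<le> (D1 + D2) * (\<bar>ker_dx (Suc n) i z\<bar> * norm z powr (1 + \<delta>))"
        by (simp add: abs_mult ac_simps)
    qed
    also have "\<dots> = (D1 + D2) * (LINT z|M3. \<bar>ker_dx (Suc n) i z\<bar> * norm z powr (1 + \<delta>))" by simp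
    also have "\<dots> \<le> (D1 + D2) * (3504 * vol3 * real n powr (- \<delta> / 2))"
      by (intro mult_left_mono ker_dx_moment n d D)
    finally show ?thesis .
  qed
  have "4 * vol3\<^sup>2 * \<bar>flux (Suc n) g w\<bar> = \<bar>- 4 * vol3\<^sup>2 * flux (Suc n) g w\<bar>" by (simp add: abs_mult)
  also have "\<dots> = \<bar>\<Sum>i\<in>UNIV. LINT z|M3. ker_dx (Suc n) i z * A i z\<bar>"
    unfolding A_def by (simp only: flux_increments[OF g w div])
  also have "\<dots> \<le> (\<Sum>i\<in>(UNIV::3 set). (D1 + D2) * (3504 * vol3 * real n powr (- \<delta> / 2)))"
    by (rule order.trans[OF sum_abs]) (intro sum_mono one)
  also have "\<dots> = 4 * vol3\<^sup>2 * (2628 / vol3 * (D1 + D2) * real n powr (- \<delta> / 2))"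
    using vol3_pos by (simp add: power2_eq_square del: vol3_pos)
  finally show ?thesis by (rule mult_left_le_imp_le) (simp add: less_imp_neq[OF vol3_pos, symmetric])
qed

lemma L2_norm_tendsto_fourier:
  assumes f: "\<And>N. integrable M3 (f N)" "integrable M3 h"
    and lim: "(\<lambda>N. LINT x|M3. \<bar>f N x - h x\<bar>) \<longlonglongrightarrow> 0"
  shows "(\<lambda>N. fourier_coeff (f N) k) \<longlonglongrightarrow> fourier_coeff h k"
proof -
  have "(\<lambda>N. fourier_coeff (f N) k - fourier_coeff h k) \<longlonglongrightarrow> 0"
  proof (rule Lim_null_comparison)
    show "\<forall>\<^sub>F N in sequentially. norm (fourier_coeff (f N) k - fourier_coeff h k) \<le> (LINT x|M3. \<bar>f N x - h x\<bar>) / vol3"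
      using norm_fourier_coeff_le by (simp add: fourier_coeff_diff[OF f, symmetric])
    show "(\<lambda>N. (LINT x|M3. \<bar>f N x - h x\<bar>) / vol3) \<longlonglongrightarrow> 0"
      using tendsto_divide[OF lim tendsto_const[of vol3]] by (simp add: less_imp_neq[OF vol3_pos, symmetric])
  qed
  then show ?thesis by (simp add: LIM_zero_iff)
qed

lemma L2_lim_product:
  assumes f: "\<And>N. L2 (f N)" "L2 f'" and g: "\<And>N. L2 (g N)" "L2 g'"
    and lf: "(\<lambda>N. LINT x|M3. (f N x - f' x)\<^sup>2) \<longlonglongrightarrow> 0"
    and lg: "(\<lambda>N. LINT x|M3. (g N x - g' x)\<^sup>2) \<longlonglongrightarrow> 0"
  shows "(\<lambda>N. LINT x|M3. \<bar>f N x * g N x - f' x * g' x\<bar>) \<longlonglongrightarrow> 0"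
proof (rule real_tendsto_sandwich[OF _ _ tendsto_const])
  define a where "a N = sqrt (LINT x|M3. (f N x - f' x)\<^sup>2)" for N
  define b where "b N = sqrt (LINT x|M3. (g N x - g' x)\<^sup>2)" for N
  have ab: "a \<longlonglongrightarrow> 0" "b \<longlonglongrightarrow> 0"
    using tendsto_real_sqrt[OF lf] tendsto_real_sqrt[OF lg] by (simp_all add: a_def[abs_def] b_def[abs_def])
  let ?F = "sqrt (LINT x|M3. (f' x)\<^sup>2)" and ?G = "sqrt (LINT x|M3. (g' x)\<^sup>2)"
  show "\<forall>\<^sub>F N in sequentially. 0 \<le> (LINT x|M3. \<bar>f N x * g N x - f' x * g' x\<bar>)" by simp
  have "(LINT x|M3. \<bar>f N x * g N x - f' x * g' x\<bar>) \<le> a N * b N + a N * ?G + ?F * b N" for N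
  proof -
    note df = L2_diff[OF f(1)[of N] f(2)] and dg = L2_diff[OF g(1)[of N] g(2)]
    have i: "integrable M3 (\<lambda>x. \<bar>(f N x - f' x) * (g N x - g' x)\<bar>)"
      "integrable M3 (\<lambda>x. \<bar>(f N x - f' x) * g' x\<bar>)" "integrable M3 (\<lambda>x. \<bar>f' x * (g N x - g' x)\<bar>)"
      "integrable M3 (\<lambda>x. \<bar>f N x * g N x - f' x * g' x\<bar>)"
      using L2_mult_integrable[OF df dg] L2_mult_integrable[OF df g(2)] L2_mult_integrable[OF f(2) dg]
        L2_mult_integrable[OF f(1)[of N] g(1)[of N]] L2_mult_integrable[OF f(2) g(2)] by auto
    have "(LINT x|M3. \<bar>f N x * g N x - f' x * g' x\<bar>)
        \<le> (LINT x|M3. \<bar>(f N x - f' x) * (g N x - g' x)\<bar> + \<bar>(f N x - f' x) * g' x\<bar> + \<bar>f' x * (g N x - g' x)\<bar>)"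
    proof (rule integral_mono[OF i(4)])
      fix x
      have "f N x * g N x - f' x * g' x = (f N x - f' x) * (g N x - g' x) + (f N x - f' x) * g' x + f' x * (g N x - g' x)"
        by (simp add: algebra_simps)
      then show "\<bar>f N x * g N x - f' x * g' x\<bar>
          \<le> \<bar>(f N x - f' x) * (g N x - g' x)\<bar> + \<bar>(f N x - f' x) * g' x\<bar> + \<bar>f' x * (g N x - g' x)\<bar>" by linarith
    qed (use i in simp)
    also have "\<dots> = (LINT x|M3. \<bar>(f N x - f' x) * (g N x - g' x)\<bar>) + (LINT x|M3. \<bar>(f N x - f' x) * g' x\<bar>)
                     + (LINT x|M3. \<bar>f' x * (g N x - g' x)\<bar>)"
      using i by simp
    also have "\<dots> \<le> a N * b N + a N * ?G + ?F * b N"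
      unfolding a_def b_def by (intro add_mono L2_cauchy_schwarz df dg f g)
    finally show ?thesis .
  qed
  then show "\<forall>\<^sub>F N in sequentially. (LINT x|M3. \<bar>f N x * g N x - f' x * g' x\<bar>) \<le> a N * b N + a N * ?G + ?F * b N" by simp
  have "(\<lambda>N. a N * b N + a N * ?G + ?F * b N) \<longlonglongrightarrow> 0 * 0 + 0 * ?G + ?F * 0"
    by (intro tendsto_intros ab)
  then show "(\<lambda>N. a N * b N + a N * ?G + ?F * b N) \<longlonglongrightarrow> 0" by simp
qed

lemma L2_lim_L1:
  assumes f: "\<And>N. L2 (f N)" "L2 f'" and lf: "(\<lambda>N. LINT x|M3. (f N x - f' x)\<^sup>2) \<longlonglongrightarrow> 0"
  shows "(\<lambda>N. LINT x|M3. \<bar>f N x - f' x\<bar>) \<longlonglongrightarrow> 0"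
  using L2_lim_product[OF f L2_continuous L2_continuous lf, of "\<lambda>_ _. 1" "\<lambda>_. 1"] by simp

text \<open>At fixed \<open>n\<close> the flux involves finitely many Fourier coefficients.\<close>

lemma flux_tendsto:
  assumes g: "\<And>N. L2 (gN N)" "L2 g" and w: "\<And>N i. L2 (wN N i)" "\<And>i. L2 (w i)"
    and lg: "(\<lambda>N. LINT x|M3. (gN N x - g x)\<^sup>2) \<longlonglongrightarrow> 0"
    and lw: "\<And>i. (\<lambda>N. LINT x|M3. (wN N i x - w i x)\<^sup>2) \<longlonglongrightarrow> 0"
  shows "(\<lambda>N. flux n (gN N) (wN N)) \<longlonglongrightarrow> flux n g w"
  unfolding flux_def
  by (intro tendsto_intros L2_norm_tendsto_fourier L2_integrable L2_mult_integrable L2_lim_product L2_lim_L1 g w lg lw)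

text \<open>The flux of square integrable fields is controlled by uniform increment bounds along any
  approximating sequence of smooth fields.\<close>

lemma flux_bound:
  assumes n: "n \<ge> 3" and d: "0 < \<delta>" "\<delta> \<le> 2" "2 * \<sigma>1 + \<sigma>2 = 1 + \<delta>"
    and g: "\<And>N. continuous_on UNIV (gN N)" "\<And>N. periodic (gN N)" "L2 g"
    and w: "\<And>N i. continuous_on UNIV (wN N i)" "\<And>N i. periodic (wN N i)" "\<And>i. L2 (w i)"
    and div: "\<And>N k. (\<Sum>i\<in>UNIV. of_int (k $ i) * fourier_coeff (wN N i) k) = 0"
    and ig: "\<And>N z. (LINT x|M3. \<bar>gN N (x + z) - gN N x\<bar> ^ 3) \<le> D1 * norm z powr (3 * \<sigma>1)"
    and iw: "\<And>N z i. (LINT x|M3. \<bar>wN N i (x + z) - wN N i x\<bar> ^ 3) \<le> D2 * norm z powr (3 * \<sigma>2)"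
    and lg: "(\<lambda>N. LINT x|M3. (gN N x - g x)\<^sup>2) \<longlonglongrightarrow> 0"
    and lw: "\<And>i. (\<lambda>N. LINT x|M3. (wN N i x - w i x)\<^sup>2) \<longlonglongrightarrow> 0"
  shows "\<bar>flux (Suc n) g w\<bar> \<le> 2628 / vol3 * (D1 + D2) * real n powr (- \<delta> / 2)"
proof -
  have "\<bar>flux (Suc n) (gN N) (wN N)\<bar> \<le> 2628 / vol3 * (D1 + D2) * real n powr (- \<delta> / 2)" for N
    by (rule flux_bound_continuous[OF n d g(1,2) w(1,2) div ig iw])
  moreover have "(\<lambda>N. \<bar>flux (Suc n) (gN N) (wN N)\<bar>) \<longlonglongrightarrow> \<bar>flux (Suc n) g w\<bar>"
    by (intro tendsto_intros flux_tendsto L2_continuous g w lg lw)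
  ultimately show ?thesis by (intro LIMSEQ_le_const2) auto
qed

section \<open>Fourier multipliers\<close>

lemma finite_lattice_box: "finite {k::int^3. \<forall>i. k $ i \<in> J}" if "finite J"
proof (rule finite_imageD)
  show "finite ((\<lambda>k::int^3. (k $ 1, k $ 2, k $ 3)) ` {k. \<forall>i. k $ i \<in> J})"
    by (rule finite_subset[of _ "J \<times> J \<times> J"]) (use that in auto)
  show "inj_on (\<lambda>k::int^3. (k $ 1, k $ 2, k $ 3)) {k. \<forall>i. k $ i \<in> J}"
    by (auto simp: inj_on_def vec_eq_iff forall_3)
qed

definition lattice_ball :: "real \<Rightarrow> (int^3) set" where
  "lattice_ball R = {k. norm (freq k) \<le> R}"

lemma abs_nth_le_norm_freq: "real_of_int \<bar>k $ i\<bar> \<le> norm (freq k)"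
  using component_le_norm_cart[of "freq k" i] by simp

lemma finite_lattice_ball [simp]: "finite (lattice_ball R)"
proof (rule finite_subset)
  show "lattice_ball R \<subseteq> {k. \<forall>i. k $ i \<in> {- \<lceil>R\<rceil>..\<lceil>R\<rceil>}}"
  proof (clarsimp simp: lattice_ball_def)
    fix k :: "int^3" and i assume "norm (freq k) \<le> R"
    then have "real_of_int \<bar>k $ i\<bar> \<le> R" using abs_nth_le_norm_freq[of k i] by linarith
    then have "\<bar>k $ i\<bar> \<le> \<lceil>R\<rceil>" by linarith
    then show "- \<lceil>R\<rceil> \<le> k $ i \<and> k $ i \<le> \<lceil>R\<rceil>" by linarith
  qed
qed (rule finite_lattice_box, simp)

lemma lattice_ball_filterlim:
  assumes "filterlim r at_top sequentially"
  shows "filterlim (\<lambda>N::nat. lattice_ball (r N)) (finite_subsets_at_top UNIV) sequentially"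
  unfolding filterlim_iff eventually_finite_subsets_at_top
proof (intro allI impI, elim exE conjE)
  fix P and X :: "(int^3) set"
  assume X: "finite X" and P: "\<forall>Y. finite Y \<and> X \<subseteq> Y \<and> Y \<subseteq> UNIV \<longrightarrow> P Y"
  define R where "R = (\<Sum>k\<in>X. norm (freq k))"
  have "\<forall>\<^sub>F N in sequentially. R \<le> r N" using assms by (simp add: filterlim_at_top)
  then show "\<forall>\<^sub>F N in sequentially. P (lattice_ball (r N))"
  proof eventually_elim
    case (elim N)
    have "norm (freq k) \<le> R" if "k \<in> X" for k
      unfolding R_def using X that by (intro member_le_sum) auto
    then have "X \<subseteq> lattice_ball (r N)" using elim by (force simp: lattice_ball_def)
    then show ?case using P by simp
  qed
qed

lemma torus_multiplier_scalar:
  fixes f :: "real^3 \<Rightarrow> real"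
  shows "torus_multiplier m f x = Re (\<Sum>\<^sub>\<infinity>k. of_real (m (freq k)) * fourier_coeff f k * ch k x)"
  by (simp add: torus_multiplier_def ch_def)

lemma torus_multiplier_nth:
  fixes f :: "real^3 \<Rightarrow> real^3"
  shows "torus_multiplier m f x $ i = torus_multiplier m (\<lambda>y. f y $ i) x"
proof -
  have "torus_multiplier m f x $ i = torus_multiplier m f x \<bullet> axis i 1"
    by (rule cart_eq_inner_axis)
  also have "\<dots> = Re (\<Sum>\<^sub>\<infinity>k. of_real (m (freq k)) * fourier_coeff (\<lambda>y. f y \<bullet> axis i 1) k * cis (freq k \<bullet> x))"
    unfolding torus_multiplier_def by (rule inner_sum_left_Basis) (auto simp: Basis_vec_def)
  finally show ?thesis by (simp add: torus_multiplier_scalar ch_def cart_eq_inner_axis[symmetric])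
qed

lemma torus_multiplier_finite:
  fixes f :: "real^3 \<Rightarrow> real"
  assumes A: "finite A" and supp: "\<And>k. m (freq k) \<noteq> 0 \<Longrightarrow> k \<in> A" and even: "\<And>\<xi>. m (- \<xi>) = m \<xi>"
  shows "complex_of_real (torus_multiplier m f x) = (\<Sum>k\<in>A. (of_real (m (freq k)) * fourier_coeff f k) * ch k x)"
proof -
  define S where "S = {k. m (freq k) \<noteq> 0}"
  have S: "finite S" "S \<subseteq> A" using A supp by (auto simp: S_def intro: finite_subset)
  let ?t = "\<lambda>k. of_real (m (freq k)) * fourier_coeff f k * ch k x"
  have "(\<Sum>\<^sub>\<infinity>k. ?t k) = (\<Sum>\<^sub>\<infinity>k\<in>S. ?t k)" by (rule infsum_cong_neutral) (auto simp: S_def)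
  also have "\<dots> = (\<Sum>k\<in>S. ?t k)" using S by simp
  finally have inf: "(\<Sum>\<^sub>\<infinity>k. ?t k) = (\<Sum>k\<in>S. ?t k)" .
  have "cnj (\<Sum>k\<in>S. ?t k) = (\<Sum>k\<in>S. ?t (- k))"
    by (simp add: fourier_coeff_uminus cnj_ch freq_minus even)
  also have "\<dots> = (\<Sum>k\<in>S. ?t k)"
    by (rule sum.reindex_bij_witness[of _ uminus uminus]) (auto simp: S_def freq_minus even)
  finally have sym: "cnj (\<Sum>k\<in>S. ?t k) = (\<Sum>k\<in>S. ?t k)" .
  have "complex_of_real (Re z) = z" if "cnj z = z" for z using that by (simp add: complex_eq_iff)
  from this[OF sym] have "complex_of_real (Re (\<Sum>k\<in>S. ?t k)) = (\<Sum>k\<in>S. ?t k)" .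
  also have "\<dots> = (\<Sum>k\<in>A. ?t k)" by (rule sum.mono_neutral_left) (use S A in \<open>auto simp: S_def\<close>)
  finally show ?thesis by (simp add: torus_multiplier_scalar inf)
qed

section \<open>Littlewood--Paley partial sums\<close>

definition lp_sym :: "(real^3 \<Rightarrow> real) \<Rightarrow> (real^3 \<Rightarrow> real) \<Rightarrow> nat \<Rightarrow> real^3 \<Rightarrow> real" where
  "lp_sym \<eta> \<rho> j \<xi> = (if j = 0 then \<eta> \<xi> else \<rho> ((1 / 2 ^ (j - 1)) *\<^sub>R \<xi>))"

lemma lp_block_sym: "lp_block \<eta> \<rho> (int j - 1) = torus_multiplier (lp_sym \<eta> \<rho> j)"
proof (cases j)
  case (Suc i)
  have "lp_sym \<eta> \<rho> j = (\<lambda>\<xi>. \<rho> ((2 powi (- (int j - 1))) *\<^sub>R \<xi>))"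
    unfolding lp_sym_def using Suc by (auto simp: power_int_minus divide_inverse fun_eq_iff)
  then show ?thesis using Suc by (simp add: lp_block_def)
qed (simp add: lp_block_def lp_sym_def[abs_def])

lemma dyadic_partitionD:
  assumes "dyadic_partition \<eta> \<rho>"
  shows "0 \<le> \<eta> \<xi>" "0 \<le> \<rho> \<xi>" "\<eta> \<xi> \<noteq> 0 \<Longrightarrow> norm \<xi> \<le> 4 / 3" "\<rho> \<xi> \<noteq> 0 \<Longrightarrow> 3 / 4 \<le> norm \<xi>"
    "\<rho> \<xi> \<noteq> 0 \<Longrightarrow> norm \<xi> \<le> 8 / 3" "(\<lambda>j. \<rho> ((1 / 2 ^ j) *\<^sub>R \<xi>)) sums (1 - \<eta> \<xi>)"
    "norm \<xi> = norm \<zeta> \<Longrightarrow> \<eta> \<xi> = \<eta> \<zeta>" "norm \<xi> = norm \<zeta> \<Longrightarrow> \<rho> \<xi> = \<rho> \<zeta>"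
    "\<eta> \<xi> \<le> 1" "smooth \<eta>"
  using assms unfolding dyadic_partition_def by blast+

lemma lp_sym_support:
  assumes dp: "dyadic_partition \<eta> \<rho>" and nz: "lp_sym \<eta> \<rho> j \<xi> \<noteq> 0" shows "norm \<xi> \<le> 2 ^ Suc j"
proof (cases j)
  case 0
  then have "norm \<xi> \<le> 4 / 3" using dyadic_partitionD(3)[OF dp, of \<xi>] nz by (simp add: lp_sym_def)
  then show ?thesis using 0 by simp
next
  case (Suc i)
  then have "norm ((1 / 2 ^ i) *\<^sub>R \<xi>) \<le> 8 / 3"
    using dyadic_partitionD(5)[OF dp, of "(1 / 2 ^ i) *\<^sub>R \<xi>"] nz by (simp add: lp_sym_def)
  then have "norm \<xi> \<le> 8 / 3 * 2 ^ i" by (simp add: field_simps)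
  also have "\<dots> \<le> 2 ^ Suc j" using Suc by simp
  finally show ?thesis .
qed

lemma lp_sym_even:
  assumes dp: "dyadic_partition \<eta> \<rho>" shows "lp_sym \<eta> \<rho> j (- \<xi>) = lp_sym \<eta> \<rho> j \<xi>"
  unfolding lp_sym_def
  using dyadic_partitionD(7)[OF dp, of "- \<xi>" \<xi>]
    dyadic_partitionD(8)[OF dp, of "(1 / 2 ^ (j - 1)) *\<^sub>R (- \<xi>)" "(1 / 2 ^ (j - 1)) *\<^sub>R \<xi>"] by simp

lemma lp_block_expansion:
  fixes f :: "real^3 \<Rightarrow> real"
  assumes dp: "dyadic_partition \<eta> \<rho>" and R: "2 ^ Suc j \<le> R"
  shows "complex_of_real (lp_block \<eta> \<rho> (int j - 1) f x)
       = (\<Sum>k\<in>lattice_ball R. (of_real (lp_sym \<eta> \<rho> j (freq k)) * fourier_coeff f k) * ch k x)"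
  unfolding lp_block_sym
proof (rule torus_multiplier_finite)
  fix k assume "lp_sym \<eta> \<rho> j (freq k) \<noteq> 0"
  then have "norm (freq k) \<le> 2 ^ Suc j" by (rule lp_sym_support[OF dp])
  then show "k \<in> lattice_ball R" unfolding lattice_ball_def using R by simp
qed (simp_all add: lp_sym_even[OF dp])

lemma lp_block_degree:
  fixes f :: "real^3 \<Rightarrow> real"
  assumes dp: "dyadic_partition \<eta> \<rho>"
  shows "degree_le (2 ^ Suc j) (lp_block \<eta> \<rho> (int j - 1) f)"
  unfolding degree_le_def
proof (intro exI conjI ballI allI)
  fix k :: "int^3" and i assume "k \<in> lattice_ball (2 ^ Suc j)"
  then have "real_of_int \<bar>k $ i\<bar> \<le> 2 ^ Suc j"
    using abs_nth_le_norm_freq[of k i] by (simp add: lattice_ball_def)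
  then have "real_of_int \<bar>k $ i\<bar> \<le> real_of_int (int (2 ^ Suc j))" by simp
  then show "\<bar>k $ i\<bar> \<le> int (2 ^ Suc j)" by (simp only: of_int_le_iff)
qed (rule finite_lattice_ball, rule lp_block_expansion[OF dp order_refl])

definition lp_partial :: "(real^3 \<Rightarrow> real) \<Rightarrow> (real^3 \<Rightarrow> real) \<Rightarrow> nat \<Rightarrow> (real^3 \<Rightarrow> real) \<Rightarrow> real^3 \<Rightarrow> real" where
  "lp_partial \<eta> \<rho> N f x = (\<Sum>j<N. lp_block \<eta> \<rho> (int j - 1) f x)"

definition lp_mass :: "(real^3 \<Rightarrow> real) \<Rightarrow> (real^3 \<Rightarrow> real) \<Rightarrow> nat \<Rightarrow> int^3 \<Rightarrow> real" where
  "lp_mass \<eta> \<rho> N k = (\<Sum>j<N. lp_sym \<eta> \<rho> j (freq k))"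

lemma lp_mass_support:
  assumes dp: "dyadic_partition \<eta> \<rho>" and nz: "lp_mass \<eta> \<rho> N k \<noteq> 0" shows "k \<in> lattice_ball (2 ^ N)"
proof -
  obtain j where j: "j < N" "lp_sym \<eta> \<rho> j (freq k) \<noteq> 0"
    using nz unfolding lp_mass_def by (metis lessThan_iff sum.neutral)
  have "norm (freq k) \<le> 2 ^ Suc j" by (rule lp_sym_support[OF dp j(2)])
  also have "\<dots> \<le> 2 ^ N" using j(1) by (intro power_increasing) auto
  finally show ?thesis by (simp add: lattice_ball_def)
qed

lemma lp_partial_expansion:
  fixes f :: "real^3 \<Rightarrow> real"
  assumes dp: "dyadic_partition \<eta> \<rho>" and A: "finite A" "lattice_ball (2 ^ N) \<subseteq> A"
  shows "complex_of_real (lp_partial \<eta> \<rho> N f x)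
       = (\<Sum>k\<in>A. (of_real (lp_mass \<eta> \<rho> N k) * fourier_coeff f k) * ch k x)"
proof -
  have "complex_of_real (lp_partial \<eta> \<rho> N f x)
      = (\<Sum>j<N. \<Sum>k\<in>lattice_ball (2 ^ N). (of_real (lp_sym \<eta> \<rho> j (freq k)) * fourier_coeff f k) * ch k x)"
    unfolding lp_partial_def of_real_sum
    by (intro sum.cong refl lp_block_expansion[OF dp]) (simp add: power_increasing del: power_Suc)
  also have "\<dots> = (\<Sum>k\<in>lattice_ball (2 ^ N). (of_real (lp_mass \<eta> \<rho> N k) * fourier_coeff f k) * ch k x)"
    by (subst sum.swap) (simp add: lp_mass_def sum_distrib_right)
  also have "\<dots> = (\<Sum>k\<in>A. (of_real (lp_mass \<eta> \<rho> N k) * fourier_coeff f k) * ch k x)"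
    by (rule sum.mono_neutral_left) (use A lp_mass_support[OF dp] in auto)
  finally show ?thesis .
qed

lemma lp_partial_continuous: "dyadic_partition \<eta> \<rho> \<Longrightarrow> continuous_on UNIV (lp_partial \<eta> \<rho> N f)"
  and lp_partial_periodic: "dyadic_partition \<eta> \<rho> \<Longrightarrow> periodic (lp_partial \<eta> \<rho> N f)"
  using sum_ch_real_continuous[OF lp_partial_expansion[OF _ finite_lattice_ball order_refl]] by blast+

lemma fourier_coeff_lp_partial:
  assumes dp: "dyadic_partition \<eta> \<rho>"
  shows "fourier_coeff (lp_partial \<eta> \<rho> N f) k = of_real (lp_mass \<eta> \<rho> N k) * fourier_coeff f k"
  using fourier_coeff_sum_ch[OF finite_lattice_ball lp_partial_expansion[OF dp finite_lattice_ball order_refl], where k = k]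
    lp_mass_support[OF dp, of N k] by (auto split: if_splits)

lemma lp_mass_tendsto:
  assumes dp: "dyadic_partition \<eta> \<rho>" shows "(\<lambda>N. lp_mass \<eta> \<rho> N k) \<longlonglongrightarrow> 1"
proof -
  have "(\<lambda>j. \<rho> ((1 / 2 ^ j) *\<^sub>R freq k)) sums (1 - \<eta> (freq k))"
    by (rule dyadic_partitionD(6)[OF dp])
  then have "(\<lambda>N. \<eta> (freq k) + (\<Sum>j<N. \<rho> ((1 / 2 ^ j) *\<^sub>R freq k))) \<longlonglongrightarrow> \<eta> (freq k) + (1 - \<eta> (freq k))"
    unfolding sums_def by (intro tendsto_intros)
  moreover have "lp_mass \<eta> \<rho> (Suc N) k = \<eta> (freq k) + (\<Sum>j<N. \<rho> ((1 / 2 ^ j) *\<^sub>R freq k))" for N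
    unfolding lp_mass_def sum.lessThan_Suc_shift by (simp add: lp_sym_def)
  ultimately have "(\<lambda>N. lp_mass \<eta> \<rho> (Suc N) k) \<longlonglongrightarrow> 1" by simp
  then show ?thesis by (rule LIMSEQ_imp_Suc)
qed

lemma lp_mass_bounds:
  assumes dp: "dyadic_partition \<eta> \<rho>" shows "0 \<le> lp_mass \<eta> \<rho> N k" "lp_mass \<eta> \<rho> N k \<le> 1"
proof -
  have nn: "lp_sym \<eta> \<rho> j \<xi> \<ge> 0" for j \<xi> using dyadic_partitionD(1,2)[OF dp] by (simp add: lp_sym_def)
  then show "0 \<le> lp_mass \<eta> \<rho> N k" by (auto simp: lp_mass_def intro: sum_nonneg)
  have "mono (\<lambda>N. lp_mass \<eta> \<rho> N k)" unfolding lp_mass_def by (intro monoI sum_mono2) (use nn in auto)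
  then show "lp_mass \<eta> \<rho> N k \<le> 1"
    using lp_mass_tendsto[OF dp] by (intro incseq_le) (auto simp: incseq_def mono_def)
qed

lemma lp_partial_tendsto:
  assumes dp: "dyadic_partition \<eta> \<rho>" and f: "L2 f"
  shows "(\<lambda>N. LINT x|M3. (lp_partial \<eta> \<rho> N f x - f x)\<^sup>2) \<longlonglongrightarrow> 0"
proof (rule LIMSEQ_I)
  fix e :: real assume e: "e > 0"
  let ?c = "\<lambda>k. (cmod (fourier_coeff f k))\<^sup>2"
  let ?S = "(LINT x|M3. (f x)\<^sup>2) / vol3"
  have "(?c has_sum ?S) UNIV" by (rule parseval[OF f])
  then have "\<forall>\<^sub>F X in finite_subsets_at_top UNIV. ?S - e / (4 * vol3) < sum ?c X"
    unfolding has_sum_def using e by (intro order_tendstoD) auto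
  then obtain X where X: "finite X" "?S - e / (4 * vol3) < sum ?c X"
    unfolding eventually_finite_subsets_at_top by blast
  have "(\<lambda>N. vol3 * (\<Sum>k\<in>X. (lp_mass \<eta> \<rho> N k - 1)\<^sup>2 * ?c k)) \<longlonglongrightarrow> vol3 * (\<Sum>k\<in>X. (1 - 1)\<^sup>2 * ?c k)"
    by (intro tendsto_intros lp_mass_tendsto[OF dp])
  then have "(\<lambda>N. vol3 * (\<Sum>k\<in>X. (lp_mass \<eta> \<rho> N k - 1)\<^sup>2 * ?c k)) \<longlonglongrightarrow> 0" by simp
  then have "\<forall>\<^sub>F N in sequentially. vol3 * (\<Sum>k\<in>X. (lp_mass \<eta> \<rho> N k - 1)\<^sup>2 * ?c k) < e / 2"
    using e by (intro order_tendstoD(2)[where y = 0]) auto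
  then obtain N0 where N0: "\<And>N. N \<ge> N0 \<Longrightarrow> vol3 * (\<Sum>k\<in>X. (lp_mass \<eta> \<rho> N k - 1)\<^sup>2 * ?c k) < e / 2"
    unfolding eventually_sequentially by blast
  show "\<exists>N0. \<forall>N\<ge>N0. norm ((LINT x|M3. (lp_partial \<eta> \<rho> N f x - f x)\<^sup>2) - 0) < e"
  proof (intro exI allI impI)
    fix N assume N: "N0 \<le> N"
    define A where "A = X \<union> lattice_ball (2 ^ N)"
    have A: "finite A" "lattice_ball (2 ^ N) \<subseteq> A" "X \<subseteq> A" using X by (auto simp: A_def)
    have "(LINT x|M3. (lp_partial \<eta> \<rho> N f x - f x)\<^sup>2)
        = (LINT x|M3. (cmod (of_real (f x) - (\<Sum>k\<in>A. (of_real (lp_mass \<eta> \<rho> N k) * fourier_coeff f k) * ch k x)))\<^sup>2)"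
      unfolding lp_partial_expansion[OF dp A(1,2), symmetric]
      by (simp add: of_real_diff[symmetric] power2_commute del: of_real_diff)
    also have "\<dots> = (LINT x|M3. (f x)\<^sup>2) - vol3 * sum ?c A
        + vol3 * (\<Sum>k\<in>A. (cmod (of_real (lp_mass \<eta> \<rho> N k) * fourier_coeff f k - fourier_coeff f k))\<^sup>2)"
      by (rule L2_distance_sum_ch[OF f A(1)])
    also have "(\<Sum>k\<in>A. (cmod (of_real (lp_mass \<eta> \<rho> N k) * fourier_coeff f k - fourier_coeff f k))\<^sup>2)
        = (\<Sum>k\<in>A. (lp_mass \<eta> \<rho> N k - 1)\<^sup>2 * ?c k)"
    proof (intro sum.cong refl)
      fix k
      have "of_real (lp_mass \<eta> \<rho> N k) * fourier_coeff f k - fourier_coeff f k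
          = of_real (lp_mass \<eta> \<rho> N k - 1) * fourier_coeff f k" by (simp add: left_diff_distrib)
      then show "(cmod (of_real (lp_mass \<eta> \<rho> N k) * fourier_coeff f k - fourier_coeff f k))\<^sup>2
          = (lp_mass \<eta> \<rho> N k - 1)\<^sup>2 * ?c k"
        by (simp only: norm_mult norm_of_real power_mult_distrib power2_abs)
    qed
    also have "\<dots> = (\<Sum>k\<in>X. (lp_mass \<eta> \<rho> N k - 1)\<^sup>2 * ?c k) + (\<Sum>k\<in>A - X. (lp_mass \<eta> \<rho> N k - 1)\<^sup>2 * ?c k)"
      using sum.subset_diff[OF A(3,1), of "\<lambda>k. (lp_mass \<eta> \<rho> N k - 1)\<^sup>2 * ?c k"] by simp
    finally have eq: "(LINT x|M3. (lp_partial \<eta> \<rho> N f x - f x)\<^sup>2)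
        = (LINT x|M3. (f x)\<^sup>2) - vol3 * sum ?c A + vol3 * (\<Sum>k\<in>X. (lp_mass \<eta> \<rho> N k - 1)\<^sup>2 * ?c k)
          + vol3 * (\<Sum>k\<in>A - X. (lp_mass \<eta> \<rho> N k - 1)\<^sup>2 * ?c k)"
      by (simp add: distrib_left)
    have "(\<Sum>k\<in>A - X. (lp_mass \<eta> \<rho> N k - 1)\<^sup>2 * ?c k) \<le> (\<Sum>k\<in>A - X. 1 * ?c k)"
      using lp_mass_bounds[OF dp, of N]
      by (intro sum_mono mult_right_mono) (auto simp: abs_square_le_1)
    also have "\<dots> = sum ?c A - sum ?c X" using sum_diff[OF A(1,3), of ?c] by simp
    finally have "vol3 * (\<Sum>k\<in>A - X. (lp_mass \<eta> \<rho> N k - 1)\<^sup>2 * ?c k) \<le> vol3 * (sum ?c A - sum ?c X)"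
      by (intro mult_left_mono) (auto simp: less_imp_le)
    then have "(LINT x|M3. (lp_partial \<eta> \<rho> N f x - f x)\<^sup>2) < (LINT x|M3. (f x)\<^sup>2) - vol3 * sum ?c X + e / 2"
      using eq N0[OF N] by (simp add: right_diff_distrib)
    also have "(LINT x|M3. (f x)\<^sup>2) - vol3 * sum ?c X < e / 4"
    proof -
      have "vol3 * (?S - e / (4 * vol3)) < vol3 * sum ?c X" using X(2) by (intro mult_strict_left_mono) auto
      then show ?thesis by (simp add: right_diff_distrib less_imp_neq[OF vol3_pos, symmetric])
    qed
    finally show "norm ((LINT x|M3. (lp_partial \<eta> \<rho> N f x - f x)\<^sup>2) - 0) < e" using e by simp
  qed
qed

text \<open>The bound does not depend on the number of blocks, so it survives the passage to the full field.\<close>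

lemma lp_partial_increment:
  assumes dp: "dyadic_partition \<eta> \<rho>" and B: "B \<ge> 0" and s: "0 < \<sigma>" "\<sigma> \<le> 1" "\<sigma> < s"
    and b: "\<And>j. (LINT x|M3. \<bar>lp_block \<eta> \<rho> (int j - 1) f x\<bar> ^ 3) \<le> (2 powr (- ((real j - 1) * s)) * B) ^ 3"
  shows "(LINT x|M3. \<bar>lp_partial \<eta> \<rho> N f (x + z) - lp_partial \<eta> \<rho> N f x\<bar> ^ 3)
          \<le> (12 * 2 powr s / (1 - 2 powr (\<sigma> - s))) ^ 3 * B ^ 3 * norm z powr (3 * \<sigma>)"
proof -
  have "(LINT x|M3. \<bar>lp_partial \<eta> \<rho> N f (x + z) - lp_partial \<eta> \<rho> N f x\<bar> ^ 3)
      \<le> (12 / (1 - 2 powr (\<sigma> - s)) * norm z powr \<sigma> * (2 powr s * B)) ^ 3"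
    unfolding lp_partial_def
  proof (rule L3_increment_dyadic[OF lp_block_degree[OF dp] _ _ s])
    show "(LINT x|M3. \<bar>lp_block \<eta> \<rho> (int j - 1) f x\<bar> ^ 3) \<le> (2 powr (- (real j * s)) * (2 powr s * B)) ^ 3" for j
      using b[of j] by (simp add: left_diff_distrib powr_diff powr_minus mult.assoc[symmetric] field_simps)
  qed (use B in auto)
  also have "\<dots> = (12 * 2 powr s / (1 - 2 powr (\<sigma> - s))) ^ 3 * B ^ 3 * (norm z powr \<sigma>) ^ 3"
    by (simp add: power_mult_distrib power_divide ac_simps)
  also have "(norm z powr \<sigma>) ^ 3 = norm z powr (3 * \<sigma>)"
    by (cases "z = 0") (simp_all add: powr_realpow[symmetric] powr_powr mult.commute)
  finally show ?thesis .
qed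

section \<open>The filtered velocity\<close>

text \<open>In an increment of the filtered velocity the coefficients of \<open>u\<close>, an \<open>\<ell>\<^sup>2\<close> sequence, are multiplied by
at most a constant times \<open>|z| / |k|\<close>, and \<open>1 / |k|\<close> belongs to \<open>\<ell>\<^sup>4\<close> over the nonzero points of the three-dimensional
lattice. By the Cauchy--Schwarz inequality the product of an \<open>\<ell>\<^sup>4\<close> sequence with an \<open>\<ell>\<^sup>2\<close> sequence has a
square summable convolution square; this is the embedding of \<open>H\<^sup>1\<close> into \<open>L\<^sup>4\<close> on the Fourier side.\<close>

lemma sum_ch_norm4_integral:
  assumes A: "finite A" and c: "\<And>k. k \<in> A \<Longrightarrow> cmod (c k) \<le> a k * b k"
    and ab: "\<And>k. a k \<ge> 0" "\<And>k. b k \<ge> 0"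
  shows "(LINT x|M3. (cmod (\<Sum>k\<in>A. c k * ch k x)) ^ 4) \<le> vol3 * ((\<Sum>k\<in>A. a k ^ 4) * (\<Sum>k\<in>A. (b k)\<^sup>2)\<^sup>2)"
proof -
  define sm where "sm p = fst p + snd p" for p :: "(int^3) \<times> (int^3)"
  define P where "P = A \<times> A"
  define Pm where "Pm m = {p \<in> P. sm p = m}" for m
  define d where "d m = (\<Sum>p\<in>Pm m. c (fst p) * c (snd p))" for m
  have P: "finite P" using A by (simp add: P_def)
  have Pm: "finite (Pm m)" for m using P by (simp add: Pm_def)
  have sq: "(\<Sum>k\<in>A. c k * ch k x)\<^sup>2 = (\<Sum>m\<in>sm ` P. d m * ch m x)" for x
  proof -
    have "(\<Sum>k\<in>A. c k * ch k x)\<^sup>2 = (\<Sum>p\<in>P. (c (fst p) * c (snd p)) * ch (sm p) x)"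
      unfolding power2_eq_square sum_product sum.cartesian_product P_def
      by (intro sum.cong) (auto simp: sm_def ch_mult[symmetric])
    also have "\<dots> = (\<Sum>m\<in>sm ` P. \<Sum>p\<in>Pm m. (c (fst p) * c (snd p)) * ch (sm p) x)"
      unfolding Pm_def by (rule sum.image_gen[OF P])
    also have "\<dots> = (\<Sum>m\<in>sm ` P. d m * ch m x)"
      unfolding d_def sum_distrib_right by (intro sum.cong) (auto simp: Pm_def)
    finally show ?thesis .
  qed
  have dm: "(cmod (d m))\<^sup>2 \<le> (\<Sum>k\<in>A. a k ^ 4) * (\<Sum>p\<in>Pm m. (b (fst p))\<^sup>2 * (b (snd p))\<^sup>2)" for m
  proof -
    have "cmod (d m) \<le> (\<Sum>p\<in>Pm m. cmod (c (fst p) * c (snd p)))" unfolding d_def by (rule norm_sum)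
    also have "\<dots> \<le> (\<Sum>p\<in>Pm m. (a (fst p) * a (snd p)) * (b (fst p) * b (snd p)))"
    proof (rule sum_mono)
      fix p assume "p \<in> Pm m"
      then have "cmod (c (fst p)) * cmod (c (snd p)) \<le> (a (fst p) * b (fst p)) * (a (snd p) * b (snd p))"
        using c ab by (intro mult_mono) (auto simp: Pm_def P_def)
      then show "cmod (c (fst p) * c (snd p)) \<le> (a (fst p) * a (snd p)) * (b (fst p) * b (snd p))"
        by (simp add: norm_mult ac_simps)
    qed
    finally have "(cmod (d m))\<^sup>2 \<le> (\<Sum>p\<in>Pm m. (a (fst p) * a (snd p)) * (b (fst p) * b (snd p)))\<^sup>2"
      by (intro power_mono) auto
    also have "\<dots> \<le> (\<Sum>p\<in>Pm m. (a (fst p) * a (snd p))\<^sup>2) * (\<Sum>p\<in>Pm m. (b (fst p) * b (snd p))\<^sup>2)"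
      by (rule Cauchy_Schwarz_ineq_sum)
    also have "\<dots> \<le> (\<Sum>k\<in>A. a k ^ 4) * (\<Sum>p\<in>Pm m. (b (fst p) * b (snd p))\<^sup>2)"
    proof (rule mult_right_mono)
      have i1: "(\<Sum>p\<in>Pm m. a (fst p) ^ 4) \<le> (\<Sum>k\<in>A. a k ^ 4)"
      proof -
        have inj: "inj_on fst (Pm m)" by (auto simp: inj_on_def Pm_def sm_def)
        have "(\<Sum>p\<in>Pm m. a (fst p) ^ 4) = (\<Sum>k\<in>fst ` Pm m. a k ^ 4)" by (simp add: sum.reindex[OF inj])
        also have "\<dots> \<le> (\<Sum>k\<in>A. a k ^ 4)" by (rule sum_mono2) (use A in \<open>auto simp: Pm_def P_def\<close>)
        finally show ?thesis .
      qed
      have i2: "(\<Sum>p\<in>Pm m. a (snd p) ^ 4) \<le> (\<Sum>k\<in>A. a k ^ 4)"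
      proof -
        have inj: "inj_on snd (Pm m)" by (auto simp: inj_on_def Pm_def sm_def)
        have "(\<Sum>p\<in>Pm m. a (snd p) ^ 4) = (\<Sum>k\<in>snd ` Pm m. a k ^ 4)" by (simp add: sum.reindex[OF inj])
        also have "\<dots> \<le> (\<Sum>k\<in>A. a k ^ 4)" by (rule sum_mono2) (use A in \<open>auto simp: Pm_def P_def\<close>)
        finally show ?thesis .
      qed
      have "(\<Sum>p\<in>Pm m. (a (fst p) * a (snd p))\<^sup>2) \<le> (\<Sum>p\<in>Pm m. (a (fst p) ^ 4 + a (snd p) ^ 4) / 2)"
      proof (rule sum_mono)
        fix p
        have "0 \<le> ((a (fst p))\<^sup>2 - (a (snd p))\<^sup>2)\<^sup>2" by simp
        then show "(a (fst p) * a (snd p))\<^sup>2 \<le> (a (fst p) ^ 4 + a (snd p) ^ 4) / 2"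
          by (simp add: power2_diff power_mult_distrib flip: power_mult)
      qed
      also have "\<dots> \<le> (\<Sum>k\<in>A. a k ^ 4)" using i1 i2 by (simp add: sum_divide_distrib[symmetric] sum.distrib)
      finally show "(\<Sum>p\<in>Pm m. (a (fst p) * a (snd p))\<^sup>2) \<le> (\<Sum>k\<in>A. a k ^ 4)" .
    qed (simp add: sum_nonneg)
    finally show ?thesis by (simp add: power_mult_distrib)
  qed
  have "(LINT x|M3. (cmod (\<Sum>k\<in>A. c k * ch k x)) ^ 4) = (LINT x|M3. (cmod (\<Sum>m\<in>sm ` P. d m * ch m x))\<^sup>2)"
    unfolding sq[symmetric] by (simp add: norm_power flip: power_mult)
  also have "\<dots> = vol3 * (\<Sum>m\<in>sm ` P. (cmod (d m))\<^sup>2)"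
    by (rule sum_ch_norm2_integral) (use P in simp)
  also have "\<dots> \<le> vol3 * (\<Sum>m\<in>sm ` P. (\<Sum>k\<in>A. a k ^ 4) * (\<Sum>p\<in>Pm m. (b (fst p))\<^sup>2 * (b (snd p))\<^sup>2))"
    by (intro mult_left_mono sum_mono dm) (auto simp: less_imp_le)
  also have "(\<Sum>m\<in>sm ` P. (\<Sum>k\<in>A. a k ^ 4) * (\<Sum>p\<in>Pm m. (b (fst p))\<^sup>2 * (b (snd p))\<^sup>2))
      = (\<Sum>k\<in>A. a k ^ 4) * (\<Sum>p\<in>P. (b (fst p))\<^sup>2 * (b (snd p))\<^sup>2)"
    unfolding sum_distrib_left[symmetric] Pm_def by (subst sum.image_gen[OF P, of _ sm]) simp
  also have "(\<Sum>p\<in>P. (b (fst p))\<^sup>2 * (b (snd p))\<^sup>2) = (\<Sum>k\<in>A. (b k)\<^sup>2)\<^sup>2"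
    unfolding power2_eq_square[of "\<Sum>k\<in>A. (b k)\<^sup>2"] sum_product sum.cartesian_product P_def
    by (intro sum.cong) auto
  finally show ?thesis .
qed

lemma int_sum_bounded:
  "\<exists>C. \<forall>J. finite J \<longrightarrow> (\<Sum>m\<in>J. (1 + (real_of_int m)\<^sup>2) powr (- 2 / 3)) \<le> C"
proof -
  define h where "h j = (1 + (real j)\<^sup>2) powr (- 2 / 3)" for j :: nat
  have h0: "h j \<ge> 0" for j by (simp add: h_def)
  have "summable h"
  proof (rule summable_comparison_test_ev)
    show "summable (\<lambda>j. real j powr (- 4 / 3))" by (subst summable_real_powr_iff) simp
    show "\<forall>\<^sub>F j in sequentially. norm (h j) \<le> real j powr (- 4 / 3)"
    proof (rule eventually_sequentiallyI[of 1])
      fix j :: nat assume j: "1 \<le> j"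
      have "h j \<le> ((real j)\<^sup>2) powr (- 2 / 3)"
        unfolding h_def using j by (intro powr_mono2') auto
      also have "\<dots> = (real j powr 2) powr (- 2 / 3)" using j by simp
      also have "\<dots> = real j powr (- 4 / 3)" by (simp only: powr_powr) simp
      finally show "norm (h j) \<le> real j powr (- 4 / 3)" using h0 by simp
    qed
  qed
  have "(\<Sum>m\<in>J. (1 + (real_of_int m)\<^sup>2) powr (- 2 / 3)) \<le> 2 * suminf h" if J: "finite J" for J
  proof -
    have eq: "(1 + (real_of_int m)\<^sup>2) powr (- 2 / 3) = h (nat \<bar>m\<bar>)" for m by (simp add: h_def)
    have half: "(\<Sum>m\<in>I. h (nat \<bar>m\<bar>)) \<le> suminf h" if "finite I" "inj_on (\<lambda>m. nat \<bar>m\<bar>) I" for I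
    proof -
      have "(\<Sum>m\<in>I. h (nat \<bar>m\<bar>)) = (\<Sum>j\<in>(\<lambda>m. nat \<bar>m\<bar>) ` I. h j)" by (simp add: sum.reindex[OF that(2)])
      also have "\<dots> \<le> suminf h" by (rule sum_le_suminf[OF \<open>summable h\<close>]) (use that h0 in auto)
      finally show ?thesis .
    qed
    have "(\<Sum>m\<in>J. h (nat \<bar>m\<bar>)) = (\<Sum>m\<in>{m\<in>J. m \<ge> 0}. h (nat \<bar>m\<bar>)) + (\<Sum>m\<in>{m\<in>J. m < 0}. h (nat \<bar>m\<bar>))"
      using J by (subst sum.union_disjoint[symmetric]) (auto intro!: sum.cong)
    also have "\<dots> \<le> suminf h + suminf h"
      using J by (intro add_mono half) (auto simp: inj_on_def)
    finally show ?thesis unfolding eq by simp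
  qed
  then show ?thesis by blast
qed

text \<open>Since \<open>(1 + x) (1 + y) (1 + z) \<le> (1 + x + y + z)\<^sup>3\<close>, the summand is dominated by a product of three
one-dimensional summands with exponent \<open>-2/3\<close>, and \<open>4/3 > 1\<close>.\<close>

lemma lattice_sum_bounded:
  assumes "\<alpha> > 0"
  shows "\<exists>C. \<forall>A. finite A \<longrightarrow> (\<Sum>k\<in>A. (1 / (1 + \<alpha>\<^sup>2 * (norm (freq k))\<^sup>2))\<^sup>2) \<le> C"
proof -
  obtain C where C: "\<And>J. finite J \<Longrightarrow> (\<Sum>m\<in>J. (1 + (real_of_int m)\<^sup>2) powr (- 2 / 3)) \<le> C"
    using int_sum_bounded by blast
  define f where "f m = (1 + (real_of_int m)\<^sup>2) powr (- 2 / 3)" for m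
  define c where "c = min 1 (\<alpha>\<^sup>2)"
  have c: "c > 0" "c \<le> 1" "c \<le> \<alpha>\<^sup>2" using assms by (auto simp: c_def)
  have f0: "f m \<ge> 0" for m by (simp add: f_def)
  have tm: "(1 / (1 + \<alpha>\<^sup>2 * (norm (freq k))\<^sup>2))\<^sup>2 \<le> (1 / c\<^sup>2) * (f (k $ 1) * f (k $ 2) * f (k $ 3))" for k
  proof -
    define x y z where "x = (real_of_int (k $ 1))\<^sup>2" and "y = (real_of_int (k $ 2))\<^sup>2" and "z = (real_of_int (k $ 3))\<^sup>2"
    have n: "(norm (freq k))\<^sup>2 = x + y + z" by (simp add: norm_sq_vec3 sum_3 x_def y_def z_def)
    have nn: "x \<ge> 0" "y \<ge> 0" "z \<ge> 0" by (auto simp: x_def y_def z_def)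
    define t where "t = 1 + x + y + z"
    have t: "t > 0" using nn by (simp add: t_def)
    have "c * t \<le> 1 + \<alpha>\<^sup>2 * (x + y + z)"
    proof -
      have "c * (x + y + z) \<le> \<alpha>\<^sup>2 * (x + y + z)" using c nn by (intro mult_right_mono) auto
      then show ?thesis using c by (simp add: t_def algebra_simps)
    qed
    then have le: "c * t \<le> 1 + \<alpha>\<^sup>2 * (x + y + z)" .
    have ct: "0 < c * t" using c t by simp
    have "(1 / (1 + \<alpha>\<^sup>2 * (norm (freq k))\<^sup>2)) \<le> 1 / (c * t)"
      unfolding n by (rule divide_left_mono[OF le _ mult_pos_pos[OF less_le_trans[OF ct le] ct]]) simp
    then have "(1 / (1 + \<alpha>\<^sup>2 * (norm (freq k))\<^sup>2))\<^sup>2 \<le> (1 / (c * t))\<^sup>2"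
      by (intro power_mono) auto
    also have "\<dots> = 1 / c\<^sup>2 * (1 / t\<^sup>2)" by (simp add: power_divide power_mult_distrib)
    also have "1 / t\<^sup>2 = (t ^ 3) powr (- 2 / 3)"
    proof -
      have "(t ^ 3) powr (- 2 / 3) = (t powr 3) powr (- 2 / 3)" using t by simp
      also have "\<dots> = t powr (- 2)" by (simp only: powr_powr) simp
      also have "\<dots> = 1 / t\<^sup>2" using t by (simp only: powr_minus_divide) simp
      finally show ?thesis by simp
    qed
    also have "(t ^ 3) powr (- 2 / 3) \<le> ((1 + x) * (1 + y) * (1 + z)) powr (- 2 / 3)"
    proof (rule powr_mono2')
      have "(1 + x) * (1 + y) * (1 + z) \<le> t * t * t" using nn by (intro mult_mono) (auto simp: t_def)
      then show "(1 + x) * (1 + y) * (1 + z) \<le> t ^ 3" by (simp add: power3_eq_cube)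
    qed (use nn in auto)
    also have "((1 + x) * (1 + y) * (1 + z)) powr (- 2 / 3) = f (k $ 1) * f (k $ 2) * f (k $ 3)"
      using nn by (simp add: f_def x_def y_def z_def powr_mult)
    finally show ?thesis using c by (simp add: divide_right_mono mult_left_mono)
  qed
  have "(\<Sum>k\<in>A. (1 / (1 + \<alpha>\<^sup>2 * (norm (freq k))\<^sup>2))\<^sup>2) \<le> 1 / c\<^sup>2 * C ^ 3" if A: "finite A" for A :: "(int^3) set"
  proof -
    define J where "J = (\<Union>k\<in>A. {k $ 1, k $ 2, k $ 3})"
    have J: "finite J" using A by (simp add: J_def)
    let ?t = "\<lambda>k::int^3. (k $ 1, k $ 2, k $ 3)"
    have inj: "inj_on ?t A" by (auto simp: inj_on_def vec_eq_iff forall_3)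
    have "(\<Sum>k\<in>A. f (k $ 1) * f (k $ 2) * f (k $ 3)) = (\<Sum>(a, b, c)\<in>?t ` A. f a * f b * f c)"
      by (simp add: sum.reindex[OF inj])
    also have "\<dots> \<le> (\<Sum>(a, b, c)\<in>J \<times> J \<times> J. f a * f b * f c)"
      by (rule sum_mono2) (use J f0 in \<open>auto simp: J_def\<close>)
    also have "\<dots> = (\<Sum>a\<in>J. f a) * ((\<Sum>b\<in>J. f b) * (\<Sum>c\<in>J. f c))"
      by (simp add: sum.cartesian_product[symmetric] sum_distrib_left[symmetric] sum_distrib_right[symmetric] mult.assoc)
    also have "\<dots> \<le> C * (C * C)"
    proof -
      have s: "0 \<le> (\<Sum>a\<in>J. f a)" "(\<Sum>a\<in>J. f a) \<le> C" using f0 C[OF J] by (auto intro: sum_nonneg simp: f_def)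
      then show ?thesis by (intro mult_mono) auto
    qed
    finally have "1 / c\<^sup>2 * (\<Sum>k\<in>A. f (k $ 1) * f (k $ 2) * f (k $ 3)) \<le> 1 / c\<^sup>2 * C ^ 3"
      by (intro mult_left_mono) (auto simp: power3_eq_cube)
    moreover have "(\<Sum>k\<in>A. (1 / (1 + \<alpha>\<^sup>2 * (norm (freq k))\<^sup>2))\<^sup>2) \<le> 1 / c\<^sup>2 * (\<Sum>k\<in>A. f (k $ 1) * f (k $ 2) * f (k $ 3))"
      unfolding sum_distrib_left by (intro sum_mono tm)
    ultimately show ?thesis by linarith
  qed
  then show ?thesis by blast
qed

definition helm :: "real \<Rightarrow> real^3 \<Rightarrow> real" where
  "helm \<alpha> \<xi> = 1 / (1 + \<alpha>\<^sup>2 * (norm \<xi>)\<^sup>2)"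

lemma helm_bounds: "0 < helm \<alpha> \<xi>" "helm \<alpha> \<xi> \<le> 1"
  by (simp_all add: helm_def add_pos_nonneg)

lemma helmholtz_inv_nth: "helmholtz_inv \<alpha> u x $ i = torus_multiplier (helm \<alpha>) (\<lambda>y. u y $ i) x"
  by (simp add: helmholtz_inv_def torus_multiplier_nth helm_def[abs_def])

definition helm_trunc :: "real \<Rightarrow> nat \<Rightarrow> (real^3 \<Rightarrow> real) \<Rightarrow> real^3 \<Rightarrow> real" where
  "helm_trunc \<alpha> N = torus_multiplier (\<lambda>\<xi>. if norm \<xi> \<le> real N then helm \<alpha> \<xi> else 0)"

lemma helm_trunc_expansion:
  "complex_of_real (helm_trunc \<alpha> N f x)
     = (\<Sum>k\<in>lattice_ball (real N). (of_real (helm \<alpha> (freq k)) * fourier_coeff f k) * ch k x)"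
proof -
  have "complex_of_real (helm_trunc \<alpha> N f x) = (\<Sum>k\<in>lattice_ball (real N).
      (of_real (if norm (freq k) \<le> real N then helm \<alpha> (freq k) else 0) * fourier_coeff f k) * ch k x)"
    unfolding helm_trunc_def
    by (rule torus_multiplier_finite[OF finite_lattice_ball])
       (auto simp: lattice_ball_def helm_def split: if_splits)
  also have "\<dots> = (\<Sum>k\<in>lattice_ball (real N). (of_real (helm \<alpha> (freq k)) * fourier_coeff f k) * ch k x)"
    by (intro sum.cong) (auto simp: lattice_ball_def)
  finally show ?thesis .
qed

lemma helm_trunc_continuous: "continuous_on UNIV (helm_trunc \<alpha> N f)"
  and helm_trunc_periodic: "periodic (helm_trunc \<alpha> N f)"
  using sum_ch_real_continuous[OF helm_trunc_expansion] by blast+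

lemma fourier_coeff_helm_trunc:
  "fourier_coeff (helm_trunc \<alpha> N f) k
     = (if k \<in> lattice_ball (real N) then of_real (helm \<alpha> (freq k)) * fourier_coeff f k else 0)"
  by (rule fourier_coeff_sum_ch[OF finite_lattice_ball helm_trunc_expansion])

lemma helm_abs_summable:
  assumes a: "\<alpha> > 0" and f: "L2 f"
  shows "(\<lambda>k. helm \<alpha> (freq k) * cmod (fourier_coeff f k)) summable_on UNIV"
proof -
  obtain C where C: "\<And>A. finite A \<Longrightarrow> (\<Sum>k\<in>A. (helm \<alpha> (freq k))\<^sup>2) \<le> C"
    using lattice_sum_bounded[OF a] unfolding helm_def by blast
  have "(\<lambda>k. (helm \<alpha> (freq k))\<^sup>2) summable_on UNIV"
    by (rule nonneg_bdd_above_summable_on) (auto intro!: bdd_aboveI[of _ C] C)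
  moreover have "(\<lambda>k. (cmod (fourier_coeff f k))\<^sup>2) summable_on UNIV"
    using parseval[OF f] by (auto simp: summable_on_def)
  ultimately have "(\<lambda>k. (helm \<alpha> (freq k))\<^sup>2 + (cmod (fourier_coeff f k))\<^sup>2) summable_on UNIV"
    by (rule summable_on_add)
  then show ?thesis
  proof (rule summable_on_comparison_test)
    show "helm \<alpha> (freq k) * cmod (fourier_coeff f k) \<le> (helm \<alpha> (freq k))\<^sup>2 + (cmod (fourier_coeff f k))\<^sup>2" for k
      using abs_mult_le_squares[of "helm \<alpha> (freq k)" "cmod (fourier_coeff f k)"] by simp
  qed (simp add: helm_bounds less_imp_le)
qed

text \<open>Both the multiplier and the coefficients are square summable, so the Fourier series of the filtered field
converges absolutely.\<close>

lemma helm_trunc_uniform: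
  assumes a: "\<alpha> > 0" and f: "L2 f"
  shows "\<exists>e. e \<longlonglongrightarrow> 0 \<and> (\<forall>N x. \<bar>helm_trunc \<alpha> N f x - torus_multiplier (helm \<alpha>) f x\<bar> \<le> e N)"
proof -
  define g where "g k = helm \<alpha> (freq k) * cmod (fourier_coeff f k)" for k
  have g: "g summable_on UNIV" unfolding g_def[abs_def] by (rule helm_abs_summable[OF a f])
  define e where "e N = infsum g UNIV - sum g (lattice_ball (real N))" for N
  have "(sum g \<longlongrightarrow> infsum g UNIV) (finite_subsets_at_top UNIV)"
    using has_sum_infsum[OF g] by (simp add: has_sum_def)
  from filterlim_compose[OF this lattice_ball_filterlim[OF filterlim_real_sequentially]]
  have "(\<lambda>N. sum g (lattice_ball (real N))) \<longlonglongrightarrow> infsum g UNIV" .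
  then have "e \<longlonglongrightarrow> infsum g UNIV - infsum g UNIV"
    unfolding e_def[abs_def] by (intro tendsto_intros)
  then have "e \<longlonglongrightarrow> 0" by simp
  moreover have "\<bar>helm_trunc \<alpha> N f x - torus_multiplier (helm \<alpha>) f x\<bar> \<le> e N" for N x
  proof -
    define t where "t k = (of_real (helm \<alpha> (freq k)) * fourier_coeff f k) * ch k x" for k
    have nt: "norm (t k) = g k" for k
      using helm_bounds[of \<alpha> "freq k"] by (simp add: t_def g_def norm_mult)
    have abs: "(\<lambda>k. norm (t k)) summable_on B" for B
      unfolding nt using summable_on_subset_banach[OF g] by blast
    let ?A = "lattice_ball (real N)"
    have "infsum t UNIV = infsum t ?A + infsum t (- ?A)"
      using infsum_Un_disjoint[of t ?A "- ?A"] abs_summable_summable[OF abs] by (simp add: Compl_partition)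
    then have d: "sum t ?A - infsum t UNIV = - infsum t (- ?A)" by simp
    have gd: "infsum g UNIV = sum g ?A + infsum g (- ?A)"
      using infsum_Un_disjoint[of g ?A "- ?A"] summable_on_subset_banach[OF g] by (simp add: Compl_partition)
    have "helm_trunc \<alpha> N f x - torus_multiplier (helm \<alpha>) f x = Re (sum t ?A - infsum t UNIV)"
      using arg_cong[OF helm_trunc_expansion[of \<alpha> N f x], of Re] by (simp add: torus_multiplier_scalar t_def[abs_def])
    then have "\<bar>helm_trunc \<alpha> N f x - torus_multiplier (helm \<alpha>) f x\<bar> \<le> norm (sum t ?A - infsum t UNIV)"
      by (simp only: abs_Re_le_cmod)
    also have "\<dots> = norm (infsum t (- ?A))" unfolding d by simp
    also have "\<dots> \<le> infsum (\<lambda>k. norm (t k)) (- ?A)" by (rule norm_infsum_bound[OF abs])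
    also have "\<dots> = e N" by (simp add: nt gd e_def)
    finally show ?thesis .
  qed
  ultimately show ?thesis by blast
qed

lemma helm_trunc_tendsto:
  assumes a: "\<alpha> > 0" and f: "L2 f"
  shows "(\<lambda>N. helm_trunc \<alpha> N f x) \<longlonglongrightarrow> torus_multiplier (helm \<alpha>) f x"
proof -
  obtain e where e: "e \<longlonglongrightarrow> 0" "\<And>N x. \<bar>helm_trunc \<alpha> N f x - torus_multiplier (helm \<alpha>) f x\<bar> \<le> e N"
    using helm_trunc_uniform[OF a f] by blast
  have "(\<lambda>N. helm_trunc \<alpha> N f x - torus_multiplier (helm \<alpha>) f x) \<longlonglongrightarrow> 0"
    by (rule Lim_null_comparison[OF _ e(1)]) (use e(2) in simp)
  then show ?thesis by (simp add: LIM_zero_iff)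
qed

lemma helm_continuous:
  assumes a: "\<alpha> > 0" and f: "L2 f"
  shows "continuous_on UNIV (torus_multiplier (helm \<alpha>) f)"
proof -
  obtain e where e: "e \<longlonglongrightarrow> 0" "\<And>N x. \<bar>helm_trunc \<alpha> N f x - torus_multiplier (helm \<alpha>) f x\<bar> \<le> e N"
    using helm_trunc_uniform[OF a f] by blast
  have "uniform_limit UNIV (\<lambda>N. helm_trunc \<alpha> N f) (torus_multiplier (helm \<alpha>) f) sequentially"
    unfolding uniform_limit_iff
  proof (intro allI impI)
    fix d :: real assume "d > 0"
    then have "\<forall>\<^sub>F N in sequentially. e N < d" using e(1) by (intro order_tendstoD(2)[where y = 0]) auto
    then show "\<forall>\<^sub>F N in sequentially. \<forall>x\<in>UNIV. dist (helm_trunc \<alpha> N f x) (torus_multiplier (helm \<alpha>) f x) < d"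
      by eventually_elim (auto simp: dist_real_def intro: le_less_trans[OF e(2)])
  qed
  then show ?thesis
    by (rule uniform_limit_theorem[rotated]) (auto simp: helm_trunc_continuous)
qed

lemma helm_trunc_L2_tendsto:
  assumes a: "\<alpha> > 0" and f: "L2 f"
  shows "(\<lambda>N. LINT x|M3. (helm_trunc \<alpha> N f x - torus_multiplier (helm \<alpha>) f x)\<^sup>2) \<longlonglongrightarrow> 0"
proof -
  obtain e where e: "e \<longlonglongrightarrow> 0" "\<And>N x. \<bar>helm_trunc \<alpha> N f x - torus_multiplier (helm \<alpha>) f x\<bar> \<le> e N"
    using helm_trunc_uniform[OF a f] by blast
  have "(\<lambda>N. vol3 * (e N)\<^sup>2) \<longlonglongrightarrow> vol3 * 0\<^sup>2" by (intro tendsto_intros e)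
  then have lim: "(\<lambda>N. vol3 * (e N)\<^sup>2) \<longlonglongrightarrow> 0" by simp
  show ?thesis
  proof (rule Lim_null_comparison[OF _ lim], intro always_eventually allI)
    fix N
    have "(LINT x|M3. (helm_trunc \<alpha> N f x - torus_multiplier (helm \<alpha>) f x)\<^sup>2) \<le> (LINT x|M3. (e N)\<^sup>2)"
    proof (intro integral_mono continuous_integrable_M3 continuous_intros helm_trunc_continuous helm_continuous[OF a f])
      fix x
      show "(helm_trunc \<alpha> N f x - torus_multiplier (helm \<alpha>) f x)\<^sup>2 \<le> (e N)\<^sup>2"
        using power_mono[OF e(2)[of N x], of 2] by simp
    qed
    also have "\<dots> = vol3 * (e N)\<^sup>2" using integral_M3_const[of "(e N)\<^sup>2"] by (simp add: vol3_def)
    finally show "norm (LINT x|M3. (helm_trunc \<alpha> N f x - torus_multiplier (helm \<alpha>) f x)\<^sup>2) \<le> vol3 * (e N)\<^sup>2"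
      by simp
  qed
qed

lemma fourier_coeff_helm:
  assumes a: "\<alpha> > 0" and f: "L2 f"
  shows "fourier_coeff (torus_multiplier (helm \<alpha>) f) k = of_real (helm \<alpha> (freq k)) * fourier_coeff f k"
proof -
  note L = L2_continuous[OF helm_trunc_continuous] L2_continuous[OF helm_continuous[OF a f]]
  have 1: "(\<lambda>N. fourier_coeff (helm_trunc \<alpha> N f) k) \<longlonglongrightarrow> fourier_coeff (torus_multiplier (helm \<alpha>) f) k"
    by (intro L2_norm_tendsto_fourier L2_integrable L L2_lim_L1 helm_trunc_L2_tendsto[OF a f])
  obtain N0 :: nat where N0: "norm (freq k) \<le> real N0" using real_arch_simple by blast
  have "fourier_coeff (helm_trunc \<alpha> N f) k = of_real (helm \<alpha> (freq k)) * fourier_coeff f k" if "N \<ge> N0" for N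
    using N0 that by (simp add: fourier_coeff_helm_trunc lattice_ball_def)
  then have 2: "(\<lambda>N. fourier_coeff (helm_trunc \<alpha> N f) k) \<longlonglongrightarrow> of_real (helm \<alpha> (freq k)) * fourier_coeff f k"
    by (intro tendsto_eventually eventually_sequentiallyI[of N0])
  show ?thesis by (rule LIMSEQ_unique[OF 1 2])
qed

lemma norm_cis_minus_1_le: "cmod (cis t - 1) \<le> \<bar>t\<bar>"
proof -
  have "(cmod (cis t - 1))\<^sup>2 = 2 * (1 - cos t)"
    using sin_cos_squared_add[of t] by (simp add: cmod_power2 power2_diff)
  also have "\<dots> \<le> \<bar>t\<bar>\<^sup>2" using one_minus_cos_le[of t] by simp
  finally show ?thesis by (rule power2_le_imp_le) simp
qed

text \<open>In the increment of the filtered field the coefficient of \<open>f\<close> at \<open>k\<close> is multiplied by at most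
\<open>|z| |k| / (1 + \<alpha>\<^sup>2|k|\<^sup>2)\<close>, and the fourth powers of these factors are summable.\<close>

lemma helm_trunc_increment4:
  assumes a: "\<alpha> > 0"
  shows "\<exists>C\<ge>0. \<forall>f N z. L2 f \<longrightarrow>
     (LINT x|M3. (helm_trunc \<alpha> N f (x + z) - helm_trunc \<alpha> N f x) ^ 4) \<le> C * (LINT x|M3. (f x)\<^sup>2)\<^sup>2 * norm z ^ 4"
proof -
  obtain C where C: "\<And>A. finite A \<Longrightarrow> (\<Sum>k\<in>A. (helm \<alpha> (freq k))\<^sup>2) \<le> C"
    using lattice_sum_bounded[OF a] unfolding helm_def by blast
  have C0: "C \<ge> 0" using C[of "{}"] by simp
  have hk: "(norm (freq k) * helm \<alpha> (freq k)) ^ 4 \<le> (1 / \<alpha> ^ 4) * (helm \<alpha> (freq k))\<^sup>2" for k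
  proof -
    define y where "y = \<alpha>\<^sup>2 * (norm (freq k))\<^sup>2"
    have "y \<ge> 0" by (simp add: y_def)
    then have "y * helm \<alpha> (freq k) \<le> 1"
      by (simp add: helm_def y_def[symmetric] divide_le_eq)
    then have "(y * helm \<alpha> (freq k))\<^sup>2 \<le> 1\<^sup>2"
      by (intro power_mono) (auto simp: y_def helm_bounds less_imp_le)
    then have "(y * helm \<alpha> (freq k))\<^sup>2 * (helm \<alpha> (freq k))\<^sup>2 \<le> 1 * (helm \<alpha> (freq k))\<^sup>2"
      by (intro mult_right_mono) auto
    moreover have "(norm (freq k) * helm \<alpha> (freq k)) ^ 4 = (1 / \<alpha> ^ 4) * ((y * helm \<alpha> (freq k))\<^sup>2 * (helm \<alpha> (freq k))\<^sup>2)"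
      using a by (simp add: y_def power_mult_distrib power2_eq_square power4_eq_xxxx)
    ultimately show ?thesis using a by (simp add: mult_left_mono divide_right_mono)
  qed
  have main: "(LINT x|M3. (helm_trunc \<alpha> N f (x + z) - helm_trunc \<alpha> N f x) ^ 4)
      \<le> (C / (\<alpha> ^ 4 * vol3)) * (LINT x|M3. (f x)\<^sup>2)\<^sup>2 * norm z ^ 4" if f: "L2 f" for f N z
  proof -
    let ?A = "lattice_ball (real N)"
    define c where "c k = (of_real (helm \<alpha> (freq k)) * fourier_coeff f k) * (ch k z - 1)" for k
    define p where "p k = norm z * (norm (freq k) * helm \<alpha> (freq k))" for k
    define q where "q k = cmod (fourier_coeff f k)" for k
    have pq: "p k \<ge> 0" "q k \<ge> 0" for k by (auto simp: p_def q_def helm_bounds less_imp_le)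
    have cc: "cmod (c k) \<le> p k * q k" for k
    proof -
      have "cmod (ch k z - 1) \<le> \<bar>freq k \<bullet> z\<bar>" unfolding ch_def by (rule norm_cis_minus_1_le)
      also have "\<dots> \<le> norm (freq k) * norm z" by (rule Cauchy_Schwarz_ineq2)
      finally have "helm \<alpha> (freq k) * q k * cmod (ch k z - 1) \<le> helm \<alpha> (freq k) * q k * (norm (freq k) * norm z)"
        by (intro mult_left_mono) (auto simp: pq helm_bounds less_imp_le)
      then show ?thesis
        using helm_bounds(1)[of \<alpha> "freq k"] by (simp add: c_def p_def q_def norm_mult ac_simps)
    qed
    have "complex_of_real (helm_trunc \<alpha> N f (x + z) - helm_trunc \<alpha> N f x) = (\<Sum>k\<in>?A. c k * ch k x)" for x
      unfolding of_real_diff helm_trunc_expansion sum_subtractf[symmetric] c_def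
      by (intro sum.cong) (auto simp: ch_add algebra_simps)
    then have "(helm_trunc \<alpha> N f (x + z) - helm_trunc \<alpha> N f x) ^ 4 = (cmod (\<Sum>k\<in>?A. c k * ch k x)) ^ 4" for x
      by (metis norm_of_real power_even_abs even_numeral)
    then have "(LINT x|M3. (helm_trunc \<alpha> N f (x + z) - helm_trunc \<alpha> N f x) ^ 4)
        \<le> vol3 * ((\<Sum>k\<in>?A. p k ^ 4) * (\<Sum>k\<in>?A. (q k)\<^sup>2)\<^sup>2)"
      using sum_ch_norm4_integral[OF finite_lattice_ball cc pq] by simp
    also have "\<dots> \<le> vol3 * ((norm z ^ 4 * (1 / \<alpha> ^ 4 * C)) * ((LINT x|M3. (f x)\<^sup>2) / vol3)\<^sup>2)"
    proof (intro mult_left_mono mult_mono power_mono)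
      have "(\<Sum>k\<in>?A. p k ^ 4) = norm z ^ 4 * (\<Sum>k\<in>?A. (norm (freq k) * helm \<alpha> (freq k)) ^ 4)"
        by (simp add: p_def power_mult_distrib sum_distrib_left)
      also have "\<dots> \<le> norm z ^ 4 * (\<Sum>k\<in>?A. 1 / \<alpha> ^ 4 * (helm \<alpha> (freq k))\<^sup>2)"
        by (intro mult_left_mono sum_mono hk) auto
      also have "\<dots> \<le> norm z ^ 4 * (1 / \<alpha> ^ 4 * C)"
        unfolding sum_distrib_left[symmetric] using a by (intro mult_left_mono C) auto
      finally show "(\<Sum>k\<in>?A. p k ^ 4) \<le> norm z ^ 4 * (1 / \<alpha> ^ 4 * C)" .
      show "(\<Sum>k\<in>?A. (q k)\<^sup>2) \<le> (LINT x|M3. (f x)\<^sup>2) / vol3"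
        using bessel[OF f finite_lattice_ball, of "real N"] by (simp add: q_def field_simps)
    qed (use a C0 in \<open>auto intro!: sum_nonneg simp: less_imp_le\<close>)
    also have "\<dots> = (C / (\<alpha> ^ 4 * vol3)) * (LINT x|M3. (f x)\<^sup>2)\<^sup>2 * norm z ^ 4"
      using less_imp_neq[OF vol3_pos, symmetric] by (simp add: power_divide power2_eq_square)
    finally show ?thesis .
  qed
  have "C / (\<alpha> ^ 4 * vol3) \<ge> 0" using C0 a by (simp add: less_imp_le)
  then show ?thesis using main by blast
qed

text \<open>The third power is absorbed by \<open>r\<^sup>3 + d\<^sup>4 / r\<close> at the scale \<open>r = |z|\<close> of the increment. No power of \<open>|z|\<close>
is lost.\<close>

lemma helm_trunc_increment:
  assumes a: "\<alpha> > 0"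
  shows "\<exists>C\<ge>0. \<forall>f N z. L2 f \<longrightarrow>
     (LINT x|M3. \<bar>helm_trunc \<alpha> N f (x + z) - helm_trunc \<alpha> N f x\<bar> ^ 3) \<le> (vol3 + C * (LINT x|M3. (f x)\<^sup>2)\<^sup>2) * norm z powr (3 * 1)"
proof -
  obtain C where C: "C \<ge> 0" "\<And>f N z. L2 f \<Longrightarrow>
     (LINT x|M3. (helm_trunc \<alpha> N f (x + z) - helm_trunc \<alpha> N f x) ^ 4) \<le> C * (LINT x|M3. (f x)\<^sup>2)\<^sup>2 * norm z ^ 4"
    using helm_trunc_increment4[OF a] by blast
  have "(LINT x|M3. \<bar>helm_trunc \<alpha> N f (x + z) - helm_trunc \<alpha> N f x\<bar> ^ 3) \<le> (vol3 + C * (LINT x|M3. (f x)\<^sup>2)\<^sup>2) * norm z powr (3 * 1)"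
    if f: "L2 f" for f N z
  proof (cases "z = 0")
    case False
    define r where "r = norm z"
    have r: "r > 0" using False by (simp add: r_def)
    define d where "d x = helm_trunc \<alpha> N f (x + z) - helm_trunc \<alpha> N f x" for x
    have cd: "continuous_on UNIV d"
      unfolding d_def by (intro continuous_intros continuous_shift helm_trunc_continuous)
    have pt: "\<bar>d x\<bar> ^ 3 \<le> r ^ 3 + d x ^ 4 / r" for x
    proof (cases "\<bar>d x\<bar> \<le> r")
      case True
      then have "\<bar>d x\<bar> ^ 3 \<le> r ^ 3" by (intro power_mono) auto
      then show ?thesis using r by (simp add: add_increasing2)
    next
      case False
      then have "\<bar>d x\<bar> ^ 3 * r \<le> \<bar>d x\<bar> ^ 3 * \<bar>d x\<bar>" by (intro mult_left_mono) auto
      also have "\<dots> = d x ^ 4" by (simp add: power4_eq_xxxx power3_eq_cube)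
      finally have "\<bar>d x\<bar> ^ 3 \<le> d x ^ 4 / r" using r by (simp add: field_simps)
      then show ?thesis using r by (simp add: add_increasing)
    qed
    have i4: "integrable M3 (\<lambda>x. d x ^ 4)" by (intro continuous_integrable_M3 continuous_intros cd)
    have ic: "integrable M3 (\<lambda>x. r ^ 3)" by (rule continuous_integrable_M3) (rule continuous_on_const)
    have "(LINT x|M3. \<bar>d x\<bar> ^ 3) \<le> (LINT x|M3. r ^ 3 + d x ^ 4 / r)"
      using i4 ic by (intro integral_mono pt continuous_integrable_M3[OF continuous_on_power] continuous_intros cd) auto
    also have "\<dots> = vol3 * r ^ 3 + (LINT x|M3. d x ^ 4) / r"
      using i4 ic integral_M3_const[of "r ^ 3"] by (simp add: vol3_def)
    also have "\<dots> \<le> vol3 * r ^ 3 + (C * (LINT x|M3. (f x)\<^sup>2)\<^sup>2 * r ^ 4) / r"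
      using C(2)[OF f, of N z] r unfolding d_def r_def by (intro add_left_mono divide_right_mono) auto
    also have "\<dots> = (vol3 + C * (LINT x|M3. (f x)\<^sup>2)\<^sup>2) * r ^ 3"
      using r by (simp add: power4_eq_xxxx power3_eq_cube distrib_right)
    also have "r ^ 3 = norm z powr (3 * 1)" using r by (simp add: r_def)
    finally show ?thesis by (simp add: d_def)
  qed simp
  then show ?thesis using C(1) by blast
qed

section \<open>Flux bounds for the two equations\<close>

text \<open>The constants come before the fields in the statement because they must not depend on the time slice.\<close>

lemma reactant_flux_bound:
  assumes dp: "dyadic_partition \<eta> \<rho>" and sr: "s > 0" "r > 0" "s + 2 * r > 1"
  shows "\<exists>C\<ge>0. \<exists>\<delta>>0. \<forall>n\<ge>3. \<forall>g w Bg Bw. L2 g \<longrightarrow> (\<forall>i. L2 (w i)) \<longrightarrow>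
     (\<forall>k. (\<Sum>i\<in>UNIV. of_int (k $ i) * fourier_coeff (w i) k) = 0) \<longrightarrow> Bg \<ge> 0 \<longrightarrow> Bw \<ge> 0 \<longrightarrow>
     (\<forall>j. (LINT x|M3. \<bar>lp_block \<eta> \<rho> (int j - 1) g x\<bar> ^ 3) \<le> (2 powr (- ((real j - 1) * r)) * Bg) ^ 3) \<longrightarrow>
     (\<forall>i j. (LINT x|M3. \<bar>lp_block \<eta> \<rho> (int j - 1) (w i) x\<bar> ^ 3) \<le> (2 powr (- ((real j - 1) * s)) * Bw) ^ 3) \<longrightarrow>
     \<bar>flux (Suc n) g w\<bar> \<le> C * (Bg ^ 3 + Bw ^ 3) * real n powr (- \<delta> / 2)"
proof -
  \<comment> \<open>Capping the regularities and then shrinking both by the factor \<open>c < 1\<close> gives exponents strictly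
    below \<open>r\<close> and \<open>s\<close> with \<open>2\<sigma>1 + \<sigma>2\<close> still above 1 and at most 2.\<close>
  define s' where "s' = min s 1"
  define r' where "r' = min r (1 / 2)"
  have sr': "0 < s'" "s' \<le> s" "s' \<le> 1" "0 < r'" "r' \<le> r" "r' \<le> 1 / 2" "s' + 2 * r' > 1" "s' + 2 * r' \<le> 2"
    using sr by (auto simp: s'_def r'_def min_def)
  define c where "c = (1 + 1 / (s' + 2 * r')) / 2"
  have c: "0 < c" "c < 1" using sr' by (auto simp: c_def field_simps)
  define \<sigma>1 where "\<sigma>1 = c * r'"
  define \<sigma>2 where "\<sigma>2 = c * s'"
  define \<delta> where "\<delta> = (s' + 2 * r' - 1) / 2"
  have "c * (s' + 2 * r') = (s' + 2 * r' + 1) / 2"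
    using sr'(7) by (simp add: c_def field_simps)
  also have "\<dots> = 1 + \<delta>" by (simp add: \<delta>_def field_simps)
  finally have d: "0 < \<delta>" "\<delta> \<le> 2" "2 * \<sigma>1 + \<sigma>2 = 1 + \<delta>"
    using sr'(7,8) by (auto simp: \<delta>_def \<sigma>1_def \<sigma>2_def distrib_left)
  have "\<sigma>1 < r'" "\<sigma>2 < s'" "0 < \<sigma>1" "0 < \<sigma>2"
    using mult_strict_right_mono[OF c(2) sr'(4)] mult_strict_right_mono[OF c(2) sr'(1)] c(1) sr'(1,4)
    by (simp_all add: \<sigma>1_def \<sigma>2_def)
  then have s1: "0 < \<sigma>1" "\<sigma>1 \<le> 1" "\<sigma>1 < r" and s2: "0 < \<sigma>2" "\<sigma>2 \<le> 1" "\<sigma>2 < s"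
    using sr' by linarith+
  define C1 where "C1 = (12 * 2 powr r / (1 - 2 powr (\<sigma>1 - r))) ^ 3"
  define C2 where "C2 = (12 * 2 powr s / (1 - 2 powr (\<sigma>2 - s))) ^ 3"
  have C12: "C1 \<ge> 0" "C2 \<ge> 0"
    using s1 s2 by (auto simp: C1_def C2_def powr_le_one_le intro!: zero_le_power divide_nonneg_nonneg less_imp_le[OF powr_less_one])
  define C where "C = 2628 / vol3 * (C1 + C2)"
  have "\<bar>flux (Suc n) g w\<bar> \<le> C * (Bg ^ 3 + Bw ^ 3) * real n powr (- \<delta> / 2)"
    if n: "n \<ge> 3" and g: "L2 g" and w: "\<And>i. L2 (w i)"
     and div: "\<And>k. (\<Sum>i\<in>UNIV. of_int (k $ i) * fourier_coeff (w i) k) = 0" and B: "Bg \<ge> 0" "Bw \<ge> 0"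
     and bg: "\<And>j. (LINT x|M3. \<bar>lp_block \<eta> \<rho> (int j - 1) g x\<bar> ^ 3) \<le> (2 powr (- ((real j - 1) * r)) * Bg) ^ 3"
     and bw: "\<And>i j. (LINT x|M3. \<bar>lp_block \<eta> \<rho> (int j - 1) (w i) x\<bar> ^ 3) \<le> (2 powr (- ((real j - 1) * s)) * Bw) ^ 3"
    for n g w Bg Bw
  proof -
    have "\<bar>flux (Suc n) g w\<bar> \<le> 2628 / vol3 * (C1 * Bg ^ 3 + C2 * Bw ^ 3) * real n powr (- \<delta> / 2)"
    proof (rule flux_bound[OF n d, where gN = "\<lambda>N. lp_partial \<eta> \<rho> N g" and wN = "\<lambda>N i. lp_partial \<eta> \<rho> N (w i)"])
      show "(\<Sum>i\<in>UNIV. of_int (k $ i) * fourier_coeff (lp_partial \<eta> \<rho> N (w i)) k) = 0" for N k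
      proof -
        have "(\<Sum>i\<in>UNIV. of_int (k $ i) * fourier_coeff (lp_partial \<eta> \<rho> N (w i)) k)
            = of_real (lp_mass \<eta> \<rho> N k) * (\<Sum>i\<in>UNIV. of_int (k $ i) * fourier_coeff (w i) k)"
          by (simp add: fourier_coeff_lp_partial[OF dp] sum_distrib_left ac_simps)
        then show ?thesis by (simp add: div)
      qed
      show "(LINT x|M3. \<bar>lp_partial \<eta> \<rho> N g (x + z) - lp_partial \<eta> \<rho> N g x\<bar> ^ 3) \<le> C1 * Bg ^ 3 * norm z powr (3 * \<sigma>1)" for N z
        unfolding C1_def by (rule lp_partial_increment[OF dp B(1) s1 bg])
      show "(LINT x|M3. \<bar>lp_partial \<eta> \<rho> N (w i) (x + z) - lp_partial \<eta> \<rho> N (w i) x\<bar> ^ 3) \<le> C2 * Bw ^ 3 * norm z powr (3 * \<sigma>2)" for N z i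
        unfolding C2_def by (rule lp_partial_increment[OF dp B(2) s2 bw])
    qed (intro lp_partial_continuous lp_partial_periodic lp_partial_tendsto dp g w)+
    also have "\<dots> \<le> 2628 / vol3 * ((C1 + C2) * (Bg ^ 3 + Bw ^ 3)) * real n powr (- \<delta> / 2)"
    proof (intro mult_right_mono mult_left_mono)
      have "0 \<le> C1 * Bw ^ 3" "0 \<le> C2 * Bg ^ 3" using C12 B by simp_all
      then show "C1 * Bg ^ 3 + C2 * Bw ^ 3 \<le> (C1 + C2) * (Bg ^ 3 + Bw ^ 3)" by (simp add: algebra_simps)
    qed (auto simp: less_imp_le)
    finally show ?thesis by (simp only: C_def mult.assoc)
  qed
  moreover have "C \<ge> 0" using C12 by (simp add: C_def less_imp_le)
  ultimately show ?thesis using d(1) by blast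
qed

text \<open>The advecting field contributes a full power of \<open>|z|\<close>, so any positive regularity of \<open>g\<close> is enough.\<close>

lemma velocity_flux_bound:
  assumes dp: "dyadic_partition \<eta> \<rho>" and s: "s > 0" and a: "\<alpha> > 0"
  shows "\<exists>C\<ge>0. \<exists>\<delta>>0. \<forall>n\<ge>3. \<forall>g u Bg U. L2 g \<longrightarrow> (\<forall>i. L2 (u i)) \<longrightarrow>
     (\<forall>k. (\<Sum>i\<in>UNIV. of_int (k $ i) * fourier_coeff (u i) k) = 0) \<longrightarrow> Bg \<ge> 0 \<longrightarrow>
     (\<forall>j. (LINT x|M3. \<bar>lp_block \<eta> \<rho> (int j - 1) g x\<bar> ^ 3) \<le> (2 powr (- ((real j - 1) * s)) * Bg) ^ 3) \<longrightarrow>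
     (\<forall>i. (LINT x|M3. (u i x)\<^sup>2) \<le> U) \<longrightarrow>
     \<bar>flux (Suc n) g (\<lambda>i. torus_multiplier (helm \<alpha>) (u i))\<bar> \<le> C * (Bg ^ 3 + 1 + U\<^sup>2) * real n powr (- \<delta> / 2)"
proof -
  define \<sigma> where "\<sigma> = min s 1 / 2"
  have s1: "0 < \<sigma>" "\<sigma> \<le> 1" "\<sigma> < s" using s by (auto simp: \<sigma>_def min_def)
  define \<delta> where "\<delta> = 2 * \<sigma>"
  have d: "0 < \<delta>" "\<delta> \<le> 2" "2 * \<sigma> + 1 = 1 + \<delta>" using s1 by (auto simp: \<delta>_def)
  obtain C2 where C2: "C2 \<ge> 0" "\<And>f N z. L2 f \<Longrightarrow>
     (LINT x|M3. \<bar>helm_trunc \<alpha> N f (x + z) - helm_trunc \<alpha> N f x\<bar> ^ 3) \<le> (vol3 + C2 * (LINT x|M3. (f x)\<^sup>2)\<^sup>2) * norm z powr (3 * 1)"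
    using helm_trunc_increment[OF a] by blast
  define C1 where "C1 = (12 * 2 powr s / (1 - 2 powr (\<sigma> - s))) ^ 3"
  have C1: "C1 \<ge> 0"
    using s1 by (auto simp: C1_def intro!: zero_le_power divide_nonneg_nonneg less_imp_le[OF powr_less_one])
  define C where "C = 2628 / vol3 * (C1 + vol3 + C2)"
  have "\<bar>flux (Suc n) g (\<lambda>i. torus_multiplier (helm \<alpha>) (u i))\<bar> \<le> C * (Bg ^ 3 + 1 + U\<^sup>2) * real n powr (- \<delta> / 2)"
    if n: "n \<ge> 3" and g: "L2 g" and u: "\<And>i. L2 (u i)"
     and div: "\<And>k. (\<Sum>i\<in>UNIV. of_int (k $ i) * fourier_coeff (u i) k) = 0" and B: "Bg \<ge> 0"
     and bg: "\<And>j. (LINT x|M3. \<bar>lp_block \<eta> \<rho> (int j - 1) g x\<bar> ^ 3) \<le> (2 powr (- ((real j - 1) * s)) * Bg) ^ 3"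
     and U: "\<And>i. (LINT x|M3. (u i x)\<^sup>2) \<le> U"
    for n g u Bg U
  proof -
    have "\<bar>flux (Suc n) g (\<lambda>i. torus_multiplier (helm \<alpha>) (u i))\<bar>
        \<le> 2628 / vol3 * (C1 * Bg ^ 3 + (vol3 + C2 * U\<^sup>2)) * real n powr (- \<delta> / 2)"
    proof (rule flux_bound[OF n d, where gN = "\<lambda>N. lp_partial \<eta> \<rho> N g" and wN = "\<lambda>N i. helm_trunc \<alpha> N (u i)"])
      show "(\<Sum>i\<in>UNIV. of_int (k $ i) * fourier_coeff (helm_trunc \<alpha> N (u i)) k) = 0" for N k
      proof (cases "k \<in> lattice_ball (real N)")
        case True
        then have "(\<Sum>i\<in>UNIV. of_int (k $ i) * fourier_coeff (helm_trunc \<alpha> N (u i)) k)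
            = of_real (helm \<alpha> (freq k)) * (\<Sum>i\<in>UNIV. of_int (k $ i) * fourier_coeff (u i) k)"
          by (simp add: fourier_coeff_helm_trunc sum_distrib_left ac_simps)
        then show ?thesis by (simp add: div)
      qed (simp add: fourier_coeff_helm_trunc)
      show "(LINT x|M3. \<bar>lp_partial \<eta> \<rho> N g (x + z) - lp_partial \<eta> \<rho> N g x\<bar> ^ 3) \<le> C1 * Bg ^ 3 * norm z powr (3 * \<sigma>)" for N z
        unfolding C1_def by (rule lp_partial_increment[OF dp B(1) s1 bg])
      show "(LINT x|M3. \<bar>helm_trunc \<alpha> N (u i) (x + z) - helm_trunc \<alpha> N (u i) x\<bar> ^ 3) \<le> (vol3 + C2 * U\<^sup>2) * norm z powr (3 * 1)" for N z i
      proof -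
        have "(LINT x|M3. (u i x)\<^sup>2)\<^sup>2 \<le> U\<^sup>2" by (intro power_mono U) simp
        then have "(vol3 + C2 * (LINT x|M3. (u i x)\<^sup>2)\<^sup>2) * norm z powr (3 * 1) \<le> (vol3 + C2 * U\<^sup>2) * norm z powr (3 * 1)"
          using C2(1) by (intro mult_right_mono add_left_mono mult_left_mono) auto
        then show ?thesis using C2(2)[OF u, of N i z] by linarith
      qed
    qed (intro lp_partial_continuous lp_partial_periodic lp_partial_tendsto helm_trunc_continuous helm_trunc_periodic
          helm_trunc_L2_tendsto L2_continuous helm_continuous a dp g u)+
    also have "\<dots> \<le> 2628 / vol3 * ((C1 + vol3 + C2) * (Bg ^ 3 + 1 + U\<^sup>2)) * real n powr (- \<delta> / 2)"
    proof (intro mult_right_mono mult_left_mono)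
      have "0 \<le> C1 * (1 + U\<^sup>2)" "0 \<le> vol3 * (Bg ^ 3 + U\<^sup>2)" "0 \<le> C2 * (Bg ^ 3 + 1)"
        using C1 C2 B by (simp_all add: less_imp_le)
      then show "C1 * Bg ^ 3 + (vol3 + C2 * U\<^sup>2) \<le> (C1 + vol3 + C2) * (Bg ^ 3 + 1 + U\<^sup>2)" by (simp add: algebra_simps)
    qed (auto simp: less_imp_le)
    finally show ?thesis by (simp only: C_def mult.assoc)
  qed
  moreover have "C \<ge> 0" using C1 C2 by (simp add: C_def less_imp_le)
  ultimately show ?thesis using d(1) by blast
qed

section \<open>Smooth functions\<close>

lemma Ck_const: "Ck n (\<lambda>x. c)"
proof (induction n arbitrary: c)
  case (Suc n)
  have "frechet_derivative (\<lambda>x. c) (at x) = (\<lambda>h. 0)" for x :: 'a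
    by (rule frechet_derivative_at[symmetric]) simp
  then show ?case using Suc[of 0] by simp
qed (simp add: continuous_intros)

lemma CkI:
  assumes "\<And>x. (f has_derivative D x) (at x)" "\<And>h. Ck n (\<lambda>x. D x h)"
  shows "Ck (Suc n) f"
proof -
  have "frechet_derivative f (at x) = D x" for x
    by (rule frechet_derivative_at[OF assms(1), symmetric])
  moreover have "f differentiable (at x)" for x using assms(1) differentiable_def by blast
  ultimately show ?thesis using assms(2) by simp
qed

lemma Ck_has_derivative:
  assumes "Ck (Suc n) f" shows "(f has_derivative frechet_derivative f (at x)) (at x)"
  using assms frechet_derivative_works by (metis Ck.simps(2))

lemma Ck_deriv: "Ck (Suc n) f \<Longrightarrow> Ck n (\<lambda>x. frechet_derivative f (at x) h)"
  by simp

lemma Ck_mono: "Ck (Suc n) f \<Longrightarrow> Ck n f"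
proof (induction n arbitrary: f)
  case 0
  then have "f differentiable (at x)" for x by simp
  then show ?case
    using differentiable_imp_continuous_within by (auto simp: continuous_on_eq_continuous_within)
next
  case (Suc n)
  show ?case
  proof (rule CkI)
    show "(f has_derivative frechet_derivative f (at x)) (at x)" for x
      by (rule Ck_has_derivative[OF Suc.prems])
    show "Ck n (\<lambda>x. frechet_derivative f (at x) h)" for h
      by (rule Suc.IH[OF Ck_deriv[OF Suc.prems]])
  qed
qed

lemma Ck_add: "Ck n f \<Longrightarrow> Ck n g \<Longrightarrow> Ck n (\<lambda>x. f x + g x)"
proof (induction n arbitrary: f g)
  case (Suc n)
  show ?case
  proof (rule CkI)
    show "((\<lambda>x. f x + g x) has_derivative (\<lambda>h. frechet_derivative f (at x) h + frechet_derivative g (at x) h)) (at x)" for x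
      using Ck_has_derivative[OF Suc.prems(1)] Ck_has_derivative[OF Suc.prems(2)] by (rule has_derivative_add)
    show "Ck n (\<lambda>x. frechet_derivative f (at x) h + frechet_derivative g (at x) h)" for h
      by (intro Suc.IH Ck_deriv Suc.prems)
  qed
qed (simp add: continuous_intros)

lemma Ck_mult:
  fixes f g :: "'a::euclidean_space \<Rightarrow> real"
  shows "Ck n f \<Longrightarrow> Ck n g \<Longrightarrow> Ck n (\<lambda>x. f x * g x)"
proof (induction n arbitrary: f g)
  case (Suc n)
  show ?case
  proof (rule CkI)
    show "((\<lambda>x. f x * g x) has_derivative (\<lambda>h. f x * frechet_derivative g (at x) h + frechet_derivative f (at x) h * g x)) (at x)" for x
      using Ck_has_derivative[OF Suc.prems(1)] Ck_has_derivative[OF Suc.prems(2)] by (rule has_derivative_mult)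
    show "Ck n (\<lambda>x. f x * frechet_derivative g (at x) h + frechet_derivative f (at x) h * g x)" for h
      by (intro Ck_add Suc.IH Ck_deriv Suc.prems Ck_mono[OF Suc.prems(1)] Ck_mono[OF Suc.prems(2)])
  qed
qed (simp add: continuous_intros)

lemma Ck_bounded_linear:
  assumes "bounded_linear B" shows "Ck n f \<Longrightarrow> Ck n (\<lambda>x. B (f x))"
proof (induction n arbitrary: f)
  case (Suc n)
  show ?case
  proof (rule CkI)
    show "((\<lambda>x. B (f x)) has_derivative (\<lambda>h. B (frechet_derivative f (at x) h))) (at x)" for x
      by (rule bounded_linear.has_derivative[OF assms Ck_has_derivative[OF Suc.prems]])
    show "Ck n (\<lambda>x. B (frechet_derivative f (at x) h))" for h by (intro Suc.IH Ck_deriv Suc.prems)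
  qed
qed (auto intro: bounded_linear.continuous_on[OF assms])

lemma Ck_compose_affine:
  fixes f :: "'b::euclidean_space \<Rightarrow> 'c::real_normed_vector" and A :: "'a::euclidean_space \<Rightarrow> 'b"
  assumes "bounded_linear A" shows "Ck n f \<Longrightarrow> Ck n (\<lambda>x. f (A x + b))"
proof (induction n arbitrary: f)
  case 0
  then show ?case
    using continuous_on_compose2[of UNIV f UNIV "\<lambda>x. A x + b"] linear_continuous_on[OF assms, of UNIV]
    by (simp add: continuous_on_add)
next
  case (Suc n)
  have d: "((\<lambda>x. A x + b) has_derivative A) (at x)" for x
    using bounded_linear_imp_has_derivative[OF assms] by (auto intro!: derivative_eq_intros)
  show ?case
  proof (rule CkI)
    show "((\<lambda>x. f (A x + b)) has_derivative (\<lambda>h. frechet_derivative f (at (A x + b)) (A h))) (at x)" for x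
      using has_derivative_compose[OF d Ck_has_derivative[OF Suc.prems]] .
    show "Ck n (\<lambda>x. frechet_derivative f (at (A x + b)) (A h))" for h by (intro Suc.IH Ck_deriv Suc.prems)
  qed
qed

lemma has_real_derivative_fun:
  assumes "(f has_real_derivative d) (at x)" shows "(f has_derivative (\<lambda>h. h * d)) (at x)"
proof -
  have "(\<lambda>h. h * d) = (*) d" by (simp add: fun_eq_iff mult.commute)
  then show ?thesis using assms by (simp only: has_field_derivative_def)
qed

lemma Ck_antiderivative:
  fixes F :: "real \<Rightarrow> real"
  assumes "\<And>x. (F has_real_derivative f x) (at x)" "Ck n f" shows "Ck (Suc n) F"
  by (rule CkI[OF has_real_derivative_fun[OF assms(1)]]) (intro Ck_mult Ck_const assms(2))

lemma Ck_sin: "Ck n (\<lambda>x::real. sin (x + c))"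
proof (induction n arbitrary: c)
  case (Suc n)
  show ?case
  proof (rule Ck_antiderivative)
    show "((\<lambda>x. sin (x + c)) has_real_derivative sin (x + (c + pi / 2))) (at x)" for x
      using sin_add[of "x + c" "pi / 2"] by (auto intro!: derivative_eq_intros simp: add.assoc)
  qed (rule Suc)
qed (auto intro!: continuous_intros)

lemma smooth_antiderivative:
  fixes F :: "real \<Rightarrow> real"
  assumes "\<And>x. (F has_real_derivative f x) (at x)" "smooth f" shows "smooth F"
  unfolding smooth_def
proof
  show "Ck n F" for n
    using assms(2) by (intro Ck_mono[OF Ck_antiderivative[OF assms(1)]]) (simp add: smooth_def)
qed

lemma smooth_const: "smooth (\<lambda>x. c)"
  and smooth_add: "smooth f \<Longrightarrow> smooth g \<Longrightarrow> smooth (\<lambda>x. f x + g x)"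
  and smooth_mult: "smooth f1 \<Longrightarrow> smooth g1 \<Longrightarrow> smooth (\<lambda>x. f1 x * g1 x :: real)"
  and smooth_bounded_linear: "bounded_linear B \<Longrightarrow> smooth f2 \<Longrightarrow> smooth (\<lambda>x. B (f2 x))"
  and smooth_compose_affine: "bounded_linear A \<Longrightarrow> smooth f3 \<Longrightarrow> smooth (\<lambda>x. f3 (A x + b))"
  unfolding smooth_def by (auto intro: Ck_const Ck_add Ck_mult Ck_bounded_linear Ck_compose_affine)

lemma smooth_continuous: "smooth f \<Longrightarrow> continuous_on UNIV f"
  unfolding smooth_def by (metis Ck.simps(1))

lemma smooth_has_derivative: "smooth f \<Longrightarrow> (f has_derivative frechet_derivative f (at x)) (at x)"
  unfolding smooth_def using Ck_has_derivative by blast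

lemma smooth_has_real_derivative:
  fixes f :: "real \<Rightarrow> real"
  assumes "smooth f" shows "(f has_real_derivative frechet_derivative f (at x) 1) (at x)"
proof -
  have d: "(f has_derivative frechet_derivative f (at x)) (at x)" by (rule smooth_has_derivative[OF assms])
  have "frechet_derivative f (at x) h = frechet_derivative f (at x) 1 * h" for h
    using linear_cmul[OF has_derivative_linear[OF d], of h 1] by (simp add: mult.commute)
  then have "frechet_derivative f (at x) = (\<lambda>h. frechet_derivative f (at x) 1 * h)" by (rule ext)
  then show ?thesis using d by (simp only: has_field_derivative_def)
qed

lemma smooth_deriv: "smooth f \<Longrightarrow> smooth (\<lambda>x. frechet_derivative f (at x) h)"
  unfolding smooth_def by (metis Ck_deriv)

lemma continuous_antiderivative:
  fixes f :: "real \<Rightarrow> real"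
  assumes "continuous_on UNIV f"
  obtains F where "\<And>x. (F has_real_derivative f x) (at x)"
proof -
  define F where "F t = integral {0..t} f - integral {t..0} f" for t
  have int: "f integrable_on {a..b}" for a b
    by (rule integrable_continuous_real) (rule continuous_on_subset[OF assms], simp)
  have "(F has_real_derivative f x) (at x)" for x
  proof -
    define R where "R = \<bar>x\<bar> + 1"
    have x: "x \<in> {- R<..<R}" by (auto simp: R_def)
    have eq: "F t = integral {- R..t} f - integral {- R..0} f" if "t \<in> {- R<..<R}" for t
    proof (cases "t \<ge> 0")
      case True
      have "integral {- R..0} f + integral {0..t} f = integral {- R..t} f"
        by (rule Henstock_Kurzweil_Integration.integral_combine) (use True int in \<open>auto simp: R_def\<close>)
      then show ?thesis using True by (cases "t = 0") (auto simp: F_def)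
    next
      case False
      then show ?thesis using Henstock_Kurzweil_Integration.integral_combine[where f = f and a = "- R" and c = t and b = 0] int that by (auto simp: F_def)
    qed
    have "((\<lambda>t. integral {- R..t} f) has_real_derivative f x) (at x within {- R..R})"
      by (rule integral_has_real_derivative) (use x in \<open>auto intro: continuous_on_subset[OF assms]\<close>)
    moreover have "at x within {- R..R} = at x"
      using x by (intro at_within_interior) auto
    ultimately have "((\<lambda>t. integral {- R..t} f - integral {- R..0} f) has_real_derivative f x - 0) (at x)"
      by (intro DERIV_diff DERIV_const) simp
    then have "((\<lambda>t. integral {- R..t} f - integral {- R..0} f) has_real_derivative f x) (at x)" by simp
    then show ?thesis
      by (rule has_field_derivative_transform_within_open[where S = "{- R<..<R}"]) (use x eq in auto)
  qed
  then show thesis by (rule that)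
qed

section \<open>Weak derivatives in time\<close>

abbreviation MT :: "real \<Rightarrow> real measure" where "MT T \<equiv> lebesgue_on {0<..<T}"

definition time_test :: "real \<Rightarrow> (real \<Rightarrow> real) \<Rightarrow> bool" where
  "time_test T \<zeta> \<longleftrightarrow> smooth \<zeta> \<and> (\<exists>a b. 0 < a \<and> b < T \<and> (\<forall>t. \<zeta> t \<noteq> 0 \<longrightarrow> a \<le> t \<and> t \<le> b))"

lemma time_testI:
  assumes "smooth \<zeta>" "0 < a" "b < T" "\<And>t. \<zeta> t \<noteq> 0 \<Longrightarrow> a \<le> t \<and> t \<le> b"
  shows "time_test T \<zeta>"
  unfolding time_test_def using assms by blast

text \<open>The low-frequency cut-off \<open>\<eta>\<close> is itself a smooth bump. Restricted to a coordinate axis it is 1 near the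
origin and 0 far away, and its normalised antiderivative is a smooth step.\<close>

lemma smooth_step:
  assumes dp: "dyadic_partition \<eta> \<rho>"
  obtains H :: "real \<Rightarrow> real" where "smooth H" "\<And>t. t \<le> - 2 \<Longrightarrow> H t = 0" "\<And>t. t \<ge> 2 \<Longrightarrow> H t = 1"
    "\<And>t. 0 \<le> H t" "\<And>t. H t \<le> 1"
proof -
  have nax: "norm (axis 1 t :: real^3) = \<bar>t\<bar>" for t
    by (simp add: norm_eq_sqrt_inner inner_axis_axis)
  define \<theta> where "\<theta> t = \<eta> (axis 1 t + 0)" for t :: real
  have bl: "bounded_linear (axis 1 :: real \<Rightarrow> real^3)"
    by (rule linear_linear[THEN iffD2] | rule linear_conv_bounded_linear[THEN iffD1])
       (auto intro!: linearI simp: axis_def vec_eq_iff)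
  have sm: "smooth \<theta>" unfolding \<theta>_def[abs_def]
    by (rule smooth_compose_affine[OF bl dyadic_partitionD(10)[OF dp]])
  have nn: "\<theta> t \<ge> 0" for t using dyadic_partitionD(1)[OF dp] by (simp add: \<theta>_def)
  have z: "\<theta> t = 0" if "\<bar>t\<bar> > 4 / 3" for t
    using dyadic_partitionD(3)[OF dp, of "axis 1 t"] that by (auto simp: \<theta>_def nax)
  have one: "\<theta> t = 1" if "\<bar>t\<bar> < 3 / 4" for t
  proof -
    have "\<rho> ((1 / 2 ^ j) *\<^sub>R axis 1 t) = 0" for j :: nat
    proof (rule ccontr)
      assume "\<rho> ((1 / 2 ^ j) *\<^sub>R axis 1 t) \<noteq> 0"
      then have "3 / 4 \<le> norm ((1 / 2 ^ j) *\<^sub>R (axis 1 t :: real^3))" by (rule dyadic_partitionD(4)[OF dp])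
      also have "\<dots> = \<bar>t\<bar> / 2 ^ j" by (simp add: nax)
      also have "\<dots> \<le> \<bar>t\<bar> / 1" by (intro divide_left_mono) auto
      finally show False using that by simp
    qed
    then have "(\<lambda>j::nat. 0) sums (1 - \<eta> (axis 1 t))"
      using dyadic_partitionD(6)[OF dp, of "axis 1 t"] by simp
    then have "1 - \<eta> (axis 1 t) = 0" using sums_unique2 sums_zero by blast
    then show ?thesis by (simp add: \<theta>_def)
  qed
  obtain F where F: "\<And>x. (F has_real_derivative \<theta> x) (at x)"
    using continuous_antiderivative[OF smooth_continuous[OF sm]] by blast
  have mono: "F x \<le> F y" if "x \<le> y" for x y
    by (rule DERIV_nonneg_imp_nondecreasing[OF that]) (use F nn in blast)
  have const: "F x = F y" if "x \<le> y" "\<And>t. x \<le> t \<Longrightarrow> t \<le> y \<Longrightarrow> \<bar>t\<bar> > 4 / 3" for x y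
  proof (cases "x = y")
    case False
    then have xy: "x < y" using that by simp
    have "\<exists>t>x. t < y \<and> F y - F x = (y - x) * \<theta> t" by (rule MVT2[OF xy]) (use F in blast)
    then obtain t where "x < t" "t < y" "F y - F x = (y - x) * \<theta> t" by blast
    then show ?thesis using z[of t] that(2)[of t] by simp
  qed simp
  have up: "F t = F 2" if "t \<ge> 2" for t using const[of 2 t] that by auto
  have lo: "F t = F (- 2)" if "t \<le> - 2" for t using const[of t "- 2"] that by auto
  have "F (- 2) < F 2"
  proof -
    have "\<exists>t>-1/2. t < 1/2 \<and> F (1/2) - F (- 1/2) = (1/2 - (- 1/2)) * \<theta> t" by (rule MVT2) (use F in auto)
    then obtain t where t: "- 1/2 < t" "t < 1/2" "F (1/2) - F (- 1/2) = (1/2 - (- 1/2)) * \<theta> t" by blast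
    then have "F (1/2) - F (- 1/2) = 1" using one[of t] by simp
    then show ?thesis using mono[of "- 2" "- 1/2"] mono[of "1/2" 2] by simp
  qed
  define c where "c = 1 / (F 2 - F (- 2))"
  have c: "c > 0" using \<open>F (- 2) < F 2\<close> by (simp add: c_def)
  define H where "H t = c * (F t + - F (- 2))" for t
  have "smooth H" unfolding H_def[abs_def]
    by (intro smooth_mult smooth_add smooth_const smooth_antiderivative[OF F sm])
  moreover have "H t = 0" if "t \<le> - 2" for t using lo[OF that] by (simp add: H_def)
  moreover have "H t = 1" if "t \<ge> 2" for t using up[OF that] \<open>F (- 2) < F 2\<close> by (simp add: H_def c_def)
  moreover have ge: "F (- 2) \<le> F t" for t using lo[of t] mono[of "- 2" t] by (cases "t \<le> - 2") auto
  moreover have le: "F t \<le> F 2" for t using up[of t] mono[of t 2] by (cases "t \<ge> 2") auto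
  have "0 \<le> H t" for t using c ge[of t] by (simp add: H_def)
  moreover have "H t \<le> 1" for t
    using le[of t] \<open>F (- 2) < F 2\<close> by (simp add: H_def c_def)
  ultimately show thesis by (intro that[of H]) auto
qed

lemma MT_finite: "finite_measure (MT T)"
  by (rule finite_measure_lebesgue_on) simp

lemma MT_FTC:
  assumes F: "\<And>x. (F has_real_derivative f x) (at x)" and f: "continuous_on UNIV f" and ab: "0 \<le> a" "a \<le> b" "b \<le> T"
  shows "(LINT t|MT T. (if a < t \<and> t < b then f t else 0)) = F b - F a"
proof -
  have fi: "integrable (lebesgue_on {a<..<b}) f"
  proof -
    interpret finite_measure "lebesgue_on {a<..<b}" by (rule finite_measure_lebesgue_on) simp
    have "compact (f ` {a..b})"
      by (intro compact_continuous_image continuous_on_subset[OF f]) auto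
    then obtain B where B: "\<And>x. x \<in> {a..b} \<Longrightarrow> norm (f x) \<le> B"
      using compact_imp_bounded bounded_iff by (metis imageI)
    show ?thesis
    proof (rule integrable_const_bound[of _ B])
      show "f \<in> borel_measurable (lebesgue_on {a<..<b})"
        by (rule continuous_imp_measurable_on_sets_lebesgue[OF continuous_on_subset[OF f]]) auto
      show "AE x in lebesgue_on {a<..<b}. norm (f x) \<le> B"
        by (rule AE_I2) (use B in simp)
    qed
  qed
  have "(LINT t|MT T. (if t \<in> {a<..<b} then f t else 0)) = (LINT t|lebesgue_on {a<..<b}. f t)"
    by (rule Lebesgue_Measure.integral_restrict) (use ab in auto)
  also have "\<dots> = integral {a<..<b} f" by (rule lebesgue_integral_eq_integral[OF fi]) simp
  also have "\<dots> = integral {a..b} f" by (rule integral_open_interval_real[symmetric])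
  also have "\<dots> = F b - F a"
    by (rule integral_unique, rule fundamental_theorem_of_calculus[OF ab(2)])
       (use F in \<open>auto simp: has_real_derivative_iff_has_vector_derivative[symmetric] intro: has_field_derivative_at_within\<close>)
  finally show ?thesis by simp
qed

lemma continuous_mult_MT:
  assumes f: "integrable (MT T) f" and k: "continuous_on UNIV (k :: real \<Rightarrow> real)"
  shows "integrable (MT T) (\<lambda>t. f t * k t)"
proof -
  have "compact (k ` {0..T})"
    by (intro compact_continuous_image continuous_on_subset[OF k]) auto
  then obtain B where B: "\<And>x. x \<in> {0..T} \<Longrightarrow> norm (k x) \<le> B"
    using compact_imp_bounded bounded_iff by (metis imageI)
  have km: "k \<in> borel_measurable (MT T)"
    by (rule continuous_imp_measurable_on_sets_lebesgue[OF continuous_on_subset[OF k]]) auto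
  show ?thesis
  proof (rule Bochner_Integration.integrable_bound)
    show "integrable (MT T) (\<lambda>t. B * f t)" using f by simp
    show "(\<lambda>t. f t * k t) \<in> borel_measurable (MT T)" using f km by (intro borel_measurable_times) auto
    show "AE t in MT T. norm (f t * k t) \<le> norm (B * f t)"
    proof (rule AE_I2)
      fix t assume "t \<in> space (MT T)"
      then have "norm (k t) \<le> \<bar>B\<bar>" using B[of t] by auto
      then have "\<bar>f t\<bar> * norm (k t) \<le> \<bar>f t\<bar> * \<bar>B\<bar>" by (intro mult_left_mono) auto
      then show "norm (f t * k t) \<le> norm (B * f t)" by (simp add: abs_mult mult.commute)
    qed
  qed
qed

text \<open>Fubini's theorem on the triangle \<open>s < t\<close>.\<close>

lemma triangle_swap:
  fixes f k :: "real \<Rightarrow> real"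
  assumes f: "integrable (MT T) f" and k: "integrable (MT T) k"
  shows "integrable (MT T) (\<lambda>t. k t * (LINT s|MT T. (if s < t then f s else 0)))"
    and "(LINT t|MT T. k t * (LINT s|MT T. (if s < t then f s else 0)))
       = (LINT s|MT T. f s * (LINT t|MT T. (if s < t then k t else 0)))"
proof -
  interpret finite_measure "MT T" by (rule MT_finite)
  interpret pair_sigma_finite "MT T" "MT T" ..
  have id: "(\<lambda>x. x) \<in> borel_measurable (MT T)"
    by (rule continuous_imp_measurable_on_sets_lebesgue) (auto intro: continuous_intros)
  have m1: "(\<lambda>p. f (fst p)) \<in> borel_measurable (MT T \<Otimes>\<^sub>M MT T)"
    using measurable_compose[OF measurable_fst borel_measurable_integrable[OF f]] .
  have m2: "(\<lambda>p. k (snd p)) \<in> borel_measurable (MT T \<Otimes>\<^sub>M MT T)"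
    using measurable_compose[OF measurable_snd borel_measurable_integrable[OF k]] .
  have m3: "(\<lambda>p. fst p :: real) \<in> borel_measurable (MT T \<Otimes>\<^sub>M MT T)" "(\<lambda>p. snd p :: real) \<in> borel_measurable (MT T \<Otimes>\<^sub>M MT T)"
    using measurable_compose[OF measurable_fst id] measurable_compose[OF measurable_snd id] by auto
  have int: "integrable (MT T \<Otimes>\<^sub>M MT T) (\<lambda>p. f (fst p) * k (snd p))"
  proof (rule Fubini_integrable)
    show "(\<lambda>p. f (fst p) * k (snd p)) \<in> borel_measurable (MT T \<Otimes>\<^sub>M MT T)" by (intro borel_measurable_times m1 m2)
    have "(\<lambda>x. LINT y|MT T. norm (f (fst (x, y)) * k (snd (x, y)))) = (\<lambda>x. \<bar>f x\<bar> * (LINT y|MT T. \<bar>k y\<bar>))"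
      by (simp add: abs_mult)
    then show "integrable (MT T) (\<lambda>x. LINT y|MT T. norm (f (fst (x, y)) * k (snd (x, y))))"
      using f by simp
  qed (use k in simp)
  have intP: "integrable (MT T \<Otimes>\<^sub>M MT T) (\<lambda>(s, t). if s < t then f s * k t else 0)"
  proof (rule Bochner_Integration.integrable_bound[OF int])
    have "{p \<in> space (MT T \<Otimes>\<^sub>M MT T). fst p < snd p} \<in> sets (MT T \<Otimes>\<^sub>M MT T)"
      by (rule borel_measurable_less[OF m3])
    then have "(\<lambda>p. if fst p < snd p then f (fst p) * k (snd p) else 0) \<in> borel_measurable (MT T \<Otimes>\<^sub>M MT T)"
      by (intro measurable_If borel_measurable_times m1 m2) auto
    then show "(\<lambda>(s, t). if s < t then f s * k t else 0) \<in> borel_measurable (MT T \<Otimes>\<^sub>M MT T)"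
      by (simp add: case_prod_unfold)
  qed (auto intro!: AE_I2)
  have e1: "(LINT s|MT T. (if s < t then f s * k t else 0)) = k t * (LINT s|MT T. (if s < t then f s else 0))" for t
  proof -
    have "(LINT s|MT T. (if s < t then f s * k t else 0)) = (LINT s|MT T. k t * (if s < t then f s else 0))"
      by (intro Bochner_Integration.integral_cong) auto
    then show ?thesis by simp
  qed
  have e2: "(LINT t|MT T. (if s < t then f s * k t else 0)) = f s * (LINT t|MT T. (if s < t then k t else 0))" for s
  proof -
    have "(LINT t|MT T. (if s < t then f s * k t else 0)) = (LINT t|MT T. f s * (if s < t then k t else 0))"
      by (intro Bochner_Integration.integral_cong) auto
    then show ?thesis by simp
  qed
  show "integrable (MT T) (\<lambda>t. k t * (LINT s|MT T. (if s < t then f s else 0)))"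
    using integrable_snd[OF intP] by (simp add: e1)
  show "(LINT t|MT T. k t * (LINT s|MT T. (if s < t then f s else 0)))
       = (LINT s|MT T. f s * (LINT t|MT T. (if s < t then k t else 0)))"
    using Fubini_integral[OF intP] by (simp only: e1 e2)
qed

lemma if_less_integrable:
  fixes f :: "real \<Rightarrow> real"
  assumes f: "integrable (MT T) f"
  shows "integrable (MT T) (\<lambda>s. if s < b then f s else 0)" "integrable (MT T) (\<lambda>s. if b < s then f s else 0)"
proof -
  have id: "(\<lambda>x::real. x) \<in> borel_measurable (MT T)"
    by (rule continuous_imp_measurable_on_sets_lebesgue) (auto intro: continuous_intros)
  have s: "{x \<in> space (MT T). x < b} \<in> sets (MT T)" "{x \<in> space (MT T). b < x} \<in> sets (MT T)"
    using borel_measurable_less[OF id borel_measurable_const] borel_measurable_less[OF borel_measurable_const id] by auto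
  show "integrable (MT T) (\<lambda>s. if s < b then f s else 0)"
    by (rule Bochner_Integration.integrable_bound[OF f]) (use f s in \<open>auto intro!: measurable_If AE_I2\<close>)
  show "integrable (MT T) (\<lambda>s. if b < s then f s else 0)"
    by (rule Bochner_Integration.integrable_bound[OF f]) (use f s in \<open>auto intro!: measurable_If AE_I2\<close>)
qed

lemma AE_MT_neq: "AE t in MT T. t \<noteq> a"
proof -
  have "AE t in lebesgue. t \<noteq> a"
    by (rule AE_I'[of "{a}"]) (auto simp: negligible_iff_null_sets[symmetric])
  then show ?thesis by (simp add: AE_restrict_space_iff) (auto elim: eventually_mono)
qed

text \<open>The chain rule for the square of an absolutely continuous function, by symmetry: both halves of the square
\<open>{0..b}\<^sup>2\<close> cut along the diagonal contribute the same.\<close>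

lemma indefinite_square:
  fixes g :: "real \<Rightarrow> real"
  assumes g: "integrable (MT T) g"
  defines "I \<equiv> \<lambda>t. LINT s|MT T. (if s < t then g s else 0)"
  shows "(I b)\<^sup>2 = (LINT s|MT T. (if s < b then 2 * (g s * I s) else 0))"
proof -
  define gb where "gb s = (if s < b then g s else 0)" for s
  have gb: "integrable (MT T) gb" unfolding gb_def[abs_def] by (rule if_less_integrable[OF g])
  define J where "J t = (LINT s|MT T. (if s < t then gb s else 0))" for t
  have IJ: "gb t * I t = gb t * J t" for t
  proof (cases "t < b")
    case True
    then have "(if s < t then g s else 0) = (if s < t then gb s else 0)" for s by (auto simp: gb_def)
    then show ?thesis by (simp add: I_def J_def)
  qed (simp add: gb_def)
  have Ib: "I b = (LINT t|MT T. gb t)" by (simp add: I_def gb_def)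
  have rest: "(LINT t|MT T. (if s < t then gb t else 0)) = I b - J s" for s
  proof -
    note i = if_less_integrable[OF gb, of s]
    have "I b = (LINT t|MT T. (if s < t then gb t else 0) + (if t < s then gb t else 0))"
      unfolding Ib
    proof (rule integral_cong_AE)
      show "AE t in MT T. gb t = (if s < t then gb t else 0) + (if t < s then gb t else 0)"
        using AE_MT_neq[where T = T and a = s] by eventually_elim auto
      show "(\<lambda>t. (if s < t then gb t else 0) + (if t < s then gb t else 0)) \<in> borel_measurable (MT T)"
        using i by (intro borel_measurable_add borel_measurable_integrable)
    qed (use gb in simp)
    then show ?thesis using i by (simp add: J_def)
  qed
  have gJ: "integrable (MT T) (\<lambda>t. gb t * J t)" unfolding J_def by (rule triangle_swap(1)[OF gb gb])
  have "(LINT t|MT T. gb t * J t) = (LINT s|MT T. gb s * (I b - J s))"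
    unfolding J_def using triangle_swap(2)[OF gb gb] unfolding rest J_def .
  also have "\<dots> = I b * I b - (LINT t|MT T. gb t * J t)"
    using gb gJ by (simp add: right_diff_distrib Ib)
  finally have "(I b)\<^sup>2 = 2 * (LINT t|MT T. gb t * J t)" by (simp add: power2_eq_square)
  also have "\<dots> = (LINT t|MT T. 2 * (gb t * I t))" by (simp add: IJ)
  also have "\<dots> = (LINT s|MT T. (if s < b then 2 * (g s * I s) else 0))"
    by (intro Bochner_Integration.integral_cong) (auto simp: gb_def)
  finally show ?thesis .
qed

lemma antiderivative_const:
  fixes F :: "real \<Rightarrow> real"
  assumes F: "\<And>x. (F has_real_derivative f x) (at x)" and "x \<le> y" "\<And>t. x < t \<Longrightarrow> t < y \<Longrightarrow> f t = 0"
  shows "F x = F y"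
proof (cases "x = y")
  case False
  then have xy: "x < y" using assms by simp
  have "\<exists>t>x. t < y \<and> F y - F x = (y - x) * f t" by (rule MVT2[OF xy]) (use F in blast)
  then show ?thesis using assms(3) by auto
qed simp

text \<open>The difference of an upward step just inside \<open>a\<close> and a downward step just inside \<open>b\<close>, with slopes tending
to infinity.\<close>

lemma interval_test_functions:
  assumes dp: "dyadic_partition \<eta> \<rho>" and ab: "0 \<le> a" "a < b" "b \<le> T"
  obtains \<theta> :: "nat \<Rightarrow> real \<Rightarrow> real" where "\<And>n. time_test T (\<theta> n)" "\<And>n t. \<bar>\<theta> n t\<bar> \<le> 1"
    "\<And>t. (\<lambda>n. \<theta> n t) \<longlonglongrightarrow> (if a < t \<and> t < b then 1 else 0)"
proof -
  obtain H :: "real \<Rightarrow> real" where H: "smooth H" "\<And>t. t \<le> - 2 \<Longrightarrow> H t = 0" "\<And>t. t \<ge> 2 \<Longrightarrow> H t = 1"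
    "\<And>t. 0 \<le> H t" "\<And>t. H t \<le> 1"
    using smooth_step[OF dp] by blast
  obtain N0 :: nat where N0: "6 / (b - a) \<le> real N0" using real_arch_simple by blast
  \<comment> \<open>The steps have width \<open>4 / m n\<close> and are centred at distance \<open>3 / m n\<close> from the end points, so the
    interval must have length at least \<open>6 / m n\<close>.\<close>
  define m where "m n = real (Suc (n + N0))" for n
  have m: "m n > 0" "m n * (b - a) \<ge> 6" "real n \<le> m n" for n
  proof -
    show "m n > 0" "real n \<le> m n" by (simp_all add: m_def)
    have "6 / (b - a) \<le> m n" using N0 by (simp add: m_def)
    then show "m n * (b - a) \<ge> 6" using ab by (simp add: field_simps)
  qed
  define \<theta> where "\<theta> n t = H (m n * t + (- m n * a - 3)) + (-1) * H (m n * t + (- m n * b + 3))" for n t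
  have z1: "\<theta> n t = 0" if "m n * (t - a) \<le> 1" for n t
  proof -
    have "m n * t + (- m n * a - 3) \<le> - 2" using that by (simp add: algebra_simps)
    moreover have "m n * t + (- m n * b + 3) \<le> - 2" using that m(2)[of n] by (simp add: algebra_simps)
    ultimately show ?thesis by (simp add: \<theta>_def H(2))
  qed
  have z2: "\<theta> n t = 0" if "m n * (b - t) \<le> 1" for n t
  proof -
    have "m n * t + (- m n * a - 3) \<ge> 2" using that m(2)[of n] by (simp add: algebra_simps)
    moreover have "m n * t + (- m n * b + 3) \<ge> 2" using that by (simp add: algebra_simps)
    ultimately show ?thesis by (simp add: \<theta>_def H(3))
  qed
  have "time_test T (\<theta> n)" for n
  proof (rule time_testI)
    show "smooth (\<theta> n)" unfolding \<theta>_def[abs_def]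
      by (intro smooth_add smooth_mult smooth_const smooth_compose_affine H(1) bounded_linear_mult_right)
    have m1: "1 / m n > 0" using m(1)[of n] by simp
    show "0 < a + 1 / m n" using ab m1 by linarith
    show "b - 1 / m n < T" using ab m1 by linarith
    fix t assume nz: "\<theta> n t \<noteq> 0"
    then have "1 < m n * (t - a)" "1 < m n * (b - t)" using z1 z2 by (meson not_le)+
    then show "a + 1 / m n \<le> t \<and> t \<le> b - 1 / m n" using m(1)[of n] by (auto simp: field_simps)
  qed
  moreover have "\<bar>\<theta> n t\<bar> \<le> 1" for n t
    using H(4,5)[of "m n * t + (- m n * a - 3)"] H(4,5)[of "m n * t + (- m n * b + 3)"] by (simp add: \<theta>_def abs_le_iff)
  moreover have "(\<lambda>n. \<theta> n t) \<longlonglongrightarrow> (if a < t \<and> t < b then 1 else 0)" for t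
  proof (cases "a < t \<and> t < b")
    case True
    define d where "d = min (t - a) (b - t)"
    have d: "d > 0" using True by (simp add: d_def)
    obtain N :: nat where N: "5 / d \<le> real N" using real_arch_simple by blast
    have "\<theta> n t = 1" if "n \<ge> N" for n
    proof -
      have "5 / d \<le> m n" using N that m(3)[of n] by (meson of_nat_le_iff order_trans)
      then have "5 \<le> m n * d" using d by (simp add: field_simps)
      also have "m n * d \<le> m n * (t - a)" using m(1)[of n] by (intro mult_left_mono) (auto simp: d_def)
      finally have 1: "5 \<le> m n * (t - a)" .
      have "5 \<le> m n * d" by fact
      also have "m n * d \<le> m n * (b - t)" using m(1)[of n] by (intro mult_left_mono) (auto simp: d_def)
      finally have 2: "5 \<le> m n * (b - t)" .
      have "m n * t + (- m n * a - 3) \<ge> 2" using 1 by (simp add: algebra_simps)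
      moreover have "m n * t + (- m n * b + 3) \<le> - 2" using 2 by (simp add: algebra_simps)
      ultimately show ?thesis by (simp add: \<theta>_def H)
    qed
    then show ?thesis using True by (intro tendsto_eventually eventually_sequentiallyI[of N]) simp
  next
    case False
    have "\<theta> n t = 0" for n
    proof (cases "t \<le> a")
      case True
      then have "m n * (t - a) \<le> 0" using m(1)[of n] by (simp add: mult_nonneg_nonpos)
      then show ?thesis by (intro z1) simp
    next
      case False
      then have "m n * (b - t) \<le> 0" using \<open>\<not> (a < t \<and> t < b)\<close> m(1)[of n] by (simp add: mult_nonneg_nonpos)
      then show ?thesis by (intro z2) simp
    qed
    then show ?thesis using False by auto
  qed
  ultimately show thesis by (rule that)
qed

text \<open>Intervals are stable under intersection and generate the Borel sets, so the integral vanishes over every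
Borel set.\<close>

lemma AE_zero_from_intervals:
  fixes g :: "real \<Rightarrow> real"
  assumes g: "integrable (MT T) g" and T: "T > 0"
    and z: "\<And>a b. 0 \<le> a \<Longrightarrow> a < b \<Longrightarrow> b \<le> T \<Longrightarrow> (LINT t|MT T. (if a < t \<and> t < b then g t else 0)) = 0"
  shows "AE t in MT T. g t = 0"
proof -
  define G where "G t = (if t \<in> {0<..<T} then g t else 0)" for t
  have G: "integrable lebesgue G" unfolding G_def[abs_def]
    by (subst Lebesgue_Measure.integrable_restrict_UNIV) (use g in auto)
  obtain G' where G': "G' \<in> borel_measurable lborel" "AE t in lborel. G t = G' t"
    using completion_ex_borel_measurable_real[OF borel_measurable_integrable[OF G]] by blast
  have aeL: "AE t in lebesgue. G t = G' t" using G'(2) by (rule AE_completion)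
  have G'm: "G' \<in> borel_measurable lebesgue" using G'(1) by (rule measurable_completion)
  have G'i: "integrable lebesgue G'"
    using integrable_cong_AE_imp[OF G G'm] aeL by (auto elim: eventually_mono)
  then have G'b: "integrable lborel G'" using integrable_completion[OF G'(1)] by simp
  define P where "P A \<longleftrightarrow> (LINT t:A|lborel. G' t) = 0" for A
  have conv: "(LINT t:A|lborel. G' t) = (LINT t|MT T. indicator A t * g t)" if A: "A \<in> sets borel" for A
  proof -
    have "(LINT t:A|lborel. G' t) = (LINT t|lborel. indicator A t * G' t)"
      by (simp add: set_lebesgue_integral_def)
    also have "\<dots> = (LINT t|lebesgue. indicator A t * G' t)"
      by (rule integral_completion[symmetric]) (use A G'(1) in simp)
    also have "\<dots> = (LINT t|lebesgue. (if t \<in> {0<..<T} then indicator A t * g t else 0))"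
    proof (rule integral_cong_AE)
      have Am: "(indicator A :: real \<Rightarrow> real) \<in> borel_measurable lebesgue"
        using A by (intro borel_measurable_indicator) auto
      show "(\<lambda>t. indicator A t * G' t) \<in> borel_measurable lebesgue" using Am G'm by (rule borel_measurable_times)
      have "(\<lambda>t. indicator A t * G t) \<in> borel_measurable lebesgue"
        using Am borel_measurable_integrable[OF G] by (rule borel_measurable_times)
      moreover have "(\<lambda>t. indicator A t * G t) = (\<lambda>t. if t \<in> {0<..<T} then indicator A t * g t else 0)"
        by (auto simp: G_def fun_eq_iff)
      ultimately show "(\<lambda>t. if t \<in> {0<..<T} then indicator A t * g t else 0) \<in> borel_measurable lebesgue" by simp
      show "AE t in lebesgue. indicator A t * G' t = (if t \<in> {0<..<T} then indicator A t * g t else 0)"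
        using aeL by eventually_elim (auto simp: G_def split: if_splits)
    qed
    also have "\<dots> = (LINT t|MT T. indicator A t * g t)"
      by (rule Lebesgue_Measure.integral_restrict_UNIV) simp
    finally show ?thesis .
  qed
  have full: "(LINT t|MT T. g t) = 0"
  proof -
    have "(LINT t|MT T. g t) = (LINT t|MT T. (if 0 < t \<and> t < T then g t else 0))"
      by (intro Bochner_Integration.integral_cong) auto
    then show ?thesis using z[of 0 T] T by simp
  qed
  have si: "set_integrable lborel A G'" if "A \<in> sets borel" for A
    unfolding set_integrable_def using G'b that by (intro integrable_mult_indicator) auto
  have "P A" if A: "A \<in> sets borel" for A
  proof -
    let ?Gen = "range (\<lambda>(a, b). box a b :: real set)"
    have b: "sigma_sets UNIV ?Gen = sets borel"
      by (subst borel_eq_box) (rule sets_measure_of[symmetric], simp)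
    have "A \<in> sigma_sets UNIV ?Gen" using A b by simp
    have IS: "Int_stable ?Gen"
    proof (rule Int_stableI)
      fix X Y assume "X \<in> ?Gen" "Y \<in> ?Gen"
      then obtain a b c d :: real where "X = box a b" "Y = box c d" by auto
      then have "X \<inter> Y = box (max a c) (min b d)" by auto
      then show "X \<inter> Y \<in> ?Gen" by auto
    qed
    have PW: "?Gen \<subseteq> Pow UNIV" by simp
    show ?thesis
      using \<open>A \<in> sigma_sets UNIV ?Gen\<close>
    proof (induction rule: sigma_sets_induct_disjoint[OF IS PW, consumes 1, case_names basic empty compl union])
      case (basic X)
      then obtain a b :: real where X: "X = box a b" by auto
      define a' where "a' = max a 0"
      define b' where "b' = min b T"
      have "(LINT t:X|lborel. G' t) = (LINT t|MT T. indicator X t * g t)" by (rule conv) (simp add: X)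
      also have "\<dots> = (LINT t|MT T. (if a' < t \<and> t < b' then g t else 0))"
        by (intro Bochner_Integration.integral_cong) (auto simp: X a'_def b'_def)
      also have "\<dots> = 0"
      proof (cases "a' < b'")
        case False
        then have "(LINT t|MT T. (if a' < t \<and> t < b' then g t else 0)) = (LINT t|MT T. 0)"
          by (intro Bochner_Integration.integral_cong) auto
        then show ?thesis by simp
      qed (intro z, auto simp: a'_def b'_def)
      finally show ?case by (simp add: P_def)
    next
      case empty
      then show ?case by (simp add: P_def set_lebesgue_integral_def)
    next
      case (compl X)
      then have X: "X \<in> sets borel" using b by simp
      have "(LINT t:(UNIV - X)|lborel. G' t) = (LINT t|MT T. indicator (UNIV - X) t * g t)"
        by (rule conv) (use X in auto)
      also have "\<dots> = (LINT t|MT T. g t - indicator X t * g t)"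
        by (intro Bochner_Integration.integral_cong) (auto simp: indicator_def)
      also have "\<dots> = (LINT t|MT T. g t) - (LINT t|MT T. indicator X t * g t)"
      proof (rule Bochner_Integration.integral_diff[OF g])
        have Xm: "(indicator X :: real \<Rightarrow> real) \<in> borel_measurable (MT T)"
          using X by (intro measurable_restrict_space1 borel_measurable_indicator) auto
        show "integrable (MT T) (\<lambda>t. indicator X t * g t)"
        proof (rule Bochner_Integration.integrable_bound[OF g])
          show "(\<lambda>t. indicator X t * g t) \<in> borel_measurable (MT T)"
            using g by (intro borel_measurable_times Xm) simp
        qed (auto intro!: AE_I2 simp: indicator_def)
      qed
      finally show ?case using compl full conv[OF X] by (simp add: P_def)
    next
      case (union X)
      then have X: "X i \<in> sets borel" for i using b by auto
      have "(LINT t:(\<Union>i. X i)|lborel. G' t) = (\<Sum>i. (LINT t:(X i)|lborel. G' t))"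
      proof (rule lebesgue_integral_countable_add)
        show "X i \<in> sets lborel" for i using X by simp
        show "X i \<inter> X j = {}" if "i \<noteq> j" for i j
          using union(1) that by (auto simp: disjoint_family_on_def)
        show "set_integrable lborel (\<Union>i. X i) G'" by (rule si) (use X in auto)
      qed
      then show ?case using union by (simp add: P_def)
    qed
  qed
  then have "AE t in lborel. G' t = 0"
    by (intro sigma_finite_measure.density_zero[OF sigma_finite_lborel G'b]) (simp add: P_def)
  then have "AE t in lebesgue. G' t = 0" by (rule AE_completion)
  then have "AE t in lebesgue. G t = 0" using aeL by eventually_elim simp
  then have "AE t in lebesgue. t \<in> {0<..<T} \<longrightarrow> g t = 0" by eventually_elim (auto simp: G_def)
  then show ?thesis by (subst AE_restrict_space_iff) auto
qed

lemma time_test_continuous: "time_test T \<zeta> \<Longrightarrow> continuous_on UNIV \<zeta>"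
  by (simp add: time_test_def smooth_continuous)

text \<open>Indicator functions of intervals are bounded pointwise limits of test functions.\<close>

lemma AE_zero_from_tests:
  assumes dp: "dyadic_partition \<eta> \<rho>" and T: "T > 0" and g: "integrable (MT T) g"
    and z: "\<And>\<zeta>. time_test T \<zeta> \<Longrightarrow> (LINT t|MT T. g t * \<zeta> t) = 0"
  shows "AE t in MT T. g t = 0"
proof (rule AE_zero_from_intervals[OF g T])
  fix a b :: real assume ab: "0 \<le> a" "a < b" "b \<le> T"
  obtain \<theta> :: "nat \<Rightarrow> real \<Rightarrow> real" where \<theta>: "\<And>n. time_test T (\<theta> n)" "\<And>n t. \<bar>\<theta> n t\<bar> \<le> 1"
    "\<And>t. (\<lambda>n. \<theta> n t) \<longlonglongrightarrow> (if a < t \<and> t < b then 1 else 0)"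
    using interval_test_functions[OF dp ab] by blast
  let ?h = "\<lambda>t. g t * (if a < t \<and> t < b then 1 else 0)"
  have gm: "(\<lambda>t. g t * \<theta> n t) \<in> borel_measurable (MT T)" for n
    by (intro borel_measurable_integrable continuous_mult_MT g time_test_continuous[OF \<theta>(1)])
  have lim: "(\<lambda>n. g t * \<theta> n t) \<longlonglongrightarrow> ?h t" for t by (intro tendsto_intros \<theta>)
  have "(\<lambda>n. LINT t|MT T. g t * \<theta> n t) \<longlonglongrightarrow> (LINT t|MT T. ?h t)"
  proof (rule integral_dominated_convergence[where w = "\<lambda>t. \<bar>g t\<bar>"])
    show "?h \<in> borel_measurable (MT T)" by (rule borel_measurable_LIMSEQ_real[OF lim gm])
    show "AE t in MT T. norm (g t * \<theta> n t) \<le> \<bar>g t\<bar>" for n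
      using \<theta>(2) by (auto simp: abs_mult intro!: mult_left_le)
  qed (use g gm lim in auto)
  then have "(LINT t|MT T. ?h t) = 0" using z[OF \<theta>(1)] by (simp add: LIMSEQ_const_iff)
  moreover have "?h = (\<lambda>t. if a < t \<and> t < b then g t else 0)" by auto
  ultimately show "(LINT t|MT T. (if a < t \<and> t < b then g t else 0)) = 0" by simp
qed

text \<open>The lemma of du Bois-Reymond. A test function is the derivative of a test function if and only if its
integral vanishes, which is achieved by subtracting a multiple of a fixed \<open>\<psi>\<close>.\<close>

lemma weak_constant:
  assumes dp: "dyadic_partition \<eta> \<rho>" and T: "T > 0" and h: "integrable (MT T) h"
    and weak: "\<And>\<zeta> \<zeta>'. time_test T \<zeta> \<Longrightarrow> (\<And>t. (\<zeta> has_real_derivative \<zeta>' t) (at t)) \<Longrightarrow> (LINT t|MT T. h t * \<zeta>' t) = 0"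
  shows "\<exists>c. AE t in MT T. h t = c"
proof -
  interpret finite_measure "MT T" by (rule MT_finite)
  obtain \<psi> where \<psi>: "time_test T \<psi>" "(LINT t|MT T. \<psi> t) \<noteq> 0"
  proof -
    have "\<exists>\<psi>. time_test T \<psi> \<and> (LINT t|MT T. \<psi> t) \<noteq> 0"
    proof (rule ccontr)
      assume "\<not> (\<exists>\<psi>. time_test T \<psi> \<and> (LINT t|MT T. \<psi> t) \<noteq> 0)"
      then have "AE t in MT T. (1 :: real) = 0" by (intro AE_zero_from_tests[OF dp T]) auto
      then have "(LINT t|MT T. (1 :: real)) = (LINT t|MT T. 0)" by (intro integral_cong_AE) auto
      moreover have "(LINT t|MT T. (1 :: real)) = (LINT t|MT T. (if 0 < t \<and> t < T then 1 else 0))"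
        by (intro Bochner_Integration.integral_cong) auto
      moreover have "\<dots> = T"
        using MT_FTC[of "\<lambda>x. x" "\<lambda>_. 1" 0 T T] T by (simp add: continuous_on_const DERIV_ident)
      ultimately show False using T by simp
    qed
    then show thesis using that by blast
  qed
  define c where "c = (LINT t|MT T. h t * \<psi> t) / (LINT t|MT T. \<psi> t)"
  have test: "(LINT t|MT T. h t * \<theta> t) = c * (LINT t|MT T. \<theta> t)" if \<theta>: "time_test T \<theta>" for \<theta>
  proof -
    define r where "r = (LINT t|MT T. \<theta> t) / (LINT t|MT T. \<psi> t)"
    define f where "f t = \<theta> t + (- r) * \<psi> t" for t
    have sf: "smooth f" unfolding f_def[abs_def]
      using \<theta> \<psi> by (intro smooth_add smooth_mult smooth_const) (auto simp: time_test_def)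
    obtain F where F: "\<And>x. (F has_real_derivative f x) (at x)"
      using continuous_antiderivative[OF smooth_continuous[OF sf]] by blast
    define \<zeta> where "\<zeta> t = F t + (- F 0)" for t
    have d: "(\<zeta> has_real_derivative f t) (at t)" for t
      unfolding \<zeta>_def using F by (auto intro!: derivative_eq_intros)
    obtain a1 b1 where ab1: "0 < a1" "b1 < T" "\<And>t. \<theta> t \<noteq> 0 \<Longrightarrow> a1 \<le> t \<and> t \<le> b1"
      using \<theta> by (auto simp: time_test_def)
    obtain a2 b2 where ab2: "0 < a2" "b2 < T" "\<And>t. \<psi> t \<noteq> 0 \<Longrightarrow> a2 \<le> t \<and> t \<le> b2"
      using \<psi> by (auto simp: time_test_def)
    define a where "a = min a1 a2"
    define b where "b = max b1 b2"
    have ab: "0 < a" "b < T" using ab1 ab2 by (auto simp: a_def b_def)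
    have fz: "f t = 0" if "t < a \<or> b < t" for t
    proof -
      have "\<theta> t = 0" by (rule ccontr) (use that ab1(3)[of t] in \<open>auto simp: a_def b_def\<close>)
      moreover have "\<psi> t = 0" by (rule ccontr) (use that ab2(3)[of t] in \<open>auto simp: a_def b_def\<close>)
      ultimately show ?thesis by (simp add: f_def)
    qed
    have i: "integrable (MT T) \<theta>" "integrable (MT T) \<psi>"
      using continuous_mult_MT[of T "\<lambda>_. 1"] time_test_continuous[OF \<theta>] time_test_continuous[OF \<psi>(1)] by auto
    have "F T - F 0 = (LINT t|MT T. (if 0 < t \<and> t < T then f t else 0))"
      by (rule MT_FTC[symmetric]) (use F smooth_continuous[OF sf] T in auto)
    also have "\<dots> = (LINT t|MT T. \<theta> t + (- r) * \<psi> t)"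
      by (intro Bochner_Integration.integral_cong) (auto simp: f_def)
    also have "\<dots> = 0" using i \<psi>(2) by (simp add: r_def)
    finally have FT: "F T = F 0" by simp
    have "time_test T \<zeta>"
    proof (rule time_testI[OF _ ab])
      show "smooth \<zeta>" by (rule smooth_antiderivative[OF d sf])
      fix t assume nz: "\<zeta> t \<noteq> 0"
      have "a \<le> t"
      proof (rule ccontr)
        assume "\<not> a \<le> t"
        then have "F (min t 0) = F t" "F (min t 0) = F 0"
          using ab by (auto intro!: antiderivative_const[OF F] fz)
        then show False using nz by (simp add: \<zeta>_def)
      qed
      moreover have "t \<le> b"
      proof (rule ccontr)
        assume "\<not> t \<le> b"
        then have "F t = F (max t T)" "F T = F (max t T)"
          using ab by (auto intro!: antiderivative_const[OF F] fz)
        then show False using nz FT by (simp add: \<zeta>_def)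
      qed
      ultimately show "a \<le> t \<and> t \<le> b" ..
    qed
    then have "(LINT t|MT T. h t * f t) = 0" using weak d by blast
    moreover have "(LINT t|MT T. h t * f t) = (LINT t|MT T. h t * \<theta> t) - r * (LINT t|MT T. h t * \<psi> t)"
    proof -
      have "integrable (MT T) (\<lambda>t. h t * \<theta> t)" "integrable (MT T) (\<lambda>t. h t * \<psi> t)"
        by (rule continuous_mult_MT[OF h time_test_continuous[OF \<theta>]],
          rule continuous_mult_MT[OF h time_test_continuous[OF \<psi>(1)]])
      then have "(LINT t|MT T. h t * \<theta> t) - r * (LINT t|MT T. h t * \<psi> t) = (LINT t|MT T. h t * \<theta> t - r * (h t * \<psi> t))"
        by simp
      also have "\<dots> = (LINT t|MT T. h t * f t)"
        by (intro Bochner_Integration.integral_cong) (auto simp: f_def algebra_simps)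
      finally show ?thesis by simp
    qed
    ultimately show ?thesis by (simp add: c_def r_def)
  qed
  have "AE t in MT T. h t - c = 0"
  proof (rule AE_zero_from_tests[OF dp T])
    show "integrable (MT T) (\<lambda>t. h t - c)" using h by simp
    fix \<theta> assume \<theta>: "time_test T \<theta>"
    have i: "integrable (MT T) (\<lambda>t. h t * \<theta> t)" "integrable (MT T) \<theta>"
      using continuous_mult_MT[OF h time_test_continuous[OF \<theta>]]
        continuous_mult_MT[of T "\<lambda>_. 1", OF _ time_test_continuous[OF \<theta>]] by auto
    then show "(LINT t|MT T. (h t - c) * \<theta> t) = 0" by (simp add: left_diff_distrib test[OF \<theta>])
  qed
  then show ?thesis by (intro exI[of _ c]) simp
qed

text \<open>An integrable function whose weak derivative is integrable agrees almost everywhere with an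
  indefinite integral, and the chain rule holds for its square.\<close>

lemma weak_derivative_square:
  assumes dp: "dyadic_partition \<eta> \<rho>" and T: "T > 0" and f: "integrable (MT T) f" and g: "integrable (MT T) g"
    and weak: "\<And>\<zeta> \<zeta>'. time_test T \<zeta> \<Longrightarrow> (\<And>t. (\<zeta> has_real_derivative \<zeta>' t) (at t)) \<Longrightarrow> continuous_on UNIV \<zeta>' \<Longrightarrow>
       (LINT t|MT T. f t * \<zeta>' t + g t * \<zeta> t) = 0"
  shows "integrable (MT T) (\<lambda>s. g s * f s) \<and> (\<exists>c. AE b in MT T. (f b)\<^sup>2 = c + (LINT s|MT T. (if s < b then 2 * (g s * f s) else 0)))"
proof -
  interpret finite_measure "MT T" by (rule MT_finite)
  define I where "I t = (LINT s|MT T. (if s < t then g s else 0))" for t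
  have gI: "integrable (MT T) (\<lambda>t. g t * I t)" unfolding I_def by (rule triangle_swap(1)[OF g g])
  have Ii: "integrable (MT T) I"
    using triangle_swap(1)[OF g, of "\<lambda>_. 1"] by (simp add: I_def[abs_def])
  have "\<exists>c. AE t in MT T. f t - I t = c"
  proof (rule weak_constant[OF dp T])
    show "integrable (MT T) (\<lambda>t. f t - I t)" using f Ii by simp
    fix \<zeta> \<zeta>' :: "real \<Rightarrow> real" assume \<zeta>: "time_test T \<zeta>" and d: "\<And>t. (\<zeta> has_real_derivative \<zeta>' t) (at t)"
    have "\<zeta>' = (\<lambda>t. frechet_derivative \<zeta> (at t) 1)"
      using DERIV_unique[OF d smooth_has_real_derivative] \<zeta> by (auto simp: time_test_def)
    then have c: "continuous_on UNIV \<zeta>'"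
      using smooth_continuous[OF smooth_deriv[of \<zeta> 1]] \<zeta> by (simp add: time_test_def)
    have ci: "integrable (MT T) \<zeta>'" using continuous_mult_MT[of T "\<lambda>_. 1" \<zeta>'] c by simp
    obtain a b where ab: "0 < a" "b < T" "\<And>t. \<zeta> t \<noteq> 0 \<Longrightarrow> a \<le> t \<and> t \<le> b"
      using \<zeta> by (auto simp: time_test_def)
    have \<zeta>T: "\<zeta> T = 0" using ab by force
    have fi: "integrable (MT T) (\<lambda>t. f t * \<zeta>' t)" "integrable (MT T) (\<lambda>t. g t * \<zeta> t)" "integrable (MT T) (\<lambda>t. I t * \<zeta>' t)"
      by (intro continuous_mult_MT f g Ii c time_test_continuous[OF \<zeta>])+
    have "(LINT t|MT T. I t * \<zeta>' t) = (LINT t|MT T. \<zeta>' t * (LINT s|MT T. (if s < t then g s else 0)))"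
      by (simp add: I_def mult.commute)
    also have "\<dots> = (LINT s|MT T. g s * (LINT t|MT T. (if s < t then \<zeta>' t else 0)))"
      by (rule triangle_swap(2)[OF g ci])
    also have "\<dots> = (LINT s|MT T. - (g s * \<zeta> s))"
    proof (rule Bochner_Integration.integral_cong[OF refl])
      fix s assume s: "s \<in> space (MT T)"
      have "(LINT t|MT T. (if s < t then \<zeta>' t else 0)) = (LINT t|MT T. (if s < t \<and> t < T then \<zeta>' t else 0))"
        by (intro Bochner_Integration.integral_cong) auto
      also have "\<dots> = \<zeta> T - \<zeta> s" by (rule MT_FTC[OF d c]) (use s in auto)
      finally show "g s * (LINT t|MT T. (if s < t then \<zeta>' t else 0)) = - (g s * \<zeta> s)" by (simp add: \<zeta>T)
    qed
    also have "\<dots> = - (LINT s|MT T. g s * \<zeta> s)" by simp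
    finally have "(LINT t|MT T. I t * \<zeta>' t) = - (LINT s|MT T. g s * \<zeta> s)" .
    moreover have "(LINT t|MT T. f t * \<zeta>' t) + (LINT t|MT T. g t * \<zeta> t) = 0"
      using weak[OF \<zeta> d c] fi by simp
    ultimately show "(LINT t|MT T. (f t - I t) * \<zeta>' t) = 0"
      using fi by (simp add: left_diff_distrib)
  qed
  then obtain c where c: "AE t in MT T. f t - I t = c" by blast
  have fm: "f \<in> borel_measurable (MT T)" "g \<in> borel_measurable (MT T)" using f g by auto
  have gcI: "integrable (MT T) (\<lambda>s. g s * (c + I s))" using g gI by (simp add: distrib_left)
  have gf: "integrable (MT T) (\<lambda>s. g s * f s)"
  proof (rule integrable_cong_AE_imp[OF gcI])
    show "(\<lambda>s. g s * f s) \<in> borel_measurable (MT T)" by (intro borel_measurable_times fm)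
    show "AE s in MT T. g s * (c + I s) = g s * f s" using c by eventually_elim (auto simp: algebra_simps)
  qed
  have "AE b in MT T. (f b)\<^sup>2 = c\<^sup>2 + (LINT s|MT T. (if s < b then 2 * (g s * f s) else 0))"
    using c
  proof eventually_elim
    case (elim b)
    have gIb: "integrable (MT T) (\<lambda>s. if s < b then 2 * (g s * I s) else 0)"
      by (rule if_less_integrable) (use gI in simp)
    have "(LINT s|MT T. (if s < b then 2 * (g s * f s) else 0))
        = (LINT s|MT T. 2 * c * (if s < b then g s else 0) + (if s < b then 2 * (g s * I s) else 0))"
    proof (rule integral_cong_AE)
      have "integrable (MT T) (\<lambda>s. if s < b then 2 * (g s * f s) else 0)"
        by (rule if_less_integrable) (use gf in simp)
      then show "(\<lambda>s. if s < b then 2 * (g s * f s) else 0) \<in> borel_measurable (MT T)" by simp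
      show "(\<lambda>s. 2 * c * (if s < b then g s else 0) + (if s < b then 2 * (g s * I s) else 0)) \<in> borel_measurable (MT T)"
        using if_less_integrable(1)[OF g, of b] gIb by (intro borel_measurable_add borel_measurable_times) auto
      show "AE s in MT T. (if s < b then 2 * (g s * f s) else 0) = 2 * c * (if s < b then g s else 0) + (if s < b then 2 * (g s * I s) else 0)"
        using c by eventually_elim (auto simp: algebra_simps)
    qed
    also have "\<dots> = 2 * c * (LINT s|MT T. (if s < b then g s else 0)) + (LINT s|MT T. (if s < b then 2 * (g s * I s) else 0))"
      using if_less_integrable(1)[OF g, of b] gIb by simp
    also have "(LINT s|MT T. (if s < b then 2 * (g s * I s) else 0)) = (I b)\<^sup>2"
      unfolding I_def by (rule indefinite_square[OF g, symmetric])
    also have "(LINT s|MT T. (if s < b then g s else 0)) = I b" by (simp add: I_def)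
    finally show ?case using elim by (simp add: power2_eq_square algebra_simps)
  qed
  then show ?thesis using gf by blast
qed

section \<open>Integration over space-time\<close>

abbreviation MS :: "real \<Rightarrow> ((real^3) \<times> real) measure" where "MS T \<equiv> lebesgue_on (spacetime T)"

lemma spacetime_borel: "spacetime T \<in> sets borel"
proof -
  have "torus3 \<times> {0<..<T} \<in> sets (borel \<Otimes>\<^sub>M borel)"
    by (rule pair_measureI) (simp_all add: torus3_def)
  then show ?thesis unfolding spacetime_def borel_prod .
qed

lemma spacetime_sets [simp]: "spacetime T \<in> sets lebesgue"
  using spacetime_borel by (simp add: sets_completionI_sets)

lemma mem_spacetime: "(x, t) \<in> spacetime T \<longleftrightarrow> x \<in> torus3 \<and> t \<in> {0<..<T}"
  by (simp add: spacetime_def)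

text \<open>Lebesgue measure on the product is the completion of a product measure and not a product measure itself.
Fubini's theorem is therefore applied to Borel representatives, and this group of lemmas moves between a
Lebesgue measurable function and such a representative.\<close>

lemma AE_lebesgue_on:
  "S \<in> sets lebesgue \<Longrightarrow> (AE x in lebesgue_on S. P x) \<longleftrightarrow> (AE x in lborel. x \<in> S \<longrightarrow> P x)"
  by (simp add: AE_restrict_space_iff AE_completion_iff)

lemma borel_measurable_AE_lborel:
  fixes g :: "'a::euclidean_space \<Rightarrow> real"
  assumes g': "g' \<in> borel_measurable lborel" and ae: "AE x in lborel. g x = g' x"
  shows "g \<in> borel_measurable lebesgue"
proof -
  obtain N where N: "N \<in> null_sets lborel" "{x \<in> space lborel. g x \<noteq> g' x} \<subseteq> N"
    using ae by (auto simp: eventually_ae_filter)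
  have neg: "negligible N" using N(1) by (simp add: negligible_iff_null_sets null_sets_completionI)
  have "g' \<in> borel_measurable lebesgue" using g' by (rule measurable_completion)
  then have "g' measurable_on UNIV" by (simp add: measurable_on_iff_borel_measurable lebesgue_on_UNIV_eq)
  then have "g measurable_on UNIV"
    by (rule measurable_on_spike[OF _ neg]) (use N(2) in auto)
  then show ?thesis by (simp add: measurable_on_iff_borel_measurable lebesgue_on_UNIV_eq)
qed

lemma integral_AE_lborel:
  fixes g :: "'a::euclidean_space \<Rightarrow> real"
  assumes g': "integrable lborel g'" and ae: "AE x in lborel. g x = g' x"
  shows "integrable lebesgue g" "integral\<^sup>L lebesgue g = integral\<^sup>L lborel g'"
proof -
  have m': "g' \<in> borel_measurable lborel" using g' by simp
  have m: "g \<in> borel_measurable lebesgue" by (rule borel_measurable_AE_lborel[OF m' ae])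
  have i: "integrable lebesgue g'" using g' integrable_completion[OF m'] by simp
  have ae': "AE x in lebesgue. g' x = g x" using AE_completion[OF ae] by (auto elim: eventually_mono)
  show "integrable lebesgue g" by (rule integrable_cong_AE_imp[OF i m ae'])
  have "integral\<^sup>L lebesgue g = integral\<^sup>L lebesgue g'"
    using ae' m i by (intro integral_cong_AE) (auto elim: eventually_mono)
  then show "integral\<^sup>L lebesgue g = integral\<^sup>L lborel g'" using integral_completion[OF m'] by simp
qed

lemma AE_lborel_swap:
  assumes "AE z in (lborel :: ('a::euclidean_space \<times> 'b::euclidean_space) measure). P z"
  shows "AE t in lborel. AE x in lborel. P (x, t)"
proof -
  obtain N where N: "N \<in> null_sets lborel" "{z \<in> space lborel. \<not> P z} \<subseteq> N"
    using assms by (auto simp: eventually_ae_filter)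
  have ae: "AE z in (lborel \<Otimes>\<^sub>M lborel :: ('a \<times> 'b) measure). z \<notin> N"
    using AE_not_in[OF N(1)] unfolding lborel_prod .
  have s: "{z \<in> space (lborel \<Otimes>\<^sub>M lborel). (fst z, snd z) \<notin> N} \<in> sets (lborel \<Otimes>\<^sub>M lborel :: ('a \<times> 'b) measure)"
  proof -
    have "{z \<in> space (lborel \<Otimes>\<^sub>M lborel). (fst z, snd z) \<notin> N} = space lborel - N" by (auto simp: space_pair_measure)
    moreover have "space lborel - N \<in> sets lborel" using null_setsD2[OF N(1)] by (rule sets.compl_sets)
    ultimately show ?thesis unfolding lborel_prod by metis
  qed
  have "AE x in lborel. AE t in lborel. (x, t) \<notin> N" using lborel_pair.AE_pair[OF ae] by simp
  then have "AE t in lborel. AE x in lborel. (x, t) \<notin> N"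
    using lborel_pair.AE_commute[of "\<lambda>x t. (x, t) \<notin> N"] s by simp
  then show ?thesis
  proof eventually_elim
    case (elim t)
    then show ?case by eventually_elim (use N(2) in auto)
  qed
qed

lemma AE_spacetime_time:
  assumes "AE t in MT T. Q t" shows "AE z in MS T. Q (snd z)"
proof -
  have ae: "AE t in lborel. t \<in> {0<..<T} \<longrightarrow> Q t" using assms by (simp add: AE_lebesgue_on)
  then obtain N where N: "N \<in> null_sets lborel" "{t \<in> space lborel. \<not> (t \<in> {0<..<T} \<longrightarrow> Q t)} \<subseteq> N"
    by (auto simp: eventually_ae_filter)
  have "AE z in (lborel \<Otimes>\<^sub>M lborel :: ((real^3) \<times> real) measure). snd z \<notin> N"
  proof (rule lborel_pair.AE_pair_measure)
    have "{z \<in> space (lborel \<Otimes>\<^sub>M lborel :: ((real^3) \<times> real) measure). snd z \<notin> N} = UNIV \<times> (- N)"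
      by (auto simp: space_pair_measure)
    also have "\<dots> \<in> sets (lborel \<Otimes>\<^sub>M lborel)"
      by (rule pair_measureI) (use N(1) in \<open>auto dest: null_setsD2\<close>)
    finally show "{z \<in> space (lborel \<Otimes>\<^sub>M lborel :: ((real^3) \<times> real) measure). snd z \<notin> N} \<in> sets (lborel \<Otimes>\<^sub>M lborel)" .
    show "AE x in lborel. AE t in lborel. snd (x :: real^3, t) \<notin> N" using AE_not_in[OF N(1)] by simp
  qed
  then have "AE z in (lborel :: ((real^3) \<times> real) measure). snd z \<notin> N" unfolding lborel_prod .
  then have "AE z in lborel. z \<in> spacetime T \<longrightarrow> Q (snd z)"
    by eventually_elim (use N(2) in \<open>auto simp: spacetime_def\<close>)
  then show ?thesis by (simp add: AE_lebesgue_on)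
qed

lemma integrable_lebesgue_on_iff:
  fixes f :: "'a::euclidean_space \<Rightarrow> real"
  assumes "S \<in> sets lebesgue"
  shows "integrable (lebesgue_on S) f \<longleftrightarrow> integrable lebesgue (\<lambda>x. if x \<in> S then f x else 0)"
    "integral\<^sup>L (lebesgue_on S) f = integral\<^sup>L lebesgue (\<lambda>x. if x \<in> S then f x else 0)"
  using Lebesgue_Measure.integrable_restrict_UNIV[OF assms, of f] Lebesgue_Measure.integral_restrict_UNIV[OF assms, of f]
  by simp_all

lemma borel_measurable_lebesgue_on_iff:
  fixes f :: "'a::euclidean_space \<Rightarrow> real"
  assumes "S \<in> sets lebesgue"
  shows "f \<in> borel_measurable (lebesgue_on S) \<longleftrightarrow> (\<lambda>x. if x \<in> S then f x else 0) \<in> borel_measurable lebesgue"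
  using measurable_on_iff_borel_measurable[OF assms, of f] measurable_on_UNIV[of S f]
    measurable_on_iff_borel_measurable[of UNIV "\<lambda>x. if x \<in> S then f x else 0"]
  by (simp add: lebesgue_on_UNIV_eq)

lemma borel_measurable_AE_on:
  fixes f g :: "'a::euclidean_space \<Rightarrow> real"
  assumes S: "S \<in> sets lebesgue" and g: "g \<in> borel_measurable (lebesgue_on S)"
    and ae: "AE x in lebesgue_on S. f x = g x"
  shows "f \<in> borel_measurable (lebesgue_on S)"
proof -
  obtain g' where g': "g' \<in> borel_measurable lborel" "AE x in lborel. (if x \<in> S then g x else 0) = g' x"
    using completion_ex_borel_measurable_real g unfolding borel_measurable_lebesgue_on_iff[OF S] by blast
  have "AE x in lborel. x \<in> S \<longrightarrow> f x = g x" using ae by (simp add: AE_lebesgue_on S)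
  then have "AE x in lborel. (if x \<in> S then f x else 0) = g' x"
    using g'(2) by eventually_elim auto
  then show ?thesis
    unfolding borel_measurable_lebesgue_on_iff[OF S] by (rule borel_measurable_AE_lborel[OF g'(1)])
qed

lemma borel_measurable_spacetime_time:
  fixes c :: "real \<Rightarrow> real"
  assumes c: "c \<in> borel_measurable (MT T)"
  shows "(\<lambda>z. c (snd z)) \<in> borel_measurable (MS T)"
proof -
  have interval: "{0<..<T} \<in> sets lebesgue" by simp
  obtain c' where c': "c' \<in> borel_measurable lborel" "AE x in lborel. (if x \<in> {0<..<T} then c x else 0) = c' x"
    using completion_ex_borel_measurable_real[OF c[unfolded borel_measurable_lebesgue_on_iff[OF interval]]] by blast
  have "(\<lambda>z :: (real^3) \<times> real. c' (snd z)) \<in> borel_measurable borel"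
    using c'(1) by (intro measurable_compose[of snd borel borel c']) (auto intro!: borel_measurable_continuous_onI continuous_intros)
  then have m: "(\<lambda>z. c' (snd z)) \<in> borel_measurable (MS T)"
    by (intro measurable_restrict_space1 measurable_completion) simp
  have "AE t in MT T. c t = c' t"
    using c'(2) by (subst AE_lebesgue_on) (auto elim: eventually_mono)
  then have "AE z in MS T. c (snd z) = c' (snd z)" by (rule AE_spacetime_time)
  then show ?thesis by (rule borel_measurable_AE_on[OF spacetime_sets m])
qed

lemma spacetime_fubini:
  fixes f :: "(real^3) \<times> real \<Rightarrow> real"
  assumes f: "integrable (MS T) f"
  shows "AE t in MT T. integrable M3 (\<lambda>x. f (x, t))"
    and "integrable (MT T) (\<lambda>t. LINT x|M3. f (x, t))"
    and "(LINT z|MS T. f z) = (LINT t|MT T. LINT x|M3. f (x, t))"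
proof -
  define F where "F z = (if z \<in> spacetime T then f z else 0)" for z
  have F: "integrable lebesgue F" and FL: "(LINT z|MS T. f z) = integral\<^sup>L lebesgue F"
    using f integrable_lebesgue_on_iff[OF spacetime_sets, of T f] by (auto simp: F_def[abs_def])
  obtain F' where F': "F' \<in> borel_measurable lborel" "AE z in lborel. F z = F' z"
    using completion_ex_borel_measurable_real[OF borel_measurable_integrable[OF F]] by blast
  have F'i: "integrable lborel F'"
  proof -
    have "F' \<in> borel_measurable lebesgue" using F'(1) by (rule measurable_completion)
    then have "integrable lebesgue F'" by (rule integrable_cong_AE_imp[OF F _ AE_completion[OF F'(2)]])
    then show ?thesis using integrable_completion[OF F'(1)] by simp
  qed
  then have pair: "integrable (lborel \<Otimes>\<^sub>M lborel) (case_prod (\<lambda>x t. F' (x, t)))" by (simp add: lborel_prod)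
  have ae: "AE t in lborel. AE x in lborel. F (x, t) = F' (x, t)" by (rule AE_lborel_swap[OF F'(2)])
  have ai: "AE t in lborel. integrable lborel (\<lambda>x. F' (x, t))" by (rule lborel_pair.AE_integrable_snd[OF pair])
  define G where "G t = (LINT x|lborel. F' (x, t))" for t
  have Gi: "integrable lborel G" unfolding G_def[abs_def] by (rule lborel_pair.integrable_snd[OF pair])
  have GL: "(LINT t|lborel. G t) = (LINT z|lborel. F' z)"
    unfolding G_def using lborel_pair.integral_snd[OF pair] by (simp add: lborel_prod)
  define g where "g t = (if t \<in> {0<..<T} then (LINT x|M3. f (x, t)) else 0)" for t
  have both: "AE t in lborel. (t \<in> {0<..<T} \<longrightarrow> integrable M3 (\<lambda>x. f (x, t))) \<and> g t = G t"
    using ae ai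
  proof eventually_elim
    case (elim t)
    note r = integral_AE_lborel[OF elim(2,1)]
    show ?case
    proof (cases "t \<in> {0<..<T}")
      case True
      then have eq: "(\<lambda>x. F (x, t)) = (\<lambda>x. if x \<in> torus3 then f (x, t) else 0)"
        by (auto simp: F_def mem_spacetime)
      show ?thesis using r True integrable_lebesgue_on_iff[OF torus3_sets, of "\<lambda>x. f (x, t)"]
        by (simp add: eq g_def G_def)
    next
      case False
      then have eq: "(\<lambda>x. F (x, t)) = (\<lambda>x. 0)" by (auto simp: F_def mem_spacetime)
      show ?thesis using r False unfolding eq g_def G_def by auto
    qed
  qed
  have gG: "AE t in lborel. g t = G t" using both by eventually_elim simp
  note R = integral_AE_lborel[OF Gi gG]
  have s: "{0<..<T} \<in> sets lebesgue" by simp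
  show "AE t in MT T. integrable M3 (\<lambda>x. f (x, t))"
    using both by (subst AE_lebesgue_on[OF s]) (auto elim: eventually_mono)
  show "integrable (MT T) (\<lambda>t. LINT x|M3. f (x, t))"
    using R(1) integrable_lebesgue_on_iff(1)[OF s, of "\<lambda>t. LINT x|M3. f (x, t)"] by (simp add: g_def[abs_def])
  have "(LINT z|MS T. f z) = (LINT z|lborel. F' z)"
    using integral_AE_lborel(2)[OF F'i F'(2)] FL by simp
  also have "\<dots> = (LINT t|MT T. LINT x|M3. f (x, t))"
    using R(2) GL integrable_lebesgue_on_iff(2)[OF s, of "\<lambda>t. LINT x|M3. f (x, t)"] by (simp add: g_def[abs_def])
  finally show "(LINT z|MS T. f z) = (LINT t|MT T. LINT x|M3. f (x, t))" .
qed

lemma spacetime_integrableI: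
  fixes f :: "(real^3) \<times> real \<Rightarrow> real"
  assumes f: "f \<in> borel_measurable (MS T)"
    and sl: "AE t in MT T. integrable M3 (\<lambda>x. f (x, t)) \<and> (LINT x|M3. \<bar>f (x, t)\<bar>) \<le> C"
  shows "integrable (MS T) f"
proof -
  have interval: "{0<..<T} \<in> sets lebesgue" by simp
  define F where "F z = (if z \<in> spacetime T then f z else 0)" for z
  have Fm: "F \<in> borel_measurable lebesgue"
    using f borel_measurable_lebesgue_on_iff[OF spacetime_sets, of f T] by (simp add: F_def[abs_def])
  obtain F' where F': "F' \<in> borel_measurable lborel" "AE z in lborel. F z = F' z"
    using completion_ex_borel_measurable_real[OF Fm] by blast
  have ae: "AE t in lborel. AE x in lborel. F (x, t) = F' (x, t)" by (rule AE_lborel_swap[OF F'(2)])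
  have sl': "AE t in lborel. t \<in> {0<..<T} \<longrightarrow> integrable M3 (\<lambda>x. f (x, t)) \<and> (LINT x|M3. \<bar>f (x, t)\<bar>) \<le> C"
    by (rule sl[unfolded AE_lebesgue_on[OF interval]])
  have F'p: "(\<lambda>z. ennreal (norm (F' z))) \<in> borel_measurable (lborel \<Otimes>\<^sub>M lborel)"
    using F'(1) by (simp add: lborel_prod)
  have F's: "(\<lambda>x. F' (x, t)) \<in> borel_measurable lborel" for t
    using F'(1) by (intro measurable_compose[of "\<lambda>x. (x, t)" lborel borel F'])
       (auto intro!: borel_measurable_continuous_onI continuous_intros)
  have bound: "AE t in lborel. (\<integral>\<^sup>+x. ennreal (norm (F' (x, t))) \<partial>lborel) \<le> ennreal C * indicator {0<..<T} t"
    using ae sl'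
  proof eventually_elim
    case (elim t)
    have aex: "AE x in lborel. F' (x, t) = F (x, t)" using elim(1) by eventually_elim simp
    show ?case
    proof (cases "t \<in> {0<..<T}")
      case True
      have eq: "(\<lambda>x. F (x, t)) = (\<lambda>x. if x \<in> torus3 then f (x, t) else 0)"
        using True by (auto simp: F_def mem_spacetime)
      have i: "integrable lebesgue (\<lambda>x. F (x, t))"
        using elim(2) True integrable_lebesgue_on_iff(1)[OF torus3_sets, of "\<lambda>x. f (x, t)"] by (simp add: eq)
      have "(\<integral>\<^sup>+x. ennreal (norm (F' (x, t))) \<partial>lborel) = (\<integral>\<^sup>+x. ennreal (norm (F' (x, t))) \<partial>lebesgue)"
        by (rule nn_integral_completion[symmetric])
      also have "\<dots> = (\<integral>\<^sup>+x. ennreal (norm (F (x, t))) \<partial>lebesgue)"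
        using AE_completion[OF aex] by (intro nn_integral_cong_AE) (auto elim: eventually_mono)
      also have "\<dots> = ennreal (LINT x|lebesgue. norm (F (x, t)))"
        using i by (intro nn_integral_eq_integral) auto
      also have "(LINT x|lebesgue. norm (F (x, t))) = (LINT x|M3. \<bar>f (x, t)\<bar>)"
      proof -
        have "(\<lambda>x. norm (F (x, t))) = (\<lambda>x. if x \<in> torus3 then \<bar>f (x, t)\<bar> else 0)"
          using True by (auto simp: F_def mem_spacetime)
        then show ?thesis using integrable_lebesgue_on_iff(2)[OF torus3_sets, of "\<lambda>x. \<bar>f (x, t)\<bar>"] by simp
      qed
      also have "ennreal \<dots> \<le> ennreal C" using elim(2) True by (intro ennreal_leI) simp
      finally show ?thesis using True by simp
    next
      case False
      then have "AE x in lborel. F' (x, t) = 0" using aex by (auto simp: F_def mem_spacetime)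
      then have "(\<integral>\<^sup>+x. ennreal (norm (F' (x, t))) \<partial>lborel) = (\<integral>\<^sup>+x. 0 \<partial>(lborel :: (real^3) measure))"
        by (intro nn_integral_cong_AE) (auto elim: eventually_mono)
      then show ?thesis using False by simp
    qed
  qed
  have "(\<integral>\<^sup>+z. ennreal (norm (F' z)) \<partial>lborel) = (\<integral>\<^sup>+t. (\<integral>\<^sup>+x. ennreal (norm (F' (x, t))) \<partial>lborel) \<partial>lborel)"
    using lborel_pair.nn_integral_snd[OF F'p] by (simp add: lborel_prod)
  also have "\<dots> \<le> (\<integral>\<^sup>+t. ennreal C * indicator {0<..<T} t \<partial>lborel)"
    by (rule nn_integral_mono_AE[OF bound])
  also have "\<dots> = ennreal C * emeasure lborel {0<..<T}"
    by (rule nn_integral_cmult_indicator) simp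
  also have "\<dots> < \<infinity>" by (cases "0 \<le> T") (auto simp: ennreal_mult_less_top)
  finally have "integrable lborel F'" using F'(1) by (intro integrableI_bounded) auto
  then have "integrable lebesgue F" by (rule integral_AE_lborel(1)[OF _ F'(2)])
  then show ?thesis
    using integrable_lebesgue_on_iff(1)[OF spacetime_sets, of T f] by (simp add: F_def[abs_def])
qed

section \<open>From the weak form to the Fourier coefficients\<close>

lemma bounded_linear_space_inner: "bounded_linear (\<lambda>z :: (real^3) \<times> real. v \<bullet> fst z)"
  by (intro bounded_linear_compose[OF bounded_linear_inner_right bounded_linear_fst])

lemma test_function_wave:
  assumes z: "time_test T \<zeta>" and d: "\<And>t. (\<zeta> has_real_derivative \<zeta>' t) (at t)"
  shows "test_function T (\<lambda>z. \<zeta> (snd z) * sin (freq k \<bullet> fst z + \<omega>))" (is ?A)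
    and "dt (\<lambda>z. \<zeta> (snd z) * sin (freq k \<bullet> fst z + \<omega>)) (x, t) = \<zeta>' t * sin (freq k \<bullet> x + \<omega>)" (is ?B)
    and "dx i (\<lambda>z. \<zeta> (snd z) * sin (freq k \<bullet> fst z + \<omega>)) (x, t) = \<zeta> t * (of_int (k $ i) * cos (freq k \<bullet> x + \<omega>))" (is ?C)
proof -
  let ?\<psi> = "\<lambda>z :: (real^3) \<times> real. \<zeta> (snd z) * sin (freq k \<bullet> fst z + \<omega>)"
  have sm: "smooth ?\<psi>"
  proof (rule smooth_mult)
    show "smooth (\<lambda>z :: (real^3) \<times> real. \<zeta> (snd z))"
      using smooth_compose_affine[OF bounded_linear_snd, of \<zeta> 0] z by (simp add: time_test_def)
    have "smooth (\<lambda>x. sin (x + \<omega>))" using Ck_sin by (simp add: smooth_def)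
    from smooth_compose_affine[OF bounded_linear_space_inner this, of "freq k" 0]
    show "smooth (\<lambda>z :: (real^3) \<times> real. sin (freq k \<bullet> fst z + \<omega>))" by simp
  qed
  have per: "sin (freq k \<bullet> (x + axis i (2 * pi)) + \<omega>) = sin (freq k \<bullet> x + \<omega>)" for x i
  proof -
    have "freq k \<bullet> (x + axis i (2 * pi)) + \<omega> = (freq k \<bullet> x + \<omega>) + of_int (k $ i) * (2 * pi)"
      by (simp add: inner_add_right inner_axis algebra_simps)
    moreover have "sin (a + of_int m * (2 * pi)) = sin a" for a m
      using sin_int_2pin[of m] cos_int_2pin[of m] by (simp add: sin_add mult.commute)
    ultimately show ?thesis by metis
  qed
  show ?A
    unfolding test_function_def
  proof (intro conjI sm)
    show "space_periodic ?\<psi>" using per by (simp add: space_periodic_def)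
    obtain a b where "0 < a" "b < T" "\<And>t. \<zeta> t \<noteq> 0 \<Longrightarrow> a \<le> t \<and> t \<le> b" using z by (auto simp: time_test_def)
    then show "\<exists>a b. 0 < a \<and> b < T \<and> (\<forall>x t. ?\<psi> (x, t) \<noteq> 0 \<longrightarrow> a \<le> t \<and> t \<le> b)" by auto
  qed
  have D: "(?\<psi> has_derivative (\<lambda>h. \<zeta> t * (cos (freq k \<bullet> x + \<omega>) * (freq k \<bullet> fst h)) + (snd h * \<zeta>' t) * sin (freq k \<bullet> x + \<omega>))) (at (x, t))"
  proof -
    have 1: "((\<lambda>z :: (real^3) \<times> real. \<zeta> (snd z)) has_derivative (\<lambda>h. snd h * \<zeta>' t)) (at (x, t))"
    proof -
      have "(\<zeta> has_derivative (\<lambda>h. h * \<zeta>' t)) (at (snd (x, t)))" using has_real_derivative_fun[OF d[of t]] by simp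
      from has_derivative_compose[OF bounded_linear_imp_has_derivative[OF bounded_linear_snd] this] show ?thesis .
    qed
    have 2: "((\<lambda>z :: (real^3) \<times> real. sin (freq k \<bullet> fst z + \<omega>)) has_derivative (\<lambda>h. cos (freq k \<bullet> x + \<omega>) * (freq k \<bullet> fst h))) (at (x, t))"
    proof -
      have "((\<lambda>s. sin (s + \<omega>)) has_real_derivative cos (freq k \<bullet> fst (x, t) + \<omega>)) (at (freq k \<bullet> fst (x, t)))"
        by (auto intro!: derivative_eq_intros)
      from has_derivative_compose[OF bounded_linear_imp_has_derivative[OF bounded_linear_space_inner] has_real_derivative_fun[OF this]]
      show ?thesis by (simp add: mult.commute)
    qed
    show ?thesis using has_derivative_mult[OF 1 2] by simp
  qed
  show ?B unfolding dt_def frechet_derivative_at[OF D, symmetric] by simp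
  show ?C unfolding dx_def frechet_derivative_at[OF D, symmetric] by (simp add: inner_axis mult.commute)
qed

lemma integral_AE_on:
  fixes f g :: "'a::euclidean_space \<Rightarrow> real"
  assumes S: "S \<in> sets lebesgue" and g: "integrable (lebesgue_on S) g"
    and ae: "AE x in lebesgue_on S. f x = g x"
  shows "integrable (lebesgue_on S) f" and "integral\<^sup>L (lebesgue_on S) f = integral\<^sup>L (lebesgue_on S) g"
proof -
  have m: "f \<in> borel_measurable (lebesgue_on S)"
    by (rule borel_measurable_AE_on[OF S borel_measurable_integrable[OF g] ae])
  have ae': "AE x in lebesgue_on S. g x = f x" using ae by eventually_elim simp
  show "integrable (lebesgue_on S) f" by (rule integrable_cong_AE_imp[OF g m ae'])
  show "integral\<^sup>L (lebesgue_on S) f = integral\<^sup>L (lebesgue_on S) g"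
    by (rule integral_cong_AE[OF m borel_measurable_integrable[OF g] ae])
qed

lemma integrable_mult_bounded:
  fixes f h :: "'a \<Rightarrow> real"
  assumes f: "integrable M f" and h: "h \<in> borel_measurable M" and B: "\<And>x. x \<in> space M \<Longrightarrow> \<bar>h x\<bar> \<le> B"
  shows "integrable M (\<lambda>x. f x * h x)"
proof (rule Bochner_Integration.integrable_bound)
  show "integrable M (\<lambda>x. B * f x)" using f by simp
  show "(\<lambda>x. f x * h x) \<in> borel_measurable M" using borel_measurable_integrable[OF f] h by measurable
  show "AE x in M. norm (f x * h x) \<le> norm (B * f x)"
  proof (rule AE_I2)
    fix x assume x: "x \<in> space M"
    have "0 \<le> B" using B[OF x] by linarith
    then show "norm (f x * h x) \<le> norm (B * f x)"
      using mult_right_mono[OF B[OF x] abs_ge_zero[of "f x"]] by (simp add: abs_mult mult.commute)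
  qed
qed

lemma continuous_measurable_lebesgue_on:
  fixes h :: "'a::euclidean_space \<Rightarrow> real"
  assumes "continuous_on UNIV h" and "S \<in> sets lebesgue"
  shows "h \<in> borel_measurable (lebesgue_on S)"
  using assms by (intro continuous_imp_measurable_on_sets_lebesgue) (auto intro: continuous_on_subset)

lemma Re_Im_fourier_coeff:
  assumes f: "integrable M3 f"
  shows "vol3 * Re (fourier_coeff f k) = (LINT x|M3. f x * cos (freq k \<bullet> x))"
    and "vol3 * Im (fourier_coeff f k) = - (LINT x|M3. f x * sin (freq k \<bullet> x))"
proof -
  note i = integrable_mult_ch[OF f, of "- k"]
  have e: "of_real vol3 * fourier_coeff f k = (LINT y|M3. of_real (f y) * ch (- k) y)"
    using LINT_mult_ch[of f "- k"] by simp
  have "Re (of_real vol3 * fourier_coeff f k) = (LINT y|M3. Re (of_real (f y) * ch (- k) y))"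
    unfolding e by (rule integral_bounded_linear[OF bounded_linear_Re i, symmetric])
  then show "vol3 * Re (fourier_coeff f k) = (LINT x|M3. f x * cos (freq k \<bullet> x))"
    by (simp add: ch_def freq_minus)
  have "Im (of_real vol3 * fourier_coeff f k) = (LINT y|M3. Im (of_real (f y) * ch (- k) y))"
    unfolding e by (rule integral_bounded_linear[OF bounded_linear_Im i, symmetric])
  then show "vol3 * Im (fourier_coeff f k) = - (LINT x|M3. f x * sin (freq k \<bullet> x))"
    by (simp add: ch_def freq_minus)
qed

lemma integrable_wave:
  assumes f: "integrable (MS T) f"
  shows "integrable (MS T) (\<lambda>z. f z * sin (freq k \<bullet> fst z + \<omega>))"
    and "integrable (MS T) (\<lambda>z. f z * cos (freq k \<bullet> fst z + \<omega>))"
  by (rule integrable_mult_bounded[OF f, where B = 1];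
      auto intro!: continuous_measurable_lebesgue_on continuous_intros)+

lemma fourier_coeff_time_integrable:
  assumes f: "integrable (MS T) f"
  shows "integrable (MT T) (\<lambda>t. Re (fourier_coeff (slice f t) k))"
    and "integrable (MT T) (\<lambda>t. Im (fourier_coeff (slice f t) k))"
proof -
  have S: "{0<..<T} \<in> sets lebesgue" by simp
  have v: "vol3 \<noteq> 0" using vol3_pos by linarith
  note s = spacetime_fubini(1)[OF f]
  have c: "integrable (MT T) (\<lambda>t. (LINT x|M3. f (x, t) * cos (freq k \<bullet> x)) / vol3)"
    using spacetime_fubini(2)[OF integrable_wave(2)[OF f, of k 0]] by simp
  have d: "integrable (MT T) (\<lambda>t. - (LINT x|M3. f (x, t) * sin (freq k \<bullet> x)) / vol3)"
    using spacetime_fubini(2)[OF integrable_wave(1)[OF f, of k 0]] by simp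
  have "AE t in MT T. Re (fourier_coeff (slice f t) k) = (LINT x|M3. f (x, t) * cos (freq k \<bullet> x)) / vol3"
    using s
  proof eventually_elim
    case (elim t)
    show ?case using Re_Im_fourier_coeff(1)[OF elim, of k] v by (simp add: slice_def field_simps)
  qed
  from integral_AE_on(1)[OF S c this] show "integrable (MT T) (\<lambda>t. Re (fourier_coeff (slice f t) k))" .
  have "AE t in MT T. Im (fourier_coeff (slice f t) k) = - (LINT x|M3. f (x, t) * sin (freq k \<bullet> x)) / vol3"
    using s
  proof eventually_elim
    case (elim t)
    show ?case using Re_Im_fourier_coeff(2)[OF elim, of k] v by (simp add: slice_def field_simps)
  qed
  from integral_AE_on(1)[OF S d this] show "integrable (MT T) (\<lambda>t. Im (fourier_coeff (slice f t) k))" .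
qed

text \<open>A plane wave with a temporal cut-off, inserted in the weak form, leaves a one-dimensional weak
equation in time. The phase \<open>\<omega>\<close> selects the real (\<open>\<pi>/2\<close>) or imaginary (0) part of the coefficient.\<close>

lemma weak_form_wave:
  fixes f :: "(real^3) \<times> real \<Rightarrow> real" and q :: "3 \<Rightarrow> (real^3) \<times> real \<Rightarrow> real"
  assumes f: "integrable (MS T) f" and q: "\<And>i. integrable (MS T) (q i)"
    and z: "time_test T \<zeta>" and d: "\<And>t. (\<zeta> has_real_derivative \<zeta>' t) (at t)" and c': "continuous_on UNIV \<zeta>'"
    and weak: "\<And>\<psi> :: (real^3) \<times> real \<Rightarrow> real. test_function T \<psi> \<Longrightarrow>
      (LINT z|MS T. f z * dt \<psi> z + (\<Sum>i\<in>UNIV. q i z * dx i \<psi> z)) = 0"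
  shows "(LINT t|MT T. (LINT x|M3. f (x, t) * sin (freq k \<bullet> x + \<omega>)) * \<zeta>' t
            + (\<Sum>i\<in>UNIV. of_int (k $ i) * (LINT x|M3. q i (x, t) * cos (freq k \<bullet> x + \<omega>))) * \<zeta> t) = 0"
proof -
  have S: "{0<..<T} \<in> sets lebesgue" by simp
  have bd: "\<exists>B. \<forall>t\<in>{0<..<T}. \<bar>h t\<bar> \<le> B" if "continuous_on UNIV h" for h :: "real \<Rightarrow> real"
  proof -
    have "compact (h ` {0..T})" using that by (intro compact_continuous_image) (auto intro: continuous_on_subset)
    then obtain B where "\<forall>y\<in>h ` {0..T}. norm y \<le> B" using compact_imp_bounded bounded_iff by metis
    then show ?thesis by (intro exI[of _ B]) auto
  qed
  have int: "integrable (MS T) (\<lambda>z. g z * h (snd z))" if g: "integrable (MS T) g" and h: "continuous_on UNIV h"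
    for g and h :: "real \<Rightarrow> real"
  proof -
    obtain B where B: "\<forall>t\<in>{0<..<T}. \<bar>h t\<bar> \<le> B" using bd[OF h] by blast
    show ?thesis
    proof (rule integrable_mult_bounded[OF g, where B = B])
      show "(\<lambda>z. h (snd z)) \<in> borel_measurable (MS T)"
      proof (rule continuous_measurable_lebesgue_on)
        show "continuous_on UNIV (\<lambda>z :: (real^3) \<times> real. h (snd z))"
          by (rule continuous_on_compose2[OF h continuous_on_snd[OF continuous_on_id]]) simp
      qed simp
      show "\<bar>h (snd z)\<bar> \<le> B" if "z \<in> space (MS T)" for z using that B by (auto simp: spacetime_def)
    qed
  qed
  let ?F = "\<lambda>z. (f z * sin (freq k \<bullet> fst z + \<omega>)) * \<zeta>' (snd z)
     + (\<Sum>i\<in>UNIV. of_int (k $ i) * ((q i z * cos (freq k \<bullet> fst z + \<omega>)) * \<zeta> (snd z)))"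
  have F: "integrable (MS T) ?F"
    by (intro Bochner_Integration.integrable_add Bochner_Integration.integrable_sum integrable_mult_right int integrable_wave f q c' time_test_continuous[OF z])
  have "?F z = f z * dt (\<lambda>z. \<zeta> (snd z) * sin (freq k \<bullet> fst z + \<omega>)) z
      + (\<Sum>i\<in>UNIV. q i z * dx i (\<lambda>z. \<zeta> (snd z) * sin (freq k \<bullet> fst z + \<omega>)) z)" for z
    by (cases z) (simp only: test_function_wave(2,3)[OF z d] fst_conv snd_conv, simp add: mult_ac)
  then have "(LINT z|MS T. ?F z) = 0" using weak[OF test_function_wave(1)[OF z d]] by simp
  then have 0: "(LINT t|MT T. LINT x|M3. ?F (x, t)) = 0" using spacetime_fubini(3)[OF F] by simp
  have qs: "AE t in MT T. \<forall>i\<in>UNIV. integrable M3 (\<lambda>x. q i (x, t) * cos (freq k \<bullet> x + \<omega>))"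
  proof (rule AE_finite_allI)
    show "AE t in MT T. integrable M3 (\<lambda>x. q i (x, t) * cos (freq k \<bullet> x + \<omega>))" for i
      using spacetime_fubini(1)[OF integrable_wave(2)[OF q[of i], of k \<omega>]] by simp
  qed simp
  have fs: "AE t in MT T. integrable M3 (\<lambda>x. f (x, t) * sin (freq k \<bullet> x + \<omega>))"
    using spacetime_fubini(1)[OF integrable_wave(1)[OF f, of k \<omega>]] by simp
  have "AE t in MT T. (LINT x|M3. f (x, t) * sin (freq k \<bullet> x + \<omega>)) * \<zeta>' t
            + (\<Sum>i\<in>UNIV. of_int (k $ i) * (LINT x|M3. q i (x, t) * cos (freq k \<bullet> x + \<omega>))) * \<zeta> t
      = (LINT x|M3. ?F (x, t))"
    using fs qs
  proof eventually_elim
    case (elim t)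
    have 1: "integrable M3 (\<lambda>x. (f (x, t) * sin (freq k \<bullet> x + \<omega>)) * \<zeta>' t)" using elim(1) by simp
    have 2: "integrable M3 (\<lambda>x. of_int (k $ i) * ((q i (x, t) * cos (freq k \<bullet> x + \<omega>)) * \<zeta> t))" for i
      using elim(2) by simp
    have "(LINT x|M3. ?F (x, t)) = (LINT x|M3. (f (x, t) * sin (freq k \<bullet> x + \<omega>)) * \<zeta>' t)
        + (\<Sum>i\<in>UNIV. LINT x|M3. of_int (k $ i) * ((q i (x, t) * cos (freq k \<bullet> x + \<omega>)) * \<zeta> t))"
      unfolding fst_conv snd_conv
      by (subst Bochner_Integration.integral_add[OF 1 Bochner_Integration.integrable_sum[OF 2]],
          subst Bochner_Integration.integral_sum[OF 2]) (rule refl)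
    also have "\<dots> = (LINT x|M3. f (x, t) * sin (freq k \<bullet> x + \<omega>)) * \<zeta>' t
            + (\<Sum>i\<in>UNIV. of_int (k $ i) * (LINT x|M3. q i (x, t) * cos (freq k \<bullet> x + \<omega>))) * \<zeta> t"
      unfolding integral_mult_left_zero integral_mult_right_zero sum_distrib_right by (simp only: mult.assoc)
    finally show ?case by simp
  qed
  from integral_AE_on(2)[OF S spacetime_fubini(2)[OF F] this] 0 show ?thesis by simp
qed

lemma integrable_sum_Re_Im:
  fixes q :: "3 \<Rightarrow> (real^3) \<times> real \<Rightarrow> real"
  assumes q: "\<And>i. integrable (MS T) (q i)"
  shows "integrable (MT T) (\<lambda>t. \<Sum>i\<in>UNIV. of_int (k $ i) * Re (fourier_coeff (slice (q i) t) k))"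
    and "integrable (MT T) (\<lambda>t. \<Sum>i\<in>UNIV. of_int (k $ i) * Im (fourier_coeff (slice (q i) t) k))"
  by (intro Bochner_Integration.integrable_sum integrable_mult_right fourier_coeff_time_integrable q)+

lemma weak_form_coeff:
  fixes f :: "(real^3) \<times> real \<Rightarrow> real" and q :: "3 \<Rightarrow> (real^3) \<times> real \<Rightarrow> real"
  assumes f: "integrable (MS T) f" and q: "\<And>i. integrable (MS T) (q i)"
    and z: "time_test T \<zeta>" and d: "\<And>t. (\<zeta> has_real_derivative \<zeta>' t) (at t)" and c': "continuous_on UNIV \<zeta>'"
    and weak: "\<And>\<psi> :: (real^3) \<times> real \<Rightarrow> real. test_function T \<psi> \<Longrightarrow>
      (LINT z|MS T. f z * dt \<psi> z + (\<Sum>i\<in>UNIV. q i z * dx i \<psi> z)) = 0"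
  shows "(LINT t|MT T. Re (fourier_coeff (slice f t) k) * \<zeta>' t
            + (\<Sum>i\<in>UNIV. of_int (k $ i) * Im (fourier_coeff (slice (q i) t) k)) * \<zeta> t) = 0" (is ?A)
    and "(LINT t|MT T. Im (fourier_coeff (slice f t) k) * \<zeta>' t
            + (- (\<Sum>i\<in>UNIV. of_int (k $ i) * Re (fourier_coeff (slice (q i) t) k))) * \<zeta> t) = 0" (is ?B)
proof -
  have S: "{0<..<T} \<in> sets lebesgue" by simp
  have qs: "AE t in MT T. \<forall>i\<in>UNIV. integrable M3 (\<lambda>x. q i (x, t))"
    by (rule AE_finite_allI) (simp_all add: spacetime_fubini(1)[OF q])
  note fs = spacetime_fubini(1)[OF f]
  have zc: "continuous_on UNIV \<zeta>" by (rule time_test_continuous[OF z])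
  note R = fourier_coeff_time_integrable[OF f, of k]
  note Q = integrable_sum_Re_Im[of T q k, OF q]
  have int1: "integrable (MT T) (\<lambda>t. vol3 * (Re (fourier_coeff (slice f t) k) * \<zeta>' t
            + (\<Sum>i\<in>UNIV. of_int (k $ i) * Im (fourier_coeff (slice (q i) t) k)) * \<zeta> t))"
    by (intro integrable_mult_right Bochner_Integration.integrable_add continuous_mult_MT R Q zc c')
  have int2: "integrable (MT T) (\<lambda>t. - vol3 * (Im (fourier_coeff (slice f t) k) * \<zeta>' t
            + (- (\<Sum>i\<in>UNIV. of_int (k $ i) * Re (fourier_coeff (slice (q i) t) k))) * \<zeta> t))"
    by (intro integrable_mult_right Bochner_Integration.integrable_add Bochner_Integration.integrable_minus continuous_mult_MT R Q zc c')
  have "AE t in MT T. (LINT x|M3. f (x, t) * sin (freq k \<bullet> x + pi / 2)) * \<zeta>' t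
            + (\<Sum>i\<in>UNIV. of_int (k $ i) * (LINT x|M3. q i (x, t) * cos (freq k \<bullet> x + pi / 2))) * \<zeta> t
      = vol3 * (Re (fourier_coeff (slice f t) k) * \<zeta>' t
            + (\<Sum>i\<in>UNIV. of_int (k $ i) * Im (fourier_coeff (slice (q i) t) k)) * \<zeta> t)"
    using fs qs
  proof eventually_elim
    case (elim t)
    have 1: "(LINT x|M3. f (x, t) * sin (freq k \<bullet> x + pi / 2)) = vol3 * Re (fourier_coeff (slice f t) k)"
      using Re_Im_fourier_coeff(1)[OF elim(1), of k] by (simp add: slice_def sin_add)
    have 2: "(LINT x|M3. q i (x, t) * cos (freq k \<bullet> x + pi / 2)) = vol3 * Im (fourier_coeff (slice (q i) t) k)" for i
      using Re_Im_fourier_coeff(2)[of "\<lambda>x. q i (x, t)" k] elim(2) by (simp add: slice_def cos_add)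
    show ?case unfolding 1 2 by (simp add: sum_distrib_left sum_distrib_right sum_negf algebra_simps)
  qed
  from integral_AE_on(2)[OF S int1 this] weak_form_wave[OF f q z d c' weak, of k "pi / 2"]
  show ?A using vol3_pos by simp
  have "AE t in MT T. (LINT x|M3. f (x, t) * sin (freq k \<bullet> x + 0)) * \<zeta>' t
            + (\<Sum>i\<in>UNIV. of_int (k $ i) * (LINT x|M3. q i (x, t) * cos (freq k \<bullet> x + 0))) * \<zeta> t
      = - vol3 * (Im (fourier_coeff (slice f t) k) * \<zeta>' t
            + (- (\<Sum>i\<in>UNIV. of_int (k $ i) * Re (fourier_coeff (slice (q i) t) k))) * \<zeta> t)"
    using fs qs
  proof eventually_elim
    case (elim t)
    have 1: "(LINT x|M3. f (x, t) * sin (freq k \<bullet> x + 0)) = - vol3 * Im (fourier_coeff (slice f t) k)"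
      using Re_Im_fourier_coeff(2)[OF elim(1), of k] by (simp add: slice_def)
    have 2: "(LINT x|M3. q i (x, t) * cos (freq k \<bullet> x + 0)) = vol3 * Re (fourier_coeff (slice (q i) t) k)" for i
      using Re_Im_fourier_coeff(1)[of "\<lambda>x. q i (x, t)" k] elim(2) by (simp add: slice_def)
    show ?case unfolding 1 2 by (simp add: sum_distrib_left sum_distrib_right sum_negf algebra_simps)
  qed
  from integral_AE_on(2)[OF S int2 this] weak_form_wave[OF f q z d c' weak, of k 0]
  have "- vol3 * (LINT t|MT T. Im (fourier_coeff (slice f t) k) * \<zeta>' t
            + (- (\<Sum>i\<in>UNIV. of_int (k $ i) * Re (fourier_coeff (slice (q i) t) k))) * \<zeta> t) = 0"
    by simp
  then show ?B using vol3_pos by simp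
qed

text \<open>The real and the imaginary part of the coefficient have integrable weak derivatives; the squared modulus is
the sum of their squares.\<close>

lemma fourier_energy_law:
  fixes f :: "(real^3) \<times> real \<Rightarrow> real" and q :: "3 \<Rightarrow> (real^3) \<times> real \<Rightarrow> real"
  assumes dp: "dyadic_partition \<eta> \<rho>" and T: "T > 0"
    and f: "integrable (MS T) f" and q: "\<And>i. integrable (MS T) (q i)"
    and weak: "\<And>\<psi> :: (real^3) \<times> real \<Rightarrow> real. test_function T \<psi> \<Longrightarrow>
      (LINT z|MS T. f z * dt \<psi> z + (\<Sum>i\<in>UNIV. q i z * dx i \<psi> z)) = 0"
  defines "G \<equiv> \<lambda>k t. \<Sum>i\<in>UNIV. of_int (k $ i) * Im (cnj (fourier_coeff (slice f t) k) * fourier_coeff (slice (q i) t) k)"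
  shows "integrable (MT T) (G k)"
    and "\<exists>c. AE b in MT T. (cmod (fourier_coeff (slice f b) k))\<^sup>2 = c + (LINT s|MT T. (if s < b then 2 * G k s else 0))"
proof -
  let ?c = "\<lambda>t. fourier_coeff (slice f t) k"
  let ?r = "\<lambda>t. \<Sum>i\<in>UNIV. of_int (k $ i) * Im (fourier_coeff (slice (q i) t) k)"
  let ?m = "\<lambda>t. - (\<Sum>i\<in>UNIV. of_int (k $ i) * Re (fourier_coeff (slice (q i) t) k))"
  note R = fourier_coeff_time_integrable[OF f, of k]
  note Q = integrable_sum_Re_Im[of T q k, OF q]
  have 1: "integrable (MT T) (\<lambda>s. ?r s * Re (?c s)) \<and> (\<exists>c. AE b in MT T. (Re (?c b))\<^sup>2 = c + (LINT s|MT T. (if s < b then 2 * (?r s * Re (?c s)) else 0)))"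
    by (rule weak_derivative_square[OF dp T R(1) Q(2)]) (rule weak_form_coeff(1)[OF f q _ _ _ weak])
  have 2: "integrable (MT T) (\<lambda>s. ?m s * Im (?c s)) \<and> (\<exists>c. AE b in MT T. (Im (?c b))\<^sup>2 = c + (LINT s|MT T. (if s < b then 2 * (?m s * Im (?c s)) else 0)))"
    by (rule weak_derivative_square[OF dp T R(2) Bochner_Integration.integrable_minus[OF Q(1)]])
       (rule weak_form_coeff(2)[OF f q _ _ _ weak])
  have G: "G k t = ?r t * Re (?c t) + ?m t * Im (?c t)" for t
    unfolding G_def by (simp add: sum_distrib_left sum_distrib_right sum_subtractf[symmetric] algebra_simps)
  show "integrable (MT T) (G k)" unfolding G[abs_def] using 1 2 by (intro Bochner_Integration.integrable_add) auto
  obtain c1 c2 where c1: "AE b in MT T. (Re (?c b))\<^sup>2 = c1 + (LINT s|MT T. (if s < b then 2 * (?r s * Re (?c s)) else 0))"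
    and c2: "AE b in MT T. (Im (?c b))\<^sup>2 = c2 + (LINT s|MT T. (if s < b then 2 * (?m s * Im (?c s)) else 0))"
    using 1 2 by blast
  have split: "(LINT s|MT T. (if s < b then 2 * G k s else 0))
     = (LINT s|MT T. (if s < b then 2 * (?r s * Re (?c s)) else 0)) + (LINT s|MT T. (if s < b then 2 * (?m s * Im (?c s)) else 0))" for b
  proof -
    have i1: "integrable (MT T) (\<lambda>s. if s < b then 2 * (?r s * Re (?c s)) else 0)"
      using 1 by (intro if_less_integrable) simp
    have i2: "integrable (MT T) (\<lambda>s. if s < b then 2 * (?m s * Im (?c s)) else 0)"
      by (rule if_less_integrable(1)) (use 2 in \<open>auto intro: integrable_mult_right\<close>)
    show ?thesis unfolding Bochner_Integration.integral_add[OF i1 i2, symmetric]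
      by (rule Bochner_Integration.integral_cong[OF refl]) (simp add: G)
  qed
  have "AE b in MT T. (cmod (?c b))\<^sup>2 = (c1 + c2) + (LINT s|MT T. (if s < b then 2 * G k s else 0))"
    using c1 c2 by eventually_elim (simp add: cmod_power2 split)
  then show "\<exists>c. AE b in MT T. (cmod (?c b))\<^sup>2 = c + (LINT s|MT T. (if s < b then 2 * G k s else 0))" by blast
qed

text \<open>Each frequency gives an exceptional null set of times, and there are countably many frequencies.\<close>

lemma divergence_free_coeff:
  fixes q :: "3 \<Rightarrow> (real^3) \<times> real \<Rightarrow> real"
  assumes dp: "dyadic_partition \<eta> \<rho>" and T: "T > 0" and q: "\<And>i. integrable (MS T) (q i)"
    and weak: "\<And>\<psi> :: (real^3) \<times> real \<Rightarrow> real. test_function T \<psi> \<Longrightarrow>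
      (LINT z|MS T. (\<Sum>i\<in>UNIV. q i z * dx i \<psi> z)) = 0"
  shows "AE t in MT T. \<forall>k. (\<Sum>i\<in>UNIV. of_int (k $ i) * fourier_coeff (slice (q i) t) k) = 0"
proof -
  have weak0: "(LINT z|MS T. 0 * dt \<psi> z + (\<Sum>i\<in>UNIV. q i z * dx i \<psi> z)) = 0" if "test_function T \<psi>" for \<psi>
    using weak[OF that] by simp
  have "AE t in MT T. (\<Sum>i\<in>UNIV. of_int (k $ i) * fourier_coeff (slice (q i) t) k) = 0" for k
  proof -
    note Q = integrable_sum_Re_Im[of T q k, OF q]
    have d: "(\<zeta> has_real_derivative frechet_derivative \<zeta> (at t) 1) (at t)"
      and c: "continuous_on UNIV (\<lambda>t. frechet_derivative \<zeta> (at t) 1)" if "time_test T \<zeta>" for \<zeta> t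
      using that by (auto simp: time_test_def intro!: smooth_has_real_derivative smooth_continuous smooth_deriv)
    have z: "fourier_coeff (slice (\<lambda>z. 0) t) k = 0" for t by (simp add: fourier_coeff_def slice_def)
    have 1: "AE t in MT T. (\<Sum>i\<in>UNIV. of_int (k $ i) * Im (fourier_coeff (slice (q i) t) k)) = 0"
    proof (rule AE_zero_from_tests[OF dp T Q(2)])
      fix \<zeta> assume \<zeta>: "time_test T \<zeta>"
      show "(LINT t|MT T. (\<Sum>i\<in>UNIV. of_int (k $ i) * Im (fourier_coeff (slice (q i) t) k)) * \<zeta> t) = 0"
        using weak_form_coeff(1)[OF integrable_zero q \<zeta> d[OF \<zeta>] c[OF \<zeta>] weak0, of k] by (simp add: z)
    qed
    have 2: "AE t in MT T. - (\<Sum>i\<in>UNIV. of_int (k $ i) * Re (fourier_coeff (slice (q i) t) k)) = 0"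
    proof (rule AE_zero_from_tests[OF dp T Bochner_Integration.integrable_minus[OF Q(1)]])
      fix \<zeta> assume \<zeta>: "time_test T \<zeta>"
      show "(LINT t|MT T. - (\<Sum>i\<in>UNIV. of_int (k $ i) * Re (fourier_coeff (slice (q i) t) k)) * \<zeta> t) = 0"
        using weak_form_coeff(2)[OF integrable_zero q \<zeta> d[OF \<zeta>] c[OF \<zeta>] weak0, of k] by (simp add: z)
    qed
    show ?thesis using 1 2 by eventually_elim (simp add: complex_eq_iff)
  qed
  then show ?thesis by (simp add: AE_all_countable)
qed

section \<open>Measurability of the filtered velocity\<close>

lemma filtered_nth: "filtered \<alpha> u (x, t) $ i = torus_multiplier (helm \<alpha>) (slice (\<lambda>z. u z $ i) t) x"
  by (simp add: filtered_def helmholtz_inv_nth slice_def)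

lemma borel_measurable_spacetime_trig:
  assumes f: "integrable (MS T) f"
  shows "(\<lambda>z. Re ((of_real a * fourier_coeff (slice f (snd z)) k) * ch k (fst z))) \<in> borel_measurable (MS T)"
proof -
  note R = fourier_coeff_time_integrable[OF f, of k]
  note m = borel_measurable_spacetime_time[OF borel_measurable_integrable[OF R(1)]]
    borel_measurable_spacetime_time[OF borel_measurable_integrable[OF R(2)]]
  have c: "(\<lambda>z. cos (freq k \<bullet> fst z)) \<in> borel_measurable (MS T)" "(\<lambda>z. sin (freq k \<bullet> fst z)) \<in> borel_measurable (MS T)"
    by (auto intro!: continuous_measurable_lebesgue_on continuous_intros)
  have e: "Re ((of_real a * fourier_coeff (slice f (snd z)) k) * ch k (fst z))
     = a * (Re (fourier_coeff (slice f (snd z)) k) * cos (freq k \<bullet> fst z)) - a * (Im (fourier_coeff (slice f (snd z)) k) * sin (freq k \<bullet> fst z))" for z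
    by (simp add: ch_def algebra_simps)
  show ?thesis unfolding e
    by (intro borel_measurable_diff borel_measurable_times borel_measurable_const m c)
qed

text \<open>The filtered field is a pointwise limit of finite sums of products of a measurable function of time and a
character.\<close>

lemma filtered_measurable:
  assumes a: "\<alpha> > 0" and f: "integrable (MS T) f" and L: "AE t in MT T. L2 (slice f t)"
  shows "(\<lambda>z. torus_multiplier (helm \<alpha>) (slice f (snd z)) (fst z)) \<in> borel_measurable (MS T)"
proof -
  let ?h = "\<lambda>N z. helm_trunc \<alpha> N (slice f (snd z)) (fst z)"
  have m: "?h N \<in> borel_measurable (MS T)" for N
  proof -
    have "?h N = (\<lambda>z. \<Sum>k\<in>lattice_ball (real N). Re ((of_real (helm \<alpha> (freq k)) * fourier_coeff (slice f (snd z)) k) * ch k (fst z)))"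
      using arg_cong[OF helm_trunc_expansion, of Re] by (auto simp: fun_eq_iff)
    then show ?thesis by (simp only:) (intro borel_measurable_sum borel_measurable_spacetime_trig f)
  qed
  have lim: "(\<lambda>z. lim (\<lambda>N. ?h N z)) \<in> borel_measurable (MS T)" by (rule borel_measurable_lim_metric[OF m])
  have "AE z in MS T. L2 (slice f (snd z))" by (rule AE_spacetime_time[OF L])
  then have "AE z in MS T. torus_multiplier (helm \<alpha>) (slice f (snd z)) (fst z) = lim (\<lambda>N. ?h N z)"
  proof eventually_elim
    case (elim z)
    from limI[OF helm_trunc_tendsto[OF a elim]] show ?case by simp
  qed
  then show ?thesis by (rule borel_measurable_AE_on[OF spacetime_sets lim])
qed

lemma helm_L2:
  assumes a: "\<alpha> > 0" and f: "L2 f"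
  shows "L2 (torus_multiplier (helm \<alpha>) f)"
    and "(LINT x|M3. (torus_multiplier (helm \<alpha>) f x)\<^sup>2) \<le> (LINT x|M3. (f x)\<^sup>2)"
proof -
  show L: "L2 (torus_multiplier (helm \<alpha>) f)" by (rule L2_continuous[OF helm_continuous[OF a f]])
  have "(cmod (fourier_coeff (torus_multiplier (helm \<alpha>) f) k))\<^sup>2 \<le> (cmod (fourier_coeff f k))\<^sup>2" for k
    using helm_bounds[of \<alpha> "freq k"]
    by (simp add: fourier_coeff_helm[OF a f] norm_mult mult_left_le_one_le power_mono)
  from has_sum_mono[OF parseval[OF L] parseval[OF f] this]
  show "(LINT x|M3. (torus_multiplier (helm \<alpha>) f x)\<^sup>2) \<le> (LINT x|M3. (f x)\<^sup>2)"
    using vol3_pos by (simp add: divide_le_cancel)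
qed

section \<open>Uniform bounds on time slices\<close>

text \<open>The class \<open>L\<^sup>\<infinity>(0,T; L\<^sup>2)\<close> for scalar fields, with the bound made explicit.\<close>

definition slice_bounded :: "real \<Rightarrow> real \<Rightarrow> ((real^3) \<times> real \<Rightarrow> real) \<Rightarrow> bool" where
  "slice_bounded T U f \<longleftrightarrow> f \<in> borel_measurable (MS T) \<and>
     (AE t in MT T. L2 (slice f t) \<and> (LINT x|M3. (slice f t x)\<^sup>2) \<le> U)"

lemma slice_bounded_mono: "slice_bounded T U f \<Longrightarrow> U \<le> U' \<Longrightarrow> slice_bounded T U' f"
  unfolding slice_bounded_def using eventually_mono order_trans
  by (smt (verit, best) eventually_mono)

lemma slice_bounded_mult:
  assumes f: "slice_bounded T U f" and g: "slice_bounded T U' g"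
  shows "integrable (MS T) (\<lambda>z. f z * g z)"
proof (rule spacetime_integrableI)
  show "(\<lambda>z. f z * g z) \<in> borel_measurable (MS T)"
    using f g by (intro borel_measurable_times) (auto simp: slice_bounded_def)
  have 1: "AE t in MT T. L2 (slice f t) \<and> (LINT x|M3. (slice f t x)\<^sup>2) \<le> U"
    and 2: "AE t in MT T. L2 (slice g t) \<and> (LINT x|M3. (slice g t x)\<^sup>2) \<le> U'"
    using f g by (auto simp: slice_bounded_def)
  show "AE t in MT T. integrable M3 (\<lambda>x. f (x, t) * g (x, t)) \<and> (LINT x|M3. \<bar>f (x, t) * g (x, t)\<bar>) \<le> U + U'"
    using 1 2
  proof eventually_elim
    case (elim t)
    have i: "integrable M3 (\<lambda>x. f (x, t) * g (x, t))"
      using L2_mult_integrable[of "slice f t" "slice g t"] elim by (simp add: slice_def)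
    have s: "integrable M3 (\<lambda>x. (f (x, t))\<^sup>2)" "integrable M3 (\<lambda>x. (g (x, t))\<^sup>2)"
      using elim by (simp_all add: L2_def slice_def)
    have "(LINT x|M3. \<bar>f (x, t) * g (x, t)\<bar>) \<le> (LINT x|M3. (f (x, t))\<^sup>2 + (g (x, t))\<^sup>2)"
      using i s by (intro integral_mono abs_mult_le_squares) auto
    also have "\<dots> \<le> U + U'" using s elim by (simp add: slice_def)
    finally show ?case using i by simp
  qed
qed

lemma slice_bounded_const: "slice_bounded T ((2 * pi) ^ 3) (\<lambda>z. 1)"
  using integral_M3_const[of "1::real"] L2_continuous[of "\<lambda>x. 1"]
  by (simp add: slice_bounded_def slice_def)

lemma slice_bounded_integrable: "slice_bounded T U f \<Longrightarrow> integrable (MS T) f"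
  using slice_bounded_mult[OF _ slice_bounded_const, of T U f] by simp

lemma slice_bounded_filtered:
  assumes a: "\<alpha> > 0" and f: "slice_bounded T U f"
  shows "slice_bounded T U (\<lambda>z. torus_multiplier (helm \<alpha>) (slice f (snd z)) (fst z))"
  unfolding slice_bounded_def
proof
  show "(\<lambda>z. torus_multiplier (helm \<alpha>) (slice f (snd z)) (fst z)) \<in> borel_measurable (MS T)"
    by (rule filtered_measurable[OF a slice_bounded_integrable[OF f]]) (use f in \<open>auto simp: slice_bounded_def\<close>)
  have "AE t in MT T. L2 (slice f t) \<and> (LINT x|M3. (slice f t x)\<^sup>2) \<le> U" using f by (auto simp: slice_bounded_def)
  then show "AE t in MT T. L2 (slice (\<lambda>z. torus_multiplier (helm \<alpha>) (slice f (snd z)) (fst z)) t) \<and>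
      (LINT x|M3. (slice (\<lambda>z. torus_multiplier (helm \<alpha>) (slice f (snd z)) (fst z)) t x)\<^sup>2) \<le> U"
  proof eventually_elim
    case (elim t)
    have e: "slice (\<lambda>z. torus_multiplier (helm \<alpha>) (slice f (snd z)) (fst z)) t = torus_multiplier (helm \<alpha>) (slice f t)"
      by (simp add: slice_def)
    show ?case unfolding e using helm_L2[OF a, of "slice f t"] elim by auto
  qed
qed

lemma torus_Lp_norm_2: "(torus_Lp_norm 2 g)\<^sup>2 = (LINT x|M3. (norm (g x))\<^sup>2)"
proof -
  have "0 \<le> (LINT x|M3. (norm (g x))\<^sup>2)" by (rule Bochner_Integration.integral_nonneg) simp
  then show ?thesis by (simp add: torus_Lp_norm_def powr_half_sqrt)
qed

lemma Linf_L2_slice_bounded: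
  assumes "Linf_Lp T 2 f"
  shows "\<exists>U. slice_bounded T U f"
proof -
  obtain C where m: "f \<in> borel_measurable (MS T)" and C: "AE t in MT T. slice f t \<in> borel_measurable M3 \<and>
      integrable M3 (\<lambda>x. norm (slice f t x) powr 2) \<and> torus_Lp_norm 2 (slice f t) \<le> C"
    using assms unfolding Linf_Lp_def by blast
  from C have "AE t in MT T. L2 (slice f t) \<and> (LINT x|M3. (slice f t x)\<^sup>2) \<le> C\<^sup>2"
  proof eventually_elim
    case (elim t)
    have "0 \<le> torus_Lp_norm 2 (slice f t)" by (simp add: torus_Lp_norm_def)
    then have "(torus_Lp_norm 2 (slice f t))\<^sup>2 \<le> C\<^sup>2" using elim by (intro power_mono) auto
    then show ?case using elim by (simp add: torus_Lp_norm_2 L2_def)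
  qed
  then show ?thesis using m unfolding slice_bounded_def by blast
qed

lemma Linf_L2_nth:
  assumes u: "Linf_Lp T 2 (u :: (real^3) \<times> real \<Rightarrow> real^3)"
  shows "Linf_Lp T 2 (\<lambda>z. u z $ i)"
proof -
  obtain C where m: "u \<in> borel_measurable (MS T)" and C: "AE t in MT T. slice u t \<in> borel_measurable M3 \<and>
      integrable M3 (\<lambda>x. norm (slice u t x) powr 2) \<and> torus_Lp_norm 2 (slice u t) \<le> C"
    using u unfolding Linf_Lp_def by blast
  have nth: "(\<lambda>v :: real^3. v $ i) \<in> borel_measurable borel"
    by (intro borel_measurable_continuous_onI continuous_intros)
  from C have "AE t in MT T. slice (\<lambda>z. u z $ i) t \<in> borel_measurable M3 \<and>
      integrable M3 (\<lambda>x. norm (slice (\<lambda>z. u z $ i) t x) powr 2) \<and> torus_Lp_norm 2 (slice (\<lambda>z. u z $ i) t) \<le> C"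
  proof eventually_elim
    case (elim t)
    have e: "slice (\<lambda>z. u z $ i) t = (\<lambda>x. slice u t x $ i)" by (simp add: slice_def)
    have m: "(\<lambda>x. slice u t x $ i) \<in> borel_measurable M3" using elim by (intro measurable_compose[OF _ nth]) simp
    have le: "(slice u t x $ i)\<^sup>2 \<le> (norm (slice u t x))\<^sup>2" for x
      using power_mono[OF component_le_norm_cart[of "slice u t x" i] abs_ge_zero, of 2] by simp
    have i: "integrable M3 (\<lambda>x. (norm (slice u t x))\<^sup>2)" using elim by simp
    have i2: "integrable M3 (\<lambda>x. (slice u t x $ i)\<^sup>2)"
      using le m by (intro Bochner_Integration.integrable_bound[OF i]) (auto intro: borel_measurable_power)
    have "(torus_Lp_norm 2 (\<lambda>x. slice u t x $ i))\<^sup>2 \<le> (torus_Lp_norm 2 (slice u t))\<^sup>2"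
      unfolding torus_Lp_norm_2 using i i2 le by (intro integral_mono) auto
    then have "torus_Lp_norm 2 (\<lambda>x. slice u t x $ i) \<le> torus_Lp_norm 2 (slice u t)"
      by (rule power2_le_imp_le) (simp add: torus_Lp_norm_def)
    then show ?case unfolding e using m i2 elim by auto
  qed
  moreover have "(\<lambda>z. u z $ i) \<in> borel_measurable (MS T)" by (rule measurable_compose[OF m nth])
  ultimately show ?thesis unfolding Linf_Lp_def by blast
qed

lemma Linf_L1_integrable:
  assumes "Linf_Lp T 1 (f :: (real^3) \<times> real \<Rightarrow> real)"
  shows "integrable (MS T) f"
proof -
  obtain C where m: "f \<in> borel_measurable (MS T)" and C: "AE t in MT T. slice f t \<in> borel_measurable M3 \<and>
      integrable M3 (\<lambda>x. norm (slice f t x) powr 1) \<and> torus_Lp_norm 1 (slice f t) \<le> C"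
    using assms unfolding Linf_Lp_def by blast
  show ?thesis
  proof (rule spacetime_integrableI[OF m])
    from C show "AE t in MT T. integrable M3 (\<lambda>x. f (x, t)) \<and> (LINT x|M3. \<bar>f (x, t)\<bar>) \<le> C"
    proof eventually_elim
      case (elim t)
      have "integrable M3 (\<lambda>x. norm (slice f t x))" using elim by simp
      then have i: "integrable M3 (slice f t)" using elim by (simp only: integrable_norm_iff)
      have "0 \<le> (LINT x|M3. \<bar>slice f t x\<bar>)" by (rule Bochner_Integration.integral_nonneg) simp
      then show ?case using i elim by (simp add: torus_Lp_norm_def slice_def)
    qed
  qed
qed

section \<open>A measurable minorant of the Besov norm\<close>

text \<open>A lower bound of the Besov norm, taken for each component of a field. Its measurability in time follows
from that of the Fourier coefficients, and with it the finiteness of the integral in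
\<^const>\<open>L3_Besov\<close> turns into integrability of a real function of time.\<close>

definition block_norm :: "(real^3 \<Rightarrow> real) \<Rightarrow> (real^3 \<Rightarrow> real) \<Rightarrow> real \<Rightarrow> (real^3 \<Rightarrow> real) \<Rightarrow> ennreal" where
  "block_norm \<eta> \<rho> s g = (SUP j. ennreal (2 powr ((real j - 1) * s) * (LINT x|M3. \<bar>lp_block \<eta> \<rho> (int j - 1) g x\<bar> ^ 3) powr (1 / 3)))"

lemma lp_block_continuous:
  fixes g :: "real^3 \<Rightarrow> real"
  assumes "dyadic_partition \<eta> \<rho>" shows "continuous_on UNIV (lp_block \<eta> \<rho> (int j - 1) g)"
  by (rule degree_le_continuous[OF lp_block_degree[OF assms]])

lemma lp_block_nth:
  fixes u :: "real^3 \<Rightarrow> real^3"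
  shows "lp_block \<eta> \<rho> j u x $ i = lp_block \<eta> \<rho> j (\<lambda>y. u y $ i) x"
  by (simp add: lp_block_def torus_multiplier_nth)

lemma block_norm_le_besov_aux:
  fixes G :: "real^3 \<Rightarrow> 'b::euclidean_space"
  assumes "\<And>j. (LINT x|M3. \<bar>lp_block \<eta> \<rho> (int j - 1) g x\<bar> ^ 3) \<le> (LINT x|M3. norm (lp_block \<eta> \<rho> (int j - 1) G x) ^ 3)"
  shows "block_norm \<eta> \<rho> s g \<le> besov_norm \<eta> \<rho> 3 s G"
  unfolding block_norm_def
proof (rule SUP_least)
  fix j :: nat
  have "(LINT x|M3. \<bar>lp_block \<eta> \<rho> (int j - 1) g x\<bar> ^ 3) powr (1 / 3) \<le> torus_Lp_norm 3 (lp_block \<eta> \<rho> (int j - 1) G)"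
    unfolding torus_Lp_norm_def using assms[of j] by (intro powr_mono2) (auto intro!: Bochner_Integration.integral_nonneg)
  then have "ennreal (2 powr ((real j - 1) * s) * (LINT x|M3. \<bar>lp_block \<eta> \<rho> (int j - 1) g x\<bar> ^ 3) powr (1 / 3))
     \<le> ennreal (2 powr (of_int (int j - 1) * s) * torus_Lp_norm 3 (lp_block \<eta> \<rho> (int j - 1) G))"
    by (intro ennreal_leI mult_mono) auto
  also have "\<dots> \<le> besov_norm \<eta> \<rho> 3 s G" unfolding besov_norm_def by (rule SUP_upper) simp
  finally show "ennreal (2 powr ((real j - 1) * s) * (LINT x|M3. \<bar>lp_block \<eta> \<rho> (int j - 1) g x\<bar> ^ 3) powr (1 / 3)) \<le> besov_norm \<eta> \<rho> 3 s G" .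
qed

lemma block_norm_le_besov: "block_norm \<eta> \<rho> s g \<le> besov_norm \<eta> \<rho> 3 s g"
  by (rule block_norm_le_besov_aux) simp

lemma block_norm_nth_le_besov:
  fixes u :: "real^3 \<Rightarrow> real^3"
  assumes dp: "dyadic_partition \<eta> \<rho>"
  shows "block_norm \<eta> \<rho> s (\<lambda>x. u x $ i) \<le> besov_norm \<eta> \<rho> 3 s u"
proof (rule block_norm_le_besov_aux)
  fix j :: nat
  have "continuous_on UNIV (\<lambda>x. \<chi> i. lp_block \<eta> \<rho> (int j - 1) (\<lambda>y. u y $ i) x)"
    by (intro continuous_on_vec_lambda lp_block_continuous[OF dp])
  then have c: "continuous_on UNIV (lp_block \<eta> \<rho> (int j - 1) u)"
    by (rule continuous_on_eq) (simp add: vec_eq_iff lp_block_nth)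
  show "(LINT x|M3. \<bar>lp_block \<eta> \<rho> (int j - 1) (\<lambda>x. u x $ i) x\<bar> ^ 3) \<le> (LINT x|M3. norm (lp_block \<eta> \<rho> (int j - 1) u x) ^ 3)"
    unfolding lp_block_nth[symmetric]
    by (intro integral_mono power_mono component_le_norm_cart continuous_integrable_M3 continuous_intros c) auto
qed

text \<open>A block is a finite sum of products of Fourier coefficients, which are measurable in time, with characters.\<close>

lemma block_norm_measurable:
  assumes dp: "dyadic_partition \<eta> \<rho>" and f: "integrable (MS T) f"
  shows "(\<lambda>t. block_norm \<eta> \<rho> s (slice f t)) \<in> borel_measurable (MT T)"
proof -
  interpret finite_measure M3 by (rule finite_M3)
  have "(\<lambda>t. LINT x|M3. \<bar>lp_block \<eta> \<rho> (int j - 1) (slice f t) x\<bar> ^ 3) \<in> borel_measurable (MT T)" for j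
  proof (rule borel_measurable_lebesgue_integral)
    have e: "lp_block \<eta> \<rho> (int j - 1) (slice f t) x
       = (\<Sum>k\<in>lattice_ball (2 ^ Suc j). lp_sym \<eta> \<rho> j (freq k) * (Re (fourier_coeff (slice f t) k) * cos (freq k \<bullet> x))
          - lp_sym \<eta> \<rho> j (freq k) * (Im (fourier_coeff (slice f t) k) * sin (freq k \<bullet> x)))" for t x
      using arg_cong[OF lp_block_expansion[OF dp order_refl, of j "slice f t" x], of Re]
      by (simp add: ch_def algebra_simps)
    have m: "(\<lambda>p. Re (fourier_coeff (slice f (fst p)) k)) \<in> borel_measurable (MT T \<Otimes>\<^sub>M M3)"
      "(\<lambda>p. Im (fourier_coeff (slice f (fst p)) k)) \<in> borel_measurable (MT T \<Otimes>\<^sub>M M3)" for k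
      by (rule measurable_compose[OF measurable_fst borel_measurable_integrable[OF fourier_coeff_time_integrable(1)[OF f]]]
          measurable_compose[OF measurable_fst borel_measurable_integrable[OF fourier_coeff_time_integrable(2)[OF f]]])+
    have c: "(\<lambda>p. cos (freq k \<bullet> snd p)) \<in> borel_measurable (MT T \<Otimes>\<^sub>M M3)"
      "(\<lambda>p. sin (freq k \<bullet> snd p)) \<in> borel_measurable (MT T \<Otimes>\<^sub>M M3)" for k
      by (rule measurable_compose[OF measurable_snd]; auto intro!: continuous_measurable_lebesgue_on continuous_intros)+
    have "(\<lambda>p. \<bar>\<Sum>k\<in>lattice_ball (2 ^ Suc j). lp_sym \<eta> \<rho> j (freq k) * (Re (fourier_coeff (slice f (fst p)) k) * cos (freq k \<bullet> snd p))
          - lp_sym \<eta> \<rho> j (freq k) * (Im (fourier_coeff (slice f (fst p)) k) * sin (freq k \<bullet> snd p))\<bar> ^ 3) \<in> borel_measurable (MT T \<Otimes>\<^sub>M M3)"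
      by (intro borel_measurable_power borel_measurable_abs borel_measurable_sum borel_measurable_diff borel_measurable_times borel_measurable_const m c)
    then show "case_prod (\<lambda>t x. \<bar>lp_block \<eta> \<rho> (int j - 1) (slice f t) x\<bar> ^ 3) \<in> borel_measurable (MT T \<Otimes>\<^sub>M M3)"
      by (simp add: e case_prod_unfold)
  qed
  note [measurable] = this
  show ?thesis unfolding block_norm_def by measurable
qed

lemma block_norm_bound:
  assumes B: "block_norm \<eta> \<rho> s g = ennreal B" and B0: "0 \<le> B"
  shows "(LINT x|M3. \<bar>lp_block \<eta> \<rho> (int j - 1) g x\<bar> ^ 3) \<le> (2 powr (- ((real j - 1) * s)) * B) ^ 3"
proof -
  let ?X = "LINT x|M3. \<bar>lp_block \<eta> \<rho> (int j - 1) g x\<bar> ^ 3"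
  have shift: "2 powr a * y \<le> B \<Longrightarrow> y \<le> 2 powr (- a) * B" for a y :: real
    by (simp add: powr_minus field_simps)
  have X0: "0 \<le> ?X" by (rule Bochner_Integration.integral_nonneg) simp
  have "ennreal (2 powr ((real j - 1) * s) * ?X powr (1 / 3)) \<le> ennreal B"
    unfolding B[symmetric] block_norm_def by (rule SUP_upper) simp
  then have "2 powr ((real j - 1) * s) * ?X powr (1 / 3) \<le> B" using B0 by simp
  then have "?X powr (1 / 3) \<le> 2 powr (- ((real j - 1) * s)) * B"
    by (rule shift)
  then have "(?X powr (1 / 3)) ^ 3 \<le> (2 powr (- ((real j - 1) * s)) * B) ^ 3" by (intro power_mono) auto
  moreover have "(?X powr (1 / 3)) ^ 3 = ?X"
    using X0 by (cases "?X = 0") (simp_all add: powr_powr flip: powr_realpow)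
  ultimately show ?thesis by simp
qed

lemma block_norm_time_bound:
  assumes dp: "dyadic_partition \<eta> \<rho>" and f: "integrable (MS T) f"
    and b: "(\<integral>\<^sup>+t. N t ^ 3 \<partial>MT T) < \<infinity>" and N: "\<And>t. block_norm \<eta> \<rho> s (slice f t) \<le> N t"
  obtains B where "\<And>t. 0 \<le> B t" "integrable (MT T) (\<lambda>t. B t ^ 3)"
    "AE t in MT T. \<forall>j. (LINT x|M3. \<bar>lp_block \<eta> \<rho> (int j - 1) (slice f t) x\<bar> ^ 3) \<le> (2 powr (- ((real j - 1) * s)) * B t) ^ 3"
proof
  let ?b = "\<lambda>t. block_norm \<eta> \<rho> s (slice f t)"
  let ?B = "\<lambda>t. enn2real (?b t)"
  note m = block_norm_measurable[OF dp f, of s]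
  have m3: "(\<lambda>t. ?b t ^ 3) \<in> borel_measurable (MT T)" using m by (rule borel_measurable_power_ennreal)
  have le: "(\<integral>\<^sup>+t. ?b t ^ 3 \<partial>MT T) < \<infinity>"
    using le_less_trans[OF nn_integral_mono b] N by (simp add: power_mono)
  have fin: "AE t in MT T. ?b t ^ 3 \<noteq> \<infinity>" by (rule nn_integral_PInf_AE[OF m3]) (use le in auto)
  have fin': "AE t in MT T. ?b t = ennreal (?B t)"
    using fin by eventually_elim (auto simp: less_top[symmetric] power_eq_top_ennreal ennreal_enn2real_if)
  show "0 \<le> ?B t" for t by simp
  show "AE t in MT T. \<forall>j. (LINT x|M3. \<bar>lp_block \<eta> \<rho> (int j - 1) (slice f t) x\<bar> ^ 3) \<le> (2 powr (- ((real j - 1) * s)) * ?B t) ^ 3"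
    using fin' by eventually_elim (blast intro: block_norm_bound enn2real_nonneg)
  show "integrable (MT T) (\<lambda>t. ?B t ^ 3)"
  proof (rule integrableI_nonneg)
    show "(\<lambda>t. ?B t ^ 3) \<in> borel_measurable (MT T)" using m by measurable
    have "(\<integral>\<^sup>+t. ennreal (?B t ^ 3) \<partial>MT T) = (\<integral>\<^sup>+t. ?b t ^ 3 \<partial>MT T)"
      using fin' by (intro nn_integral_cong_AE) (auto elim!: eventually_mono simp: ennreal_power[symmetric])
    then show "(\<integral>\<^sup>+t. ennreal (?B t ^ 3) \<partial>MT T) < \<infinity>" using le by simp
  qed simp
qed

section \<open>Quantities with an integrable rate of change\<close>

definition has_rate :: "real \<Rightarrow> (real \<Rightarrow> real) \<Rightarrow> (real \<Rightarrow> real) \<Rightarrow> bool" where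
  "has_rate T f g \<longleftrightarrow> integrable (MT T) g \<and> (\<exists>c. AE b in MT T. f b = c + (LINT s|MT T. (if s < b then g s else 0)))"

lemma has_rate_zero: "has_rate T (\<lambda>t. 0) (\<lambda>t. 0)"
  unfolding has_rate_def by (auto intro: exI[of _ 0])

lemma has_rate_add:
  assumes 1: "has_rate T f1 g1" and 2: "has_rate T f2 g2"
  shows "has_rate T (\<lambda>t. f1 t + f2 t) (\<lambda>t. g1 t + g2 t)"
proof -
  obtain c1 c2 where c1: "AE b in MT T. f1 b = c1 + (LINT s|MT T. (if s < b then g1 s else 0))"
    and c2: "AE b in MT T. f2 b = c2 + (LINT s|MT T. (if s < b then g2 s else 0))"
    using 1 2 unfolding has_rate_def by blast
  have i: "integrable (MT T) g1" "integrable (MT T) g2" using 1 2 unfolding has_rate_def by blast+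
  have split: "(LINT s|MT T. (if s < b then g1 s + g2 s else 0))
     = (LINT s|MT T. (if s < b then g1 s else 0)) + (LINT s|MT T. (if s < b then g2 s else 0))" for b
    unfolding Bochner_Integration.integral_add[OF if_less_integrable(1)[OF i(1)] if_less_integrable(1)[OF i(2)], symmetric]
    by (rule Bochner_Integration.integral_cong[OF refl]) simp
  have "AE b in MT T. f1 b + f2 b = (c1 + c2) + (LINT s|MT T. (if s < b then g1 s + g2 s else 0))"
    using c1 c2 by eventually_elim (simp add: split)
  then show ?thesis using i unfolding has_rate_def by auto
qed

lemma has_rate_mult:
  assumes 1: "has_rate T f g"
  shows "has_rate T (\<lambda>t. a * f t) (\<lambda>t. a * g t)"
proof -
  obtain c where c: "AE b in MT T. f b = c + (LINT s|MT T. (if s < b then g s else 0))"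
    using 1 unfolding has_rate_def by blast
  have i: "integrable (MT T) g" using 1 unfolding has_rate_def by blast
  have split: "(LINT s|MT T. (if s < b then a * g s else 0)) = a * (LINT s|MT T. (if s < b then g s else 0))" for b
    unfolding integral_mult_right_zero[symmetric] by (rule Bochner_Integration.integral_cong[OF refl]) simp
  have "AE b in MT T. a * f b = a * c + (LINT s|MT T. (if s < b then a * g s else 0))"
    using c by eventually_elim (simp add: split algebra_simps)
  then show ?thesis using i unfolding has_rate_def by auto
qed

lemma has_rate_sum:
  assumes "finite A" "\<And>a. a \<in> A \<Longrightarrow> has_rate T (f a) (g a)"
  shows "has_rate T (\<lambda>t. \<Sum>a\<in>A. f a t) (\<lambda>t. \<Sum>a\<in>A. g a t)"
  using assms(1)
proof (rule finite_subset_induct[OF _ order_refl])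
  show "has_rate T (\<lambda>t. \<Sum>a\<in>{}. f a t) (\<lambda>t. \<Sum>a\<in>{}. g a t)"
    unfolding sum.empty by (rule has_rate_zero)
next
  fix a F assume F: "finite F" "a \<in> A" "a \<notin> F" and IH: "has_rate T (\<lambda>t. \<Sum>a\<in>F. f a t) (\<lambda>t. \<Sum>a\<in>F. g a t)"
  show "has_rate T (\<lambda>t. \<Sum>a\<in>insert a F. f a t) (\<lambda>t. \<Sum>a\<in>insert a F. g a t)"
    unfolding sum.insert[OF F(1,3)] by (rule has_rate_add[OF assms(2)[OF F(2)] IH])
qed

text \<open>Each \<open>E\<^sub>n\<close> is within \<open>\<epsilon>\<^sub>n \<integral> M\<close> of a constant, so the limits at two times agree.\<close>

lemma vanishing_rate_conserved:
  assumes rate: "\<And>n::nat. has_rate T (E n) (g n)" and M: "integrable (MT T) M"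
    and bound: "\<And>n. AE t in MT T. \<bar>g n t\<bar> \<le> \<epsilon> n * M t" and \<epsilon>: "\<epsilon> \<longlonglongrightarrow> 0"
    and lim: "AE t in MT T. (\<lambda>n. E n t) \<longlonglongrightarrow> e t"
  shows "AE t1 in MT T. AE t2 in MT T. e t1 = e t2"
proof -
  have "\<forall>n. \<exists>c. AE b in MT T. E n b = c + (LINT s|MT T. (if s < b then g n s else 0))"
    using rate unfolding has_rate_def by blast
  from choice[OF this] obtain c where c: "\<forall>n. AE b in MT T. E n b = c n + (LINT s|MT T. (if s < b then g n s else 0))"
    by (rule exE)
  have gi: "integrable (MT T) (g n)" for n using rate unfolding has_rate_def by blast
  have small: "\<bar>LINT s|MT T. (if s < b then g n s else 0)\<bar> \<le> \<epsilon> n * (LINT s|MT T. M s)" for n b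
  proof -
    have "\<bar>LINT s|MT T. (if s < b then g n s else 0)\<bar> \<le> (LINT s|MT T. \<epsilon> n * M s)"
    proof (rule order_trans[OF integral_abs_bound], rule integral_mono_AE)
      show "integrable (MT T) (\<lambda>s. \<bar>if s < b then g n s else 0\<bar>)"
        by (intro integrable_abs if_less_integrable gi)
      show "AE s in MT T. \<bar>if s < b then g n s else 0\<bar> \<le> \<epsilon> n * M s"
        using bound[of n] by eventually_elim (auto intro: order_trans[OF abs_ge_zero])
    qed (use M in simp)
    then show ?thesis by simp
  qed
  have "AE b in MT T. \<forall>n. \<bar>E n b - c n\<bar> \<le> \<epsilon> n * (LINT s|MT T. M s)"
    unfolding AE_all_countable
  proof
    show "AE b in MT T. \<bar>E n b - c n\<bar> \<le> \<epsilon> n * (LINT s|MT T. M s)" for n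
      using spec[OF c, of n] by eventually_elim (simp add: small)
  qed
  then have good: "AE b in MT T. (\<lambda>n. E n b - c n) \<longlonglongrightarrow> 0 \<and> (\<lambda>n. E n b) \<longlonglongrightarrow> e b"
    using lim
  proof eventually_elim
    case (elim b)
    have z: "(\<lambda>n. \<epsilon> n * (LINT s|MT T. M s)) \<longlonglongrightarrow> 0" using tendsto_mult_right[OF \<epsilon>, of "LINT s|MT T. M s"] by simp
    have "(\<lambda>n. E n b - c n) \<longlonglongrightarrow> 0"
      by (rule Lim_null_comparison[OF _ z]) (use elim in simp)
    then show ?case using elim by simp
  qed
  show ?thesis
    using good
  proof eventually_elim
    case (elim t1)
    note 1 = elim
    show ?case using good
    proof eventually_elim
      case (elim t2)
      have "(\<lambda>n. (E n t1 - c n) - (E n t2 - c n)) \<longlonglongrightarrow> 0 - 0" by (intro tendsto_diff) (use 1 elim in auto)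
      moreover have "(\<lambda>n. (E n t1 - c n) - (E n t2 - c n)) \<longlonglongrightarrow> e t1 - e t2"
        using tendsto_diff[of "\<lambda>n. E n t1" "e t1" _ "\<lambda>n. E n t2" "e t2"] 1 elim by simp
      ultimately show ?case using LIMSEQ_unique by fastforce
    qed
  qed
qed

text \<open>Dominated convergence for series: the multipliers are bounded by 1, and they converge on every finite set
of frequencies.\<close>

lemma mollified_energy_tendsto:
  assumes f: "L2 f"
  shows "(\<lambda>n. \<Sum>k\<in>kset n. kap n k * (cmod (fourier_coeff f k))\<^sup>2) \<longlonglongrightarrow> (LINT x|M3. (f x)\<^sup>2) / vol3"
proof (rule LIMSEQ_I)
  let ?a = "\<lambda>k. (cmod (fourier_coeff f k))\<^sup>2" and ?S = "(LINT x|M3. (f x)\<^sup>2) / vol3"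
  fix e :: real assume e: "e > 0"
  have le: "sum ?a A \<le> ?S" if "finite A" for A using bessel[OF f that] vol3_pos by (simp add: field_simps)
  have "((\<lambda>A. sum ?a A) \<longlongrightarrow> ?S) (finite_subsets_at_top UNIV)" using parseval[OF f] by (simp add: has_sum_def)
  then have "eventually (\<lambda>A. dist (sum ?a A) ?S < e / 3) (finite_subsets_at_top UNIV)" by (rule tendstoD) (use e in simp)
  then obtain F where F: "finite F" "dist (sum ?a F) ?S < e / 3"
    unfolding eventually_finite_subsets_at_top by blast
  have "(\<lambda>n. \<Sum>k\<in>F. kap n k * ?a k) \<longlonglongrightarrow> (\<Sum>k\<in>F. 1 * ?a k)" by (intro tendsto_intros kap_tendsto)
  then have "\<forall>\<^sub>F n in sequentially. dist (\<Sum>k\<in>F. kap n k * ?a k) (\<Sum>k\<in>F. 1 * ?a k) < e / 3" by (rule tendstoD) (use e in simp)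
  then obtain N where N: "\<And>n. n \<ge> N \<Longrightarrow> dist (\<Sum>k\<in>F. kap n k * ?a k) (\<Sum>k\<in>F. ?a k) < e / 3"
    unfolding eventually_sequentially by auto
  show "\<exists>no. \<forall>n\<ge>no. norm ((\<Sum>k\<in>kset n. kap n k * ?a k) - ?S) < e"
  proof (intro exI[of _ N] allI impI)
    fix n assume n: "N \<le> n"
    have kn: "finite (kset n)" by simp
    have "(\<Sum>k\<in>kset n. kap n k * ?a k) = (\<Sum>k\<in>kset n \<union> F. kap n k * ?a k)"
      by (rule sum.mono_neutral_left) (use F(1) kn in \<open>auto simp: kset_def kap_def\<close>)
    also have "kset n \<union> F = F \<union> (kset n - F)" by auto
    also have "(\<Sum>k\<in>F \<union> (kset n - F). kap n k * ?a k) = (\<Sum>k\<in>F. kap n k * ?a k) + (\<Sum>k\<in>kset n - F. kap n k * ?a k)"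
      by (rule sum.union_disjoint) (use F(1) kn in auto)
    finally have split: "(\<Sum>k\<in>kset n. kap n k * ?a k) = (\<Sum>k\<in>F. kap n k * ?a k) + (\<Sum>k\<in>kset n - F. kap n k * ?a k)" .
    have "\<bar>\<Sum>k\<in>kset n - F. kap n k * ?a k\<bar> \<le> (\<Sum>k\<in>kset n - F. \<bar>kap n k * ?a k\<bar>)" by (rule sum_abs)
    also have "\<dots> \<le> (\<Sum>k\<in>kset n - F. ?a k)"
      by (intro sum_mono) (simp add: abs_mult mult_left_le_one_le abs_kap_le)
    also have "\<dots> = sum ?a (F \<union> (kset n - F)) - sum ?a F"
      by (subst sum.union_disjoint) (use F(1) kn in auto)
    also have "\<dots> \<le> ?S - sum ?a F" using le[of "F \<union> (kset n - F)"] F(1) kn by simp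
    finally have t: "\<bar>\<Sum>k\<in>kset n - F. kap n k * ?a k\<bar> \<le> ?S - sum ?a F" .
    show "norm ((\<Sum>k\<in>kset n. kap n k * ?a k) - ?S) < e"
      using t F(2) N[OF n] e unfolding split dist_real_def real_norm_def by linarith
  qed
qed

section \<open>Scalar conservation laws contained in the weak formulation\<close>

lemma integral_AE_measurable_on:
  fixes f g :: "'a::euclidean_space \<Rightarrow> real"
  assumes S: "S \<in> sets lebesgue" and g: "g \<in> borel_measurable (lebesgue_on S)"
    and ae: "AE x in lebesgue_on S. f x = g x"
  shows "integral\<^sup>L (lebesgue_on S) f = integral\<^sup>L (lebesgue_on S) g"
  by (rule integral_cong_AE[OF borel_measurable_AE_on[OF S g ae] g ae])

lemma test_function_measurable:
  fixes \<psi> :: "(real^3) \<times> real \<Rightarrow> real"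
  assumes "test_function T \<psi>"
  shows "dt \<psi> \<in> borel_measurable (MS T)" "dx i \<psi> \<in> borel_measurable (MS T)"
proof -
  have s: "smooth \<psi>" using assms by (simp add: test_function_def)
  show "dt \<psi> \<in> borel_measurable (MS T)" "dx i \<psi> \<in> borel_measurable (MS T)"
    unfolding dt_def[abs_def] dx_def[abs_def]
    by (intro continuous_measurable_lebesgue_on smooth_continuous smooth_deriv s spacetime_sets)+
qed

lemma vector_test_function:
  fixes \<psi> :: "(real^3) \<times> real \<Rightarrow> real"
  assumes t: "test_function T \<psi>"
  shows "test_function T (\<lambda>z. \<psi> z *\<^sub>R (axis j 1 :: real^3))" (is "test_function T ?\<Psi>")
    and "dt (\<lambda>z. \<psi> z *\<^sub>R (axis j 1 :: real^3)) z = dt \<psi> z *\<^sub>R axis j 1"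
    and "dx i (\<lambda>z. \<psi> z *\<^sub>R (axis j 1 :: real^3)) z = dx i \<psi> z *\<^sub>R axis j 1"
proof -
  have s: "smooth \<psi>" using t by (simp add: test_function_def)
  have bl: "bounded_linear (\<lambda>r::real. r *\<^sub>R (axis j 1 :: real^3))" by (rule bounded_linear_scaleR_left)
  have "smooth ?\<Psi>" by (rule smooth_bounded_linear[OF bl s])
  then show "test_function T ?\<Psi>" using t by (auto simp: test_function_def space_periodic_def)
  have "(?\<Psi> has_derivative (\<lambda>h. frechet_derivative \<psi> (at z) h *\<^sub>R axis j 1)) (at z)"
    by (rule bounded_linear.has_derivative[OF bl smooth_has_derivative[OF s]])
  note D = frechet_derivative_at[OF this, symmetric]
  show "dt ?\<Psi> z = dt \<psi> z *\<^sub>R axis j 1" "dx i ?\<Psi> z = dx i \<psi> z *\<^sub>R axis j 1"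
    unfolding dt_def dx_def D by simp_all
qed

lemma momentum_component:
  assumes w: "weak_solution \<alpha> K \<phi> \<theta> Y T u p Z" and t: "test_function T (\<psi> :: (real^3) \<times> real \<Rightarrow> real)"
  shows "(LINT z|MS T. u z $ j * dt \<psi> z
     + (\<Sum>i\<in>UNIV. (u z $ j * filtered \<alpha> u z $ i + (if i = j then p z else 0)) * dx i \<psi> z)) = 0"
proof -
  have "(LINT z|MS T. u z \<bullet> dt (\<lambda>z. \<psi> z *\<^sub>R (axis j 1 :: real^3)) z
     + (\<Sum>i\<in>UNIV. \<Sum>j'\<in>UNIV. u z $ j' * filtered \<alpha> u z $ i * dx i (\<lambda>z. \<psi> z *\<^sub>R (axis j 1 :: real^3)) z $ j')
     + p z * (\<Sum>i\<in>UNIV. dx i (\<lambda>z. \<psi> z *\<^sub>R (axis j 1 :: real^3)) z $ i)) = 0"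
    using w vector_test_function(1)[OF t, of j] unfolding weak_solution_def Let_def by blast
  moreover have "u z \<bullet> dt (\<lambda>z. \<psi> z *\<^sub>R (axis j 1 :: real^3)) z
     + (\<Sum>i\<in>UNIV. \<Sum>j'\<in>UNIV. u z $ j' * filtered \<alpha> u z $ i * dx i (\<lambda>z. \<psi> z *\<^sub>R (axis j 1 :: real^3)) z $ j')
     + p z * (\<Sum>i\<in>UNIV. dx i (\<lambda>z. \<psi> z *\<^sub>R (axis j 1 :: real^3)) z $ i)
     = u z $ j * dt \<psi> z + (\<Sum>i\<in>UNIV. (u z $ j * filtered \<alpha> u z $ i + (if i = j then p z else 0)) * dx i \<psi> z)" for z
  proof -
    have a: "axis j (1::real) $ m = (if m = j then 1 else 0)" for m by (simp add: axis_def)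
    show ?thesis
      unfolding vector_test_function(2,3)[OF t]
      by (simp add: inner_axis a distrib_right sum.distrib if_distrib[where f = "\<lambda>c. c * _"] if_distrib[where f = "\<lambda>c. _ * c"] sum.delta cong: if_cong)
  qed
  ultimately show ?thesis by simp
qed

lemma reactant_equation:
  assumes w: "weak_solution \<alpha> K \<phi> \<theta> Y T u p Z" and t: "test_function T (\<psi> :: (real^3) \<times> real \<Rightarrow> real)"
    and mZ: "Z \<in> borel_measurable (MS T)" and mu: "\<And>i. (\<lambda>z. u z $ i) \<in> borel_measurable (MS T)"
  shows "(LINT z|MS T. Z z * dt \<psi> z + (\<Sum>i\<in>UNIV. (Z z * u z $ i) * dx i \<psi> z)) = 0"
proof -
  have 0: "AE z in MS T. K * \<phi> (\<theta> z) * Y z = 0" using w by (simp add: weak_solution_def)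
  have eq: "(LINT z|MS T. Z z * dt \<psi> z + Z z * (\<Sum>i\<in>UNIV. u z $ i * dx i \<psi> z) + K * \<phi> (\<theta> z) * Y z * \<psi> z) = 0"
    using w t unfolding weak_solution_def Let_def by blast
  have m: "(\<lambda>z. Z z * dt \<psi> z + (\<Sum>i\<in>UNIV. (Z z * u z $ i) * dx i \<psi> z)) \<in> borel_measurable (MS T)"
    by (intro borel_measurable_add borel_measurable_times borel_measurable_sum mZ mu test_function_measurable t)
  have "AE z in MS T. Z z * dt \<psi> z + Z z * (\<Sum>i\<in>UNIV. u z $ i * dx i \<psi> z) + K * \<phi> (\<theta> z) * Y z * \<psi> z
      = Z z * dt \<psi> z + (\<Sum>i\<in>UNIV. (Z z * u z $ i) * dx i \<psi> z)"
    using 0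
  proof eventually_elim
    case (elim z)
    have "K * \<phi> (\<theta> z) * Y z * \<psi> z = 0" unfolding elim by simp
    then show ?case by (simp add: sum_distrib_left mult.assoc)
  qed
  from integral_AE_measurable_on[OF spacetime_sets m this] eq show ?thesis by simp
qed

lemma velocity_divergence_free:
  assumes dp: "dyadic_partition \<eta> \<rho>" and T: "T > 0" and a: "\<alpha> > 0"
    and w: "weak_solution \<alpha> K \<phi> \<theta> Y T u p Z" and u: "\<And>i. slice_bounded T U (\<lambda>z. u z $ i)"
  shows "AE t in MT T. \<forall>k. (\<Sum>i\<in>UNIV. of_int (k $ i) * fourier_coeff (slice (\<lambda>z. u z $ i) t) k) = 0"
proof -
  let ?v = "\<lambda>i z. torus_multiplier (helm \<alpha>) (slice (\<lambda>z. u z $ i) (snd z)) (fst z)"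
  have v: "filtered \<alpha> u z $ i = ?v i z" for z i by (cases z) (simp add: filtered_nth)
  have "AE t in MT T. \<forall>k. (\<Sum>i\<in>UNIV. of_int (k $ i) * fourier_coeff (slice (?v i) t) k) = 0"
  proof (rule divergence_free_coeff[OF dp T])
    show "integrable (MS T) (?v i)" for i by (rule slice_bounded_integrable[OF slice_bounded_filtered[OF a u]])
    show "(LINT z|MS T. (\<Sum>i\<in>UNIV. ?v i z * dx i \<psi> z)) = 0" if "test_function T \<psi>" for \<psi>
      using w that unfolding weak_solution_def Let_def v by blast
  qed
  moreover have "AE t in MT T. \<forall>i\<in>UNIV. L2 (slice (\<lambda>z. u z $ i) t)"
    by (rule AE_finite_allI) (use u in \<open>auto simp: slice_bounded_def elim!: eventually_mono\<close>)
  ultimately show ?thesis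
  proof eventually_elim
    case (elim t)
    show ?case
    proof
      fix k
      have "slice (?v i) t = torus_multiplier (helm \<alpha>) (slice (\<lambda>z. u z $ i) t)" for i by (simp add: slice_def)
      then have "(\<Sum>i\<in>UNIV. of_int (k $ i) * (of_real (helm \<alpha> (freq k)) * fourier_coeff (slice (\<lambda>z. u z $ i) t) k)) = 0"
        using elim fourier_coeff_helm[OF a] by auto
      then have "of_real (helm \<alpha> (freq k)) * (\<Sum>i\<in>UNIV. of_int (k $ i) * fourier_coeff (slice (\<lambda>z. u z $ i) t) k) = 0"
        by (simp add: sum_distrib_left algebra_simps)
      then show "(\<Sum>i\<in>UNIV. of_int (k $ i) * fourier_coeff (slice (\<lambda>z. u z $ i) t) k) = 0"
        using helm_bounds(1)[of \<alpha> "freq k"] by auto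
    qed
  qed
qed

section \<open>Energy balance of the mollified fields\<close>

lemma reactant_energy_rate:
  assumes dp: "dyadic_partition \<eta> \<rho>" and T: "T > 0"
    and w: "weak_solution \<alpha> K \<phi> \<theta> Y T u p Z"
    and Z: "slice_bounded T U Z" and u: "\<And>i. slice_bounded T U (\<lambda>z. u z $ i)"
  shows "has_rate T (\<lambda>t. \<Sum>k\<in>kset n. kap n k * (cmod (fourier_coeff (slice Z t) k))\<^sup>2)
           (\<lambda>t. 2 * flux n (slice Z t) (\<lambda>i. slice (\<lambda>z. u z $ i) t))"
proof -
  let ?G = "\<lambda>k t. \<Sum>i\<in>UNIV. of_int (k $ i) * Im (cnj (fourier_coeff (slice Z t) k) * fourier_coeff (slice (\<lambda>z. Z z * u z $ i) t) k)"
  have mZ: "Z \<in> borel_measurable (MS T)" and mu: "(\<lambda>z. u z $ i) \<in> borel_measurable (MS T)" for i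
    using Z u by (simp_all add: slice_bounded_def)
  note law = fourier_energy_law[OF dp T slice_bounded_integrable[OF Z] slice_bounded_mult[OF Z u] reactant_equation[OF w _ mZ mu]]
  have "has_rate T (\<lambda>t. (cmod (fourier_coeff (slice Z t) k))\<^sup>2) (\<lambda>t. 2 * ?G k t)" for k
    unfolding has_rate_def using law[of k] by simp
  then have "has_rate T (\<lambda>t. \<Sum>k\<in>kset n. kap n k * (cmod (fourier_coeff (slice Z t) k))\<^sup>2) (\<lambda>t. \<Sum>k\<in>kset n. kap n k * (2 * ?G k t))"
    by (intro has_rate_sum has_rate_mult finite_kset)
  moreover have "(\<Sum>k\<in>kset n. kap n k * (2 * ?G k t)) = 2 * flux n (slice Z t) (\<lambda>i. slice (\<lambda>z. u z $ i) t)" for t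
    unfolding flux_def by (simp add: slice_def sum_distrib_left mult.left_commute)
  ultimately show ?thesis by simp
qed

text \<open>The rate contains the pressure through \<open>\<Sum>\<^sub>j k\<^sub>j Im(cnj \<F>u\<^sub>j(k) \<F>p(k))\<close>, which vanishes because \<open>u\<close> is
divergence free. This holds for the sum over the components only, and almost everywhere in time.\<close>

lemma velocity_energy_rate:
  assumes dp: "dyadic_partition \<eta> \<rho>" and T: "T > 0" and a: "\<alpha> > 0"
    and w: "weak_solution \<alpha> K \<phi> \<theta> Y T u p Z"
    and u: "\<And>i. slice_bounded T U (\<lambda>z. u z $ i)" and p: "integrable (MS T) p"
  obtains g where "has_rate T (\<lambda>t. \<Sum>j\<in>UNIV. \<Sum>k\<in>kset n. kap n k * (cmod (fourier_coeff (slice (\<lambda>z. u z $ j) t) k))\<^sup>2) g"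
    and "AE t in MT T. g t = 2 * (\<Sum>j\<in>UNIV. flux n (slice (\<lambda>z. u z $ j) t) (\<lambda>i. torus_multiplier (helm \<alpha>) (slice (\<lambda>z. u z $ i) t)))"
proof -
  let ?u = "\<lambda>j z. u z $ j" and ?v = "\<lambda>i z. torus_multiplier (helm \<alpha>) (slice (\<lambda>z. u z $ i) (snd z)) (fst z)"
  let ?P = "\<lambda>j i z. if i = j then p z else 0"
  let ?q = "\<lambda>j i z. ?u j z * ?v i z + ?P j i z"
  let ?c = "\<lambda>j t. fourier_coeff (slice (?u j) t)"
  let ?G = "\<lambda>j k t. \<Sum>i\<in>UNIV. of_int (k $ i) * Im (cnj (?c j t k) * fourier_coeff (slice (?q j i) t) k)"
  let ?H = "\<lambda>j k t. \<Sum>i\<in>UNIV. of_int (k $ i) * Im (cnj (?c j t k) * fourier_coeff (slice (\<lambda>z. ?u j z * ?v i z) t) k)"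
  have v: "filtered \<alpha> u z $ i = ?v i z" for z i by (cases z) (simp add: filtered_nth)
  have ip: "integrable (MS T) (?P j i)" for j i using p by (cases "i = j") simp_all
  have iv: "integrable (MS T) (\<lambda>z. ?u j z * ?v i z)" for j i
    by (rule slice_bounded_mult[OF u slice_bounded_filtered[OF a u]])
  have iq: "integrable (MS T) (?q j i)" for j i by (rule Bochner_Integration.integrable_add[OF iv ip])
  have "has_rate T (\<lambda>t. (cmod (?c j t k))\<^sup>2) (\<lambda>t. 2 * ?G j k t)" for j k
    unfolding has_rate_def
    using fourier_energy_law[OF dp T slice_bounded_integrable[OF u[of j]] iq[of j] momentum_component[OF w, where j = j, unfolded v], of k]
    by simp
  then have rate: "has_rate T (\<lambda>t. \<Sum>j\<in>UNIV. \<Sum>k\<in>kset n. kap n k * (cmod (?c j t k))\<^sup>2)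
      (\<lambda>t. \<Sum>j\<in>UNIV. \<Sum>k\<in>kset n. kap n k * (2 * ?G j k t))"
    by (intro has_rate_sum has_rate_mult finite_kset finite_class.finite_UNIV)
  have sq: "AE t in MT T. \<forall>j\<in>UNIV. \<forall>i\<in>UNIV. integrable M3 (slice (?q j i) t)"
    by (intro AE_finite_allI finite_class.finite_UNIV) (unfold slice_def, rule spacetime_fubini(1)[OF iq, unfolded slice_def])
  have sp: "AE t in MT T. integrable M3 (slice p t)" unfolding slice_def by (rule spacetime_fubini(1)[OF p])
  have "AE t in MT T. (\<Sum>j\<in>UNIV. \<Sum>k\<in>kset n. kap n k * (2 * ?G j k t))
     = 2 * (\<Sum>j\<in>UNIV. flux n (slice (\<lambda>z. u z $ j) t) (\<lambda>i. torus_multiplier (helm \<alpha>) (slice (\<lambda>z. u z $ i) t)))"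
    using sq sp velocity_divergence_free[OF dp T a w u]
  proof eventually_elim
    case (elim t)
    have coeff: "fourier_coeff (slice (?q j i) t) k
        = fourier_coeff (slice (\<lambda>z. ?u j z * ?v i z) t) k + (if i = j then fourier_coeff (slice p t) k else 0)" for j i k
    proof (cases "i = j")
      case True
      have "fourier_coeff (\<lambda>x. slice (?q j i) t x - slice p t x) k = fourier_coeff (slice (?q j i) t) k - fourier_coeff (slice p t) k"
        by (rule fourier_coeff_diff) (use elim in auto)
      moreover have "(\<lambda>x. slice (?q j i) t x - slice p t x) = slice (\<lambda>z. ?u j z * ?v i z) t"
        using True by (simp add: slice_def fun_eq_iff)
      ultimately show ?thesis using True by simp
    qed simp
    have press: "(\<Sum>j\<in>UNIV. of_int (k $ j) * Im (cnj (?c j t k) * X)) = 0" for k X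
    proof -
      have "(\<Sum>j\<in>UNIV. of_int (k $ j) * (cnj (?c j t k) * X)) = cnj (\<Sum>j\<in>UNIV. of_int (k $ j) * ?c j t k) * X"
        by (simp add: sum_distrib_right mult.assoc)
      also have "\<dots> = 0" using elim(3) by simp
      finally have "Im (\<Sum>j\<in>UNIV. of_int (k $ j) * (cnj (?c j t k) * X)) = 0" by simp
      moreover have "Im (of_int m * y) = of_int m * Im y" for m y by simp
      ultimately show ?thesis by (simp only: Im_sum)
    qed
    have GH: "?G j k t = ?H j k t + of_int (k $ j) * Im (cnj (?c j t k) * fourier_coeff (slice p t) k)" for j k
    proof -
      have "?G j k t = (\<Sum>i\<in>UNIV. of_int (k $ i) * Im (cnj (?c j t k) * fourier_coeff (slice (\<lambda>z. ?u j z * ?v i z) t) k)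
          + (if i = j then of_int (k $ i) * Im (cnj (?c j t k) * fourier_coeff (slice p t) k) else 0))"
        unfolding coeff by (rule sum.cong[OF refl]) (simp add: distrib_left)
      then show ?thesis by (simp only: sum.distrib sum.delta finite_class.finite_UNIV UNIV_I if_True)
    qed
    have "(\<Sum>j\<in>UNIV. ?G j k t) = (\<Sum>j\<in>UNIV. ?H j k t)" for k
      unfolding GH sum.distrib press by simp
    then have "(\<Sum>k\<in>kset n. 2 * (kap n k * (\<Sum>j\<in>UNIV. ?G j k t))) = (\<Sum>k\<in>kset n. 2 * (kap n k * (\<Sum>j\<in>UNIV. ?H j k t)))"
      by simp
    then have "(\<Sum>j\<in>UNIV. \<Sum>k\<in>kset n. kap n k * (2 * ?G j k t)) = 2 * (\<Sum>j\<in>UNIV. \<Sum>k\<in>kset n. kap n k * ?H j k t)"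
      by (subst (1 2) sum.swap) (simp only: sum_distrib_left mult.left_commute)
    then show ?case unfolding flux_def by (simp only: slice_def fst_conv snd_conv)
  qed
  with rate show ?thesis by (rule that)
qed

lemma torus_Lp_norm_2_components:
  assumes "\<And>i. L2 (\<lambda>x. g x $ i)"
  shows "(torus_Lp_norm 2 (g :: real^3 \<Rightarrow> real^3))\<^sup>2 = (\<Sum>i\<in>UNIV. LINT x|M3. (g x $ i)\<^sup>2)"
proof -
  have "(norm (g x))\<^sup>2 = (\<Sum>i\<in>UNIV. (g x $ i)\<^sup>2)" for x
    unfolding power2_norm_eq_inner inner_vec_def by (simp add: power2_eq_square)
  then show ?thesis using assms by (simp add: torus_Lp_norm_2 L2_def)
qed

theorem theorem7p1:
  fixes T \<alpha> K s r :: real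
    and \<phi> :: "real \<Rightarrow> real"
    and \<theta> Y p Z :: "(real^3) \<times> real \<Rightarrow> real"
    and u :: "(real^3) \<times> real \<Rightarrow> real^3"
    and \<eta> \<rho> :: "real^3 \<Rightarrow> real"
  assumes "T > 0" and "\<alpha> > 0"
    and "mono_on {0..} \<phi>" and "\<exists>L. L-lipschitz_on {0..} \<phi>" and "\<forall>x\<ge>0. \<phi> x \<ge> 0"
    and "space_periodic \<theta>" and "space_periodic Y"
    and "AE z in lebesgue_on (spacetime T). \<theta> z \<ge> 0"
    and "dyadic_partition \<eta> \<rho>"
    and "weak_solution \<alpha> K \<phi> \<theta> Y T u p Z"
    and "L3_Besov \<eta> \<rho> T s u" and "L3_Besov \<eta> \<rho> T r Z"
    and "s > 0" and "r > 0" and "s + 2 * r > 1"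
  shows "AE t1 in lebesgue_on {0<..<T}. AE t2 in lebesgue_on {0<..<T}.
           (torus_Lp_norm 2 (slice u t1))\<^sup>2 + (torus_Lp_norm 2 (slice Z t1))\<^sup>2
         = (torus_Lp_norm 2 (slice u t2))\<^sup>2 + (torus_Lp_norm 2 (slice Z t2))\<^sup>2"
proof -
  note T = \<open>T > 0\<close> and a = \<open>\<alpha> > 0\<close> and dp = \<open>dyadic_partition \<eta> \<rho>\<close> and w = \<open>weak_solution \<alpha> K \<phi> \<theta> Y T u p Z\<close>
  have Lu: "Linf_Lp T 2 u" and Lp: "Linf_Lp T 1 p" and LZ: "Linf_Lp T 2 Z"
    using w by (simp_all add: weak_solution_def)
  let ?u = "\<lambda>i z. u z $ i"
  let ?v = "\<lambda>t i. torus_multiplier (helm \<alpha>) (slice (?u i) t)"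
  obtain UZ where UZ: "slice_bounded T UZ Z" using Linf_L2_slice_bounded[OF LZ] by blast
  have "\<forall>i. \<exists>U. slice_bounded T U (?u i)" using Linf_L2_slice_bounded[OF Linf_L2_nth[OF Lu]] by blast
  from choice[OF this] obtain Uu where Uu: "\<forall>i. slice_bounded T (Uu i) (?u i)" by (rule exE)
  define U where "U = \<bar>UZ\<bar> + (\<Sum>i\<in>UNIV. \<bar>Uu i\<bar>)"
  have Uu_le: "Uu i \<le> U" for i
    using member_le_sum[of i UNIV "\<lambda>i. \<bar>Uu i\<bar>"] unfolding U_def by simp
  have Z: "slice_bounded T U Z" by (rule slice_bounded_mono[OF UZ]) (simp add: U_def sum_nonneg add_increasing2)
  have u: "slice_bounded T U (?u i)" for i by (rule slice_bounded_mono[OF spec[OF Uu] Uu_le])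
  note iZ = slice_bounded_integrable[OF Z] and iu = slice_bounded_integrable[OF u] and ip = Linf_L1_integrable[OF Lp]

  obtain BZ where BZ: "\<And>t. 0 \<le> BZ t" "integrable (MT T) (\<lambda>t. BZ t ^ 3)"
    "AE t in MT T. \<forall>j. (LINT x|M3. \<bar>lp_block \<eta> \<rho> (int j - 1) (slice Z t) x\<bar> ^ 3) \<le> (2 powr (- ((real j - 1) * r)) * BZ t) ^ 3"
    using block_norm_time_bound[OF dp iZ \<open>L3_Besov \<eta> \<rho> T r Z\<close>[unfolded L3_Besov_def] block_norm_le_besov] by blast
  have "\<exists>B. (\<forall>t. 0 \<le> B t) \<and> integrable (MT T) (\<lambda>t. B t ^ 3) \<and>
    (AE t in MT T. \<forall>j. (LINT x|M3. \<bar>lp_block \<eta> \<rho> (int j - 1) (slice (?u i) t) x\<bar> ^ 3) \<le> (2 powr (- ((real j - 1) * s)) * B t) ^ 3)" for i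
  proof -
    have "block_norm \<eta> \<rho> s (slice (?u i) t) \<le> besov_norm \<eta> \<rho> 3 s (slice u t)" for t
      using block_norm_nth_le_besov[OF dp, of s "slice u t" i] by (simp add: slice_def)
    from dp iu[of i] \<open>L3_Besov \<eta> \<rho> T s u\<close>[unfolded L3_Besov_def] this show ?thesis
      by (rule block_norm_time_bound) (intro exI conjI allI)
  qed
  then have "\<forall>i. \<exists>B. (\<forall>t. 0 \<le> B t) \<and> integrable (MT T) (\<lambda>t. B t ^ 3) \<and>
    (AE t in MT T. \<forall>j. (LINT x|M3. \<bar>lp_block \<eta> \<rho> (int j - 1) (slice (?u i) t) x\<bar> ^ 3) \<le> (2 powr (- ((real j - 1) * s)) * B t) ^ 3)" by (rule allI)
  from choice[OF this] obtain Bu where Bu: "\<forall>i. (\<forall>t. 0 \<le> Bu i t) \<and> integrable (MT T) (\<lambda>t. Bu i t ^ 3) \<and>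
    (AE t in MT T. \<forall>j. (LINT x|M3. \<bar>lp_block \<eta> \<rho> (int j - 1) (slice (?u i) t) x\<bar> ^ 3) \<le> (2 powr (- ((real j - 1) * s)) * Bu i t) ^ 3)"
    by (rule exE)
  have Bu0: "0 \<le> Bu i t" and Bui: "integrable (MT T) (\<lambda>t. Bu i t ^ 3)"
    and Bub: "AE t in MT T. \<forall>j. (LINT x|M3. \<bar>lp_block \<eta> \<rho> (int j - 1) (slice (?u i) t) x\<bar> ^ 3) \<le> (2 powr (- ((real j - 1) * s)) * Bu i t) ^ 3" for i t
    using Bu by blast+
  define S where "S t = (\<Sum>i\<in>UNIV. Bu i t ^ 3)" for t
  have S0: "0 \<le> S t" for t unfolding S_def by (intro sum_nonneg zero_le_power Bu0)

  obtain C1 \<delta>1 where C1: "C1 \<ge> 0" "\<delta>1 > 0" and flux1: "\<forall>n\<ge>3. \<forall>g w Bg Bw. L2 g \<longrightarrow> (\<forall>i. L2 (w i)) \<longrightarrow>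
     (\<forall>k. (\<Sum>i\<in>UNIV. of_int (k $ i) * fourier_coeff (w i) k) = 0) \<longrightarrow> Bg \<ge> 0 \<longrightarrow> Bw \<ge> 0 \<longrightarrow>
     (\<forall>j. (LINT x|M3. \<bar>lp_block \<eta> \<rho> (int j - 1) g x\<bar> ^ 3) \<le> (2 powr (- ((real j - 1) * r)) * Bg) ^ 3) \<longrightarrow>
     (\<forall>i j. (LINT x|M3. \<bar>lp_block \<eta> \<rho> (int j - 1) (w i) x\<bar> ^ 3) \<le> (2 powr (- ((real j - 1) * s)) * Bw) ^ 3) \<longrightarrow>
     \<bar>flux (Suc n) g w\<bar> \<le> C1 * (Bg ^ 3 + Bw ^ 3) * real n powr (- \<delta>1 / 2)"
    using reactant_flux_bound[OF dp \<open>s > 0\<close> \<open>r > 0\<close> \<open>s + 2 * r > 1\<close>] by blast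
  obtain C2 \<delta>2 where C2: "C2 \<ge> 0" "\<delta>2 > 0" and flux2: "\<forall>n\<ge>3. \<forall>g u Bg U. L2 g \<longrightarrow> (\<forall>i. L2 (u i)) \<longrightarrow>
     (\<forall>k. (\<Sum>i\<in>UNIV. of_int (k $ i) * fourier_coeff (u i) k) = 0) \<longrightarrow> Bg \<ge> 0 \<longrightarrow>
     (\<forall>j. (LINT x|M3. \<bar>lp_block \<eta> \<rho> (int j - 1) g x\<bar> ^ 3) \<le> (2 powr (- ((real j - 1) * s)) * Bg) ^ 3) \<longrightarrow>
     (\<forall>i. (LINT x|M3. (u i x)\<^sup>2) \<le> U) \<longrightarrow>
     \<bar>flux (Suc n) g (\<lambda>i. torus_multiplier (helm \<alpha>) (u i))\<bar> \<le> C2 * (Bg ^ 3 + 1 + U\<^sup>2) * real n powr (- \<delta>2 / 2)"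
    using velocity_flux_bound[OF dp \<open>s > 0\<close> a] by blast

  \<comment> \<open>The flux bounds hold from \<open>n = 3\<close> on, hence the shift of the index by 4.\<close>
  define E where "E n t = (\<Sum>j\<in>UNIV. \<Sum>k\<in>kset (n + 4). kap (n + 4) k * (cmod (fourier_coeff (slice (?u j) t) k))\<^sup>2)
      + (\<Sum>k\<in>kset (n + 4). kap (n + 4) k * (cmod (fourier_coeff (slice Z t) k))\<^sup>2)" for n t
  define e where "e t = (\<Sum>j\<in>UNIV. (LINT x|M3. (slice (?u j) t x)\<^sup>2) / vol3) + (LINT x|M3. (slice Z t x)\<^sup>2) / vol3" for t
  define \<epsilon> where "\<epsilon> n = real (n + 3) powr (- \<delta>1 / 2) + real (n + 3) powr (- \<delta>2 / 2)" for n
  define M where "M t = 2 * (C1 * (BZ t ^ 3 + S t)) + 2 * (\<Sum>j\<in>UNIV. C2 * (Bu j t ^ 3 + 1 + U\<^sup>2))" for t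

  have static: "AE t in MT T. (\<forall>i. L2 (slice (?u i) t) \<and> (LINT x|M3. (slice (?u i) t x)\<^sup>2) \<le> U) \<and> L2 (slice Z t)
     \<and> (\<forall>k. (\<Sum>i\<in>UNIV. of_int (k $ i) * fourier_coeff (slice (?u i) t) k) = 0)
     \<and> (\<forall>j. (LINT x|M3. \<bar>lp_block \<eta> \<rho> (int j - 1) (slice Z t) x\<bar> ^ 3) \<le> (2 powr (- ((real j - 1) * r)) * BZ t) ^ 3)
     \<and> (\<forall>i j. (LINT x|M3. \<bar>lp_block \<eta> \<rho> (int j - 1) (slice (?u i) t) x\<bar> ^ 3) \<le> (2 powr (- ((real j - 1) * s)) * Bu i t) ^ 3)"
  proof -
    have 1: "AE t in MT T. \<forall>i\<in>UNIV. L2 (slice (?u i) t) \<and> (LINT x|M3. (slice (?u i) t x)\<^sup>2) \<le> U"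
      by (intro AE_finite_allI finite_class.finite_UNIV) (use u in \<open>unfold slice_bounded_def, blast\<close>)
    have 2: "AE t in MT T. L2 (slice Z t) \<and> (LINT x|M3. (slice Z t x)\<^sup>2) \<le> U" using Z unfolding slice_bounded_def by blast
    have 3: "AE t in MT T. \<forall>i\<in>UNIV. \<forall>j. (LINT x|M3. \<bar>lp_block \<eta> \<rho> (int j - 1) (slice (?u i) t) x\<bar> ^ 3) \<le> (2 powr (- ((real j - 1) * s)) * Bu i t) ^ 3"
      by (intro AE_finite_allI finite_class.finite_UNIV) (rule Bub)
    show ?thesis using 1 2 3 velocity_divergence_free[OF dp T a w u] BZ(3) by eventually_elim blast
  qed

  have Mi: "integrable (MT T) M"
    unfolding M_def S_def using finite_measure.integrable_const[OF MT_finite]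
    by (intro Bochner_Integration.integrable_add integrable_mult_right Bochner_Integration.integrable_sum BZ Bui) auto
  have \<epsilon>: "\<epsilon> \<longlonglongrightarrow> 0"
  proof -
    have "(\<lambda>n. real (n + 3) powr (- \<delta> / 2)) \<longlonglongrightarrow> 0" if "\<delta> > 0" for \<delta>
      by (rule tendsto_neg_powr[OF _ filterlim_compose[OF filterlim_real_sequentially filterlim_add_const_nat_at_top]]) (use that in simp)
    from tendsto_add[OF this[OF C1(2)] this[OF C2(2)]] show ?thesis unfolding \<epsilon>_def[abs_def] by simp
  qed

  have "\<forall>n. \<exists>g. has_rate T (E n) g \<and> (AE t in MT T. \<bar>g t\<bar> \<le> \<epsilon> n * M t)"
  proof
    fix n
    obtain gu where gu: "has_rate T (\<lambda>t. \<Sum>j\<in>UNIV. \<Sum>k\<in>kset (n + 4). kap (n + 4) k * (cmod (fourier_coeff (slice (?u j) t) k))\<^sup>2) gu"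
      "AE t in MT T. gu t = 2 * (\<Sum>j\<in>UNIV. flux (n + 4) (slice (?u j) t) (?v t))"
      using velocity_energy_rate[OF dp T a w u ip] by blast
    let ?g = "\<lambda>t. gu t + 2 * flux (n + 4) (slice Z t) (\<lambda>i. slice (?u i) t)"
    have rate: "has_rate T (E n) ?g"
      unfolding E_def[abs_def] by (rule has_rate_add[OF gu(1) reactant_energy_rate[OF dp T w Z u]])
    have "AE t in MT T. \<bar>?g t\<bar> \<le> \<epsilon> n * M t"
      using gu(2) static
    proof eventually_elim
      case (elim t)
      \<comment> \<open>One constant that bounds all components of the velocity and whose cube is integrable in time.\<close>
      let ?B = "root 3 (S t)"
      let ?e1 = "real (n + 3) powr (- \<delta>1 / 2)" and ?e2 = "real (n + 3) powr (- \<delta>2 / 2)"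
      from elim(2) have LZt: "L2 (slice Z t)" and Lut: "\<And>i. L2 (slice (?u i) t)"
        and Ut: "\<And>i. (LINT x|M3. (slice (?u i) t x)\<^sup>2) \<le> U"
        and divt: "\<And>k. (\<Sum>i\<in>UNIV. of_int (k $ i) * fourier_coeff (slice (?u i) t) k) = 0"
        and bZt: "\<And>j. (LINT x|M3. \<bar>lp_block \<eta> \<rho> (int j - 1) (slice Z t) x\<bar> ^ 3) \<le> (2 powr (- ((real j - 1) * r)) * BZ t) ^ 3"
        and but: "\<And>i j. (LINT x|M3. \<bar>lp_block \<eta> \<rho> (int j - 1) (slice (?u i) t) x\<bar> ^ 3) \<le> (2 powr (- ((real j - 1) * s)) * Bu i t) ^ 3"
        by blast+
      have B3: "?B ^ 3 = S t" using S0[of t] by simp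
      have B0: "0 \<le> ?B" using S0[of t] by simp
      have BuB: "Bu i t \<le> ?B" for i
      proof (rule power_le_imp_le_base)
        show "Bu i t ^ Suc 2 \<le> ?B ^ Suc 2"
          using member_le_sum[of i UNIV "\<lambda>i. Bu i t ^ 3"] Bu0 B3 by (simp add: S_def numeral_3_eq_3 del: power_Suc)
      qed (rule B0)
      have uB: "(LINT x|M3. \<bar>lp_block \<eta> \<rho> (int j - 1) (slice (?u i) t) x\<bar> ^ 3) \<le> (2 powr (- ((real j - 1) * s)) * ?B) ^ 3" for i j
      proof (rule order_trans)
        show "(LINT x|M3. \<bar>lp_block \<eta> \<rho> (int j - 1) (slice (?u i) t) x\<bar> ^ 3) \<le> (2 powr (- ((real j - 1) * s)) * Bu i t) ^ 3"
          by (rule but)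
        show "(2 powr (- ((real j - 1) * s)) * Bu i t) ^ 3 \<le> (2 powr (- ((real j - 1) * s)) * ?B) ^ 3"
          using Bu0[of i t] BuB[of i] by (intro power_mono mult_left_mono) auto
      qed
      have "\<bar>flux (Suc (n + 3)) (slice Z t) (\<lambda>i. slice (?u i) t)\<bar> \<le> C1 * (BZ t ^ 3 + ?B ^ 3) * ?e1"
        by (rule flux1[rule_format, OF _ LZt Lut divt BZ(1) B0 bZt uB]) simp
      then have f1: "\<bar>flux (n + 4) (slice Z t) (\<lambda>i. slice (?u i) t)\<bar> \<le> C1 * (BZ t ^ 3 + S t) * ?e1"
        unfolding B3 by (simp add: numeral_eq_Suc)
      have f2: "\<bar>flux (n + 4) (slice (?u j) t) (?v t)\<bar> \<le> C2 * (Bu j t ^ 3 + 1 + U\<^sup>2) * ?e2" for j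
      proof -
        have "\<bar>flux (Suc (n + 3)) (slice (?u j) t) (?v t)\<bar> \<le> C2 * (Bu j t ^ 3 + 1 + U\<^sup>2) * ?e2"
          by (rule flux2[rule_format, OF _ Lut Lut divt Bu0 but Ut]) simp
        then show ?thesis by (simp add: numeral_eq_Suc)
      qed
      let ?X = "C1 * (BZ t ^ 3 + S t)" and ?W = "\<Sum>j\<in>UNIV. C2 * (Bu j t ^ 3 + 1 + U\<^sup>2)"
      have X0: "0 \<le> ?X" using C1 BZ(1)[of t] S0[of t] by simp
      have W0: "0 \<le> ?W" using C2 Bu0 by (intro sum_nonneg mult_nonneg_nonneg add_nonneg_nonneg) auto
      have "\<bar>\<Sum>j\<in>UNIV. flux (n + 4) (slice (?u j) t) (?v t)\<bar> \<le> (\<Sum>j\<in>UNIV. C2 * (Bu j t ^ 3 + 1 + U\<^sup>2) * ?e2)"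
        by (rule order_trans[OF sum_abs sum_mono[OF f2]])
      also have "\<dots> = ?W * ?e2" by (rule sum_distrib_right[symmetric])
      finally have "\<bar>?g t\<bar> \<le> 2 * (?W * ?e2) + 2 * (?X * ?e1)" using f1 unfolding elim(1) by linarith
      also have "\<dots> \<le> (?e1 + ?e2) * (2 * ?X + 2 * ?W)"
      proof -
        have "0 \<le> ?W * ?e1" "0 \<le> ?X * ?e2" using W0 X0 by simp_all
        moreover have "(?e1 + ?e2) * (2 * ?X + 2 * ?W) = 2 * (?W * ?e2) + 2 * (?X * ?e1) + 2 * (?W * ?e1) + 2 * (?X * ?e2)"
          by (simp only: distrib_left distrib_right mult_ac add_ac)
        ultimately show ?thesis by linarith
      qed
      finally show ?case unfolding \<epsilon>_def M_def .
    qed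
    with rate show "\<exists>g. has_rate T (E n) g \<and> (AE t in MT T. \<bar>g t\<bar> \<le> \<epsilon> n * M t)" by blast
  qed
  from choice[OF this] obtain g where g: "\<forall>n. has_rate T (E n) (g n) \<and> (AE t in MT T. \<bar>g n t\<bar> \<le> \<epsilon> n * M t)"
    by (rule exE)
  have lim: "AE t in MT T. (\<lambda>n. E n t) \<longlonglongrightarrow> e t"
    using static
  proof eventually_elim
    case (elim t)
    have sh: "(\<lambda>n. \<Sum>k\<in>kset (n + 4). kap (n + 4) k * (cmod (fourier_coeff f k))\<^sup>2) \<longlonglongrightarrow> (LINT x|M3. (f x)\<^sup>2) / vol3"
      if "L2 f" for f by (rule LIMSEQ_ignore_initial_segment[OF mollified_energy_tendsto[OF that]])
    show ?case unfolding E_def e_def by (intro tendsto_add tendsto_sum sh) (use elim in blast)+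
  qed
  have cons: "AE t1 in MT T. AE t2 in MT T. e t1 = e t2"
    by (rule vanishing_rate_conserved[OF _ Mi _ \<epsilon> lim, of g]) (use g in blast)+
  have energy: "AE t in MT T. (torus_Lp_norm 2 (slice u t))\<^sup>2 + (torus_Lp_norm 2 (slice Z t))\<^sup>2 = vol3 * e t"
    using static
  proof eventually_elim
    case (elim t)
    have "L2 (\<lambda>x. slice u t x $ i)" for i using elim by (simp add: slice_def)
    from torus_Lp_norm_2_components[OF this] show ?case
      using vol3_pos unfolding e_def by (simp add: torus_Lp_norm_2[of "\<lambda>x. Z (x, t)"] slice_def less_imp_neq[symmetric] sum_divide_distrib[symmetric] distrib_left)
  qed
  show ?thesis
    using cons energy
  proof eventually_elim
    case (elim t1)
    note 1 = elim
    show ?case using 1(1) energy by eventually_elim (simp add: 1(2))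
  qed
qed

end
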